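(* Let $X\subset\mathbb P^n$ be an irreducible projective variety over $\mathbb C$, let $\omega\in\mathbb Z^{n+1}$, and let $\mathcal X\to\mathbb A^1$ be the Gröbner degeneration of $X$ with respect to the weight $\omega$, with fibers $X_t$. Then the relative conormal space $\mathcal N_{\mathcal X/\mathbb A^1}\subset\mathbb P^n\times(\mathbb P^n)^\vee\times\mathbb A^1$ is the Gröbner degeneration of the conormal variety $\mathcal N_X\subset\mathbb P^n\times(\mathbb P^n)^\vee$ with respect to the weight $(\omega,-\omega)$ (weight $\omega$ on the coordinates of $\mathbb P^n$ and $-\omega$ on the dual coordinates of $(\mathbb P^n)^\vee$). In particular, $\mathcal N_{X_t}=(\mathcal N_{\mathcal X/\mathbb A^1})_t$ for every $t\in\mathbb C^\times$, and, set-theoretically, $\mathcal N_{X_0}\subseteq(\mathcal N_{\mathcal X/\mathbb A^1})_0$.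
   Context: Everything is over $\mathbb C$; a variety is a reduced separated scheme of finite type. Gröbner degeneration: for a weight $\omega\in\mathbb Z^{n+1}$ and $f=\sum_\alpha c_\alpha y^\alpha$, put $v(f)=\max\{\omega\cdot\alpha : c_\alpha\ne0\}$ and $f^t_\omega=t^{v(f)}\sum_\alpha c_\alpha t^{-\omega\cdot\alpha}y^\alpha$. For an ideal $I$ let $I^t_\omega=(f^t_\omega : f\in I)\subset\mathbb C[y,t]$. The Gröbner degeneration of $X$ with ideal $I_X$ is the flat family $\mathcal X\subset\mathbb P^n\times\mathbb A^1$ defined by $(I_X)^t_\omega$. Its fiber over $1$ is $X$; for $t\neq0$, $X_t=t^\omega\cdot X$ where $t^\omega\cdot x=[t^{\omega_0}x_0:\dots:t^{\omega_n}x_n]$; its special fiber $X_0$ is defined by the initial ideal $\mathrm{in}_\omega(I_X)$ (initial forms consist of the terms of maximal $\omega$-weight). The same construction applies to bihomogeneous ideals and subvarieties of $\mathbb P^n\times(\mathbb P^n)^\vee$ with a weight on all variables. Conormal variety: for an irreducible projective variety $Y\subset\mathbb P^n$ with smooth locus $Y^{\rm sm}$ and embedded projective tangent spaces $T_xY$, let $\mathrm{Con}(Y^{\rm sm})=\{(x,H)\in\mathbb P^n\times(\mathbb P^n)^\vee : x\in Y^{\rm sm},\ T_xY\subseteq H\}$ and $\mathcal N_Y=\overline{\mathrm{Con}(Y^{\rm sm})}$. If $X_0$ is non-reduced or reducible, $\mathcal N_{X_0}$ means the union of the conormal varieties of the irreducible components of $(X_0)^{\rm red}$. Relative conormal space: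 $\mathcal N_{\mathcal X/\mathbb A^1}$ is the scheme-theoretic closure of $\bigcup_{t\ne0}\mathrm{Con}(X_t^{\rm sm})\times\{t\}$ in $\mathbb P^n\times(\mathbb P^n)^\vee\times\mathbb A^1$; $(\mathcal N_{\mathcal X/\mathbb A^1})_t$ is its fiber over $t$. *)

theory Defs
  imports "HOL-Analysis.Analysis" "HOL-Library.Poly_Mapping"
begin

section \<open>Polynomials in finitely many variables over the complex numbers\<close>

type_synonym 'v mpoly = "('v \<Rightarrow>\<^sub>0 nat) \<Rightarrow>\<^sub>0 complex"

definition mvar :: "'v \<Rightarrow> 'v mpoly" where
  "mvar v = Poly_Mapping.single (Poly_Mapping.single v 1) 1"

definition mconst :: "complex \<Rightarrow> 'v mpoly" where
  "mconst c = Poly_Mapping.single 0 c"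

definition meval :: "('v::finite \<Rightarrow> complex) \<Rightarrow> 'v mpoly \<Rightarrow> complex" where
  "meval a f = (\<Sum>\<alpha>\<in>Poly_Mapping.keys f.
     Poly_Mapping.lookup f \<alpha> * (\<Prod>v\<in>UNIV. a v ^ Poly_Mapping.lookup \<alpha> v))"

definition msubst :: "('v::finite \<Rightarrow> 'w mpoly) \<Rightarrow> 'v mpoly \<Rightarrow> 'w mpoly" where
  "msubst s f = (\<Sum>\<alpha>\<in>Poly_Mapping.keys f.
     mconst (Poly_Mapping.lookup f \<alpha>) * (\<Prod>v\<in>UNIV. s v ^ Poly_Mapping.lookup \<alpha> v))"

definition mpderiv :: "'v \<Rightarrow> 'v mpoly \<Rightarrow> 'v mpoly" where
  "mpderiv v f = (\<Sum>\<alpha>\<in>Poly_Mapping.keys f.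
     Poly_Mapping.single (\<alpha> - Poly_Mapping.single v 1)
       (of_nat (Poly_Mapping.lookup \<alpha> v) * Poly_Mapping.lookup f \<alpha>))"

definition ideal_generated :: "'v mpoly set \<Rightarrow> 'v mpoly set" where
  "ideal_generated S = module.span (*) S"

text \<open>Homogeneity with respect to the variables in \<open>B\<close> only.\<close>

definition homogeneous_in :: "'v set \<Rightarrow> 'v mpoly \<Rightarrow> bool" where
  "homogeneous_in B f \<longleftrightarrow>
     (\<exists>d. \<forall>\<alpha>\<in>Poly_Mapping.keys f. (\<Sum>v\<in>B. Poly_Mapping.lookup \<alpha> v) = d)"


section \<open>Projective space and products\<close>

text \<open>
  The index type \<open>'n\<close> has \<open>n + 1\<close> elements, so that \<open>'n proj\<close> is projective \<open>n\<close>-space. A point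
  is the set of all its vectors of homogeneous coordinates. The same type serves for the dual
  projective space, a point \<open>H\<close> with coordinates \<open>u\<close> standing for the hyperplane
  \<open>u\<^sub>0 x\<^sub>0 + \<dots> + u\<^sub>n x\<^sub>n = 0\<close>.
\<close>

typedef ('n::finite) proj = "{{c *s v |c. c \<noteq> 0} |v :: complex ^ 'n. v \<noteq> 0}"
  morphisms homog_coords Abs_proj
proof -
  have "(1 :: complex ^ 'n) \<noteq> 0" by simp
  then show ?thesis by blast
qed

definition hyperplane :: "'n::finite proj \<Rightarrow> 'n proj set" where
  "hyperplane H = {p. \<forall>u\<in>homog_coords H. \<forall>z\<in>homog_coords p. (\<Sum>i\<in>UNIV. u $ i * z $ i) = 0}"

text \<open>
  Variables of the coordinate rings: \<open>'n\<close> for projective space; \<open>'n + 'n\<close> for its product with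
  the dual space (\<open>Inl\<close> for the coordinates of points, \<open>Inr\<close> for those of hyperplanes); and
  \<open>'v option\<close> for the product with the affine line, whose coordinate \<open>t\<close> is the variable \<open>None\<close>.
\<close>

definition crd :: "'n::finite proj \<Rightarrow> ('n \<Rightarrow> complex) set" where
  "crd p = {(\<lambda>i. v $ i) |v. v \<in> homog_coords p}"

definition crd2 :: "'n::finite proj \<times> 'n proj \<Rightarrow> ('n + 'n \<Rightarrow> complex) set" where
  "crd2 q = {case_sum a b |a b. a \<in> crd (fst q) \<and> b \<in> crd (snd q)}"

definition crd2t :: "('n::finite proj \<times> 'n proj) \<times> complex \<Rightarrow> (('n + 'n) option \<Rightarrow> complex) set" where
  "crd2t q = {case_option (snd q) c |c. c \<in> crd2 (fst q)}"

abbreviation hom1 :: "'n::finite mpoly \<Rightarrow> bool" where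
  "hom1 \<equiv> homogeneous_in UNIV"

definition hom2 :: "('n::finite + 'n) mpoly \<Rightarrow> bool" where
  "hom2 f \<longleftrightarrow> homogeneous_in (range Inl) f \<and> homogeneous_in (range Inr) f"

definition hom2t :: "('n::finite + 'n) option mpoly \<Rightarrow> bool" where
  "hom2t f \<longleftrightarrow> homogeneous_in (Some ` range Inl) f \<and> homogeneous_in (Some ` range Inr) f"

text \<open>
  The following notions are uniform in the ambient space, which is given by its coordinate vectors
  (\<open>cs = crd, crd2, crd2t\<close>) and its (multi)homogeneous polynomials (\<open>hom = hom1, hom2, hom2t\<close>).
\<close>

definition zero_locus :: "('p \<Rightarrow> ('v::finite \<Rightarrow> complex) set) \<Rightarrow> 'v mpoly set \<Rightarrow> 'p set" where
  "zero_locus cs F = {p. \<forall>f\<in>F. \<forall>a\<in>cs p. meval a f = 0}"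

definition vanishing_ideal ::
    "('v::finite mpoly \<Rightarrow> bool) \<Rightarrow> ('p \<Rightarrow> ('v \<Rightarrow> complex) set) \<Rightarrow> 'p set \<Rightarrow> 'v mpoly set" where
  "vanishing_ideal hom cs Y = ideal_generated {f. hom f \<and> (\<forall>p\<in>Y. \<forall>a\<in>cs p. meval a f = 0)}"

definition zariski ::
    "('v::finite mpoly \<Rightarrow> bool) \<Rightarrow> ('p \<Rightarrow> ('v \<Rightarrow> complex) set) \<Rightarrow> 'p topology" where
  "zariski hom cs = topology_generated_by {- zero_locus cs {f} |f. hom f}"

abbreviation zariski1 :: "'n::finite proj topology" where
  "zariski1 \<equiv> zariski hom1 crd"

abbreviation zariski2 :: "('n::finite proj \<times> 'n proj) topology" where
  "zariski2 \<equiv> zariski hom2 crd2"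


section \<open>Varieties, smooth points, conormal varieties\<close>

definition irreducible_closed :: "'p topology \<Rightarrow> 'p set \<Rightarrow> bool" where
  "irreducible_closed T Z \<longleftrightarrow> closedin T Z \<and> Z \<noteq> {} \<and>
     (\<forall>A B. closedin T A \<and> closedin T B \<and> Z \<subseteq> A \<union> B \<longrightarrow> Z \<subseteq> A \<or> Z \<subseteq> B)"

definition irreducible_components :: "'p topology \<Rightarrow> 'p set \<Rightarrow> 'p set set" where
  "irreducible_components T Z = {Y. irreducible_closed T Y \<and> Y \<subseteq> Z \<and>
     (\<forall>Y'. irreducible_closed T Y' \<and> Y \<subseteq> Y' \<and> Y' \<subseteq> Z \<longrightarrow> Y' = Y)}"

definition krull_dim :: "'p topology \<Rightarrow> 'p set \<Rightarrow> enat" where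
  "krull_dim T Z = Sup {enat k |k. \<exists>C :: nat \<Rightarrow> 'p set.
     (\<forall>i\<le>k. irreducible_closed T (C i) \<and> C i \<subseteq> Z) \<and> (\<forall>i<k. C i \<subset> C (Suc i))}"

text \<open>
  The linear subspace whose projectivization is the embedded projective tangent space of \<open>Y\<close> at
  \<open>x\<close>.
\<close>

definition tangent_cone_space :: "'n::finite proj set \<Rightarrow> 'n proj \<Rightarrow> (complex ^ 'n) set" where
  "tangent_cone_space Y x = {z. \<forall>f\<in>vanishing_ideal hom1 crd Y. \<forall>a\<in>crd x.
     (\<Sum>i\<in>UNIV. meval a (mpderiv i f) * z $ i) = 0}"

definition proj_tangent_space :: "'n::finite proj set \<Rightarrow> 'n proj \<Rightarrow> 'n proj set" where
  "proj_tangent_space Y x = {p. homog_coords p \<subseteq> tangent_cone_space Y x}"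

text \<open>
  For irreducible \<open>Y\<close>: a point is smooth iff its tangent space has the dimension of \<open>Y\<close>. The
  \<open>+ 1\<close> is due to the passage from the projective tangent space to the linear one.
\<close>

definition smooth_locus :: "'n::finite proj set \<Rightarrow> 'n proj set" where
  "smooth_locus Y = {x\<in>Y. enat (vec.dim (tangent_cone_space Y x)) = krull_dim zariski1 Y + 1}"

definition Con_smooth :: "'n::finite proj set \<Rightarrow> ('n proj \<times> 'n proj) set" where
  "Con_smooth Y = {(x, H). x \<in> smooth_locus Y \<and> proj_tangent_space Y x \<subseteq> hyperplane H}"

definition conormal_variety :: "'n::finite proj set \<Rightarrow> ('n proj \<times> 'n proj) set" where
  "conormal_variety Y = zariski2 closure_of Con_smooth Y"

definition conormal_union :: "'n::finite proj set \<Rightarrow> ('n proj \<times> 'n proj) set" where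
  "conormal_union Z = (\<Union>Y\<in>irreducible_components zariski1 Z. conormal_variety Y)"


section \<open>Groebner degenerations\<close>

definition wdeg :: "('v::finite \<Rightarrow> int) \<Rightarrow> ('v \<Rightarrow>\<^sub>0 nat) \<Rightarrow> int" where
  "wdeg \<omega> \<alpha> = (\<Sum>v\<in>UNIV. \<omega> v * int (Poly_Mapping.lookup \<alpha> v))"

text \<open>
  All exponents \<open>v(f) - \<omega> \<cdot> \<alpha>\<close> of \<open>t\<close> are nonnegative, so \<open>nat\<close> does not truncate; for \<open>f = 0\<close> the
  (unspecified) maximum is irrelevant because the sum is empty.
\<close>

definition weight_homogenization :: "('v::finite \<Rightarrow> int) \<Rightarrow> 'v mpoly \<Rightarrow> 'v option mpoly" where
  "weight_homogenization \<omega> f = (\<Sum>\<alpha>\<in>Poly_Mapping.keys f.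
     mconst (Poly_Mapping.lookup f \<alpha>)
     * mvar None ^ nat (Max (wdeg \<omega> ` Poly_Mapping.keys f) - wdeg \<omega> \<alpha>)
     * (\<Prod>v\<in>UNIV. mvar (Some v) ^ Poly_Mapping.lookup \<alpha> v))"

definition groebner_degeneration :: "('v::finite \<Rightarrow> int) \<Rightarrow> 'v mpoly set \<Rightarrow> 'v option mpoly set" where
  "groebner_degeneration \<omega> I = ideal_generated (weight_homogenization \<omega> ` I)"

text \<open>
  Setting \<open>t = t0\<close>. For \<open>t0 = 0\<close> the weight homogenization of \<open>f\<close> becomes the initial form of \<open>f\<close>
  (terms of maximal weight), so that the special fibre of a Groebner degeneration is defined by the
  initial ideal.
\<close>

definition fibre_ideal :: "complex \<Rightarrow> 'v::finite option mpoly set \<Rightarrow> 'v mpoly set" where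
  "fibre_ideal t0 J = msubst (case_option (mconst t0) mvar) ` J"

text \<open>The closed points of the fibre over \<open>t0\<close> of the family in projective space defined by \<open>J\<close>.\<close>

definition fibre_points :: "'n::finite option mpoly set \<Rightarrow> complex \<Rightarrow> 'n proj set" where
  "fibre_points J t0 = zero_locus crd (fibre_ideal t0 J)"


section \<open>Closed subschemes of the products\<close>

text \<open>
  Two bihomogeneous ideals define the same closed subscheme of the product of projective space with
  its dual (and possibly the affine line) iff they have the same saturation with respect to the
  products \<open>x\<^sub>i u\<^sub>j\<close>. The closed subscheme defined by \<open>J\<close> is therefore represented by the saturation
  of \<open>J\<close>, and equality of subschemes is equality of these saturated ideals.
\<close>

definition saturation :: "'v mpoly set \<Rightarrow> 'v mpoly set \<Rightarrow> 'v mpoly set" where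
  "saturation G J = {f. \<forall>g\<in>G. \<exists>k. g ^ k * f \<in> J}"

definition subscheme2 :: "('n::finite + 'n) mpoly set \<Rightarrow> ('n + 'n) mpoly set" where
  "subscheme2 J = saturation {mvar (Inl i) * mvar (Inr j) |i j. True} J"

definition subscheme2t :: "('n::finite + 'n) option mpoly set \<Rightarrow> ('n + 'n) option mpoly set" where
  "subscheme2t J = saturation {mvar (Some (Inl i)) * mvar (Some (Inr j)) |i j. True} J"

definition reduced_subscheme2 :: "('n::finite proj \<times> 'n proj) set \<Rightarrow> ('n + 'n) mpoly set" where
  "reduced_subscheme2 Z = subscheme2 (vanishing_ideal hom2 crd2 Z)"

text \<open>The scheme-theoretic fibre over \<open>t0\<close>.\<close>

definition subscheme_fibre ::
    "('n::finite + 'n) option mpoly set \<Rightarrow> complex \<Rightarrow> ('n + 'n) mpoly set" where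
  "subscheme_fibre N t0 = subscheme2 (fibre_ideal t0 N)"

text \<open>
  The relative conormal space of the family defined by \<open>J\<close>. The scheme-theoretic closure of a set
  of closed points is the closed subscheme given by all functions vanishing on that set.
\<close>

definition relative_conormal :: "'n::finite option mpoly set \<Rightarrow> ('n + 'n) option mpoly set" where
  "relative_conormal J = subscheme2t (vanishing_ideal hom2t crd2t
     (\<Union>t\<in>-{0}. Con_smooth (fibre_points J t) \<times> {t}))"

end

theory Submission
  imports Defs "HOL-Computational_Algebra.Computational_Algebra"
begin

text \<open>
  All ideals involved are ideals of all functions vanishing on a set of coordinate vectors. The
  Groebner degeneration of the vanishing ideal of \<open>S\<close> is the vanishing ideal of the translates
  \<open>t\<^sup>\<omega> S\<close>, \<open>t \<noteq> 0\<close>, placed over \<open>t\<close>. Since the torus acts on the dual space by the inverse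
  characters, the conormal vectors of \<open>t\<^sup>\<omega> X\<close> are the translates of those of \<open>X\<close> by the
  weight \<open>(\<omega>, -\<omega>)\<close>; this gives the two equalities.

  For the special fibre, a conormal vector of a component \<open>Y\<close> of \<open>X\<^sub>0\<close> at \<open>y\<close> is the gradient at \<open>y\<close> of
  some \<open>g\<close> that vanishes on \<open>Y\<close>. Generic points \<open>y\<close> of \<open>X\<^sub>0\<close> are limits of points of \<open>X\<^sub>t\<close>, and near them
  all points of \<open>X\<^sub>t\<close> are smooth: the family is finite over the parameters formed by \<open>t\<close> and linear
  forms, and the singular points lie over a proper hypersurface not containing \<open>t = 0\<close>. Minimising
  \<open>Re g(x) + |x - y|\<^sup>2\<close> over \<open>X\<^sub>t\<close> near \<open>y\<close> yields points \<open>x\<^sub>t\<close> at which the gradient of \<open>g\<close> plus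
  twice the conjugate of \<open>x\<^sub>t - y\<close> is conormal to \<open>X\<^sub>t\<close>. Since \<open>g\<close> vanishes on \<open>X\<^sub>0\<close> near \<open>y\<close>, these points converge
  to \<open>y\<close> and the conormal vectors to the gradient of \<open>g\<close> at \<open>y\<close>.
\<close>

text \<open>Primality, algebraic dependence and dimension are all tested on values of functions at
  points, so that no quotient ring or fraction field occurs. Dimension is the least number of linear
  forms without common zero on a cone, and these forms serve as parameters.

  The obstacle is finiteness at \<open>t = 0\<close>: the leading coefficient of an algebraic
  relation over the parameters may vanish on the special fibre, and then roots could escape to
  infinity. Compactness of the sphere excludes the escape, and the bound is turned back into
  algebra: a quotient of polynomials bounded by a continuous function is a polynomial. The result is
  a relation whose leading coefficient has no zero at \<open>t = 0\<close>, so points of the special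
  fibre can be moved and lifted.

  Minimising needs a function that vanishes on all of \<open>X\<^sub>0\<close>, whereas a conormal
  vector of a component \<open>Y\<close> only yields \<open>g\<close> vanishing on \<open>Y\<close>.
  So \<open>g\<close> is multiplied by some \<open>f\<close> that vanishes on the other components
  but not on \<open>Y\<close>; on \<open>Y\<close> the gradient of \<open>f * g\<close> is
  \<open>f\<close> times that of \<open>g\<close>, and rescaling the dual coordinates removes the
  factor.\<close>

definition mon :: "('v::finite \<Rightarrow> complex) \<Rightarrow> ('v \<Rightarrow>\<^sub>0 nat) \<Rightarrow> complex" where
  "mon a \<alpha> = (\<Prod>v\<in>UNIV. a v ^ Poly_Mapping.lookup \<alpha> v)"

lemma mon_add: "mon a (\<alpha> + \<beta>) = mon a \<alpha> * mon a \<beta>"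
  by (simp add: mon_def lookup_add power_add prod.distrib)

lemma mon_0 [simp]: "mon a 0 = 1"
  by (simp add: mon_def)

lemma mon_single_1 [simp]: "mon a (Poly_Mapping.single v 1) = a v"
proof -
  have "mon a (Poly_Mapping.single v 1) = (\<Prod>w\<in>UNIV. if w = v then a v else 1)"
    unfolding mon_def by (rule prod.cong) (auto simp: lookup_single when_def)
  then show ?thesis by simp
qed

lemma meval_eq_sum_mon: "meval a f = (\<Sum>\<alpha>\<in>Poly_Mapping.keys f. Poly_Mapping.lookup f \<alpha> * mon a \<alpha>)"
  by (simp add: meval_def mon_def)

lemma meval_superset:
  assumes "finite K" "Poly_Mapping.keys f \<subseteq> K"
  shows "meval a f = (\<Sum>\<alpha>\<in>K. Poly_Mapping.lookup f \<alpha> * mon a \<alpha>)"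
  unfolding meval_eq_sum_mon
  by (rule sum.mono_neutral_left) (use assms in \<open>auto simp: in_keys_iff\<close>)

lemma meval_0 [simp]: "meval a 0 = 0"
  by (simp add: meval_def)

lemma meval_single [simp]: "meval a (Poly_Mapping.single \<alpha> c) = c * mon a \<alpha>"
  by (subst meval_superset[of "{\<alpha>}"]) auto

lemma meval_add [simp]: "meval a (f + g) = meval a f + meval a g"
proof -
  let ?K = "Poly_Mapping.keys f \<union> Poly_Mapping.keys g"
  have "Poly_Mapping.keys (f + g) \<subseteq> ?K" by (rule keys_add)
  then show ?thesis
    by (subst (1 2 3) meval_superset[of ?K]) (auto simp: lookup_add algebra_simps sum.distrib)
qed

lemma meval_sum [simp]: "meval a (sum f A) = (\<Sum>x\<in>A. meval a (f x))"
  by (induction A rule: infinite_finite_induct) auto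

lemma mpoly_sum_monomials:
  "f = (\<Sum>\<alpha>\<in>Poly_Mapping.keys f. Poly_Mapping.single \<alpha> (Poly_Mapping.lookup f \<alpha>))"
  by (rule poly_mapping_eqI)
    (auto simp: lookup_sum lookup_single when_def in_keys_iff sum.delta')

lemma meval_mult [simp]: "meval a (f * g) = meval a f * meval a g"
proof -
  have "f * g = (\<Sum>\<alpha>\<in>Poly_Mapping.keys f. \<Sum>\<beta>\<in>Poly_Mapping.keys g.
      Poly_Mapping.single (\<alpha> + \<beta>) (Poly_Mapping.lookup f \<alpha> * Poly_Mapping.lookup g \<beta>))"
    by (subst mpoly_sum_monomials[of f], subst mpoly_sum_monomials[of g])
      (simp add: sum_product mult_single)
  then show ?thesis
    by (simp add: meval_eq_sum_mon[of a f] meval_eq_sum_mon[of a g] sum_product mon_add mult_ac)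
qed

lemma meval_mconst [simp]: "meval a (mconst c) = c"
  by (simp add: mconst_def)

lemma meval_mvar [simp]: "meval a (mvar v) = a v"
  unfolding mvar_def using mon_single_1[of a v] by simp

lemma meval_1 [simp]: "meval a 1 = 1"
  using meval_single[of a 0 1] by (simp del: meval_single)

lemma meval_uminus [simp]: "meval a (- f) = - meval a f"
  using meval_add[of a f "- f"] by (simp del: meval_add add: eq_neg_iff_add_eq_0 add.commute)

lemma meval_diff [simp]: "meval a (f - g) = meval a f - meval a g"
  using meval_add[of a f "- g"] by (simp del: meval_add)

lemma meval_power [simp]: "meval a (f ^ n) = meval a f ^ n"
  by (induction n) auto

lemma meval_prod [simp]: "meval a (prod f A) = (\<Prod>x\<in>A. meval a (f x))"
  by (induction A rule: infinite_finite_induct) auto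

lemma meval_msubst: "meval a (msubst s f) = meval (\<lambda>v. meval a (s v)) f"
  unfolding msubst_def meval_def[of _ f] by simp

lemma mvar_power: "mvar v ^ k = Poly_Mapping.single (Poly_Mapping.single v k) 1"
  by (induction k) (auto simp: mvar_def mult_single single_add[symmetric])

lemma prod_single:
  "finite A \<Longrightarrow> (\<Prod>x\<in>A. Poly_Mapping.single (e x) (1::complex)) = Poly_Mapping.single (\<Sum>x\<in>A. e x) 1"
  by (induction rule: finite_induct) (auto simp: mult_single)

subsection \<open>Vanishing ideals of sets of coordinate vectors\<close>

definition Iv :: "('v::finite \<Rightarrow> complex) set \<Rightarrow> 'v mpoly set" where
  "Iv S = {f. \<forall>a\<in>S. meval a f = 0}"

lemma module_mult: "module ((*) :: 'a::comm_ring_1 \<Rightarrow> 'a \<Rightarrow> 'a)"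
  by standard (auto simp: algebra_simps)

lemma ideal_generated_base: "f \<in> S \<Longrightarrow> f \<in> ideal_generated S"
  unfolding ideal_generated_def by (rule module.span_base[OF module_mult])

lemma ideal_generated_mult: "f \<in> ideal_generated S \<Longrightarrow> g * f \<in> ideal_generated S"
  unfolding ideal_generated_def by (rule module.span_scale[OF module_mult])

lemma ideal_generated_sum:
  "(\<And>x. x \<in> A \<Longrightarrow> f x \<in> ideal_generated S) \<Longrightarrow> sum f A \<in> ideal_generated S"
  unfolding ideal_generated_def by (rule module.span_sum[OF module_mult])

lemma ideal_generated_subset_Iv:
  assumes "S \<subseteq> Iv A"
  shows "ideal_generated S \<subseteq> Iv A"
proof
  fix f assume "f \<in> ideal_generated S"
  then show "f \<in> Iv A"
    unfolding ideal_generated_def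
    by (induction rule: module.span_induct_alt[OF module_mult, consumes 1])
      (use assms in \<open>auto simp: Iv_def subset_iff\<close>)
qed

lemma Iv_antimono: "A \<subseteq> B \<Longrightarrow> Iv B \<subseteq> Iv A"
  by (auto simp: Iv_def)

section \<open>Homogeneous components and scaling of variables\<close>

definition deg_in :: "'v set \<Rightarrow> ('v::finite \<Rightarrow>\<^sub>0 nat) \<Rightarrow> nat" where
  "deg_in B \<alpha> = (\<Sum>v\<in>B. Poly_Mapping.lookup \<alpha> v)"

definition hcomp :: "'v::finite set \<Rightarrow> nat \<Rightarrow> 'v mpoly \<Rightarrow> 'v mpoly" where
  "hcomp B d f = (\<Sum>\<alpha> | \<alpha> \<in> Poly_Mapping.keys f \<and> deg_in B \<alpha> = d.
     Poly_Mapping.single \<alpha> (Poly_Mapping.lookup f \<alpha>))"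

definition degrees_in :: "'v::finite set \<Rightarrow> 'v mpoly \<Rightarrow> nat set" where
  "degrees_in B f = deg_in B ` Poly_Mapping.keys f"

lemma finite_degrees_in [simp]: "finite (degrees_in B f)"
  by (simp add: degrees_in_def)

lemma sum_hcomp: "(\<Sum>d\<in>degrees_in B f. hcomp B d f) = f"
proof -
  have "(\<Sum>d\<in>degrees_in B f. hcomp B d f) =
    (\<Sum>\<alpha>\<in>Poly_Mapping.keys f. Poly_Mapping.single \<alpha> (Poly_Mapping.lookup f \<alpha>))"
    unfolding hcomp_def
    by (rule sum.group) (auto simp: degrees_in_def)
  then show ?thesis using mpoly_sum_monomials[of f] by simp
qed

lemma lookup_hcomp:
  "Poly_Mapping.lookup (hcomp B d f) \<alpha> = (if deg_in B \<alpha> = d then Poly_Mapping.lookup f \<alpha> else 0)"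
proof -
  have "finite {\<alpha> \<in> Poly_Mapping.keys f. deg_in B \<alpha> = d}" by simp
  then show ?thesis
    by (auto simp: hcomp_def lookup_sum lookup_single when_def in_keys_iff sum.delta')
qed

lemma keys_hcomp: "Poly_Mapping.keys (hcomp B d f) = {\<alpha> \<in> Poly_Mapping.keys f. deg_in B \<alpha> = d}"
  by (auto simp: in_keys_iff lookup_hcomp split: if_splits)

lemma homogeneous_in_hcomp: "homogeneous_in B (hcomp B d f)"
  unfolding homogeneous_in_def by (auto simp: keys_hcomp deg_in_def)

lemma homogeneous_in_hcomp': "homogeneous_in C f \<Longrightarrow> homogeneous_in C (hcomp B d f)"
  unfolding homogeneous_in_def by (auto simp: keys_hcomp)

definition scale_in :: "'v set \<Rightarrow> complex \<Rightarrow> ('v \<Rightarrow> complex) \<Rightarrow> 'v \<Rightarrow> complex" where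
  "scale_in B c a = (\<lambda>v. if v \<in> B then c * a v else a v)"

lemma mon_scale_in: "mon (scale_in B c a) \<alpha> = c ^ deg_in B \<alpha> * mon a (\<alpha> :: 'v::finite \<Rightarrow>\<^sub>0 nat)"
proof -
  have "mon (scale_in B c a) \<alpha> =
      (\<Prod>v\<in>UNIV. (if v \<in> B then c ^ Poly_Mapping.lookup \<alpha> v else 1) * a v ^ Poly_Mapping.lookup \<alpha> v)"
    unfolding mon_def scale_in_def by (rule prod.cong) (auto simp: power_mult_distrib)
  also have "\<dots> = (\<Prod>v\<in>UNIV. (if v \<in> B then c ^ Poly_Mapping.lookup \<alpha> v else 1)) * mon a \<alpha>"
    by (simp add: prod.distrib mon_def)
  also have "(\<Prod>v\<in>UNIV. (if v \<in> B then c ^ Poly_Mapping.lookup \<alpha> v else 1)) =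
      (\<Prod>v\<in>B. c ^ Poly_Mapping.lookup \<alpha> v)"
    by (subst prod.inter_restrict[symmetric]) auto
  also have "\<dots> = c ^ deg_in B \<alpha>" by (simp add: deg_in_def power_sum)
  finally show ?thesis .
qed

lemma meval_hcomp:
  "meval a (hcomp B d f) = (\<Sum>\<alpha> | \<alpha> \<in> Poly_Mapping.keys f \<and> deg_in B \<alpha> = d. Poly_Mapping.lookup f \<alpha> * mon a \<alpha>)"
  by (simp add: hcomp_def)

lemma meval_hcomp_scale: "meval (scale_in B c a) (hcomp B d f) = c ^ d * meval a (hcomp B d f)"
  unfolding meval_hcomp by (auto simp: mon_scale_in sum_distrib_left intro!: sum.cong)

lemma meval_scale_in: "meval (scale_in B c a) f = (\<Sum>d\<in>degrees_in B f. c ^ d * meval a (hcomp B d f))"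
  by (subst sum_hcomp[of B f, symmetric], subst meval_sum) (simp add: meval_hcomp_scale)

text \<open>Multiplication by \<open>t ^ K\<close> clears the negative exponents and leaves a
  polynomial with infinitely many roots. This is how the weights of a torus action are separated by
  evaluation alone.\<close>

lemma laurent_zero:
  fixes c :: "int \<Rightarrow> complex"
  assumes "finite M" and inf: "infinite T" "0 \<notin> T" and "\<And>t. t \<in> T \<Longrightarrow> (\<Sum>m\<in>M. c m * t powi m) = 0" and "m \<in> M"
  shows "c m = 0"
proof -
  define K where "K = Max ((\<lambda>m. nat (- m)) ` M)"
  have K: "0 \<le> m + int K" if "m \<in> M" for m
  proof -
    have "nat (- m) \<le> K" unfolding K_def using that assms(1) by (intro Max_ge) auto
    then show ?thesis by linarith
  qed
  define P where "P = (\<Sum>m\<in>M. monom (c m) (nat (m + int K)))"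
  have "poly P t = 0" if "t \<in> T" for t
  proof -
    have t: "t \<noteq> 0" using that inf by auto
    have "poly P t = (\<Sum>m\<in>M. c m * t ^ nat (m + int K))" by (simp add: P_def poly_sum poly_monom)
    also have "\<dots> = (\<Sum>m\<in>M. t ^ K * (c m * t powi m))"
    proof (rule sum.cong[OF refl])
      fix m assume "m \<in> M"
      have "t ^ nat (m + int K) = t powi (m + int K)" using K[OF \<open>m \<in> M\<close>] by (simp add: power_int_def)
      also have "\<dots> = t powi m * t ^ K" using t by (simp add: power_int_add)
      finally show "c m * t ^ nat (m + int K) = t ^ K * (c m * t powi m)" by (simp add: mult_ac)
    qed
    also have "\<dots> = 0" using assms(4)[OF that] by (simp flip: sum_distrib_left)
    finally show ?thesis .
  qed
  then have "P = 0" using poly_roots_finite[of P] inf(1) finite_subset[of T "{x. poly P x = 0}"] by auto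
  have inj: "nat (m' + int K) = nat (m + int K) \<longleftrightarrow> m' = m" if "m' \<in> M" for m'
    using K[OF that] K[OF assms(5)] by auto
  have "coeff P (nat (m + int K)) = (\<Sum>m'\<in>M. if m' = m then c m' else 0)"
    by (simp add: P_def coeff_sum coeff_monom inj cong: sum.cong)
  also have "\<dots> = c m" using assms(1,5) by (simp add: sum.delta)
  finally show ?thesis using \<open>P = 0\<close> by simp
qed

lemma infinite_nonzero_complex: "infinite (- {0::complex})"
  by (simp add: infinite_UNIV_char_0)

text \<open>On the orbit of \<open>a\<close> under scaling, \<open>f\<close> is a polynomial in the
  scaling factor whose coefficients are the values of its components at \<open>a\<close>.\<close>

lemma hcomp_in_Iv:
  assumes "f \<in> Iv S" "\<And>a c. a \<in> S \<Longrightarrow> c \<noteq> 0 \<Longrightarrow> scale_in B c a \<in> S"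
  shows "hcomp B d f \<in> Iv S"
  unfolding Iv_def
proof (intro CollectI ballI)
  fix a assume a: "a \<in> S"
  show "meval a (hcomp B d f) = 0"
  proof (cases "d \<in> degrees_in B f")
    case True
    have *: "(\<Sum>m\<in>int ` degrees_in B f. meval a (hcomp B (nat m) f) * t powi m) = 0" if "t \<in> - {0}" for t
    proof -
      have "(\<Sum>m\<in>int ` degrees_in B f. meval a (hcomp B (nat m) f) * t powi m) = meval (scale_in B t a) f"
        by (simp add: sum.reindex meval_scale_in mult.commute)
      then show ?thesis using assms(1) assms(2)[OF a] that by (simp add: Iv_def)
    qed
    show ?thesis
      using laurent_zero[OF _ infinite_nonzero_complex _ *, of "int d"] True by auto
  next
    case False
    then have e: "{\<alpha> \<in> Poly_Mapping.keys f. deg_in B \<alpha> = d} = {}" by (auto simp: degrees_in_def)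
    show ?thesis unfolding meval_hcomp e by simp
  qed
qed

lemma vanishing_ideal_eq_Iv1:
  assumes "\<And>a c. a \<in> \<Union>(cs ` Y) \<Longrightarrow> c \<noteq> 0 \<Longrightarrow> scale_in B c a \<in> \<Union>(cs ` Y)"
  shows "vanishing_ideal (homogeneous_in B) cs Y = Iv (\<Union>(cs ` Y))"
proof
  show "vanishing_ideal (homogeneous_in B) cs Y \<subseteq> Iv (\<Union>(cs ` Y))"
    unfolding vanishing_ideal_def by (rule ideal_generated_subset_Iv) (auto simp: Iv_def)
  show "Iv (\<Union>(cs ` Y)) \<subseteq> vanishing_ideal (homogeneous_in B) cs Y"
  proof
    fix f assume f: "f \<in> Iv (\<Union>(cs ` Y))"
    have "hcomp B d f \<in> vanishing_ideal (homogeneous_in B) cs Y" for d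
      using hcomp_in_Iv[OF f assms] homogeneous_in_hcomp[of B d f] unfolding vanishing_ideal_def
      by (intro ideal_generated_base) (auto simp: Iv_def)
    then have "(\<Sum>d\<in>degrees_in B f. hcomp B d f) \<in> vanishing_ideal (homogeneous_in B) cs Y"
      unfolding vanishing_ideal_def by (intro ideal_generated_sum)
    then show "f \<in> vanishing_ideal (homogeneous_in B) cs Y" by (simp add: sum_hcomp)
  qed
qed

text \<open>Components are taken with respect to \<open>B\<close> and then \<open>C\<close>; the
  second step only selects monomials and so preserves homogeneity in \<open>B\<close>.\<close>

lemma vanishing_ideal_eq_Iv2:
  assumes "\<And>a c. a \<in> \<Union>(cs ` Y) \<Longrightarrow> c \<noteq> 0 \<Longrightarrow> scale_in B c a \<in> \<Union>(cs ` Y)"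
    and "\<And>a c. a \<in> \<Union>(cs ` Y) \<Longrightarrow> c \<noteq> 0 \<Longrightarrow> scale_in C c a \<in> \<Union>(cs ` Y)"
  shows "vanishing_ideal (\<lambda>f. homogeneous_in B f \<and> homogeneous_in C f) cs Y = Iv (\<Union>(cs ` Y))"
    (is "?V = _")
proof
  show "?V \<subseteq> Iv (\<Union>(cs ` Y))"
    unfolding vanishing_ideal_def by (rule ideal_generated_subset_Iv) (auto simp: Iv_def)
  show "Iv (\<Union>(cs ` Y)) \<subseteq> ?V"
  proof
    fix f assume f: "f \<in> Iv (\<Union>(cs ` Y))"
    have "hcomp C e (hcomp B d f) \<in> ?V" for d e
      using hcomp_in_Iv[OF hcomp_in_Iv[OF f assms(1)] assms(2)]
        homogeneous_in_hcomp'[OF homogeneous_in_hcomp[of B d f], of C e]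
        homogeneous_in_hcomp[of C e]
      unfolding vanishing_ideal_def
      by (intro ideal_generated_base) (auto simp: Iv_def)
    then have "(\<Sum>e\<in>degrees_in C (hcomp B d f). hcomp C e (hcomp B d f)) \<in> ?V" for d
      unfolding vanishing_ideal_def by (intro ideal_generated_sum)
    then have "hcomp B d f \<in> ?V" for d by (simp add: sum_hcomp)
    then have "(\<Sum>d\<in>degrees_in B f. hcomp B d f) \<in> ?V"
      unfolding vanishing_ideal_def by (intro ideal_generated_sum)
    then show "f \<in> ?V" by (simp add: sum_hcomp)
  qed
qed

subsection \<open>Groebner degenerations of vanishing ideals\<close>

definition act :: "('v \<Rightarrow> int) \<Rightarrow> complex \<Rightarrow> ('v \<Rightarrow> complex) \<Rightarrow> 'v \<Rightarrow> complex" where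
  "act w t a = (\<lambda>v. t powi w v * a v)"

lemma prod_power_int:
  "finite A \<Longrightarrow> t \<noteq> 0 \<Longrightarrow> (\<Prod>v\<in>A. t powi f v) = (t::complex) powi (\<Sum>v\<in>A. f v)"
  by (induction rule: finite_induct) (auto simp: power_int_add)

lemma mon_act:
  fixes \<alpha> :: "'v::finite \<Rightarrow>\<^sub>0 nat"
  assumes "t \<noteq> 0"
  shows "mon (act w t a) \<alpha> = t powi wdeg w \<alpha> * mon a \<alpha>"
proof -
  have "mon (act w t a) \<alpha> =
      (\<Prod>v\<in>UNIV. t powi (w v * int (Poly_Mapping.lookup \<alpha> v)) * a v ^ Poly_Mapping.lookup \<alpha> v)"
    unfolding mon_def act_def by (rule prod.cong) (auto simp: power_mult_distrib power_int_mult)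
  then show ?thesis using assms by (simp add: prod.distrib prod_power_int wdeg_def mon_def)
qed

definition restrict_exp :: "('v option \<Rightarrow>\<^sub>0 nat) \<Rightarrow> ('v::finite \<Rightarrow>\<^sub>0 nat)" where
  "restrict_exp \<beta> = (\<Sum>v\<in>UNIV. Poly_Mapping.single v (Poly_Mapping.lookup \<beta> (Some v)))"

definition extend_exp :: "('v::finite \<Rightarrow>\<^sub>0 nat) \<Rightarrow> nat \<Rightarrow> ('v option \<Rightarrow>\<^sub>0 nat)" where
  "extend_exp \<alpha> k = Poly_Mapping.single None k + (\<Sum>v\<in>UNIV. Poly_Mapping.single (Some v) (Poly_Mapping.lookup \<alpha> v))"

lemma lookup_restrict_exp [simp]: "Poly_Mapping.lookup (restrict_exp \<beta>) v = Poly_Mapping.lookup \<beta> (Some v)"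
  by (simp add: restrict_exp_def lookup_sum lookup_single when_def sum.delta')

lemma lookup_extend_exp [simp]:
  "Poly_Mapping.lookup (extend_exp \<alpha> k) None = k"
  "Poly_Mapping.lookup (extend_exp \<alpha> k) (Some v) = Poly_Mapping.lookup \<alpha> v"
  by (simp_all add: extend_exp_def lookup_add lookup_sum lookup_single when_def sum.delta')

lemma mon_case_option:
  fixes b :: "'v::finite \<Rightarrow> complex"
  shows "mon (case_option t b) \<beta> = t ^ Poly_Mapping.lookup \<beta> None * mon b (restrict_exp \<beta>)"
  by (simp add: mon_def UNIV_option_conv prod.reindex)

lemma weight_homogenization_eq:
  "weight_homogenization \<omega> f = (\<Sum>\<alpha>\<in>Poly_Mapping.keys f.
     Poly_Mapping.single (extend_exp \<alpha> (nat (Max (wdeg \<omega> ` Poly_Mapping.keys f) - wdeg \<omega> \<alpha>))) (Poly_Mapping.lookup f \<alpha>))"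
  unfolding weight_homogenization_def extend_exp_def
  by (simp add: mconst_def mvar_power prod_single mult_single)

lemma meval_weight_homogenization:
  "meval (case_option t b) (weight_homogenization \<omega> f) = (\<Sum>\<alpha>\<in>Poly_Mapping.keys f.
     Poly_Mapping.lookup f \<alpha> * t ^ nat (Max (wdeg \<omega> ` Poly_Mapping.keys f) - wdeg \<omega> \<alpha>) * mon b \<alpha>)"
  by (simp add: weight_homogenization_def mon_def mult_ac)

lemma meval_weight_homogenization_act:
  assumes "t \<noteq> 0"
  shows "meval (case_option t (act \<omega> t a)) (weight_homogenization \<omega> f) =
    t powi Max (wdeg \<omega> ` Poly_Mapping.keys f) * meval a f"
proof -
  let ?M = "Max (wdeg \<omega> ` Poly_Mapping.keys f)"
  have "t ^ nat (?M - wdeg \<omega> \<alpha>) * t powi wdeg \<omega> \<alpha> = t powi ?M" if "\<alpha> \<in> Poly_Mapping.keys f" for \<alpha>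
  proof -
    have "wdeg \<omega> \<alpha> \<le> ?M" using that by (intro Max_ge) auto
    then have "t ^ nat (?M - wdeg \<omega> \<alpha>) = t powi (?M - wdeg \<omega> \<alpha>)" by (simp add: power_int_def)
    then show ?thesis using assms by (simp flip: power_int_add)
  qed
  then have "Poly_Mapping.lookup f \<alpha> * t ^ nat (?M - wdeg \<omega> \<alpha>) * mon (act \<omega> t a) \<alpha> =
      t powi ?M * (Poly_Mapping.lookup f \<alpha> * mon a \<alpha>)" if "\<alpha> \<in> Poly_Mapping.keys f" for \<alpha>
    using that by (simp add: mon_act[OF assms] mult_ac)
  then show ?thesis
    unfolding meval_weight_homogenization meval_eq_sum_mon[of a f] sum_distrib_left
    by (intro sum.cong) auto
qed

definition degen :: "('v::finite \<Rightarrow> int) \<Rightarrow> ('v \<Rightarrow> complex) set \<Rightarrow> ('v option \<Rightarrow> complex) set" where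
  "degen \<omega> S = {case_option t (act \<omega> t a) |t a. t \<noteq> 0 \<and> a \<in> S}"

text \<open>The exponent of \<open>t\<close> that a monomial acquires on the curve of points
  \<open>case_option t (act \<omega> t a)\<close>, that is, the grading in which \<open>t\<close>
  has weight one.\<close>

definition tdeg :: "('v::finite \<Rightarrow> int) \<Rightarrow> ('v option \<Rightarrow>\<^sub>0 nat) \<Rightarrow> int" where
  "tdeg \<omega> \<beta> = int (Poly_Mapping.lookup \<beta> None) + wdeg \<omega> (restrict_exp \<beta>)"

lemma exp_option_eqI:
  assumes "Poly_Mapping.lookup \<beta> None = Poly_Mapping.lookup \<gamma> None" "restrict_exp \<beta> = restrict_exp \<gamma>"
  shows "\<beta> = \<gamma>"
proof (rule poly_mapping_eqI)
  fix x show "Poly_Mapping.lookup \<beta> x = Poly_Mapping.lookup \<gamma> x"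
    using assms by (cases x) (auto simp flip: lookup_restrict_exp)
qed

text \<open>For the inclusion from right to left, \<open>g\<close> is split by \<open>tdeg\<close>.
  On the orbits the parts belong to different powers of \<open>t\<close>, so each part, with
  \<open>t\<close> set to 1, vanishes on \<open>S\<close>. The part itself is the weight
  homogenization of this times a power of \<open>t\<close>.\<close>

lemma groebner_degeneration_Iv: "groebner_degeneration \<omega> (Iv S) = Iv (degen \<omega> S)"
proof
  show "groebner_degeneration \<omega> (Iv S) \<subseteq> Iv (degen \<omega> S)"
    unfolding groebner_degeneration_def
  proof (rule ideal_generated_subset_Iv, rule image_subsetI)
    fix f assume f: "f \<in> Iv S"
    show "weight_homogenization \<omega> f \<in> Iv (degen \<omega> S)"
      using f by (auto simp: Iv_def degen_def meval_weight_homogenization_act)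
  qed
  show "Iv (degen \<omega> S) \<subseteq> groebner_degeneration \<omega> (Iv S)"
  proof
    fix g assume g: "g \<in> Iv (degen \<omega> S)"
    define B where "B m = {\<beta> \<in> Poly_Mapping.keys g. tdeg \<omega> \<beta> = m}" for m
    define gm where "gm m = (\<Sum>\<beta>\<in>B m. Poly_Mapping.single \<beta> (Poly_Mapping.lookup g \<beta>))" for m
    define h where "h m = (\<Sum>\<beta>\<in>B m. Poly_Mapping.single (restrict_exp \<beta>) (Poly_Mapping.lookup g \<beta>))" for m
    define M where "M = tdeg \<omega> ` Poly_Mapping.keys g"
    have finB: "finite (B m)" for m by (simp add: B_def)
    \<comment> \<open>Within one \<open>tdeg\<close> the exponent of \<open>t\<close> is determined
      by the other exponents, so setting \<open>t = 1\<close> causes no cancellation.\<close>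
    have inj: "inj_on restrict_exp (B m)" for m
      by (rule inj_onI, rule exp_option_eqI) (auto simp: B_def tdeg_def)
    have lh: "Poly_Mapping.lookup (h m) (restrict_exp \<beta>) = Poly_Mapping.lookup g \<beta>" if "\<beta> \<in> B m" for m \<beta>
    proof -
      have "Poly_Mapping.lookup (h m) (restrict_exp \<beta>) =
          (\<Sum>\<gamma>\<in>B m. if \<gamma> = \<beta> then Poly_Mapping.lookup g \<gamma> else 0)"
        unfolding h_def lookup_sum
        by (rule sum.cong) (use inj_onD[OF inj, OF _ _ that] in \<open>auto simp: lookup_single when_def\<close>)
      then show ?thesis using that finB by (simp add: sum.delta)
    qed
    have kh: "Poly_Mapping.keys (h m) = restrict_exp ` B m" for m
    proof
      show "Poly_Mapping.keys (h m) \<subseteq> restrict_exp ` B m"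
        unfolding h_def by (rule order.trans[OF keys_sum]) (auto split: if_splits)
      show "restrict_exp ` B m \<subseteq> Poly_Mapping.keys (h m)"
        by (auto simp: in_keys_iff lh) (auto simp: B_def in_keys_iff)
    qed
    have "finite M" by (simp add: M_def)
    have "g = (\<Sum>m\<in>M. gm m)"
    proof -
      have "(\<Sum>m\<in>M. gm m) = (\<Sum>\<beta>\<in>Poly_Mapping.keys g. Poly_Mapping.single \<beta> (Poly_Mapping.lookup g \<beta>))"
        unfolding gm_def B_def by (rule sum.group) (auto simp: M_def)
      then show ?thesis using mpoly_sum_monomials[of g] by simp
    qed
    have hS: "h m \<in> Iv S" if "m \<in> M" for m
      unfolding Iv_def
    proof (intro CollectI ballI)
      fix a assume a: "a \<in> S"
      have *: "(\<Sum>m\<in>M. meval a (h m) * t powi m) = 0" if "t \<in> - {0}" for t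
      proof -
        have t: "t \<noteq> 0" using that by simp
        have "0 = meval (case_option t (act \<omega> t a)) g"
          using g a t by (force simp: Iv_def degen_def)
        also have "\<dots> = (\<Sum>m\<in>M. meval (case_option t (act \<omega> t a)) (gm m))"
          by (subst \<open>g = _\<close>) simp
        also have "\<dots> = (\<Sum>m\<in>M. meval a (h m) * t powi m)"
        proof (rule sum.cong[OF refl])
          fix m
          have "mon (case_option t (act \<omega> t a)) \<beta> = t powi m * mon a (restrict_exp \<beta>)" if "\<beta> \<in> B m" for \<beta>
            using that t by (auto simp: B_def tdeg_def mon_case_option mon_act power_int_add)
          then show "meval (case_option t (act \<omega> t a)) (gm m) = meval a (h m) * t powi m"
            unfolding gm_def h_def by (simp add: sum_distrib_left sum_distrib_right mult_ac)
        qed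
        finally show ?thesis by simp
      qed
      show "meval a (h m) = 0"
        using laurent_zero[OF \<open>finite M\<close> infinite_nonzero_complex _ *] that by auto
    qed
    have "gm m \<in> groebner_degeneration \<omega> (Iv S)" if "m \<in> M" for m
    proof -
      define W where "W = Max (wdeg \<omega> ` Poly_Mapping.keys (h m))"
      have W1: "wdeg \<omega> (restrict_exp \<beta>) \<le> W" if "\<beta> \<in> B m" for \<beta>
        unfolding W_def by (rule Max_ge) (use that finB in \<open>auto simp: kh\<close>)
      have W2: "W \<le> m"
      proof -
        have "B m \<noteq> {}" using \<open>m \<in> M\<close> by (auto simp: M_def B_def)
        then show ?thesis
          unfolding W_def kh by (subst Max_le_iff) (use finB in \<open>auto simp: B_def tdeg_def\<close>)
      qed
      \<comment> \<open>The weight homogenization only reaches \<open>tdeg\<close> equal to the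
        largest weight \<open>W\<close> of \<open>h m\<close>; the missing factor is
        \<open>t ^ (m - W)\<close>.\<close>
      have "mvar None ^ nat (m - W) * weight_homogenization \<omega> (h m) =
          (\<Sum>\<alpha>\<in>restrict_exp ` B m. Poly_Mapping.single (Poly_Mapping.single None (nat (m - W)) +
             extend_exp \<alpha> (nat (W - wdeg \<omega> \<alpha>))) (Poly_Mapping.lookup (h m) \<alpha>))"
        unfolding weight_homogenization_eq mvar_power W_def[symmetric]
        by (simp add: sum_distrib_left mult_single W_def[symmetric] flip: kh)
      also have "\<dots> = gm m"
        unfolding gm_def sum.reindex[OF inj] comp_def
      proof (rule sum.cong[OF refl])
        fix \<beta> assume \<beta>: "\<beta> \<in> B m"
        have "Poly_Mapping.single None (nat (m - W)) + extend_exp (restrict_exp \<beta>) (nat (W - wdeg \<omega> (restrict_exp \<beta>))) = \<beta>"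
        proof (rule exp_option_eqI)
          show "Poly_Mapping.lookup (Poly_Mapping.single None (nat (m - W)) +
              extend_exp (restrict_exp \<beta>) (nat (W - wdeg \<omega> (restrict_exp \<beta>)))) None = Poly_Mapping.lookup \<beta> None"
            using W1[OF \<beta>] W2 \<beta> by (auto simp: lookup_add B_def tdeg_def)
          show "restrict_exp (Poly_Mapping.single None (nat (m - W)) +
              extend_exp (restrict_exp \<beta>) (nat (W - wdeg \<omega> (restrict_exp \<beta>)))) = restrict_exp \<beta>"
            by (rule poly_mapping_eqI) (simp add: lookup_add lookup_single when_def)
        qed
        then show "Poly_Mapping.single (Poly_Mapping.single None (nat (m - W)) +
            extend_exp (restrict_exp \<beta>) (nat (W - wdeg \<omega> (restrict_exp \<beta>)))) (Poly_Mapping.lookup (h m) (restrict_exp \<beta>)) =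
            Poly_Mapping.single \<beta> (Poly_Mapping.lookup g \<beta>)"
          using lh[OF \<beta>] by simp
      qed
      finally have "gm m = mvar None ^ nat (m - W) * weight_homogenization \<omega> (h m)" ..
      then show ?thesis
        unfolding groebner_degeneration_def using hS[OF \<open>m \<in> M\<close>]
        by (simp add: ideal_generated_mult ideal_generated_base)
    qed
    then show "g \<in> groebner_degeneration \<omega> (Iv S)"
      unfolding \<open>g = _\<close> groebner_degeneration_def by (intro ideal_generated_sum)
  qed
qed

subsection \<open>Polynomial functions on irreducible sets\<close>

text \<open>Functions on sequences instead of polynomials over a fixed type of variables:
  coordinates can be adjoined or eliminated one at a time by changing the index set
  \<open>A\<close>.\<close>

inductive_set polfun :: "nat set \<Rightarrow> ((nat \<Rightarrow> complex) \<Rightarrow> complex) set" for A where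
  const: "(\<lambda>p. c) \<in> polfun A"
| coord: "i \<in> A \<Longrightarrow> (\<lambda>p. p i) \<in> polfun A"
| add: "f \<in> polfun A \<Longrightarrow> g \<in> polfun A \<Longrightarrow> (\<lambda>p. f p + g p) \<in> polfun A"
| mult: "f \<in> polfun A \<Longrightarrow> g \<in> polfun A \<Longrightarrow> (\<lambda>p. f p * g p) \<in> polfun A"

lemma polfun_mono: "A \<subseteq> B \<Longrightarrow> f \<in> polfun A \<Longrightarrow> f \<in> polfun B"
  by (rotate_tac 1, induction rule: polfun.induct) (auto intro: polfun.intros)

lemma polfun_lessThan_mono: "i \<le> j \<Longrightarrow> f \<in> polfun {..<i} \<Longrightarrow> f \<in> polfun {..<j}"
  by (rule polfun_mono[of "{..<i}"]) auto

lemma polfun_cong: "f \<in> polfun A \<Longrightarrow> (\<And>i. i \<in> A \<Longrightarrow> p i = q i) \<Longrightarrow> f p = f q"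
  by (induction rule: polfun.induct) auto

lemma polfun_uminus: "f \<in> polfun A \<Longrightarrow> (\<lambda>p. - f p) \<in> polfun A"
  using polfun.mult[OF polfun.const[of "-1"], of f A] by simp

lemma polfun_diff: "f \<in> polfun A \<Longrightarrow> g \<in> polfun A \<Longrightarrow> (\<lambda>p. f p - g p) \<in> polfun A"
  using polfun.add[OF _ polfun_uminus] by fastforce

lemma polfun_sum: "(\<And>x. x \<in> X \<Longrightarrow> f x \<in> polfun A) \<Longrightarrow> (\<lambda>p. \<Sum>x\<in>X. f x p) \<in> polfun A"
  by (induction X rule: infinite_finite_induct) (auto intro: polfun.intros)

lemma polfun_prod: "(\<And>x. x \<in> X \<Longrightarrow> f x \<in> polfun A) \<Longrightarrow> (\<lambda>p. \<Prod>x\<in>X. f x p) \<in> polfun A"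
  by (induction X rule: infinite_finite_induct) (auto intro: polfun.intros)

lemma polfun_power: "f \<in> polfun A \<Longrightarrow> (\<lambda>p. f p ^ n) \<in> polfun A"
  by (induction n) (auto intro: polfun.intros)

lemmas polfun_intros = polfun.intros polfun_diff polfun_uminus polfun_sum polfun_prod polfun_power

lemma polfun_expand:
  assumes "f \<in> polfun (insert j A)" "j \<notin> A"
  obtains n a where "\<And>i. a i \<in> polfun A" "\<And>p. f p = (\<Sum>i\<le>n. a i p * p j ^ i)"
proof -
  \<comment> \<open>The clause that coefficients beyond \<open>n\<close> vanish lets the sums for
    \<open>f\<close> and \<open>g\<close> be extended to a common degree and multiplied by
    \<open>polynomial_product\<close>.\<close>
  have "\<exists>n a. (\<forall>i. a i \<in> polfun A) \<and> (\<forall>i>n. \<forall>p. a i p = 0) \<and> (\<forall>p. f p = (\<Sum>i\<le>n. a i p * p j ^ i))"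
    using assms(1)
  proof (induction rule: polfun.induct)
    case (const c)
    show ?case
      by (rule exI[of _ 0], rule exI[of _ "\<lambda>i p. if i = 0 then c else 0"]) (auto intro: polfun.const)
  next
    case (coord i)
    show ?case
    proof (cases "i = j")
      case True
      then show ?thesis
        by (intro exI[of _ 1] exI[of _ "\<lambda>i p. if i = 1 then 1 else 0"]) (auto intro: polfun.const)
    next
      case False
      then have "i \<in> A" using coord by auto
      then have "(\<lambda>p. if k = 0 then p i else 0) \<in> polfun A" for k :: nat
        by (cases "k = 0") (auto intro: polfun.intros)
      then show ?thesis
        by (intro exI[of _ 0] exI[of _ "\<lambda>k p. if k = 0 then p i else 0"]) auto
    qed
  next
    case (add f g)
    from add.IH(1) obtain n a where f: "\<forall>i. a i \<in> polfun A" "\<forall>i>n. \<forall>p. a i p = 0"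
      "\<forall>p. f p = (\<Sum>i\<le>n. a i p * p j ^ i)" by (elim exE conjE) (rule that)
    from add.IH(2) obtain m b where g: "\<forall>i. b i \<in> polfun A" "\<forall>i>m. \<forall>p. b i p = 0"
      "\<forall>p. g p = (\<Sum>i\<le>m. b i p * p j ^ i)" by (elim exE conjE) (rule that)
    have "f p = (\<Sum>i\<le>max n m. a i p * p j ^ i)" for p
      unfolding f(3)[rule_format] by (rule sum.mono_neutral_left) (use f(2) in auto)
    moreover have "g p = (\<Sum>i\<le>max n m. b i p * p j ^ i)" for p
      unfolding g(3)[rule_format] by (rule sum.mono_neutral_left) (use g(2) in auto)
    ultimately show ?case
      using f g by (intro exI[of _ "max n m"] exI[of _ "\<lambda>i p. a i p + b i p"])
        (auto simp: distrib_right sum.distrib intro: polfun.intros)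
  next
    case (mult f g)
    from mult.IH(1) obtain n a where f: "\<forall>i. a i \<in> polfun A" "\<forall>i>n. \<forall>p. a i p = 0"
      "\<forall>p. f p = (\<Sum>i\<le>n. a i p * p j ^ i)" by (elim exE conjE) (rule that)
    from mult.IH(2) obtain m b where g: "\<forall>i. b i \<in> polfun A" "\<forall>i>m. \<forall>p. b i p = 0"
      "\<forall>p. g p = (\<Sum>i\<le>m. b i p * p j ^ i)" by (elim exE conjE) (rule that)
    have "f p * g p = (\<Sum>r\<le>n + m. (\<Sum>k\<le>r. a k p * b (r - k) p) * p j ^ r)" for p
      unfolding f(3)[rule_format] g(3)[rule_format] by (rule polynomial_product) (use f g in auto)
    moreover have "(\<Sum>k\<le>r. a k p * b (r - k) p) = 0" if "r > n + m" for r p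
    proof (rule sum.neutral, rule ballI)
      fix k assume "k \<in> {..r}"
      then have "k > n \<or> r - k > m" using that by auto
      then show "a k p * b (r - k) p = 0" using f(2) g(2) by auto
    qed
    ultimately show ?case
      using f g by (intro exI[of _ "n + m"] exI[of _ "\<lambda>r p. \<Sum>k\<le>r. a k p * b (r - k) p"])
        (auto intro!: polfun_intros)
  qed
  then show ?thesis using that by blast
qed

lemma polfun_expand_Suc:
  assumes "f \<in> polfun {..<Suc j}"
  obtains n a where "\<And>i. a i \<in> polfun {..<j}" "\<And>p. f p = (\<Sum>i\<le>n. a i p * p j ^ i)"
proof -
  have "f \<in> polfun (insert j {..<j})" using assms by (simp add: lessThan_Suc)
  then show ?thesis
  proof (rule polfun_expand)
    show "j \<notin> {..<j}" by simp
  qed (rule that)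
qed

lemma polfun_poly:
  assumes "f \<in> polfun A"
  obtains P :: "complex poly" where "\<And>s. f (\<lambda>i. poly (Q i) s) = poly P s"
proof -
  have "\<exists>P. \<forall>s. f (\<lambda>i. poly (Q i) s) = poly P s"
    using assms
  proof (induction rule: polfun.induct)
    case (const c) show ?case by (rule exI[of _ "[:c:]"]) simp
  next
    case (coord i) show ?case by blast
  next
    case (add f g) then show ?case by (metis poly_add)
  next
    case (mult f g) then show ?case by (metis poly_mult)
  qed
  then show ?thesis using that by blast
qed

lemma polfun_line:
  assumes "f \<in> polfun A"
  obtains P :: "complex poly" where "\<And>s. f (\<lambda>i. q i + s * (p i - q i)) = poly P s"
  using polfun_poly[OF assms, of "\<lambda>i. [:q i, p i - q i:]"] by auto

lemma poly_nonzero_near_0: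
  assumes "P \<noteq> (0::complex poly)" "\<epsilon> > 0"
  obtains s where "s \<noteq> 0" "norm s < \<epsilon>" "poly P s \<noteq> 0"
proof -
  have "finite ({s. poly P s = 0} \<union> {0})" using poly_roots_finite[OF assms(1)] by simp
  moreover have "infinite (ball (0::complex) \<epsilon>)" using assms(2) uncountable_infinite uncountable_ball by blast
  ultimately have "\<not> ball (0::complex) \<epsilon> \<subseteq> {s. poly P s = 0} \<union> {0}" using finite_subset by blast
  then obtain s where "s \<in> ball 0 \<epsilon>" "s \<notin> {s. poly P s = 0} \<union> {0}" by blast
  then show ?thesis using that[of s] by auto
qed

text \<open>Restricted to the line through \<open>q\<close> and \<open>p\<close>, \<open>f\<close>
  is a nonzero polynomial in \<open>s\<close>. Hence nonzeros of \<open>f\<close> accumulate at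
  every \<open>q\<close> in the usual topology.\<close>

lemma polfun_generic:
  assumes "f \<in> polfun A" "f p \<noteq> 0" "\<epsilon> > 0"
  obtains s where "s \<noteq> 0" "norm s < \<epsilon>" "f (\<lambda>i. q i + s * (p i - q i)) \<noteq> 0"
proof -
  obtain P where P: "\<And>s. f (\<lambda>i. q i + s * (p i - q i)) = poly P s"
    using polfun_line[OF assms(1)] by blast
  have "P \<noteq> 0" using P[of 1] assms(2) by auto
  then show ?thesis using poly_nonzero_near_0[OF _ assms(3)] P that by metis
qed

lemma polfun_nonzero_mult:
  assumes "f \<in> polfun A" "f p \<noteq> 0" "g \<in> polfun A" "g q \<noteq> 0"
  obtains r where "f r \<noteq> 0" "g r \<noteq> 0"
proof -
  obtain P where P: "\<And>s. f (\<lambda>i. q i + s * (p i - q i)) = poly P s"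
    using polfun_line[OF assms(1)] by blast
  obtain Q where Q: "\<And>s. g (\<lambda>i. q i + s * (p i - q i)) = poly Q s"
    using polfun_line[OF assms(3)] by blast
  have "P \<noteq> 0" using P[of 1] assms by auto
  moreover have "Q \<noteq> 0" using Q[of 0] assms by auto
  ultimately have "P * Q \<noteq> 0" by simp
  then obtain s where "poly (P * Q) s \<noteq> 0" by (metis poly_all_0_iff_0)
  then show ?thesis using that[of "\<lambda>i. q i + s * (p i - q i)"] P Q by simp
qed

text \<open>Multiplying by the leading coefficient \<open>b e\<close> before each division step
  avoids fractions, so the identity holds at all \<open>p\<close>, also where \<open>b e\<close>
  vanishes. For \<open>n < e\<close> the subtraction truncates and the quotient is chosen
  zero.\<close>

lemma polfun_pseudo_div:
  assumes "\<And>i. b i \<in> polfun A" "\<And>i. c i \<in> polfun A"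
  shows "\<exists>k q r. (\<forall>i. q i \<in> polfun A) \<and> (\<forall>i. r i \<in> polfun A) \<and>
     (\<forall>p x. b e p ^ k * (\<Sum>i\<le>n. c i p * x ^ i) =
        (\<Sum>i\<le>n - e. q i p * x ^ i) * (\<Sum>i\<le>e. b i p * x ^ i) + (\<Sum>i<e. r i p * x ^ i))"
  using assms(2)
proof (induction n arbitrary: c)
  case 0
  show ?case
  proof (cases "e = 0")
    case True
    then show ?thesis using 0 by (intro exI[of _ 1] exI[of _ c] exI[of _ "\<lambda>i p. 0"]) (auto intro: polfun.intros)
  next
    case False
    have "(\<Sum>i<e. (if i = 0 then c 0 p else 0) * x ^ i) = c 0 p" for p x
    proof -
      have "(\<Sum>i<e. (if i = 0 then c 0 p else 0) * x ^ i) = (\<Sum>i<e. if i = 0 then c 0 p else 0)"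
        by (rule sum.cong) auto
      then show ?thesis using False by simp
    qed
    moreover have "(\<lambda>p. if i = 0 then c 0 p else 0) \<in> polfun A" for i :: nat
      using 0 by (cases "i = 0") (auto intro: polfun.intros)
    ultimately show ?thesis
      by (intro exI[of _ 0] exI[of _ "\<lambda>i p. 0"] exI[of _ "\<lambda>i p. if i = 0 then c 0 p else 0"])
        (auto intro: polfun.intros)
  qed
next
  case (Suc n)
  show ?case
  proof (cases "Suc n < e")
    case True
    have "(\<Sum>i<e. (if i \<le> Suc n then c i p else 0) * x ^ i) = (\<Sum>i\<le>Suc n. c i p * x ^ i)" for p x
    proof -
      have "(\<Sum>i<e. (if i \<le> Suc n then c i p else 0) * x ^ i) = (\<Sum>i\<le>Suc n. (if i \<le> Suc n then c i p else 0) * x ^ i)"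
        by (rule sum.mono_neutral_right) (use True in auto)
      then show ?thesis by simp
    qed
    moreover have "(\<lambda>p. if i \<le> Suc n then c i p else 0) \<in> polfun A" for i
      using Suc.prems by (cases "i \<le> Suc n") (auto intro: polfun.intros)
    ultimately show ?thesis
      by (intro exI[of _ 0] exI[of _ "\<lambda>i p. 0"] exI[of _ "\<lambda>i p. if i \<le> Suc n then c i p else 0"])
        (auto intro: polfun.intros)
  next
    case False
    define l where "l = Suc n - e"
    have l: "l + e = Suc n" using False by (simp add: l_def)
    \<comment> \<open>\<open>b e\<close> times the dividend minus the multiple of the divisor that
      cancels the coefficient of degree \<open>Suc n\<close>.\<close>
    define c' where "c' i p = b e p * c i p - (if l \<le> i then c (Suc n) p * b (i - l) p else 0)" for i p
    have c'A: "c' i \<in> polfun A" for i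
      unfolding c'_def using Suc.prems assms by (cases "l \<le> i") (auto intro!: polfun_intros)
    have c': "(\<Sum>i\<le>n. c' i p * x ^ i) =
        b e p * (\<Sum>i\<le>Suc n. c i p * x ^ i) - c (Suc n) p * x ^ l * (\<Sum>i\<le>e. b i p * x ^ i)" for p x
    proof -
      have "(\<Sum>i\<le>n. c' i p * x ^ i) = (\<Sum>i\<le>Suc n. c' i p * x ^ i)"
        using l by (simp add: c'_def) (metis add_diff_cancel_left' l)
      also have "\<dots> = b e p * (\<Sum>i\<le>Suc n. c i p * x ^ i) -
          (\<Sum>i\<le>Suc n. if l \<le> i then c (Suc n) p * b (i - l) p * x ^ i else 0)"
        unfolding c'_def sum_distrib_left sum_subtractf[symmetric]
        by (rule sum.cong) (auto simp: algebra_simps)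
      also have "(\<Sum>i\<le>Suc n. if l \<le> i then c (Suc n) p * b (i - l) p * x ^ i else 0) =
          (\<Sum>i\<in>{0 + l..e + l}. c (Suc n) p * b (i - l) p * x ^ i)"
        by (rule sum.mono_neutral_cong_right) (use l in auto)
      also have "\<dots> = c (Suc n) p * x ^ l * (\<Sum>i\<le>e. b i p * x ^ i)"
        unfolding sum.shift_bounds_cl_nat_ivl sum_distrib_left
        by (rule sum.cong) (auto simp: power_add algebra_simps)
      finally show ?thesis .
    qed
    obtain k q r where q: "\<forall>i. q i \<in> polfun A" and r: "\<forall>i. r i \<in> polfun A"
      and eq: "\<And>p x. b e p ^ k * (\<Sum>i\<le>n. c' i p * x ^ i) =
        (\<Sum>i\<le>n - e. q i p * x ^ i) * (\<Sum>i\<le>e. b i p * x ^ i) + (\<Sum>i<e. r i p * x ^ i)"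
      using Suc.IH[of c', OF c'A] by blast
    define q' where "q' i p = (if i \<le> n - e then q i p else 0) + (if i = l then b e p ^ k * c (Suc n) p else 0)" for i p
    have "q' i \<in> polfun A" for i
      unfolding q'_def using q Suc.prems assms(1)
      by (cases "i \<le> n - e"; cases "i = l") (auto intro!: polfun_intros)
    moreover have "(\<Sum>i\<le>Suc n - e. q' i p * x ^ i) = (\<Sum>i\<le>n - e. q i p * x ^ i) + b e p ^ k * c (Suc n) p * x ^ l" for p x
    proof -
      have "(\<Sum>i\<le>Suc n - e. (if i \<le> n - e then q i p else 0) * x ^ i) = (\<Sum>i\<le>n - e. q i p * x ^ i)"
        by (rule sum.mono_neutral_cong_right) auto
      moreover have "(\<Sum>i\<le>Suc n - e. (if i = l then b e p ^ k * c (Suc n) p else 0) * x ^ i) =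
          (\<Sum>i\<le>Suc n - e. if i = l then b e p ^ k * c (Suc n) p * x ^ l else 0)"
        by (rule sum.cong) auto
      ultimately show ?thesis
        unfolding q'_def distrib_right sum.distrib by (simp add: l_def)
    qed
    moreover have "b e p ^ Suc k * (\<Sum>i\<le>Suc n. c i p * x ^ i) =
        ((\<Sum>i\<le>n - e. q i p * x ^ i) + b e p ^ k * c (Suc n) p * x ^ l) * (\<Sum>i\<le>e. b i p * x ^ i) +
        (\<Sum>i<e. r i p * x ^ i)" for p x
    proof -
      have "b e p ^ Suc k * (\<Sum>i\<le>Suc n. c i p * x ^ i) =
          b e p ^ k * (b e p * (\<Sum>i\<le>Suc n. c i p * x ^ i))" by (simp only: power_Suc mult_ac)
      also have "b e p * (\<Sum>i\<le>Suc n. c i p * x ^ i) =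
          (\<Sum>i\<le>n. c' i p * x ^ i) + c (Suc n) p * x ^ l * (\<Sum>i\<le>e. b i p * x ^ i)"
        unfolding c' by simp
      finally show ?thesis
        unfolding distrib_left distrib_right eq by (simp only: mult_ac add_ac)
    qed
    ultimately show ?thesis
      using r by (intro exI[of _ "Suc k"] exI[of _ q'] exI[of _ r]) simp
  qed
qed

lemma complex_root_exists:
  assumes "(a :: nat \<Rightarrow> complex) d \<noteq> 0" "d > 0"
  obtains x where "(\<Sum>i\<le>d. a i * x ^ i) = 0"
proof -
  define P where "P = (\<Sum>i\<le>d. monom (a i) i)"
  have "coeff P d = a d" by (simp add: P_def coeff_sum coeff_monom)
  then have "\<not> constant (poly P)"
    using assms le_degree[of P d] by (auto simp: constant_degree)
  then obtain x where "poly P x = 0" using fundamental_theorem_of_algebra by blast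
  then show ?thesis using that by (simp add: P_def poly_sum poly_monom)
qed

section \<open>Coordinate rings of irreducible point sets\<close>

locale irreducible_points =
  fixes Z :: "(nat \<Rightarrow> complex) set"
  assumes nonempty: "Z \<noteq> {}"
    and prime: "f \<in> polfun UNIV \<Longrightarrow> g \<in> polfun UNIV \<Longrightarrow> (\<And>p. p \<in> Z \<Longrightarrow> f p * g p = 0) \<Longrightarrow>
      (\<forall>p\<in>Z. f p = 0) \<or> (\<forall>p\<in>Z. g p = 0)"
begin

definition van :: "((nat \<Rightarrow> complex) \<Rightarrow> complex) \<Rightarrow> bool" where
  "van f \<longleftrightarrow> (\<forall>p\<in>Z. f p = 0)"

definition alg :: "nat \<Rightarrow> bool" where
  "alg j \<longleftrightarrow> (\<exists>n a. (\<forall>i. a i \<in> polfun {..<j}) \<and> \<not> van (a n) \<and> van (\<lambda>p. \<Sum>i\<le>n. a i p * p j ^ i))"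

text \<open>The minimal polynomial of coordinate \<open>j\<close> over the earlier ones, with
  denominators cleared into the leading coefficient \<open>a d\<close>. Minimality is stated as
  independence of the powers below \<open>d\<close>, the form in which remainders are shown to
  vanish.\<close>

definition minpol :: "nat \<Rightarrow> nat \<Rightarrow> (nat \<Rightarrow> (nat \<Rightarrow> complex) \<Rightarrow> complex) \<Rightarrow> bool" where
  "minpol j d a \<longleftrightarrow> (\<forall>i. a i \<in> polfun {..<j}) \<and> \<not> van (a d) \<and> van (\<lambda>p. \<Sum>i\<le>d. a i p * p j ^ i) \<and>
     (\<forall>r. (\<forall>i. r i \<in> polfun {..<j}) \<longrightarrow> van (\<lambda>p. \<Sum>i<d. r i p * p j ^ i) \<longrightarrow> (\<forall>i<d. van (r i)))"

text \<open>The Zariski closure of the projection of \<open>Z\<close> to the first \<open>j\<close>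
  coordinates.\<close>

definition zeros :: "nat \<Rightarrow> (nat \<Rightarrow> complex) \<Rightarrow> bool" where
  "zeros j p \<longleftrightarrow> (\<forall>h\<in>polfun {..<j}. van h \<longrightarrow> h p = 0)"

lemma van_mult: "f \<in> polfun A \<Longrightarrow> g \<in> polfun B \<Longrightarrow> van (\<lambda>p. f p * g p) \<Longrightarrow> van f \<or> van g"
  using prime[of f g] polfun_mono[of A UNIV f] polfun_mono[of B UNIV g] by (auto simp: van_def)

lemma van_power: "f \<in> polfun A \<Longrightarrow> van (\<lambda>p. f p ^ k) \<Longrightarrow> van f"
  by (auto simp: van_def)

lemma van_leading:
  assumes "van (\<lambda>p. \<Sum>i<n. r i p * p j ^ i)" "\<not> (\<forall>i<n. van (r i))"
  obtains e where "e < n" "\<not> van (r e)" "van (\<lambda>p. \<Sum>i\<le>e. r i p * p j ^ i)"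
proof -
  define E where "E = {i. i < n \<and> \<not> van (r i)}"
  have E: "finite E" "E \<noteq> {}" using assms(2) by (auto simp: E_def)
  define e where "e = Max E"
  have e: "e < n" "\<not> van (r e)" using Max_in[OF E] by (auto simp: E_def e_def)
  have "i \<le> e" if "i < n" "\<not> van (r i)" for i
    unfolding e_def by (rule Max_ge) (use that E in \<open>auto simp: E_def\<close>)
  then have "van (r i)" if "i < n" "i > e" for i using that by force
  then have "(\<Sum>i\<le>e. r i p * p j ^ i) = (\<Sum>i<n. r i p * p j ^ i)" if "p \<in> Z" for p
    by (intro sum.mono_neutral_left) (use e that in \<open>auto simp: van_def not_le\<close>)
  then have "van (\<lambda>p. \<Sum>i\<le>e. r i p * p j ^ i)" using assms(1) by (simp add: van_def)
  then show ?thesis using that e by blast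
qed

lemma minpol_exists:
  assumes "alg j"
  obtains d a where "minpol j d a"
proof -
  define P where "P n \<longleftrightarrow> (\<exists>a. (\<forall>i. a i \<in> polfun {..<j}) \<and> \<not> van (a n) \<and> van (\<lambda>p. \<Sum>i\<le>n. a i p * p j ^ i))" for n
  have "\<exists>n. P n" using assms by (auto simp: alg_def P_def)
  define d where "d = (LEAST n. P n)"
  have "P d" unfolding d_def using \<open>\<exists>n. P n\<close> by (rule LeastI_ex)
  then obtain a where a: "\<forall>i. a i \<in> polfun {..<j}" "\<not> van (a d)" "van (\<lambda>p. \<Sum>i\<le>d. a i p * p j ^ i)"
    unfolding P_def by (elim exE conjE) (rule that)
  have "\<forall>i<d. van (r i)" if r: "\<forall>i. r i \<in> polfun {..<j}" "van (\<lambda>p. \<Sum>i<d. r i p * p j ^ i)" for r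
  proof (rule ccontr)
    assume "\<not> (\<forall>i<d. van (r i))"
    then obtain e where "e < d" "\<not> van (r e)" "van (\<lambda>p. \<Sum>i\<le>e. r i p * p j ^ i)"
      using van_leading[OF r(2)] by blast
    then have "P e" using r(1) by (auto simp: P_def)
    then show False using \<open>e < d\<close> not_less_Least[of e P] by (simp add: d_def)
  qed
  then have "minpol j d a" using a by (auto simp: minpol_def)
  then show ?thesis using that by blast
qed

lemma minpol_pos: "minpol j d a \<Longrightarrow> d > 0"
  by (cases d) (auto simp: minpol_def van_def)

lemma polfun_poly_in: "(\<And>i. a i \<in> polfun {..<j}) \<Longrightarrow> (\<lambda>p. \<Sum>i\<in>I. a i p * p j ^ i) \<in> polfun {..<Suc j}"
  by (intro polfun_sum polfun.mult polfun_power polfun.coord) (auto intro: polfun_lessThan_mono[of j])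

text \<open>A Euclidean remainder of least degree shows that every nonzero element of the coordinate ring
  of \<open>Z\<close> divides a nonzero element that does not involve the last, algebraic, coordinate.\<close>

lemma norm_step:
  assumes mp: "minpol j d a" and f: "f \<in> polfun {..<Suc j}" "\<not> van f"
  obtains h q where "h \<in> polfun {..<j}" "\<not> van h" "q \<in> polfun {..<Suc j}" "van (\<lambda>p. h p - q p * f p)"
proof -
  have a: "\<And>i. a i \<in> polfun {..<j}" "\<not> van (a d)" "van (\<lambda>p. \<Sum>i\<le>d. a i p * p j ^ i)"
    and min: "\<And>r i. (\<forall>i. r i \<in> polfun {..<j}) \<Longrightarrow> van (\<lambda>p. \<Sum>i<d. r i p * p j ^ i) \<Longrightarrow> i < d \<Longrightarrow> van (r i)"
    using mp by (auto simp: minpol_def)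
  \<comment> \<open>\<open>M e\<close> says that, modulo functions vanishing on \<open>Z\<close>,
    some multiple of \<open>f\<close> has degree \<open>e\<close> in coordinate \<open>j\<close>,
    with nonzero leading coefficient.\<close>
  define M where "M e \<longleftrightarrow> (\<exists>r q. (\<forall>i. r i \<in> polfun {..<j}) \<and> q \<in> polfun {..<Suc j} \<and> \<not> van (r e) \<and>
      van (\<lambda>p. (\<Sum>i\<le>e. r i p * p j ^ i) - q p * f p))" for e
  have M_intro: "\<exists>e<n. M e" if "\<forall>i. r i \<in> polfun {..<j}" "q \<in> polfun {..<Suc j}"
      "van (\<lambda>p. (\<Sum>i<n. r i p * p j ^ i) - q p * f p)" "\<not> (\<forall>i<n. van (r i))" for r q n
  proof -
    define E where "E = {i. i < n \<and> \<not> van (r i)}"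
    have E: "finite E" "E \<noteq> {}" using that by (auto simp: E_def)
    define e where "e = Max E"
    have e: "e < n" "\<not> van (r e)" using Max_in[OF E] by (auto simp: E_def e_def)
    have "i \<le> e" if "i < n" "\<not> van (r i)" for i
      unfolding e_def by (rule Max_ge) (use that E in \<open>auto simp: E_def\<close>)
    then have "van (r i)" if "i < n" "i > e" for i using that by force
    then have "(\<Sum>i\<le>e. r i p * p j ^ i) = (\<Sum>i<n. r i p * p j ^ i)" if "p \<in> Z" for p
      by (intro sum.mono_neutral_left) (use e that in \<open>auto simp: van_def not_le\<close>)
    then have "van (\<lambda>p. (\<Sum>i\<le>e. r i p * p j ^ i) - q p * f p)" using that(3) by (simp add: van_def)
    then show ?thesis using that e unfolding M_def by blast
  qed
  obtain n c where c: "\<And>i. c i \<in> polfun {..<j}" "\<And>p. f p = (\<Sum>i\<le>n. c i p * p j ^ i)"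
    by (rule polfun_expand_Suc[OF f(1)]) (rule that)
  \<comment> \<open>Pseudo-division of \<open>f\<close> by the minimal polynomial leaves a remainder
    that equals \<open>a d ^ k * f\<close> on \<open>Z\<close>; it is nonzero because
    \<open>a d\<close> and \<open>f\<close> are.\<close>
  have "\<exists>e<d. M e"
  proof -
    obtain k q r where q: "\<forall>i. q i \<in> polfun {..<j}" and r: "\<forall>i. r i \<in> polfun {..<j}"
      and eq: "\<And>p x. a d p ^ k * (\<Sum>i\<le>n. c i p * x ^ i) =
        (\<Sum>i\<le>n - d. q i p * x ^ i) * (\<Sum>i\<le>d. a i p * x ^ i) + (\<Sum>i<d. r i p * x ^ i)"
      using polfun_pseudo_div[of a "{..<j}" c d n] a(1) c(1) by blast
    have r': "(\<Sum>i<d. r i p * p j ^ i) = a d p ^ k * f p" if "p \<in> Z" for p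
      using eq[of p "p j"] a(3) that by (simp add: c(2) van_def)
    have "\<not> (\<forall>i<d. van (r i))"
    proof
      assume *: "\<forall>i<d. van (r i)"
      have "van (\<lambda>p. a d p ^ k * f p)"
        unfolding van_def
      proof
        fix p assume "p \<in> Z"
        then show "a d p ^ k * f p = 0" using * by (subst r'[symmetric]) (auto simp: van_def)
      qed
      then show False using van_mult[OF polfun_power[OF a(1)] f(1)] van_power[OF a(1)] a(2) f(2) by blast
    qed
    then show ?thesis
      using M_intro[OF r, of "\<lambda>p. a d p ^ k" d] r' polfun_lessThan_mono[OF _ polfun_power[OF a(1)], of "Suc j"]
      by (auto simp: van_def)
  qed
  define e where "e = (LEAST e. M e)"
  have Me: "M e" and ed: "e < d"
    using \<open>\<exists>e<d. M e\<close> LeastI[of M] Least_le[of M] unfolding e_def by (blast, metis le_less_trans)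
  obtain r q where r: "\<And>i. r i \<in> polfun {..<j}" and q: "q \<in> polfun {..<Suc j}" and re: "\<not> van (r e)"
    and rq: "van (\<lambda>p. (\<Sum>i\<le>e. r i p * p j ^ i) - q p * f p)" using Me unfolding M_def by blast
  \<comment> \<open>If \<open>e > 0\<close>, the minimal polynomial is divided by the element of
    degree \<open>e\<close>. The remainder vanishes by minimality of \<open>e\<close>; then so does
    the quotient, whose degree is below \<open>d\<close>. Together this kills
    \<open>r e ^ k * a d\<close>.\<close>
  have "e = 0"
  proof (rule ccontr)
    assume "e \<noteq> 0"
    obtain k Q R where Q: "\<forall>i. Q i \<in> polfun {..<j}" and R: "\<forall>i. R i \<in> polfun {..<j}"
      and eq: "\<And>p x. r e p ^ k * (\<Sum>i\<le>d. a i p * x ^ i) =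
        (\<Sum>i\<le>d - e. Q i p * x ^ i) * (\<Sum>i\<le>e. r i p * x ^ i) + (\<Sum>i<e. R i p * x ^ i)"
      using polfun_pseudo_div[of r "{..<j}" a e d] a(1) r by blast
    let ?Q = "\<lambda>p. \<Sum>i\<le>d - e. Q i p * p j ^ i"
    have Q': "?Q \<in> polfun {..<Suc j}" using Q by (intro polfun_poly_in) auto
    have R': "(\<Sum>i<e. R i p * p j ^ i) = - ?Q p * q p * f p" if "p \<in> Z" for p
      using eq[of p "p j"] a(3) rq that by (simp add: van_def eq_neg_iff_add_eq_0 add.commute mult.assoc)
    have vR: "\<forall>i<e. van (R i)"
    proof (rule ccontr)
      assume "\<not> (\<forall>i<e. van (R i))"
      moreover have "(\<lambda>p. - ?Q p * q p) \<in> polfun {..<Suc j}" by (intro polfun.mult polfun_uminus Q' q)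
      moreover have "van (\<lambda>p. (\<Sum>i<e. R i p * p j ^ i) - - ?Q p * q p * f p)" using R' by (simp add: van_def)
      ultimately have "\<exists>e'<e. M e'" by (intro M_intro[OF R])
      then show False using not_less_Least unfolding e_def by blast
    qed
    have "van (\<lambda>p. ?Q p * (\<Sum>i\<le>e. r i p * p j ^ i))"
      unfolding van_def
    proof
      fix p assume p: "p \<in> Z"
      have "(\<Sum>i<e. R i p * p j ^ i) = 0" using vR p by (auto simp: van_def)
      then show "?Q p * (\<Sum>i\<le>e. r i p * p j ^ i) = 0" using eq[of p "p j"] a(3) p by (simp add: van_def)
    qed
    moreover have "\<not> van (\<lambda>p. \<Sum>i\<le>e. r i p * p j ^ i)"
    proof
      assume v: "van (\<lambda>p. \<Sum>i\<le>e. r i p * p j ^ i)"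
      have "(\<Sum>i<d. (if i \<le> e then r i p else 0) * p j ^ i) = (\<Sum>i\<le>e. r i p * p j ^ i)" for p
        by (rule sum.mono_neutral_cong_right) (use ed in auto)
      moreover have "(\<lambda>p. if i \<le> e then r i p else 0) \<in> polfun {..<j}" for i
        using r by (cases "i \<le> e") (auto intro: polfun.intros)
      ultimately have "van (\<lambda>p. if e \<le> e then r e p else 0)"
        using min[of "\<lambda>i p. if i \<le> e then r i p else 0" e] v ed by auto
      then show False using re by simp
    qed
    ultimately have vQ: "van ?Q"
      using van_mult[OF Q' polfun_poly_in[of r j "{..e}"]] r by blast
    have vQi: "van (Q i)" if "i \<le> d - e" for i
    proof -
      have "(\<Sum>i<d. (if i \<le> d - e then Q i p else 0) * p j ^ i) = ?Q p" for p
        by (rule sum.mono_neutral_cong_right) (use \<open>e \<noteq> 0\<close> ed in auto)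
      moreover have "(\<lambda>p. if i \<le> d - e then Q i p else 0) \<in> polfun {..<j}" for i
        using Q by (cases "i \<le> d - e") (auto intro: polfun.intros)
      moreover have "i < d" using that \<open>e \<noteq> 0\<close> ed by linarith
      ultimately have "van (\<lambda>p. if i \<le> d - e then Q i p else 0)"
        using min[of "\<lambda>i p. if i \<le> d - e then Q i p else 0" i] vQ by auto
      then show ?thesis using that by simp
    qed
    have "r e p ^ k * a d p = 0" if p: "p \<in> Z" for p
    proof -
      have z: "(\<Sum>i\<le>d. (r e p ^ k * a i p) * x ^ i) = 0" for x
      proof -
        have "(\<Sum>i\<le>d. (r e p ^ k * a i p) * x ^ i) = r e p ^ k * (\<Sum>i\<le>d. a i p * x ^ i)"
          by (simp add: sum_distrib_left mult.assoc)
        also have "\<dots> = 0"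
          unfolding eq using vR vQi p by (auto simp: van_def)
        finally show ?thesis .
      qed
      then show ?thesis using polyfun_eq_0[of "\<lambda>i. r e p ^ k * a i p" d] by simp
    qed
    then have "van (\<lambda>p. r e p ^ k * a d p)" by (simp add: van_def)
    then show False using van_mult[OF polfun_power[OF r] a(1)] van_power[OF r] a(2) re by blast
  qed
  then show ?thesis using that[of "r 0" q] r q re rq by simp
qed

text \<open>The algebraic coordinates are eliminated one after another, from the last down to
  \<open>D\<close>.\<close>

lemma norm_exists:
  assumes "D \<le> j" "\<And>i. D \<le> i \<Longrightarrow> i < j \<Longrightarrow> alg i" "f \<in> polfun {..<j}" "\<not> van f"
  obtains h q where "h \<in> polfun {..<D}" "\<not> van h" "q \<in> polfun {..<j}" "van (\<lambda>p. h p - q p * f p)"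
proof -
  have "\<exists>h q. h \<in> polfun {..<D} \<and> \<not> van h \<and> q \<in> polfun {..<j} \<and> van (\<lambda>p. h p - q p * f p)"
    using assms
  proof (induction arbitrary: f rule: dec_induct)
    case base
    then show ?case by (intro exI[of _ f] exI[of _ "\<lambda>p. 1"]) (auto simp: van_def intro: polfun.intros)
  next
    case (step n)
    have "alg n" using step by auto
    then obtain d a where "minpol n d a" by (rule minpol_exists)
    then obtain h q where h: "h \<in> polfun {..<n}" "\<not> van h" "q \<in> polfun {..<Suc n}" "van (\<lambda>p. h p - q p * f p)"
      using norm_step step.prems(2,3) by blast
    then obtain h' q' where h': "h' \<in> polfun {..<D}" "\<not> van h'" "q' \<in> polfun {..<n}" "van (\<lambda>p. h' p - q' p * h p)"
      using step.IH[of h] step.prems by auto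
    then have "van (\<lambda>p. h' p - (q' p * q p) * f p)" using h by (simp add: van_def mult.assoc)
    moreover have "(\<lambda>p. q' p * q p) \<in> polfun {..<Suc n}"
      using h h' polfun_lessThan_mono[of n "Suc n"] by (intro polfun.mult) auto
    ultimately show ?case using h' by blast
  qed
  then show ?thesis using that by blast
qed

text \<open>The identity between \<open>h\<close> and \<open>q * f\<close> on \<open>Z\<close>
  persists on the closure described by \<open>zeros\<close>.\<close>

lemma zeros_norm_nonzero:
  assumes "h \<in> polfun {..<D}" "D \<le> j" "q \<in> polfun {..<j}" "f \<in> polfun {..<j}"
    "van (\<lambda>p. h p - q p * f p)" "zeros j p" "h p \<noteq> 0"
  shows "f p \<noteq> 0"
proof -
  have "(\<lambda>p. h p - q p * f p) \<in> polfun {..<j}"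
    using assms polfun_lessThan_mono by (intro polfun_diff polfun.mult) auto
  then have "h p - q p * f p = 0" using assms(6)[unfolded zeros_def, rule_format, OF _ assms(5)] by blast
  then show ?thesis using assms(7) by auto
qed

text \<open>A function \<open>h\<close> vanishing on \<open>Z\<close> is pseudo-divided by the
  minimal polynomial. The coefficients of the remainder vanish on \<open>Z\<close> by minimality,
  hence at \<open>p\<close>; as \<open>a d p\<close> is nonzero, \<open>h\<close> vanishes at each
  root.\<close>

lemma zeros_extend:
  assumes mp: "minpol j d a" and "zeros j p" "a d p \<noteq> 0" "(\<Sum>i\<le>d. a i p * x ^ i) = 0"
  shows "zeros (Suc j) (p(j := x))"
  unfolding zeros_def
proof (intro ballI impI)
  fix h assume h: "h \<in> polfun {..<Suc j}" "van h"
  have a: "\<And>i. a i \<in> polfun {..<j}" "\<not> van (a d)" "van (\<lambda>p. \<Sum>i\<le>d. a i p * p j ^ i)"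
    and min: "\<And>r i. (\<forall>i. r i \<in> polfun {..<j}) \<Longrightarrow> van (\<lambda>p. \<Sum>i<d. r i p * p j ^ i) \<Longrightarrow> i < d \<Longrightarrow> van (r i)"
    using mp by (auto simp: minpol_def)
  obtain n c where c: "\<And>i. c i \<in> polfun {..<j}" "\<And>p. h p = (\<Sum>i\<le>n. c i p * p j ^ i)"
    by (rule polfun_expand_Suc[OF h(1)]) (rule that)
  obtain k q r where q: "\<forall>i. q i \<in> polfun {..<j}" and r: "\<forall>i. r i \<in> polfun {..<j}"
    and eq: "\<And>p x. a d p ^ k * (\<Sum>i\<le>n. c i p * x ^ i) =
      (\<Sum>i\<le>n - d. q i p * x ^ i) * (\<Sum>i\<le>d. a i p * x ^ i) + (\<Sum>i<d. r i p * x ^ i)"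
    using polfun_pseudo_div[of a "{..<j}" c d n] a(1) c(1) by blast
  have "van (\<lambda>p. \<Sum>i<d. r i p * p j ^ i)"
    unfolding van_def
  proof
    fix p assume p: "p \<in> Z"
    then show "(\<Sum>i<d. r i p * p j ^ i) = 0"
      using eq[of p "p j"] a(3) h(2) by (simp add: van_def flip: c(2))
  qed
  then have "van (r i)" if "i < d" for i using min r that by blast
  then have "r i p = 0" if "i < d" for i using assms(2) r that by (auto simp: zeros_def)
  then have "a d p ^ k * (\<Sum>i\<le>n. c i p * x ^ i) = 0" using eq[of p x] assms(4) by simp
  moreover have "c i (p(j := x)) = c i p" for i by (rule polfun_cong[OF c(1)]) auto
  ultimately show "h (p(j := x)) = 0" using assms(3) by (simp add: c(2))
qed

text \<open>Each further coordinate is a root of its minimal polynomial, available where the leading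
  coefficient is nonzero. A norm \<open>h\<close> of that coefficient in the first \<open>D\<close>
  coordinates turns this into a condition on \<open>q\<close>, and \<open>N\<close> is the product
  of these norms.\<close>

lemma lift_exists:
  assumes "D \<le> j" "\<And>i. D \<le> i \<Longrightarrow> i < j \<Longrightarrow> alg i"
  shows "\<exists>N. N \<in> polfun {..<D} \<and> \<not> van N \<and>
     (\<forall>q. zeros D q \<longrightarrow> N q \<noteq> 0 \<longrightarrow> (\<exists>p. (\<forall>i<D. p i = q i) \<and> zeros j p))"
  using assms
proof (induction rule: dec_induct)
  case base
  have "\<not> van (\<lambda>p. 1)" using nonempty by (auto simp: van_def)
  then show ?case by (intro exI[of _ "\<lambda>p. 1"]) (auto intro: polfun.const)
next
  case (step n)
  obtain N where N: "N \<in> polfun {..<D}" "\<not> van N"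
    "\<And>q. zeros D q \<Longrightarrow> N q \<noteq> 0 \<Longrightarrow> \<exists>p. (\<forall>i<D. p i = q i) \<and> zeros n p"
    using step.IH step.prems by auto
  have "alg n" using step by auto
  then obtain d a where mp: "minpol n d a" by (rule minpol_exists)
  then have a: "a d \<in> polfun {..<n}" "\<not> van (a d)" by (auto simp: minpol_def)
  obtain h q where h: "h \<in> polfun {..<D}" "\<not> van h" "q \<in> polfun {..<n}" "van (\<lambda>p. h p - q p * a d p)"
    using norm_exists[OF \<open>D \<le> n\<close> _ a] step.prems by (metis less_Suc_eq)
  have "\<not> van (\<lambda>p. N p * h p)" using van_mult[OF N(1) h(1)] N(2) h(2) by blast
  moreover have "\<exists>p. (\<forall>i<D. p i = q i) \<and> zeros (Suc n) p" if q: "zeros D q" "N q * h q \<noteq> 0" for q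
  proof -
    obtain p where p: "\<forall>i<D. p i = q i" "zeros n p" using N(3)[OF q(1)] q(2) by auto
    have "h p = h q" by (rule polfun_cong[OF h(1)]) (use p in auto)
    then have "a d p \<noteq> 0"
      using zeros_norm_nonzero[OF h(1) \<open>D \<le> n\<close> h(3) a(1) h(4) p(2)] q(2) by simp
    moreover obtain x where x: "(\<Sum>i\<le>d. a i p * x ^ i) = 0"
      using complex_root_exists[of "\<lambda>i. a i p" d, OF \<open>a d p \<noteq> 0\<close> minpol_pos[OF mp]] by blast
    ultimately have "zeros (Suc n) (p(n := x))" using zeros_extend[OF mp p(2)] by blast
    then show ?thesis using p(1) \<open>D \<le> n\<close> by (intro exI[of _ "p(n := x)"]) auto
  qed
  ultimately show ?case
    using polfun.mult[OF N(1) h(1)] by (intro exI[of _ "\<lambda>p. N p * h p"]) auto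
qed

end

subsection \<open>Roots depending on parameters\<close>

lemma norm_prod_mset_ge:
  fixes A :: "complex multiset"
  assumes "\<And>x. x \<in># A \<Longrightarrow> \<delta> \<le> norm (y - x)" "\<delta> \<ge> 0"
  shows "\<delta> ^ size A \<le> norm (\<Prod>x\<in>#A. y - x)"
  using assms(1)
proof (induction A)
  case (add x A)
  then have "\<delta> * \<delta> ^ size A \<le> norm (y - x) * norm (\<Prod>x\<in>#A. y - x)"
    using assms(2) by (intro mult_mono) auto
  then show ?case by (simp add: norm_mult)
qed simp

lemma poly_factorization:
  fixes a :: "nat \<Rightarrow> complex"
  assumes "a d \<noteq> 0"
  obtains A where "size A = d" "\<And>y. (\<Sum>i\<le>d. a i * y ^ i) = a d * (\<Prod>x\<in>#A. y - x)"
    "\<And>r. r \<in># A \<Longrightarrow> (\<Sum>i\<le>d. a i * r ^ i) = 0"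
proof -
  define P where "P = (\<Sum>i\<le>d. monom (a i) i)"
  have cP: "coeff P i = (if i \<le> d then a i else 0)" for i by (simp add: P_def coeff_sum coeff_monom)
  have deg: "degree P = d"
    using assms by (intro antisym degree_le le_degree) (auto simp: cP)
  have evP: "poly P y = (\<Sum>i\<le>d. a i * y ^ i)" for y by (simp add: P_def poly_sum poly_monom)
  have "P \<noteq> 0" using cP[of d] assms by auto
  then obtain A where A: "size A = degree P" "P = smult (lead_coeff P) (\<Prod>x\<in>#A. [:-x, 1:])"
    using alg_closed_imp_factorization by blast
  have "poly (\<Prod>x\<in>#A. [:-x, 1:]) y = (\<Prod>x\<in>#A. y - x)" for y
    by (induction A) (auto simp: algebra_simps)
  then have ev: "(\<Sum>i\<le>d. a i * y ^ i) = a d * (\<Prod>x\<in>#A. y - x)" for y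
    using arg_cong[OF A(2), of "\<lambda>P. poly P y"] by (simp add: evP deg cP)
  moreover have "(\<Prod>x\<in>#A. r - x) = 0" if "r \<in># A" for r
    using that by (auto simp: prod_mset_zero_iff)
  ultimately show ?thesis using that[of A] A(1) deg by simp
qed

text \<open>The value at \<open>y\<close> is the leading coefficient times the product of the
  differences \<open>y - x\<close> over the roots \<open>x\<close>; for the nearest root
  \<open>r\<close> each factor has norm at least \<open>norm (y - r)\<close>.\<close>

lemma close_root:
  fixes a :: "nat \<Rightarrow> complex"
  assumes "a d \<noteq> 0" "d > 0"
  obtains r where "(\<Sum>i\<le>d. a i * r ^ i) = 0" "norm (r - y) ^ d \<le> norm (\<Sum>i\<le>d. a i * y ^ i) / norm (a d)"
proof -
  obtain A where A: "size A = d" "\<And>y. (\<Sum>i\<le>d. a i * y ^ i) = a d * (\<Prod>x\<in>#A. y - x)"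
    "\<And>r. r \<in># A \<Longrightarrow> (\<Sum>i\<le>d. a i * r ^ i) = 0"
    using poly_factorization[of a d, OF assms(1)] by blast
  have ne: "set_mset A \<noteq> {}" using A(1) assms(2) by auto
  define r where "r = arg_min_on (\<lambda>x. norm (y - x)) (set_mset A)"
  have r: "r \<in># A" "\<And>x. x \<in># A \<Longrightarrow> norm (y - r) \<le> norm (y - x)"
    unfolding r_def using arg_min_if_finite[OF _ ne] arg_min_least[OF _ ne] by auto
  have "norm (y - r) ^ d \<le> norm (\<Prod>x\<in>#A. y - x)"
    using norm_prod_mset_ge[of A "norm (y - r)" y] r(2) A(1) by auto
  then have "norm (r - y) ^ d \<le> norm (\<Sum>i\<le>d. a i * y ^ i) / norm (a d)"
    using assms(1) by (simp add: A(2) norm_mult norm_minus_commute)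
  then show ?thesis using A(3)[OF r(1)] that by blast
qed

lemma tendsto_power_0D:
  fixes f :: "'a \<Rightarrow> 'b::real_normed_vector"
  assumes "((\<lambda>x. norm (f x) ^ d) \<longlongrightarrow> 0) F" "d > 0"
  shows "(f \<longlongrightarrow> 0) F"
proof -
  have "((\<lambda>x. root d (norm (f x) ^ d)) \<longlongrightarrow> root d 0) F"
    by (intro tendsto_real_root assms(1))
  then show ?thesis using assms(2) by (simp add: real_root_power_cancel tendsto_norm_zero_iff)
qed

text \<open>An implicit function theorem at the single point 0. The roots are picked by
  \<open>close_root\<close> for each \<open>s\<close> separately, so \<open>x\<close> may jump
  elsewhere, but the estimate forces convergence and a derivative at 0.\<close>

lemma root_branch:
  fixes A :: "nat \<Rightarrow> complex \<Rightarrow> complex"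
  assumes diff: "\<And>i. (A i has_field_derivative A' i) (at 0)" and "A d 0 \<noteq> 0" and d: "d > 0"
    and root: "(\<Sum>i\<le>d. A i 0 * x0 ^ i) = 0"
    and simple: "(\<Sum>i\<le>d. of_nat i * A i 0 * x0 ^ (i - 1)) \<noteq> 0"
  obtains x x' where "x 0 = x0" "eventually (\<lambda>s. (\<Sum>i\<le>d. A i s * x s ^ i) = 0) (nhds 0)"
    "(x has_field_derivative x') (at 0)"
proof -
  have "\<exists>r. A d s \<noteq> 0 \<longrightarrow> (\<Sum>i\<le>d. A i s * r ^ i) = 0 \<and>
      norm (r - x0) ^ d \<le> norm (\<Sum>i\<le>d. A i s * x0 ^ i) / norm (A d s)" for s
    using close_root[of "\<lambda>i. A i s" d x0] d by metis
  then obtain r where r: "\<And>s. A d s \<noteq> 0 \<Longrightarrow> (\<Sum>i\<le>d. A i s * r s ^ i) = 0"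
    "\<And>s. A d s \<noteq> 0 \<Longrightarrow> norm (r s - x0) ^ d \<le> norm (\<Sum>i\<le>d. A i s * x0 ^ i) / norm (A d s)"
    by metis
  define Q where "Q s = (\<Sum>i\<le>d. A i s * x0 ^ i)" for s
  \<comment> \<open>The difference quotient in the unknown between \<open>x0\<close> and
    \<open>r s\<close>, so that \<open>(r s - x0) * R s = - Q s\<close>; its limit at 0 is the
    nonzero derivative.\<close>
  define R where "R s = (\<Sum>i\<le>d. A i s * (\<Sum>k<i. x0 ^ (i - Suc k) * r s ^ k))" for s
  have cont: "isCont (A i) 0" for i using diff DERIV_isCont by blast
  then have tA: "(A i \<longlongrightarrow> A i 0) (nhds 0)" for i by (simp add: isCont_def tendsto_at_iff_tendsto_nhds)
  have ne: "eventually (\<lambda>s. A d s \<noteq> 0) (nhds 0)"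
    using tA \<open>A d 0 \<noteq> 0\<close> by (rule tendsto_imp_eventually_ne)
  have at_le: "at (0::complex) \<le> nhds 0" by (simp add: at_within_def)
  have Q0: "Q 0 = 0" using root by (simp add: Q_def)
  have Q': "(Q has_field_derivative (\<Sum>i\<le>d. A' i * x0 ^ i)) (at 0)"
    unfolding Q_def by (auto intro!: derivative_eq_intros diff)
  have "((\<lambda>s. norm (Q s) / norm (A d s)) \<longlongrightarrow> norm (Q 0) / norm (A d 0)) (nhds 0)"
    using tA \<open>A d 0 \<noteq> 0\<close> unfolding Q_def by (intro tendsto_intros) auto
  then have lim: "((\<lambda>s. norm (Q s) / norm (A d s)) \<longlongrightarrow> 0) (nhds 0)" by (simp add: Q0)
  have "((\<lambda>s. norm (r s - x0) ^ d) \<longlongrightarrow> 0) (nhds 0)"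
    by (rule tendsto_sandwich[OF _ _ tendsto_const lim]) (use ne r(2) in \<open>auto elim!: eventually_mono simp: Q_def\<close>)
  then have rlim: "(r \<longlongrightarrow> x0) (nhds 0)"
    using tendsto_power_0D[of "\<lambda>s. r s - x0"] d LIM_zero_iff by blast
  then have r0: "r 0 = x0" using tendsto_nhds_iff[of r x0 0]
    by (metis isCont_def tendsto_at_iff_tendsto_nhds tendsto_unique t1_space_nhds tendsto_const)
  have eqQ: "(r s - x0) * R s = - Q s" if "A d s \<noteq> 0" for s
  proof -
    have "(r s - x0) * R s = (\<Sum>i\<le>d. A i s * (r s ^ i - x0 ^ i))"
      unfolding R_def sum_distrib_left power_diff_sumr2 by (simp add: mult_ac sum_distrib_left)
    also have "\<dots> = - Q s"
      using r(1)[OF that] by (simp add: Q_def algebra_simps sum_subtractf)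
    finally show ?thesis .
  qed
  have "(R \<longlongrightarrow> (\<Sum>i\<le>d. A i 0 * (\<Sum>k<i. x0 ^ (i - Suc k) * x0 ^ k))) (nhds 0)"
    unfolding R_def by (intro tendsto_intros tA rlim)
  also have "(\<Sum>i\<le>d. A i 0 * (\<Sum>k<i. x0 ^ (i - Suc k) * x0 ^ k)) = (\<Sum>i\<le>d. of_nat i * A i 0 * x0 ^ (i - 1))"
  proof (rule sum.cong[OF refl])
    fix i
    have "(\<Sum>k<i. x0 ^ (i - Suc k) * x0 ^ k) = (\<Sum>k<i. x0 ^ (i - 1))"
      by (rule sum.cong) (auto simp flip: power_add)
    then show "A i 0 * (\<Sum>k<i. x0 ^ (i - Suc k) * x0 ^ k) = of_nat i * A i 0 * x0 ^ (i - 1)" by simp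
  qed
  finally have Rlim: "(R \<longlongrightarrow> (\<Sum>i\<le>d. of_nat i * A i 0 * x0 ^ (i - 1))) (nhds 0)" .
  have Rne: "eventually (\<lambda>s. R s \<noteq> 0) (nhds 0)"
    using Rlim simple by (rule tendsto_imp_eventually_ne)
  have "((\<lambda>s. - (Q s / s) / R s) \<longlongrightarrow> - (\<Sum>i\<le>d. A' i * x0 ^ i) / (\<Sum>i\<le>d. of_nat i * A i 0 * x0 ^ (i - 1))) (at 0)"
  proof (intro tendsto_intros simple)
    show "((\<lambda>s. Q s / s) \<longlongrightarrow> (\<Sum>i\<le>d. A' i * x0 ^ i)) (at 0)"
      using Q' by (simp add: DERIV_def Q0)
    show "(R \<longlongrightarrow> (\<Sum>i\<le>d. of_nat i * A i 0 * x0 ^ (i - 1))) (at 0)"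
      using Rlim by (rule tendsto_mono[OF at_le])
  qed
  moreover have neq0: "eventually (\<lambda>s. s \<noteq> 0) (at (0::complex))" by (rule eventually_neq_at_within)
  have "eventually (\<lambda>s. - (Q s / s) / R s = (r s - x0) / s) (at 0)"
    using filter_leD[OF at_le ne] filter_leD[OF at_le Rne] neq0
  proof eventually_elim
    case (elim s)
    then show ?case using eqQ[of s] by (simp add: field_simps)
  qed
  ultimately have "((\<lambda>s. (r s - x0) / s) \<longlongrightarrow> - (\<Sum>i\<le>d. A' i * x0 ^ i) / (\<Sum>i\<le>d. of_nat i * A i 0 * x0 ^ (i - 1))) (at 0)"
    by (rule Lim_transform_eventually)
  then have "(r has_field_derivative - (\<Sum>i\<le>d. A' i * x0 ^ i) / (\<Sum>i\<le>d. of_nat i * A i 0 * x0 ^ (i - 1))) (at 0)"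
    by (simp add: DERIV_def r0)
  moreover have "eventually (\<lambda>s. (\<Sum>i\<le>d. A i s * r s ^ i) = 0) (nhds 0)"
    using ne by eventually_elim (rule r(1))
  ultimately show ?thesis using that r0 by blast
qed

lemma polfun_differentiable:
  assumes "f \<in> polfun A" "\<And>i. i \<in> A \<Longrightarrow> (\<lambda>s. p s i) field_differentiable at s0"
  shows "(\<lambda>s. f (p s)) field_differentiable at s0"
  using assms(1)
  by (induction rule: polfun.induct)
    (auto intro: assms(2) field_differentiable_add field_differentiable_mult field_differentiable_const)

section \<open>Simple roots and curves in the closure\<close>

context irreducible_points
begin

text \<open>The derivative has degree \<open>d - 1\<close> and leading coefficient
  \<open>d * a d\<close>, nonzero in characteristic zero, so minimality applies.\<close>

lemma minpol_deriv_not_van: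
  assumes "minpol j d a"
  shows "\<not> van (\<lambda>p. \<Sum>i\<le>d. of_nat i * a i p * p j ^ (i - 1))"
proof
  assume v: "van (\<lambda>p. \<Sum>i\<le>d. of_nat i * a i p * p j ^ (i - 1))"
  obtain d' where d': "d = Suc d'" using minpol_pos[OF assms] by (cases d) auto
  have a: "\<And>i. a i \<in> polfun {..<j}" "\<not> van (a d)"
    and min: "\<And>r i. (\<forall>i. r i \<in> polfun {..<j}) \<Longrightarrow> van (\<lambda>p. \<Sum>i<d. r i p * p j ^ i) \<Longrightarrow> i < d \<Longrightarrow> van (r i)"
    using assms by (auto simp: minpol_def)
  have "van (\<lambda>p. of_nat (Suc d') * a (Suc d') p)"
  proof (rule min[of "\<lambda>i p. of_nat (Suc i) * a (Suc i) p" d'])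
    have "(\<Sum>i\<le>d. of_nat i * a i p * p j ^ (i - 1)) = (\<Sum>i<d. of_nat (Suc i) * a (Suc i) p * p j ^ i)" for p
      unfolding d' sum.atMost_Suc_shift by (simp add: lessThan_Suc_atMost)
    then show "van (\<lambda>p. \<Sum>i<d. (of_nat (Suc i) * a (Suc i) p) * p j ^ i)" using v by simp
    show "\<forall>i. (\<lambda>p. of_nat (Suc i) * a (Suc i) p) \<in> polfun {..<j}"
      using a by (intro allI polfun.mult polfun.const)
  qed (simp add: d')
  then have "van (a d)" by (auto simp: van_def d' simp del: of_nat_Suc)
  then show False using a by simp
qed

text \<open>The first \<open>D\<close> coordinates move along a straight line in direction
  \<open>w\<close>; each later coordinate follows the root branch of its minimal polynomial.\<close>

lemma curve_exists:
  assumes "D \<le> j" "\<And>i. D \<le> i \<Longrightarrow> i < j \<Longrightarrow> minpol i (d i) (a i)"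
    and indep: "\<And>q. zeros D q"
    and "\<And>i. D \<le> i \<Longrightarrow> i < j \<Longrightarrow> a i (d i) p0 \<noteq> 0"
    and "\<And>i. D \<le> i \<Longrightarrow> i < j \<Longrightarrow> (\<Sum>k\<le>d i. of_nat k * a i k p0 * p0 i ^ (k - 1)) \<noteq> 0"
    and "\<And>i. D \<le> i \<Longrightarrow> i < j \<Longrightarrow> (\<Sum>k\<le>d i. a i k p0 * p0 i ^ k) = 0"
  shows "\<exists>p. (\<forall>i<j. p 0 i = p0 i) \<and> eventually (\<lambda>s. zeros j (p s)) (nhds 0) \<and>
     (\<forall>i<j. (\<lambda>s. p s i) field_differentiable at 0) \<and> (\<forall>i<D. \<forall>s. p s i = p0 i + s * w i)"
  using assms(1,2,4,5,6)
proof (induction rule: dec_induct)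
  case base
  have "(\<lambda>s. p0 i + s * w i) field_differentiable at 0" for i
    by (rule field_differentiable_add[OF _ field_differentiable_mult])
      (auto simp: field_differentiable_const field_differentiable_ident)
  then show ?case by (intro exI[of _ "\<lambda>s i. p0 i + s * w i"]) (auto simp: indep)
next
  case (step n)
  have "\<exists>p. (\<forall>i<n. p 0 i = p0 i) \<and> eventually (\<lambda>s. zeros n (p s)) (nhds 0) \<and>
     (\<forall>i<n. (\<lambda>s. p s i) field_differentiable at 0) \<and> (\<forall>i<D. \<forall>s. p s i = p0 i + s * w i)"
    by (rule step.IH; rule step.prems; simp)
  then obtain p where p: "\<forall>i<n. p 0 i = p0 i" "eventually (\<lambda>s. zeros n (p s)) (nhds 0)"
    "\<forall>i<n. (\<lambda>s. p s i) field_differentiable at 0" "\<forall>i<D. \<forall>s. p s i = p0 i + s * w i"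
    by (elim exE conjE) (rule that)
  have mp: "minpol n (d n) (a n)" using step by auto
  then have aA: "a n k \<in> polfun {..<n}" for k by (simp add: minpol_def)
  have a0: "a n k (p 0) = a n k p0" for k by (rule polfun_cong[OF aA]) (use p(1) in auto)
  have "(\<lambda>s. a n k (p s)) field_differentiable at 0" for k
    by (rule polfun_differentiable[OF aA]) (use p(3) in auto)
  then obtain A' where A': "\<And>k. ((\<lambda>s. a n k (p s)) has_field_derivative A' k) (at 0)"
    unfolding field_differentiable_def by metis
  have "a n (d n) (p 0) \<noteq> 0" "(\<Sum>k\<le>d n. a n k (p 0) * p0 n ^ k) = 0"
    "(\<Sum>k\<le>d n. of_nat k * a n k (p 0) * p0 n ^ (k - 1)) \<noteq> 0"
    unfolding a0 using step.prems(2-4)[of n] \<open>D \<le> n\<close> by auto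
  note rb = root_branch[of "\<lambda>k s. a n k (p s)" A' "d n" "p0 n", OF A' this(1) minpol_pos[OF mp] this(2,3)]
  obtain x x' where x: "x 0 = p0 n" "eventually (\<lambda>s. (\<Sum>i\<le>d n. a n i (p s) * x s ^ i) = 0) (nhds 0)"
    "(x has_field_derivative x') (at 0)"
    by (rule rb) (rule that)
  have "((\<lambda>s. a n (d n) (p s)) \<longlongrightarrow> a n (d n) (p 0)) (nhds 0)"
    using DERIV_isCont[OF A'[of "d n"]] tendsto_at_iff_tendsto_nhds[of "\<lambda>s. a n (d n) (p s)" 0]
    by (simp add: isCont_def)
  then have "eventually (\<lambda>s. a n (d n) (p s) \<noteq> 0) (nhds 0)"
    by (rule tendsto_imp_eventually_ne) (use a0 step.prems \<open>D \<le> n\<close> in auto)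
  define P where "P s = (p s)(n := x s)" for s
  have P: "P s i = (if i = n then x s else p s i)" for s i by (simp add: P_def)
  from \<open>eventually (\<lambda>s. a n (d n) (p s) \<noteq> 0) (nhds 0)\<close> p(2) x(2)
  have "eventually (\<lambda>s. zeros (Suc n) (P s)) (nhds 0)"
    unfolding P_def by eventually_elim (rule zeros_extend[OF mp])
  moreover have "(\<lambda>s. P s i) field_differentiable at 0" if "i < Suc n" for i
    using that p(3) x(3) by (cases "i = n") (auto simp: P field_differentiable_def)
  moreover have "\<forall>i<Suc n. P 0 i = p0 i" "\<forall>i<D. \<forall>s. P s i = p0 i + s * w i"
    using p x(1) \<open>D \<le> n\<close> by (auto simp: less_Suc_eq P)
  ultimately show ?case by blast
qed

end

section \<open>Derivatives of polynomials along curves\<close>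

lemma meval_mpderiv:
  "meval a (mpderiv v f) = (\<Sum>\<alpha>\<in>Poly_Mapping.keys f. Poly_Mapping.lookup f \<alpha> *
     (of_nat (Poly_Mapping.lookup \<alpha> v) * a v ^ (Poly_Mapping.lookup \<alpha> v - 1) *
      (\<Prod>u\<in>UNIV - {v}. a u ^ Poly_Mapping.lookup \<alpha> u)))"
proof -
  have "mon a (\<alpha> - Poly_Mapping.single v 1) =
      a v ^ (Poly_Mapping.lookup \<alpha> v - 1) * (\<Prod>u\<in>UNIV - {v}. a u ^ Poly_Mapping.lookup \<alpha> u)" for \<alpha>
    unfolding mon_def
    by (subst prod.remove[of _ v]) (auto simp: lookup_minus lookup_single when_def intro!: prod.cong)
  then show ?thesis
    by (simp add: mpderiv_def mult_ac)
qed

lemma meval_has_field_derivative: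
  fixes x :: "complex \<Rightarrow> 'v::finite \<Rightarrow> complex"
  assumes "\<And>v. ((\<lambda>s. x s v) has_field_derivative x' v) (at s0)"
  shows "((\<lambda>s. meval (x s) f) has_field_derivative (\<Sum>v\<in>UNIV. meval (x s0) (mpderiv v f) * x' v)) (at s0)"
proof -
  have 1: "((\<lambda>s. mon (x s) \<alpha>) has_field_derivative
      (\<Sum>v\<in>UNIV. (of_nat (Poly_Mapping.lookup \<alpha> v) * x s0 v ^ (Poly_Mapping.lookup \<alpha> v - 1) * x' v) *
        (\<Prod>u\<in>UNIV - {v}. x s0 u ^ Poly_Mapping.lookup \<alpha> u))) (at s0)" for \<alpha>
    unfolding mon_def has_field_derivative_def
    by (rule has_derivative_eq_rhs, rule has_derivative_prod)
      (auto intro!: assms[THEN has_field_derivative_imp_has_derivative, THEN has_derivative_power]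
        simp: fun_eq_iff sum_distrib_left sum_distrib_right mult_ac intro!: sum.cong)
  have "((\<lambda>s. \<Sum>\<alpha>\<in>Poly_Mapping.keys f. Poly_Mapping.lookup f \<alpha> * mon (x s) \<alpha>) has_field_derivative
      (\<Sum>\<alpha>\<in>Poly_Mapping.keys f. Poly_Mapping.lookup f \<alpha> *
      (\<Sum>v\<in>UNIV. (of_nat (Poly_Mapping.lookup \<alpha> v) * x s0 v ^ (Poly_Mapping.lookup \<alpha> v - 1) * x' v) *
        (\<Prod>u\<in>UNIV - {v}. x s0 u ^ Poly_Mapping.lookup \<alpha> u)))) (at s0)"
    by (intro DERIV_sum DERIV_cmult 1)
  moreover have "(\<Sum>\<alpha>\<in>Poly_Mapping.keys f. Poly_Mapping.lookup f \<alpha> *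
      (\<Sum>v\<in>UNIV. (of_nat (Poly_Mapping.lookup \<alpha> v) * x s0 v ^ (Poly_Mapping.lookup \<alpha> v - 1) * x' v) *
        (\<Prod>u\<in>UNIV - {v}. x s0 u ^ Poly_Mapping.lookup \<alpha> u))) =
      (\<Sum>v\<in>UNIV. meval (x s0) (mpderiv v f) * x' v)"
    unfolding meval_mpderiv sum_distrib_left sum_distrib_right
    by (subst sum.swap) (simp add: mult_ac)
  ultimately show ?thesis by (simp add: meval_eq_sum_mon)
qed

subsection \<open>Algebraic dependence over a system of parameters\<close>

definition polymap :: "(('v::finite \<Rightarrow> complex) \<Rightarrow> complex) set" where
  "polymap = range (\<lambda>F a. meval a F)"

lemma polymap_meval: "(\<lambda>a. meval a F) \<in> polymap"
  by (auto simp: polymap_def)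

lemma polymap_const: "(\<lambda>a. c) \<in> polymap"
  using polymap_meval[of "mconst c"] by simp

lemma polymap_coord: "(\<lambda>a. a v) \<in> polymap"
  using polymap_meval[of "mvar v"] by simp

lemma polymap_add: "f \<in> polymap \<Longrightarrow> g \<in> polymap \<Longrightarrow> (\<lambda>a. f a + g a) \<in> polymap"
  unfolding polymap_def by (auto simp flip: meval_add)

lemma polymap_mult: "f \<in> polymap \<Longrightarrow> g \<in> polymap \<Longrightarrow> (\<lambda>a. f a * g a) \<in> polymap"
  unfolding polymap_def by (auto simp flip: meval_mult)

lemma polymap_sum: "(\<And>x. x \<in> X \<Longrightarrow> f x \<in> polymap) \<Longrightarrow> (\<lambda>p. \<Sum>x\<in>X. f x p) \<in> polymap"
  by (induction X rule: infinite_finite_induct) (auto intro: polymap_const polymap_add)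

lemma polymap_prod: "(\<And>x. x \<in> X \<Longrightarrow> f x \<in> polymap) \<Longrightarrow> (\<lambda>p. \<Prod>x\<in>X. f x p) \<in> polymap"
  by (induction X rule: infinite_finite_induct) (auto intro: polymap_const polymap_mult)

lemma polymap_compose:
  assumes "f \<in> polfun A" "\<And>i. i \<in> A \<Longrightarrow> \<xi> i \<in> polymap"
  shows "(\<lambda>a. f (\<lambda>i. \<xi> i a)) \<in> polymap"
  using assms(1)
  by (induction rule: polfun.induct) (auto intro: polymap_const polymap_add polymap_mult assms(2))

lemma polfun_polymap:
  assumes "\<eta> \<in> polymap" "\<And>v. e v \<in> A"
  shows "(\<lambda>p. \<eta> (\<lambda>v. p (e v))) \<in> polfun A"
proof -
  obtain F where "\<eta> = (\<lambda>a. meval a F)" using assms(1) by (auto simp: polymap_def)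
  then show ?thesis
    unfolding meval_def using assms(2) by (auto intro!: polfun_intros)
qed

text \<open>Equivalent to \<open>Iv S\<close> being a prime ideal.\<close>

definition irr :: "('v::finite \<Rightarrow> complex) set \<Rightarrow> bool" where
  "irr S \<longleftrightarrow> S \<noteq> {} \<and> (\<forall>f\<in>polymap. \<forall>g\<in>polymap. (\<forall>a\<in>S. f a * g a = 0) \<longrightarrow>
     (\<forall>a\<in>S. f a = 0) \<or> (\<forall>a\<in>S. g a = 0))"

lemma irr_cancel:
  assumes "irr S" "f \<in> polymap" "g \<in> polymap" "\<forall>a\<in>S. f a * g a = 0" "\<exists>a\<in>S. g a \<noteq> 0"
  shows "\<forall>a\<in>S. f a = 0"
  using assms(1)[unfolded irr_def, THEN conjunct2, rule_format, of f g] assms(2-5) by blast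

text \<open>The Zariski closure in affine space; for a cone without vertex it can contain the
  origin.\<close>

definition Vz :: "('v::finite \<Rightarrow> complex) set \<Rightarrow> ('v \<Rightarrow> complex) set" where
  "Vz S = {a. \<forall>f\<in>Iv S. meval a f = 0}"

lemma subset_Vz: "S \<subseteq> Vz S"
  by (auto simp: Vz_def Iv_def)

text \<open>Any sequence of polynomial functions may serve as coordinates. The applications list
  parameters first and the ambient coordinates last, so that the latter are the ones
  eliminated.\<close>

lemma irr_irreducible_points:
  assumes "irr S" "\<And>i. \<xi> i \<in> polymap"
  shows "irreducible_points ((\<lambda>a i. \<xi> i a) ` S)"
proof
  show "(\<lambda>a i. \<xi> i a) ` S \<noteq> {}" using assms(1) by (simp add: irr_def)
  fix f g assume fg: "f \<in> polfun UNIV" "g \<in> polfun UNIV"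
    "\<And>p. p \<in> (\<lambda>a i. \<xi> i a) ` S \<Longrightarrow> f p * g p = 0"
  have "(\<lambda>a. f (\<lambda>i. \<xi> i a)) \<in> polymap" "(\<lambda>a. g (\<lambda>i. \<xi> i a)) \<in> polymap"
    using fg assms(2) by (auto intro: polymap_compose)
  moreover have "\<forall>a\<in>S. f (\<lambda>i. \<xi> i a) * g (\<lambda>i. \<xi> i a) = 0" using fg(3) by blast
  ultimately have "(\<forall>a\<in>S. f (\<lambda>i. \<xi> i a) = 0) \<or> (\<forall>a\<in>S. g (\<lambda>i. \<xi> i a) = 0)"
    using assms(1)[unfolded irr_def, THEN conjunct2, rule_format, of "\<lambda>a. f (\<lambda>i. \<xi> i a)" "\<lambda>a. g (\<lambda>i. \<xi> i a)"]
    by simp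
  then show "(\<forall>p\<in>(\<lambda>a i. \<xi> i a) ` S. f p = 0) \<or> (\<forall>p\<in>(\<lambda>a i. \<xi> i a) ` S. g p = 0)" by blast
qed

definition algindep :: "nat \<Rightarrow> (nat \<Rightarrow> ('v::finite \<Rightarrow> complex) \<Rightarrow> complex) \<Rightarrow> ('v \<Rightarrow> complex) set \<Rightarrow> bool" where
  "algindep n \<xi> S \<longleftrightarrow> (\<forall>f\<in>polfun {..<n}. (\<forall>a\<in>S. f (\<lambda>i. \<xi> i a) = 0) \<longrightarrow> (\<forall>p. f p = 0))"

lemma algindep_cong: "(\<And>i. i < n \<Longrightarrow> \<xi> i = \<zeta> i) \<Longrightarrow> algindep n \<xi> S = algindep n \<zeta> S"
proof -
  assume "\<And>i. i < n \<Longrightarrow> \<xi> i = \<zeta> i"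
  then have eq: "f (\<lambda>i. \<xi> i a) = f (\<lambda>i. \<zeta> i a)" if "f \<in> polfun {..<n}" for f a
    by (intro polfun_cong[OF that]) auto
  then have "(\<forall>a\<in>S. f (\<lambda>i. \<xi> i a) = 0) = (\<forall>a\<in>S. f (\<lambda>i. \<zeta> i a) = 0)" if "f \<in> polfun {..<n}" for f
    using eq[OF that] by simp
  then show ?thesis unfolding algindep_def by (intro ball_cong) auto
qed

lemma algindep_inj:
  assumes "algindep n \<xi> S" "i < n" "j < n" "\<xi> i = \<xi> j"
  shows "i = j"
proof (rule ccontr)
  assume "i \<noteq> j"
  have "(\<lambda>p. p i - p j) \<in> polfun {..<n}" using assms by (intro polfun_diff polfun.coord) auto
  moreover have "\<forall>a\<in>S. \<xi> i a - \<xi> j a = 0" using assms(4) by simp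
  ultimately have "\<forall>p. p i - p j = (0::complex)"
    using assms(1)[unfolded algindep_def, THEN bspec[of _ _ "\<lambda>p. p i - p j"]] by simp
  then show False using \<open>i \<noteq> j\<close> by (auto dest: spec[of _ "\<lambda>k. if k = i then 1 else 0"])
qed

lemma algebraic_relation:
  assumes "algindep D \<xi> S" "\<not> algindep (Suc D) (\<xi>(D := \<eta>)) S"
  obtains n a where "\<And>i. a i \<in> polfun {..<D}" "\<exists>b\<in>S. a n (\<lambda>i. \<xi> i b) \<noteq> 0"
    "\<And>b. b \<in> S \<Longrightarrow> (\<Sum>i\<le>n. a i (\<lambda>i. \<xi> i b) * \<eta> b ^ i) = 0"
proof -
  obtain f p where f: "f \<in> polfun {..<Suc D}" "\<forall>a\<in>S. f (\<lambda>i. (\<xi>(D := \<eta>)) i a) = 0" "f p \<noteq> 0"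
    using assms(2) by (auto simp: algindep_def)
  obtain n a where a: "\<And>i. a i \<in> polfun {..<D}" "\<And>p. f p = (\<Sum>i\<le>n. a i p * p D ^ i)"
    by (rule polfun_expand_Suc[OF f(1)]) (rule that)
  have c: "a i (\<lambda>i. (\<xi>(D := \<eta>)) i b) = a i (\<lambda>i. \<xi> i b)" for i b
    by (rule polfun_cong[OF a(1)]) auto
  define E where "E = {i. i \<le> n \<and> (\<exists>b\<in>S. a i (\<lambda>i. \<xi> i b) \<noteq> 0)}"
  \<comment> \<open>If all coefficients vanished on \<open>S\<close>, independence of the first
    \<open>D\<close> functions would make \<open>f\<close> zero.\<close>
  have "E \<noteq> {}"
  proof
    assume "E = {}"
    then have "\<forall>b\<in>S. a i (\<lambda>i. \<xi> i b) = 0" if "i \<le> n" for i using that by (auto simp: E_def)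
    then have "a i p = 0" if "i \<le> n" for i using assms(1) a(1) that unfolding algindep_def by blast
    then show False using f(3) a(2) by simp
  qed
  moreover have "finite E" by (simp add: E_def)
  ultimately have m: "Max E \<in> E" by (rule Max_in[rotated])
  have gt: "a i (\<lambda>i. \<xi> i b) = 0" if "b \<in> S" "i \<le> n" "i > Max E" for i b
  proof -
    have "i \<notin> E" using Max_ge[OF \<open>finite E\<close>, of i] that(3) by auto
    then show ?thesis using that(1,2) by (auto simp: E_def)
  qed
  show ?thesis
  proof (rule that[OF a(1)])
    show "\<exists>b\<in>S. a (Max E) (\<lambda>i. \<xi> i b) \<noteq> 0" using m by (simp add: E_def)
    fix b assume b: "b \<in> S"
    have "(\<Sum>i\<le>Max E. a i (\<lambda>i. \<xi> i b) * \<eta> b ^ i) = (\<Sum>i\<le>n. a i (\<lambda>i. \<xi> i b) * \<eta> b ^ i)"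
      by (rule sum.mono_neutral_left) (use m gt[OF b] in \<open>auto simp: E_def not_le\<close>)
    also have "\<dots> = 0" using f(2) b unfolding a(2) c by simp
    finally show "(\<Sum>i\<le>Max E. a i (\<lambda>i. \<xi> i b) * \<eta> b ^ i) = 0" .
  qed
qed

text \<open>The ambient coordinates occur among the \<open>\<xi>\<close> and are read off from
  \<open>p\<close>. The other entries of \<open>p\<close> are the values of \<open>\<xi>\<close>
  there because each \<open>\<xi> i\<close> minus its expression in these coordinates vanishes on
  the image of \<open>S\<close>.\<close>

lemma zeros_point:
  assumes "irreducible_points ((\<lambda>a i. \<xi> i a) ` S)" "\<And>i. \<xi> i \<in> polymap"
    and idx: "\<And>v. idx v < m" "\<And>v. \<xi> (idx v) = (\<lambda>a. a v)"
    and p: "irreducible_points.zeros ((\<lambda>a i. \<xi> i a) ` S) m p"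
  defines "a \<equiv> \<lambda>v. p (idx v)"
  shows "a \<in> Vz S" "\<And>i. i < m \<Longrightarrow> \<xi> i a = p i"
proof -
  interpret irreducible_points "(\<lambda>a i. \<xi> i a) ` S" by fact
  show "a \<in> Vz S"
    unfolding Vz_def
  proof (intro CollectI ballI)
    fix F assume F: "F \<in> Iv S"
    have "(\<lambda>p. meval (\<lambda>v. p (idx v)) F) \<in> polfun {..<m}"
      by (rule polfun_polymap[OF polymap_meval]) (use idx in auto)
    moreover have "van (\<lambda>p. meval (\<lambda>v. p (idx v)) F)" using F by (auto simp: van_def idx Iv_def)
    ultimately show "meval a F = 0" using p unfolding zeros_def a_def by blast
  qed
  fix i assume i: "i < m"
  have "(\<lambda>p. p i - \<xi> i (\<lambda>v. p (idx v))) \<in> polfun {..<m}"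
    using i idx(1) assms(2) by (intro polfun_diff polfun.coord polfun_polymap) auto
  moreover have "van (\<lambda>p. p i - \<xi> i (\<lambda>v. p (idx v)))" by (auto simp: van_def idx)
  ultimately have "p i - \<xi> i (\<lambda>v. p (idx v)) = 0" using p unfolding zeros_def by blast
  then show "\<xi> i a = p i" by (simp add: a_def)
qed

lemma algindep_zeros:
  assumes "irreducible_points ((\<lambda>a i. \<xi> i a) ` S)" "algindep D \<xi> S"
  shows "irreducible_points.zeros ((\<lambda>a i. \<xi> i a) ` S) D q"
proof -
  interpret irreducible_points "(\<lambda>a i. \<xi> i a) ` S" by fact
  show ?thesis using assms(2) by (auto simp: zeros_def van_def algindep_def)
qed

lemma algebraic_alg:
  assumes "irreducible_points ((\<lambda>a i. \<zeta> i a) ` S)" "\<And>i. i < D \<Longrightarrow> \<zeta> i = \<xi> i" "D \<le> j"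
    "algindep D \<xi> S" "\<not> algindep (Suc D) (\<xi>(D := \<zeta> j)) S"
  shows "irreducible_points.alg ((\<lambda>a i. \<zeta> i a) ` S) j"
proof -
  interpret irreducible_points "(\<lambda>a i. \<zeta> i a) ` S" by fact
  obtain n a where a: "\<And>i. a i \<in> polfun {..<D}" "\<exists>b\<in>S. a n (\<lambda>i. \<xi> i b) \<noteq> 0"
    "\<And>b. b \<in> S \<Longrightarrow> (\<Sum>i\<le>n. a i (\<lambda>i. \<xi> i b) * \<zeta> j b ^ i) = 0"
    by (rule algebraic_relation[OF assms(4,5)]) (rule that)
  have c: "a i (\<lambda>i. \<zeta> i b) = a i (\<lambda>i. \<xi> i b)" for i b
    by (rule polfun_cong[OF a(1)]) (use assms(2) in auto)
  show ?thesis
    unfolding alg_def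
  proof (intro exI conjI allI)
    show "a i \<in> polfun {..<j}" for i using a(1) assms(3) polfun_lessThan_mono by blast
    show "\<not> van (a n)" using a(2) by (auto simp: van_def c)
    show "van (\<lambda>p. \<Sum>i\<le>n. a i p * p j ^ i)" using a(3) by (auto simp: van_def c)
  qed
qed

lemma enumerate_finite_type:
  obtains vn :: "nat \<Rightarrow> 'v::finite" and ix where "\<And>v. ix v < CARD('v)" "\<And>v. vn (ix v) = v"
    "\<And>i. i < CARD('v) \<Longrightarrow> ix (vn i) = i"
proof -
  obtain h :: "nat \<Rightarrow> 'v" where h: "bij_betw h {0..<CARD('v)} UNIV"
    using ex_bij_betw_nat_finite[of "UNIV :: 'v set"] by auto
  show ?thesis
  proof (rule that[of "inv_into {0..<CARD('v)} h" h])
    fix v show "inv_into {0..<CARD('v)} h v < CARD('v)"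
      using inv_into_into[of v h "{0..<CARD('v)}"] h by (auto simp: bij_betw_def)
    show "h (inv_into {0..<CARD('v)} h v) = v"
      using h by (simp add: bij_betw_def f_inv_into_f)
  next
    fix i assume "i < CARD('v)"
    then show "inv_into {0..<CARD('v)} h (h i) = i" using h by (simp add: bij_betw_def inv_into_f_f)
  qed
qed

text \<open>If \<open>\<eta>\<close> were independent, one could lift parameter values at which \<open>\<eta>\<close> exceeds the bound.\<close>

lemma bounded_imp_algebraic:
  fixes S :: "('v::finite \<Rightarrow> complex) set"
  assumes irr: "irr S" and xi: "\<And>i. \<xi> i \<in> polymap" and eta: "\<eta> \<in> polymap" and "\<rho> > 0"
    and bd: "\<And>a. a \<in> Vz S \<Longrightarrow> (\<And>i. i < D \<Longrightarrow> norm (\<xi> i a - q0 i) < \<rho>) \<Longrightarrow> norm (\<eta> a) \<le> C"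
  shows "\<not> algindep (Suc D) (\<xi>(D := \<eta>)) S"
proof
  assume ind: "algindep (Suc D) (\<xi>(D := \<eta>)) S"
  obtain vn :: "nat \<Rightarrow> 'v" and ix where ix: "\<And>v. ix v < CARD('v)" "\<And>v. vn (ix v) = v"
    "\<And>i. i < CARD('v) \<Longrightarrow> ix (vn i) = i" by (rule enumerate_finite_type) blast
  \<comment> \<open>The order is: parameters, \<open>\<eta>\<close>, chosen coordinates
    \<open>vs\<close>, all ambient coordinates. A longest independent choice of \<open>vs\<close>
    makes every later coordinate algebraic over the initial block.\<close>
  define ext where "ext vs i = (if i < D then \<xi> i else if i = D then \<eta> else
     if i < Suc D + length vs then (\<lambda>a. a (vs ! (i - Suc D))) else (\<lambda>a. a (vn (i - (Suc D + length vs)))))" for vs :: "'v list" and i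
  define P where "P n \<longleftrightarrow> (\<exists>vs. length vs = n \<and> algindep (Suc D + n) (ext vs) S)" for n
  have ext: "ext vs i \<in> polymap" for vs i using xi eta by (auto simp: ext_def polymap_coord)
  have "P 0"
    unfolding P_def using ind
    by (intro exI[of _ "[]"]) (auto simp: ext_def elim!: algindep_cong[THEN iffD1, rotated])
  \<comment> \<open>Independence forces \<open>vs\<close> to be free of repetitions, so a longest
    choice exists.\<close>
  have bound: "n \<le> CARD('v)" if Pn: "P n" for n
  proof -
    obtain vs where vs: "length vs = n" "algindep (Suc D + n) (ext vs) S"
      using Pn unfolding P_def by (elim exE conjE) (rule that)
    have "distinct vs"
      unfolding distinct_conv_nth
    proof (intro allI impI)
      fix i j assume "i < length vs" "j < length vs" "i \<noteq> j"
      then show "vs ! i \<noteq> vs ! j"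
        using algindep_inj[OF vs(2), of "Suc D + i" "Suc D + j"] vs(1) by (auto simp: ext_def)
    qed
    then show ?thesis using vs(1) distinct_card[of vs] card_mono[of UNIV "set vs"] by auto
  qed
  define n where "n = (GREATEST n. P n)"
  have "P n" unfolding n_def using GreatestI_nat[of P 0 "CARD('v)"] \<open>P 0\<close> bound by blast
  have "\<not> P (Suc n)" using Greatest_le_nat[of P "Suc n", of "CARD('v)"] bound by (auto simp: n_def)
  obtain vs where vs: "length vs = n" "algindep (Suc D + n) (ext vs) S"
    using \<open>P n\<close> unfolding P_def by (elim exE conjE) (rule that)
  define D' where "D' = Suc D + n"
  define m where "m = D' + CARD('v)"
  define \<zeta> where "\<zeta> = ext vs"
  have ip: "irreducible_points ((\<lambda>a i. \<zeta> i a) ` S)"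
    unfolding \<zeta>_def by (rule irr_irreducible_points[OF irr ext])
  interpret irreducible_points "(\<lambda>a i. \<zeta> i a) ` S" by fact
  have dep: "\<not> algindep (Suc D') (\<zeta>(D' := (\<lambda>a. a v))) S" for v
  proof
    assume "algindep (Suc D') (\<zeta>(D' := (\<lambda>a. a v))) S"
    moreover have "algindep (Suc D') (\<zeta>(D' := (\<lambda>a. a v))) S = algindep (Suc D') (ext (vs @ [v])) S"
      by (rule algindep_cong) (auto simp: \<zeta>_def ext_def vs D'_def nth_append less_Suc_eq)
    ultimately have "P (Suc n)" unfolding P_def using vs(1) by (intro exI[of _ "vs @ [v]"]) (auto simp: D'_def)
    then show False using \<open>\<not> P (Suc n)\<close> by simp
  qed
  have alg: "alg j" if "D' \<le> j" "j < m" for j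
  proof (rule algebraic_alg[OF ip])
    show "D' \<le> j" "algindep D' \<zeta> S" using that vs by (auto simp: D'_def \<zeta>_def)
    have "\<zeta> j = (\<lambda>a. a (vn (j - D')))" using that vs by (auto simp: \<zeta>_def ext_def D'_def)
    then show "\<not> algindep (Suc D') (\<zeta>(D' := \<zeta> j)) S" using dep by simp
  qed auto
  have "D' \<le> m" by (simp add: m_def)
  then obtain N where N: "N \<in> polfun {..<D'}" "\<not> van N"
    "\<And>q. zeros D' q \<Longrightarrow> N q \<noteq> 0 \<Longrightarrow> \<exists>p. (\<forall>i<D'. p i = q i) \<and> zeros m p"
    using lift_exists[of D' m] alg by auto
  obtain p1 where p1: "N p1 \<noteq> 0" using N(2) by (auto simp: van_def)
  \<comment> \<open>At index \<open>D\<close> the target \<open>C + 1\<close> exceeds the bound by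
    1. A perturbation by less than \<open>min \<rho> 1\<close> keeps the parameters in the box and
    the value above \<open>C\<close>.\<close>
  define q1 where "q1 i = (if i < D then q0 i else complex_of_real (C + 1))" for i
  define B where "B = Max (insert 0 ((\<lambda>i. norm (p1 i - q1 i)) ` {..D}))"
  have B: "norm (p1 i - q1 i) \<le> B" if "i \<le> D" for i
    unfolding B_def by (rule Max_ge) (use that in auto)
  have "B \<ge> 0" unfolding B_def by (rule Max_ge) auto
  define \<epsilon> where "\<epsilon> = min \<rho> 1 / (B + 1)"
  have "\<epsilon> > 0" using \<open>\<rho> > 0\<close> \<open>B \<ge> 0\<close> by (simp add: \<epsilon>_def)
  obtain s where s: "norm s < \<epsilon>" "N (\<lambda>i. q1 i + s * (p1 i - q1 i)) \<noteq> 0"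
    using polfun_generic[OF N(1) p1 \<open>\<epsilon> > 0\<close>] by blast
  define q where "q = (\<lambda>i. q1 i + s * (p1 i - q1 i))"
  have q: "norm (q i - q1 i) < min \<rho> 1" if "i \<le> D" for i
  proof -
    have "norm (q i - q1 i) = norm s * norm (p1 i - q1 i)" by (simp add: q_def norm_mult)
    also have "\<dots> \<le> norm s * (B + 1)" using B[OF that] by (intro mult_left_mono) auto
    also have "\<dots> < \<epsilon> * (B + 1)" using s(1) \<open>B \<ge> 0\<close> by (intro mult_strict_right_mono) auto
    also have "\<dots> = min \<rho> 1" using \<open>B \<ge> 0\<close> by (simp add: \<epsilon>_def)
    finally show ?thesis .
  qed
  have "zeros D' q" by (rule algindep_zeros[OF ip]) (use vs in \<open>simp add: D'_def \<zeta>_def\<close>)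
  then obtain p where p: "\<forall>i<D'. p i = q i" "zeros m p" using N(3) s(2) by (auto simp: q_def)
  define idx where "idx v = D' + ix v" for v
  have idx: "idx v < m" "\<zeta> (idx v) = (\<lambda>a. a v)" for v
    using ix by (auto simp: idx_def m_def \<zeta>_def ext_def vs D'_def)
  define a where "a = (\<lambda>v. p (idx v))"
  have za: "\<zeta> i \<in> polymap" for i by (simp add: \<zeta>_def ext)
  have a: "a \<in> Vz S" "\<And>i. i < m \<Longrightarrow> \<zeta> i a = p i"
    using zeros_point[OF ip za idx p(2)] by (simp_all add: a_def)
  have DD: "D < D'" "D < m" by (auto simp: D'_def m_def)
  have "norm (\<xi> i a - q0 i) < \<rho>" if "i < D" for i
    using a(2)[of i] q[of i] that DD p(1) by (auto simp: \<zeta>_def ext_def q1_def)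
  then have "norm (\<eta> a) \<le> C" by (rule bd[OF a(1)])
  moreover have "\<eta> a = q D" using a(2)[of D] DD p(1) by (auto simp: \<zeta>_def ext_def)
  moreover have "norm (q D) > C"
  proof -
    have "norm (complex_of_real (C + 1)) - norm (q D) \<le> norm (q D - complex_of_real (C + 1))"
      by (metis norm_minus_commute norm_triangle_ineq2)
    also have "\<dots> < 1" using q[of D] by (simp add: q1_def)
    finally show ?thesis unfolding norm_of_real by linarith
  qed
  ultimately show False by simp
qed

text \<open>In the order parameters, \<open>\<eta>\<close>, ambient coordinates, \<open>a\<close> is
  the minimal polynomial of \<open>\<eta>\<close>. The obstruction \<open>N1\<close> to lifting a
  root depends on the parameters and \<open>\<eta>\<close>; \<open>N\<close> is a norm of it that
  depends on the parameters alone.\<close>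

lemma generic_lift:
  fixes S :: "('v::finite \<Rightarrow> complex) set"
  assumes irr: "irr S" and xi: "\<And>i. \<xi> i \<in> polymap" and eta: "\<eta> \<in> polymap"
    and ind: "algindep D \<xi> S" and dep: "\<And>\<theta>. \<theta> \<in> polymap \<Longrightarrow> \<not> algindep (Suc D) (\<xi>(D := \<theta>)) S"
  obtains d a N where "d > 0" "\<And>i. a i \<in> polfun {..<D}" "N \<in> polfun {..<D}" "\<exists>q. N q \<noteq> 0" "\<exists>q. a d q \<noteq> 0"
    "\<And>b. b \<in> S \<Longrightarrow> (\<Sum>i\<le>d. a i (\<lambda>i. \<xi> i b) * \<eta> b ^ i) = 0"
    "\<And>r i q. \<forall>i. r i \<in> polfun {..<D} \<Longrightarrow> \<forall>b\<in>S. (\<Sum>i<d. r i (\<lambda>i. \<xi> i b) * \<eta> b ^ i) = 0 \<Longrightarrow> i < d \<Longrightarrow> r i q = 0"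
    "\<And>q \<tau>. N q \<noteq> 0 \<Longrightarrow> a d q \<noteq> 0 \<Longrightarrow> (\<Sum>i\<le>d. a i q * \<tau> ^ i) = 0 \<Longrightarrow>
       \<exists>b\<in>Vz S. (\<forall>i<D. \<xi> i b = q i) \<and> \<eta> b = \<tau>"
proof -
  obtain vn :: "nat \<Rightarrow> 'v" and ix where ix: "\<And>v. ix v < CARD('v)" "\<And>v. vn (ix v) = v"
    "\<And>i. i < CARD('v) \<Longrightarrow> ix (vn i) = i" by (rule enumerate_finite_type) blast
  define \<zeta> where "\<zeta> i = (if i < D then \<xi> i else if i = D then \<eta> else (\<lambda>a. a (vn (i - Suc D))))" for i
  define m where "m = Suc D + CARD('v)"
  have za: "\<zeta> i \<in> polymap" for i using xi eta by (auto simp: \<zeta>_def polymap_coord)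
  have ip: "irreducible_points ((\<lambda>a i. \<zeta> i a) ` S)" by (rule irr_irreducible_points[OF irr za])
  interpret irreducible_points "(\<lambda>a i. \<zeta> i a) ` S" by fact
  have alg: "alg j" if "D \<le> j" for j
    by (rule algebraic_alg[OF ip _ that ind dep[OF za]]) (auto simp: \<zeta>_def)
  obtain d a where mp: "minpol D d a" using alg[of D] by (rule minpol_exists[OF]) auto
  have aA: "a i \<in> polfun {..<D}" "\<not> van (a d)" "van (\<lambda>p. \<Sum>i\<le>d. a i p * p D ^ i)" for i
    using mp by (auto simp: minpol_def)
  have "Suc D \<le> m" by (simp add: m_def)
  then obtain N1 where N1: "N1 \<in> polfun {..<Suc D}" "\<not> van N1"
    "\<And>q. zeros (Suc D) q \<Longrightarrow> N1 q \<noteq> 0 \<Longrightarrow> \<exists>p. (\<forall>i<Suc D. p i = q i) \<and> zeros m p"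
    using lift_exists[of "Suc D" m] alg by auto
  obtain N h where N: "N \<in> polfun {..<D}" "\<not> van N" "h \<in> polfun {..<Suc D}" "van (\<lambda>p. N p - h p * N1 p)"
    using norm_step[OF mp N1(1,2)] by blast
  have "algindep D \<zeta> S = algindep D \<xi> S" by (rule algindep_cong) (simp add: \<zeta>_def)
  then have zD: "zeros D q" for q using algindep_zeros[OF ip] ind by simp
  define idx where "idx v = Suc D + ix v" for v
  have idx: "idx v < m" "\<zeta> (idx v) = (\<lambda>a. a v)" for v
    using ix by (auto simp: idx_def m_def \<zeta>_def)
  have c: "a i (\<lambda>i. \<zeta> i b) = a i (\<lambda>i. \<xi> i b)" for i b
    by (rule polfun_cong[OF aA(1)]) (auto simp: \<zeta>_def)
  show ?thesis
  proof (rule that[OF minpol_pos[OF mp] aA(1) N(1)])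
    show "\<exists>q. N q \<noteq> 0" "\<exists>q. a d q \<noteq> 0" using N(2) aA(2) by (auto simp: van_def)
    show "(\<Sum>i\<le>d. a i (\<lambda>i. \<xi> i b) * \<eta> b ^ i) = 0" if "b \<in> S" for b
    proof -
      have "(\<Sum>i\<le>d. a i (\<lambda>i. \<zeta> i b) * \<zeta> D b ^ i) = 0"
        using aA(3) that unfolding van_def by auto
      moreover have "\<zeta> D = \<eta>" by (simp add: \<zeta>_def)
      ultimately show ?thesis by (simp add: c)
    qed
    show "r i q = 0" if r: "\<forall>i. r i \<in> polfun {..<D}" "\<forall>b\<in>S. (\<Sum>i<d. r i (\<lambda>i. \<xi> i b) * \<eta> b ^ i) = 0" "i < d" for r i q
    proof -
      have c: "r i (\<lambda>i. \<zeta> i b) = r i (\<lambda>i. \<xi> i b)" for i b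
        by (rule polfun_cong[of _ "{..<D}"]) (use r(1) in \<open>auto simp: \<zeta>_def\<close>)
      have "\<zeta> D = \<eta>" by (simp add: \<zeta>_def)
      then have "van (\<lambda>p. \<Sum>i<d. r i p * p D ^ i)" using r(2) by (simp add: van_def c)
      then have "van (r i)" using mp r(1,3) unfolding minpol_def by blast
      then show "r i q = 0" using zD[of q] r(1) unfolding zeros_def by blast
    qed
    fix q \<tau> assume q: "N q \<noteq> 0" "a d q \<noteq> 0" "(\<Sum>i\<le>d. a i q * \<tau> ^ i) = 0"
    have z: "zeros (Suc D) (q(D := \<tau>))" by (rule zeros_extend[OF mp zD q(2,3)])
    have "N (q(D := \<tau>)) = N q" by (rule polfun_cong[OF N(1)]) auto
    then have "N1 (q(D := \<tau>)) \<noteq> 0"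
      using zeros_norm_nonzero[OF N(1) _ N(3) N1(1) N(4) z] q(1) by simp
    then obtain p where p: "\<forall>i<Suc D. p i = (q(D := \<tau>)) i" "zeros m p" using N1(3)[OF z] by blast
    have a: "(\<lambda>v. p (idx v)) \<in> Vz S" "\<And>i. i < m \<Longrightarrow> \<zeta> i (\<lambda>v. p (idx v)) = p i"
      using zeros_point[OF ip za idx p(2)] by simp_all
    have "\<xi> i (\<lambda>v. p (idx v)) = q i" if "i < D" for i
      using a(2)[of i] that p(1) by (auto simp: \<zeta>_def m_def)
    moreover have "\<eta> (\<lambda>v. p (idx v)) = \<tau>" using a(2)[of D] p(1) by (auto simp: \<zeta>_def m_def)
    ultimately show "\<exists>b\<in>Vz S. (\<forall>i<D. \<xi> i b = q i) \<and> \<eta> b = \<tau>" using a(1) by blast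
  qed
qed

text \<open>The constant term of an algebraic relation for \<open>\<delta>\<close> is a multiple of
  \<open>\<delta>\<close>. If it vanishes on \<open>S\<close>, a factor \<open>\<delta>\<close> is
  cancelled and the degree drops.\<close>

lemma nonzero_multiple_in_parameters:
  assumes irr: "irr S" and xi: "\<And>i. \<xi> i \<in> polymap" and "\<delta> \<in> polymap" "\<exists>b\<in>S. \<delta> b \<noteq> 0"
    and ind: "algindep D \<xi> S" and dep: "\<not> algindep (Suc D) (\<xi>(D := \<delta>)) S"
  obtains N F where "N \<in> polfun {..<D}" "\<exists>q. N q \<noteq> 0" "F \<in> polymap"
    "\<And>b. b \<in> S \<Longrightarrow> N (\<lambda>i. \<xi> i b) = F b * \<delta> b"
proof -
  obtain n a where a: "\<And>i. a i \<in> polfun {..<D}" "\<exists>b\<in>S. a n (\<lambda>i. \<xi> i b) \<noteq> 0"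
    "\<And>b. b \<in> S \<Longrightarrow> (\<Sum>i\<le>n. a i (\<lambda>i. \<xi> i b) * \<delta> b ^ i) = 0"
    by (rule algebraic_relation[OF ind dep]) (rule that)
  have pm: "(\<lambda>b. a i (\<lambda>i. \<xi> i b)) \<in> polymap" for i by (rule polymap_compose[OF a(1) xi])
  have pw: "(\<lambda>b. \<delta> b ^ k) \<in> polymap" for k
    using polymap_prod[of "{..<k}" "\<lambda>_. \<delta>"] assms(3) by simp
  have "\<exists>N F. N \<in> polfun {..<D} \<and> (\<exists>q. N q \<noteq> 0) \<and> F \<in> polymap \<and>
      (\<forall>b\<in>S. N (\<lambda>i. \<xi> i b) = F b * \<delta> b)"
    using a
  proof (induction n arbitrary: a)
    case 0
    then show ?case by auto
  next
    case (Suc n)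
    have pm: "(\<lambda>b. a i (\<lambda>i. \<xi> i b)) \<in> polymap" for i by (rule polymap_compose[OF Suc.prems(1) xi])
    let ?F = "\<lambda>b. - (\<Sum>i\<le>n. a (Suc i) (\<lambda>i. \<xi> i b) * \<delta> b ^ i)"
    have "(\<lambda>b. -1 * (\<Sum>i\<le>n. a (Suc i) (\<lambda>i. \<xi> i b) * \<delta> b ^ i)) \<in> polymap"
      by (intro polymap_mult polymap_const polymap_sum pm pw)
    then have F: "?F \<in> polymap" by simp
    have eq: "a 0 (\<lambda>i. \<xi> i b) = ?F b * \<delta> b" if "b \<in> S" for b
      using Suc.prems(3)[OF that] unfolding sum.atMost_Suc_shift
      by (simp add: sum_distrib_left sum_distrib_right mult_ac eq_neg_iff_add_eq_0)
    show ?case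
    proof (cases "\<exists>b\<in>S. a 0 (\<lambda>i. \<xi> i b) \<noteq> 0")
      case True
      then show ?thesis using eq F Suc.prems(1) by blast
    next
      case False
      then have "\<forall>b\<in>S. ?F b * \<delta> b = 0" using eq by auto
      then have "\<forall>b\<in>S. ?F b = 0" by (rule irr_cancel[OF irr F assms(3) _ assms(4)])
      then show ?thesis using Suc.IH[of "\<lambda>i. a (Suc i)"] Suc.prems(1,2) by simp
    qed
  qed
  then obtain N F where "N \<in> polfun {..<D} \<and> (\<exists>q. N q \<noteq> 0) \<and> F \<in> polymap \<and>
      (\<forall>b\<in>S. N (\<lambda>i. \<xi> i b) = F b * \<delta> b)" by (elim exE)
  then show ?thesis by (intro that[of N F]) simp_all
qed

lemma irr_prod_nonzero:
  assumes "irr S" "finite X" "\<And>x. x \<in> X \<Longrightarrow> f x \<in> polymap" "\<And>x. x \<in> X \<Longrightarrow> \<exists>b\<in>S. f x b \<noteq> 0"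
  shows "\<exists>b\<in>S. (\<Prod>x\<in>X. f x b) \<noteq> 0"
  using assms(2,3,4)
proof (induction rule: finite_induct)
  case empty
  then show ?case using assms(1) by (auto simp: irr_def)
next
  case (insert x X)
  show ?case
  proof (rule ccontr)
    assume "\<not> ?case"
    then have "\<forall>b\<in>S. f x b * (\<Prod>x\<in>X. f x b) = 0" using insert by simp
    then have "\<forall>b\<in>S. f x b = 0"
      by (rule irr_cancel[OF assms(1), rotated 2]) (use insert in \<open>auto intro: polymap_prod\<close>)
    then show False using insert.prems by auto
  qed
qed

text \<open>Where \<open>\<delta>\<close> is nonzero the parameters are local coordinates: every
  velocity \<open>w\<close> of them is realised by a curve, and a tangent vector that fixes them is
  zero. \<open>\<delta>\<close> collects the leading coefficients and derivatives of the minimal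
  polynomials of the ambient coordinates.\<close>

lemma generic_smoothness:
  fixes S :: "('v::finite \<Rightarrow> complex) set"
  assumes irr: "irr S" and xi: "\<And>i. \<xi> i \<in> polymap"
    and ind: "algindep D \<xi> S" and dep: "\<And>\<theta>. \<theta> \<in> polymap \<Longrightarrow> \<not> algindep (Suc D) (\<xi>(D := \<theta>)) S"
  obtains \<delta> where "\<delta> \<in> polymap" "\<exists>b\<in>S. \<delta> b \<noteq> 0"
    "\<And>b w. b \<in> S \<Longrightarrow> \<delta> b \<noteq> 0 \<Longrightarrow> \<exists>x. x 0 = b \<and> eventually (\<lambda>s. x s \<in> Vz S) (nhds 0) \<and>
       (\<forall>u. (\<lambda>s. x s u) field_differentiable at 0) \<and> (\<forall>i<D. eventually (\<lambda>s. \<xi> i (x s) = \<xi> i b + s * w i) (nhds 0))"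
    "\<And>b v. b \<in> S \<Longrightarrow> \<delta> b \<noteq> 0 \<Longrightarrow> \<forall>F\<in>Iv S. (\<Sum>u\<in>UNIV. meval b (mpderiv u F) * v u) = 0 \<Longrightarrow>
       \<forall>i<D. \<forall>s. \<xi> i (\<lambda>u. b u + s * v u) = \<xi> i b \<Longrightarrow> v = (\<lambda>u. 0)"
proof -
  obtain vn :: "nat \<Rightarrow> 'v" and ix where ix: "\<And>v. ix v < CARD('v)" "\<And>v. vn (ix v) = v"
    "\<And>i. i < CARD('v) \<Longrightarrow> ix (vn i) = i" by (rule enumerate_finite_type) blast
  define \<zeta> where "\<zeta> i = (if i < D then \<xi> i else (\<lambda>a. a (vn (i - D))))" for i
  define m where "m = D + CARD('v)"
  have za: "\<zeta> i \<in> polymap" for i using xi by (auto simp: \<zeta>_def polymap_coord)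
  have ip: "irreducible_points ((\<lambda>a i. \<zeta> i a) ` S)" by (rule irr_irreducible_points[OF irr za])
  interpret irreducible_points "(\<lambda>a i. \<zeta> i a) ` S" by fact
  have alg: "alg j" if "D \<le> j" for j
    by (rule algebraic_alg[OF ip _ that ind dep[OF za]]) (auto simp: \<zeta>_def)
  have "\<forall>j. \<exists>d a. D \<le> j \<longrightarrow> minpol j d a" using alg minpol_exists by metis
  then obtain d a where mp: "\<And>j. D \<le> j \<Longrightarrow> minpol j (d j) (a j)" by metis
  have aA: "a j i \<in> polfun {..<j}" "\<not> van (a j (d j))" "van (\<lambda>p. \<Sum>i\<le>d j. a j i p * p j ^ i)" if "D \<le> j" for i j
    using mp[OF that] by (auto simp: minpol_def)
  have "algindep D \<zeta> S = algindep D \<xi> S" by (rule algindep_cong) (simp add: \<zeta>_def)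
  then have zD: "zeros D q" for q using algindep_zeros[OF ip] ind by simp
  define idx where "idx v = D + ix v" for v
  have idx: "idx v < m" "\<zeta> (idx v) = (\<lambda>a. a v)" for v
    using ix by (auto simp: idx_def m_def \<zeta>_def)
  define L where "L j b = a j (d j) (\<lambda>i. \<zeta> i b)" for j b
  define E where "E j b = (\<Sum>k\<le>d j. of_nat k * a j k (\<lambda>i. \<zeta> i b) * \<zeta> j b ^ (k - 1))" for j b
  have L: "L j \<in> polymap" "\<exists>b\<in>S. L j b \<noteq> 0" if "D \<le> j" for j
    using aA(1,2)[OF that] polymap_compose[OF aA(1)[OF that] za] by (auto simp: L_def[abs_def] van_def)
  have E: "E j \<in> polymap" "\<exists>b\<in>S. E j b \<noteq> 0" if "D \<le> j" for j
  proof -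
    have "(\<lambda>p. \<Sum>k\<le>d j. of_nat k * a j k p * p j ^ (k - 1)) \<in> polfun {..<Suc j}"
      using aA(1)[OF that] polfun_lessThan_mono[of j "Suc j"] by (auto intro!: polfun_intros)
    from polymap_compose[OF this za] show "E j \<in> polymap" by (simp add: E_def[abs_def])
    show "\<exists>b\<in>S. E j b \<noteq> 0" using minpol_deriv_not_van[OF mp[OF that]] by (auto simp: E_def van_def)
  qed
  define \<delta> where "\<delta> b = (\<Prod>j\<in>{D..<m}. L j b * E j b)" for b
  have LE: "(\<lambda>b. L j b * E j b) \<in> polymap" "\<exists>b\<in>S. L j b * E j b \<noteq> 0" if "D \<le> j" for j
  proof -
    show "(\<lambda>b. L j b * E j b) \<in> polymap" using L E that by (intro polymap_mult) auto
    show "\<exists>b\<in>S. L j b * E j b \<noteq> 0"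
      using irr_cancel[OF irr L(1)[OF that] E(1)[OF that]] L(2)[OF that] E(2)[OF that] by blast
  qed
  have nz: "L j b \<noteq> 0" "E j b \<noteq> 0" if "\<delta> b \<noteq> 0" "D \<le> j" "j < m" for j b
    using that by (auto simp: \<delta>_def)
  show ?thesis
  proof (rule that)
    show "\<delta> \<in> polymap" unfolding \<delta>_def[abs_def] using LE by (intro polymap_prod) auto
    show "\<exists>b\<in>S. \<delta> b \<noteq> 0" unfolding \<delta>_def using LE by (intro irr_prod_nonzero[OF irr]) auto
  next
    fix b w assume b: "b \<in> S" "\<delta> b \<noteq> 0"
    define p0 where "p0 i = \<zeta> i b" for i
    have p0: "p0 = (\<lambda>i. \<zeta> i b)" by (auto simp: p0_def)
    have "\<exists>p. (\<forall>i<m. p 0 i = p0 i) \<and> eventually (\<lambda>s. zeros m (p s)) (nhds 0) \<and>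
     (\<forall>i<m. (\<lambda>s. p s i) field_differentiable at 0) \<and> (\<forall>i<D. \<forall>s. p s i = p0 i + s * w i)"
    proof (rule curve_exists[of D m d a])
      show "D \<le> m" by (simp add: m_def)
      show "a i (d i) p0 \<noteq> 0" "(\<Sum>k\<le>d i. of_nat k * a i k p0 * p0 i ^ (k - 1)) \<noteq> 0" if "D \<le> i" "i < m" for i
        using nz[OF b(2) that] by (simp_all add: L_def E_def p0)
      show "(\<Sum>k\<le>d i. a i k p0 * p0 i ^ k) = 0" if "D \<le> i" for i
        using aA(3)[OF that] b(1) by (auto simp: van_def p0)
    qed (auto intro: mp zD)
    then obtain p where p: "\<forall>i<m. p 0 i = p0 i" "eventually (\<lambda>s. zeros m (p s)) (nhds 0)"
      "\<forall>i<m. (\<lambda>s. p s i) field_differentiable at 0" "\<forall>i<D. \<forall>s. p s i = p0 i + s * w i"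
      by (elim exE conjE) (rule that)
    define x where "x s v = p s (idx v)" for s v
    have zp: "x s \<in> Vz S" "\<And>i. i < m \<Longrightarrow> \<zeta> i (x s) = p s i" if "zeros m (p s)" for s
      using zeros_point[OF ip za idx that] by (simp_all add: x_def[abs_def])
    show "\<exists>x. x 0 = b \<and> eventually (\<lambda>s. x s \<in> Vz S) (nhds 0) \<and>
       (\<forall>u. (\<lambda>s. x s u) field_differentiable at 0) \<and> (\<forall>i<D. eventually (\<lambda>s. \<xi> i (x s) = \<xi> i b + s * w i) (nhds 0))"
    proof (intro exI conjI allI impI)
      show "x 0 = b" using p(1) idx by (auto simp: x_def p0_def)
      show "eventually (\<lambda>s. x s \<in> Vz S) (nhds 0)" using p(2) by eventually_elim (rule zp)
      show "(\<lambda>s. x s u) field_differentiable at 0" for u unfolding x_def using p(3) idx(1) by blast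
      fix i assume i: "i < D"
      show "eventually (\<lambda>s. \<xi> i (x s) = \<xi> i b + s * w i) (nhds 0)"
        using p(2)
      proof eventually_elim
        case (elim s)
        then show ?case using zp(2)[OF elim, of i] i p(4) by (simp add: \<zeta>_def m_def p0_def)
      qed
    qed
  next
    fix b v assume b: "b \<in> S" "\<delta> b \<noteq> 0"
      and tan: "\<forall>F\<in>Iv S. (\<Sum>u\<in>UNIV. meval b (mpderiv u F) * v u) = 0"
      and base: "\<forall>i<D. \<forall>s. \<xi> i (\<lambda>u. b u + s * v u) = \<xi> i b"
    \<comment> \<open>The coordinates are constant along the line one after another: once the
      earlier ones are, the derivative of the minimal polynomial of coordinate \<open>j\<close> is
      \<open>E j b * v u\<close>, and it is zero because that polynomial defines an element of
      \<open>Iv S\<close>.\<close>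
    have const: "\<zeta> j (\<lambda>u. b u + s * v u) = \<zeta> j b" if "j < m" for j s
      using that
    proof (induction j arbitrary: s rule: less_induct)
      case (less j)
      show ?case
      proof (cases "j < D")
        case True
        then show ?thesis using base by (simp add: \<zeta>_def)
      next
        case False
        then have j: "D \<le> j" by simp
        define u where "u = vn (j - D)"
        have zj: "\<zeta> j = (\<lambda>a. a u)" using False by (simp add: \<zeta>_def u_def)
        have "(\<lambda>p. \<Sum>k\<le>d j. a j k p * p j ^ k) \<in> polfun {..<Suc j}"
          using aA(1)[OF j] by (intro polfun_poly_in) auto
        from polymap_compose[OF this, of \<zeta>, OF za] obtain F where
          F: "(\<lambda>b. \<Sum>k\<le>d j. a j k (\<lambda>i. \<zeta> i b) * \<zeta> j b ^ k) = (\<lambda>b. meval b F)"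
          by (auto simp: polymap_def)
        have "F \<in> Iv S"
          using aA(3)[OF j] fun_cong[OF F] by (auto simp: Iv_def van_def)
        have c: "a j k (\<lambda>i. \<zeta> i (\<lambda>u. b u + s * v u)) = a j k (\<lambda>i. \<zeta> i b)" for k s
          by (rule polfun_cong[OF aA(1)[OF j]]) (use less in auto)
        have "((\<lambda>s. meval (\<lambda>u. b u + s * v u) F) has_field_derivative (\<Sum>u\<in>UNIV. meval (\<lambda>u. b u + 0 * v u) (mpderiv u F) * v u)) (at 0)"
          by (rule meval_has_field_derivative) (auto intro!: derivative_eq_intros)
        then have d0: "((\<lambda>s. meval (\<lambda>u. b u + s * v u) F) has_field_derivative 0) (at 0)"
          using tan[rule_format, OF \<open>F \<in> Iv S\<close>] by simp
        have eq: "(\<lambda>s. meval (\<lambda>u. b u + s * v u) F) = (\<lambda>s. \<Sum>k\<le>d j. a j k (\<lambda>i. \<zeta> i b) * (b u + s * v u) ^ k)"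
          unfolding fun_cong[OF F, symmetric] c zj ..
        have "((\<lambda>s. \<Sum>k\<le>d j. a j k (\<lambda>i. \<zeta> i b) * (b u + s * v u) ^ k) has_field_derivative E j b * v u) (at 0)"
          unfolding E_def zj
          by (auto intro!: derivative_eq_intros simp: sum_distrib_left mult_ac)
        then have "E j b * v u = 0" using d0 unfolding eq by (rule DERIV_unique)
        then have "v u = 0" using nz(2)[OF b(2) j less.prems] by simp
        then show ?thesis by (simp add: zj)
      qed
    qed
    show "v = (\<lambda>u. 0)"
    proof
      fix u show "v u = 0" using const[OF idx(1)[of u], of 1] by (simp add: idx(2))
    qed
  qed
qed

subsection \<open>Homogeneous coordinates and the Zariski topology\<close>

lemma crd_obtain:
  obtains a where "\<exists>i. a i \<noteq> 0" "crd p = {\<lambda>i. c * a i |c. c \<noteq> 0}"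
proof -
  obtain v :: "complex ^ 'a" where v: "v \<noteq> 0" "homog_coords p = {c *s v |c. c \<noteq> 0}"
    using homog_coords[of p] by auto
  show ?thesis
  proof (rule that[of "\<lambda>i. v $ i"])
    show "\<exists>i. v $ i \<noteq> 0" using v(1) by (auto simp: vec_eq_iff)
    show "crd p = {\<lambda>i. c * v $ i |c. c \<noteq> 0}"
    proof (intro set_eqI iffI)
      fix x assume "x \<in> {\<lambda>i. c * v $ i |c. c \<noteq> 0}"
      then obtain c where "c \<noteq> 0" "x = (\<lambda>i. (c *s v) $ i)" by auto
      then show "x \<in> crd p" unfolding crd_def v(2) by blast
    qed (auto simp: crd_def v(2) fun_eq_iff)
  qed
qed

lemma crd_exists:
  assumes "a i \<noteq> 0"
  shows "\<exists>p. a \<in> crd p"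
proof -
  define v :: "complex ^ 'a" where "v = (\<chi> i. a i)"
  have v0: "v \<noteq> 0" using assms by (auto simp: v_def vec_eq_iff)
  then have "homog_coords (Abs_proj {c *s v |c. c \<noteq> 0}) = {c *s v |c. c \<noteq> 0}"
    by (intro Abs_proj_inverse) auto
  moreover have "v = 1 *s v" by simp
  ultimately have "v \<in> homog_coords (Abs_proj {c *s v |c. c \<noteq> 0})" by (metis (mono_tags, lifting) mem_Collect_eq one_neq_zero)
  then have "(\<lambda>i. v $ i) \<in> crd (Abs_proj {c *s v |c. c \<noteq> 0})" unfolding crd_def by blast
  then show ?thesis unfolding v_def by auto
qed

lemma crd_nonempty: "crd p \<noteq> {}"
  by (rule crd_obtain[of p]) auto

lemma crd_scale: "a \<in> crd p \<Longrightarrow> c \<noteq> 0 \<Longrightarrow> (\<lambda>i. c * a i) \<in> crd p"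
proof -
  assume "a \<in> crd p" "c \<noteq> 0"
  obtain a0 where "crd p = {\<lambda>i. c * a0 i |c. c \<noteq> 0}" by (rule crd_obtain)
  then obtain d where "a = (\<lambda>i. d * a0 i)" "d \<noteq> 0" using \<open>a \<in> crd p\<close> by auto
  then show ?thesis using \<open>crd p = _\<close> \<open>c \<noteq> 0\<close> by (auto intro!: exI[of _ "c * d"] simp: mult.assoc)
qed

lemma crd_nonzero: "a \<in> crd p \<Longrightarrow> \<exists>i. a i \<noteq> 0"
  by (rule crd_obtain[of p]) auto

lemma crd_proportional:
  assumes "a \<in> crd p" "b \<in> crd p"
  obtains c where "c \<noteq> 0" "b = (\<lambda>i. c * a i)"
proof -
  obtain a0 where "crd p = {\<lambda>i. c * a0 i |c. c \<noteq> 0}" by (rule crd_obtain)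
  then obtain d e where "a = (\<lambda>i. d * a0 i)" "d \<noteq> 0" "b = (\<lambda>i. e * a0 i)" "e \<noteq> 0" using assms by auto
  then show ?thesis by (intro that[of "e / d"]) auto
qed

lemma crd_unique:
  assumes "a \<in> crd p" "a \<in> crd q"
  shows "p = q"
proof -
  have "crd p = crd q"
  proof (intro equalityI subsetI)
    fix b
    show "b \<in> crd q" if "b \<in> crd p"
      by (rule crd_proportional[OF assms(1) that]) (auto intro: crd_scale assms)
    show "b \<in> crd p" if "b \<in> crd q"
      by (rule crd_proportional[OF assms(2) that]) (auto intro: crd_scale assms)
  qed
  moreover have "homog_coords r = (\<lambda>a. \<chi> i. a i) ` crd r" for r :: "'a proj"
    by (auto simp: crd_def image_iff) force
  ultimately have "homog_coords p = homog_coords q" by simp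
  then show ?thesis by (simp add: homog_coords_inject)
qed

text \<open>Homogeneous coordinate vectors are nonzero, so the cone lacks its vertex, and closures
  have to be compared away from the origin.\<close>

definition affine_cone :: "'n::finite proj set \<Rightarrow> ('n \<Rightarrow> complex) set" where
  "affine_cone X = \<Union>(crd ` X)"

lemma mem_cone_iff: "a \<in> crd p \<Longrightarrow> a \<in> affine_cone X \<longleftrightarrow> p \<in> X"
  unfolding affine_cone_def UN_iff using crd_unique by metis

lemma cone_scale: "a \<in> affine_cone X \<Longrightarrow> c \<noteq> 0 \<Longrightarrow> (\<lambda>i. c * a i) \<in> affine_cone X"
  unfolding affine_cone_def using crd_scale by blast

lemma cone_nonzero: "a \<in> affine_cone X \<Longrightarrow> \<exists>i. a i \<noteq> 0"
  unfolding affine_cone_def using crd_nonzero by blast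

lemma cone_mono_iff: "affine_cone X \<subseteq> affine_cone Y \<longleftrightarrow> X \<subseteq> Y"
proof
  assume *: "affine_cone X \<subseteq> affine_cone Y"
  show "X \<subseteq> Y"
  proof
    fix p assume "p \<in> X"
    obtain a where a: "a \<in> crd p" using crd_nonempty[of p] by auto
    show "p \<in> Y" using * \<open>p \<in> X\<close> mem_cone_iff[OF a] by auto
  qed
qed (auto simp: affine_cone_def)

lemma cone_Un: "affine_cone (X \<union> Y) = affine_cone X \<union> affine_cone Y"
  by (auto simp: affine_cone_def)

lemma scale_in_UNIV: "scale_in UNIV c a = (\<lambda>v. c * a v)"
  by (simp add: scale_in_def)

lemma vanishing_ideal_cone: "vanishing_ideal hom1 crd X = Iv (affine_cone X)"
  unfolding affine_cone_def
  by (rule vanishing_ideal_eq_Iv1) (auto simp: scale_in_UNIV intro: crd_scale)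

lemma homogeneous_in_1: "homogeneous_in B 1"
  by (auto simp: homogeneous_in_def)

lemma homogeneous_in_mult:
  assumes "homogeneous_in B f" "homogeneous_in B g"
  shows "homogeneous_in B (f * g)"
proof -
  obtain d e where *: "\<forall>\<alpha>\<in>Poly_Mapping.keys f. (\<Sum>v\<in>B. Poly_Mapping.lookup \<alpha> v) = d"
    "\<forall>\<alpha>\<in>Poly_Mapping.keys g. (\<Sum>v\<in>B. Poly_Mapping.lookup \<alpha> v) = e"
    using assms by (auto simp: homogeneous_in_def)
  show ?thesis
    unfolding homogeneous_in_def
  proof (intro exI[of _ "d + e"] ballI)
    fix \<gamma> assume "\<gamma> \<in> Poly_Mapping.keys (f * g)"
    then obtain \<alpha> \<beta> where "\<gamma> = \<alpha> + \<beta>" "\<alpha> \<in> Poly_Mapping.keys f" "\<beta> \<in> Poly_Mapping.keys g"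
      using keys_mult[of f g] by auto
    then show "(\<Sum>v\<in>B. Poly_Mapping.lookup \<gamma> v) = d + e" using * by (simp add: lookup_add sum.distrib)
  qed
qed

lemma homogeneous_meval_scale:
  assumes "homogeneous_in B f"
  shows "\<exists>d. \<forall>c a. meval (scale_in B c a) f = c ^ d * meval a f"
proof -
  obtain d where d: "\<forall>\<alpha>\<in>Poly_Mapping.keys f. deg_in B \<alpha> = d"
    using assms by (auto simp: homogeneous_in_def deg_in_def)
  have "meval (scale_in B c a) f = c ^ d * meval a f" for c a
    unfolding meval_eq_sum_mon sum_distrib_left
    by (rule sum.cong) (use d in \<open>auto simp: mon_scale_in\<close>)
  then show ?thesis by blast
qed

lemma hom1_zero_locus_iff:
  assumes "hom1 f" "a \<in> crd p"
  shows "p \<in> zero_locus crd {f} \<longleftrightarrow> meval a f = 0"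
proof
  assume *: "meval a f = 0"
  obtain d where d: "\<forall>c a. meval (\<lambda>v. c * a v) f = c ^ d * meval a f"
    using homogeneous_meval_scale[OF assms(1)] by (auto simp: scale_in_UNIV)
  show "p \<in> zero_locus crd {f}"
    unfolding zero_locus_def
  proof (clarsimp)
    fix b assume "b \<in> crd p"
    then obtain c where "b = (\<lambda>i. c * a i)" using crd_proportional[OF assms(2)] by metis
    then show "meval b f = 0" using d * by simp
  qed
qed (use assms in \<open>auto simp: zero_locus_def\<close>)

section \<open>Closed and irreducible sets in terms of equations\<close>

lemma topspace_zariski:
  assumes "hom 1" "\<And>p. cs p \<noteq> {}"
  shows "topspace (zariski hom cs) = UNIV"
proof -
  have "zero_locus cs {1} = {}" using assms(2) by (auto simp: zero_locus_def)
  then have "UNIV \<in> {- zero_locus cs {f} |f. hom f}" using assms(1) by force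
  then show ?thesis unfolding zariski_def topology_generated_by_topspace by blast
qed

lemma topspace_zariski1 [simp]: "topspace zariski1 = UNIV"
  by (rule topspace_zariski) (auto simp: homogeneous_in_1 crd_nonempty)

lemma closedin_zero_locus_hom:
  assumes "hom 1" "\<And>p. cs p \<noteq> {}" "hom f"
  shows "closedin (zariski hom cs) (zero_locus cs {f})"
proof -
  have "openin (zariski hom cs) (- zero_locus cs {f})"
    unfolding zariski_def by (rule topology_generated_by_Basis) (use assms in auto)
  then show ?thesis using topspace_zariski[of hom cs] assms by (simp add: closedin_def Compl_eq_Diff_UNIV)
qed

text \<open>\<open>F\<close> may contain inhomogeneous polynomials: vanishing on all coordinate
  vectors of a point means that every homogeneous component vanishes there.\<close>

lemma closedin_zariski1_zero_locus: "closedin zariski1 (zero_locus crd F)"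
proof (cases "F = {}")
  case True
  then have "zero_locus crd F = topspace zariski1" by (auto simp: zero_locus_def)
  then show ?thesis using closedin_topspace by metis
next
  case False
  define C where "C = (\<lambda>(f, d). zero_locus crd {hcomp UNIV d f}) ` (F \<times> UNIV)"
  have "zero_locus crd F = \<Inter>C"
  proof (intro equalityI subsetI)
    fix p assume "p \<in> zero_locus crd F"
    then have "f \<in> Iv (crd p)" if "f \<in> F" for f using that by (auto simp: Iv_def zero_locus_def)
    then have "hcomp UNIV d f \<in> Iv (crd p)" if "f \<in> F" for f d
      using that by (intro hcomp_in_Iv) (auto simp: scale_in_UNIV crd_scale)
    then show "p \<in> \<Inter>C" by (auto simp: C_def zero_locus_def Iv_def)
  next
    fix p assume "p \<in> \<Inter>C"
    then have *: "meval a (hcomp UNIV d f) = 0" if "a \<in> crd p" "f \<in> F" for a d f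
      using that by (force simp: C_def zero_locus_def)
    show "p \<in> zero_locus crd F"
      unfolding zero_locus_def
    proof (intro CollectI ballI)
      fix f a assume "f \<in> F" "a \<in> crd p"
      then have "(\<Sum>d\<in>degrees_in UNIV f. meval a (hcomp UNIV d f)) = 0" using * by simp
      then show "meval a f = 0" by (simp flip: meval_sum add: sum_hcomp)
    qed
  qed
  moreover have "closedin zariski1 (\<Inter>C)"
    by (rule closedin_Inter) (use False in \<open>auto simp: C_def intro!: closedin_zero_locus_hom homogeneous_in_1 homogeneous_in_hcomp crd_nonempty\<close>)
  ultimately show ?thesis by simp
qed

text \<open>Induction over the generation of open sets, stated for complements; finite intersections
  of open sets correspond to products of polynomials.\<close>

lemma closedin_zariski1_separate:
  assumes "closedin zariski1 Z" "p \<notin> Z"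
  obtains f where "hom1 f" "p \<notin> zero_locus crd {f}" "Z \<subseteq> zero_locus crd {f}"
proof -
  have "openin zariski1 (- Z)" using assms(1) by (simp add: closedin_def Compl_eq_Diff_UNIV)
  then have "generate_topology_on {- zero_locus crd {f} |f. hom1 f} (- Z)"
    by (simp add: zariski_def openin_topology_generated_by_iff)
  then have "\<forall>p\<in>-Z. \<exists>f. hom1 f \<and> p \<notin> zero_locus crd {f} \<and> - (- Z) \<subseteq> zero_locus crd {f}"
  proof (induction "- Z" arbitrary: Z rule: generate_topology_on.induct)
    case Empty
    then show ?case by auto
  next
    case (Int a b Z)
    show ?case
    proof
      fix p assume p: "p \<in> - Z"
      then have "p \<in> a" "p \<in> b" using Int by auto
      then obtain f where f: "hom1 f" "p \<notin> zero_locus crd {f}" "- a \<subseteq> zero_locus crd {f}"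
        using Int(2)[of "- a"] by auto
      obtain g where g: "hom1 g" "p \<notin> zero_locus crd {g}" "- b \<subseteq> zero_locus crd {g}"
        using Int(4)[of "- b"] \<open>p \<in> b\<close> by auto
      obtain e where e: "e \<in> crd p" using crd_nonempty[of p] by auto
      have "p \<notin> zero_locus crd {f * g}"
        using f(1,2) g(1,2) e by (simp add: hom1_zero_locus_iff homogeneous_in_mult)
      moreover have "- (- Z) \<subseteq> zero_locus crd {f * g}"
      proof
        fix q assume "q \<in> - (- Z)"
        then have "q \<in> - a \<or> q \<in> - b" using Int(5) by auto
        then show "q \<in> zero_locus crd {f * g}" using f(3) g(3) by (auto simp: zero_locus_def)
      qed
      ultimately show "\<exists>f. hom1 f \<and> p \<notin> zero_locus crd {f} \<and> - (- Z) \<subseteq> zero_locus crd {f}"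
        using homogeneous_in_mult[OF f(1) g(1)] by blast
    qed
  next
    case (UN K Z)
    show ?case
    proof
      fix p assume "p \<in> - Z"
      then have "p \<in> \<Union>K" using UN(3) by simp
      then obtain k where k: "k \<in> K" "p \<in> k" by blast
      then obtain f where "hom1 f" "p \<notin> zero_locus crd {f}" "- k \<subseteq> zero_locus crd {f}"
        using UN(2)[of "- k"] by auto
      moreover have "Z \<subseteq> - k" using UN(3) k(1) by auto
      ultimately show "\<exists>f. hom1 f \<and> p \<notin> zero_locus crd {f} \<and> - (- Z) \<subseteq> zero_locus crd {f}" by auto
    qed
  next
    case Basis
    then obtain f where "hom1 f" "- Z = - zero_locus crd {f}" by auto
    then show ?case by (auto intro!: exI[of _ f])
  qed
  then show ?thesis using that assms(2) by auto
qed

lemma closed_Vz: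
  assumes "closedin zariski1 Z" "a \<in> Vz (affine_cone Z)" "a i \<noteq> 0"
  shows "a \<in> affine_cone Z"
proof (rule ccontr)
  assume na: "a \<notin> affine_cone Z"
  obtain p where p: "a \<in> crd p" using crd_exists[of a i, OF assms(3)] by blast
  then have "p \<notin> Z" using na mem_cone_iff by blast
  then obtain f where f: "hom1 f" "p \<notin> zero_locus crd {f}" "Z \<subseteq> zero_locus crd {f}"
    by (rule closedin_zariski1_separate[OF assms(1)]) auto
  then have "f \<in> Iv (affine_cone Z)" by (auto simp: Iv_def affine_cone_def zero_locus_def)
  then have "meval a f = 0" using assms(2) by (auto simp: Vz_def)
  then show False using f p by (simp add: hom1_zero_locus_iff)
qed

text \<open>Topological irreducibility only sees closed subsets of projective space, whereas
  \<open>f\<close> and \<open>g\<close> are arbitrary. On the line through a coordinate vector they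
  are polynomials in the scaling factor with zero product, so one of them vanishes on the whole
  line.\<close>

lemma irreducible_closed_imp_irr:
  assumes "irreducible_closed zariski1 X"
  shows "irr (affine_cone X)"
  unfolding irr_def
proof (intro conjI ballI impI)
  have "X \<noteq> {}" using assms by (simp add: irreducible_closed_def)
  then show "affine_cone X \<noteq> {}" using crd_nonempty by (fastforce simp: affine_cone_def)
  fix f g :: "('a \<Rightarrow> complex) \<Rightarrow> complex"
  assume "f \<in> polymap" "g \<in> polymap" and fg: "\<forall>a\<in>affine_cone X. f a * g a = 0"
  then obtain F G where FG: "f = (\<lambda>a. meval a F)" "g = (\<lambda>a. meval a G)" by (auto simp: polymap_def)
  have "X \<subseteq> zero_locus crd {F} \<union> zero_locus crd {G}"
  proof
    fix p assume p: "p \<in> X"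
    obtain a where a: "a \<in> crd p" using crd_nonempty[of p] by auto
    define P where "P H = (\<Sum>d\<in>degrees_in UNIV H. monom (meval a (hcomp UNIV d H)) d)" for H
    have P: "poly (P H) c = meval (\<lambda>v. c * a v) H" for H c
      using meval_scale_in[of UNIV c a H] by (simp add: P_def poly_sum poly_monom scale_in_UNIV mult.commute)
    have "poly (P F * P G) c = 0" if "c \<noteq> 0" for c
      using fg crd_scale[OF a that] p by (auto simp: P FG affine_cone_def)
    then have "- {0} \<subseteq> {c. poly (P F * P G) c = 0}" by auto
    then have "infinite {c. poly (P F * P G) c = 0}" using infinite_nonzero_complex finite_subset by blast
    then have "P F * P G = 0" using poly_roots_finite by blast
    then have "P F = 0 \<or> P G = 0" by simp
    moreover have "p \<in> zero_locus crd {H}" if H: "P H = 0" for H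
      unfolding zero_locus_def
    proof (clarsimp)
      fix b assume "b \<in> crd p"
      then obtain c where "b = (\<lambda>i. c * a i)" using crd_proportional[OF a] by metis
      then show "meval b H = 0" using P[of H c] H by simp
    qed
    ultimately show "p \<in> zero_locus crd {F} \<union> zero_locus crd {G}" by blast
  qed
  then have "X \<subseteq> zero_locus crd {F} \<or> X \<subseteq> zero_locus crd {G}"
    using assms closedin_zariski1_zero_locus unfolding irreducible_closed_def by blast
  then show "(\<forall>a\<in>affine_cone X. f a = 0) \<or> (\<forall>a\<in>affine_cone X. g a = 0)"
    by (auto simp: FG zero_locus_def affine_cone_def)
qed

lemma irr_imp_irreducible_closed:
  assumes "closedin zariski1 X" "irr (affine_cone X)"
  shows "irreducible_closed zariski1 X"
  unfolding irreducible_closed_def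
proof (intro conjI allI impI)
  show "X \<noteq> {}" using assms(2) by (auto simp: irr_def affine_cone_def)
  fix A B assume AB: "closedin zariski1 A \<and> closedin zariski1 B \<and> X \<subseteq> A \<union> B"
  show "X \<subseteq> A \<or> X \<subseteq> B"
  proof (rule ccontr)
    assume "\<not> (X \<subseteq> A \<or> X \<subseteq> B)"
    then obtain p q where pq: "p \<in> X" "p \<notin> A" "q \<in> X" "q \<notin> B" by blast
    obtain f where f: "hom1 f" "p \<notin> zero_locus crd {f}" "A \<subseteq> zero_locus crd {f}"
      by (rule closedin_zariski1_separate[OF _ pq(2)]) (use AB in auto)
    obtain g where g: "hom1 g" "q \<notin> zero_locus crd {g}" "B \<subseteq> zero_locus crd {g}"
      by (rule closedin_zariski1_separate[OF _ pq(4)]) (use AB in auto)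
    have "\<forall>a\<in>affine_cone X. meval a f * meval a g = 0"
    proof
      fix a assume "a \<in> affine_cone X"
      then obtain r where "r \<in> X" "a \<in> crd r" by (auto simp: affine_cone_def)
      then show "meval a f * meval a g = 0" using AB f(3) g(3) by (force simp: zero_locus_def)
    qed
    then have "(\<forall>a\<in>affine_cone X. meval a f = 0) \<or> (\<forall>a\<in>affine_cone X. meval a g = 0)"
      using assms(2)[unfolded irr_def, THEN conjunct2, THEN bspec, OF polymap_meval[of f],
          THEN bspec, OF polymap_meval[of g]] by simp
    then show False using pq f(2) g(2) by (auto simp: zero_locus_def affine_cone_def)
  qed
qed (use assms in auto)

subsection \<open>Noetherianity\<close>

text \<open>Passing to a subsequence for one coordinate at a time: a monotone sequence of naturals
  is increasing, or decreasing and then constant from where its minimum is attained.\<close>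

lemma monotone_subsequence:
  fixes f :: "nat \<Rightarrow> 'v \<Rightarrow> nat"
  assumes "finite V"
  shows "\<exists>r :: nat \<Rightarrow> nat. strict_mono r \<and> (\<forall>v\<in>V. \<forall>i j. i \<le> j \<longrightarrow> f (r i) v \<le> f (r j) v)"
  using assms
proof (induction V rule: finite_induct)
  case empty
  show ?case by (rule exI[of _ id]) (auto simp: strict_mono_def)
next
  case (insert v V)
  then obtain r :: "nat \<Rightarrow> nat" where r: "strict_mono r" "\<forall>v\<in>V. \<forall>i j. i \<le> j \<longrightarrow> f (r i) v \<le> f (r j) v" by blast
  define g where "g i = f (r i) v" for i
  obtain s where s: "strict_mono s" "monoseq (\<lambda>n. g (s n))" using seq_monosub[of g] by blast
  have "\<exists>N. \<forall>i j. N \<le> i \<longrightarrow> i \<le> j \<longrightarrow> g (s i) \<le> g (s j)"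
  proof (cases "incseq (\<lambda>n. g (s n))")
    case True
    then show ?thesis by (auto simp: incseq_def)
  next
    case False
    then have dec: "decseq (\<lambda>n. g (s n))" using s(2) monoseq_iff by blast
    define m where "m = (LEAST m. \<exists>n. g (s n) = m)"
    have "\<exists>m n. g (s n) = m" by blast
    then have "\<exists>n. g (s n) = m" unfolding m_def by (rule LeastI_ex)
    then obtain N where N: "g (s N) = m" by blast
    have "m \<le> g (s j)" for j unfolding m_def by (rule Least_le) blast
    moreover have "g (s i) \<le> m" if "N \<le> i" for i using dec that N by (auto simp: decseq_def)
    ultimately show ?thesis by (meson le_trans)
  qed
  then obtain N where N: "\<And>i j. N \<le> i \<Longrightarrow> i \<le> j \<Longrightarrow> g (s i) \<le> g (s j)" by blast
  have "strict_mono (\<lambda>i. r (s (i + N)))" using r(1) s(1) by (auto simp: strict_mono_def)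
  moreover have "f (r (s (i + N))) u \<le> f (r (s (j + N))) u" if "u \<in> insert v V" "i \<le> j" for u i j
  proof (cases "u = v")
    case True
    then show ?thesis using N[of "i + N" "j + N"] that by (simp add: g_def)
  next
    case False
    have "s (i + N) \<le> s (j + N)" using s(1) that by (simp add: strict_mono_less_eq)
    then show ?thesis using r(2) False that by auto
  qed
  ultimately show ?case by blast
qed

text \<open>The minimal exponents are pairwise incomparable, but an infinite sequence of exponents
  contains an ascending pair. Descent on the total degree finds a minimal exponent below each
  element.\<close>

lemma dickson:
  fixes M :: "('v::finite \<Rightarrow>\<^sub>0 nat) set"
  shows "\<exists>B. finite B \<and> B \<subseteq> M \<and> (\<forall>\<alpha>\<in>M. \<exists>\<beta>\<in>B. \<exists>\<gamma>. \<alpha> = \<gamma> + \<beta>)"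
proof -
  define le where "le \<beta> \<alpha> \<longleftrightarrow> (\<forall>v. Poly_Mapping.lookup \<beta> v \<le> Poly_Mapping.lookup \<alpha> v)" for \<alpha> \<beta> :: "'v \<Rightarrow>\<^sub>0 nat"
  define B where "B = {\<beta>\<in>M. \<forall>\<alpha>\<in>M. le \<alpha> \<beta> \<longrightarrow> \<alpha> = \<beta>}"
  have "finite B"
  proof (rule ccontr)
    assume "infinite B"
    then obtain f :: "nat \<Rightarrow> 'v \<Rightarrow>\<^sub>0 nat" where f: "inj f" "range f \<subseteq> B"
      using infinite_countable_subset by blast
    obtain r :: "nat \<Rightarrow> nat" where r: "strict_mono r"
      "\<forall>v\<in>UNIV. \<forall>i j. i \<le> j \<longrightarrow> Poly_Mapping.lookup (f (r i)) v \<le> Poly_Mapping.lookup (f (r j)) v"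
      using monotone_subsequence[of UNIV "\<lambda>i v. Poly_Mapping.lookup (f i) v"] by auto
    have "le (f (r 0)) (f (r 1))" using r(2) by (auto simp: le_def)
    then have "f (r 0) = f (r 1)" using f(2) unfolding B_def by blast
    then have "r 0 = r 1" using f(1) by (simp add: inj_eq)
    then show False using r(1) by (metis strict_mono_eq zero_neq_one)
  qed
  moreover have "\<exists>\<beta>\<in>B. le \<beta> \<alpha>" if "\<alpha> \<in> M" for \<alpha>
    using that
  proof (induction "deg_in UNIV \<alpha>" arbitrary: \<alpha> rule: less_induct)
    case (less \<alpha>)
    show ?case
    proof (cases "\<alpha> \<in> B")
      case True
      then show ?thesis by (auto simp: le_def)
    next
      case False
      then obtain \<beta> where \<beta>: "\<beta> \<in> M" "le \<beta> \<alpha>" "\<beta> \<noteq> \<alpha>" using less by (auto simp: B_def)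
      then obtain v where "Poly_Mapping.lookup \<beta> v \<noteq> Poly_Mapping.lookup \<alpha> v"
        using poly_mapping_eqI[of \<beta> \<alpha>] by blast
      then have "deg_in UNIV \<beta> < deg_in UNIV \<alpha>"
        unfolding deg_in_def using \<beta>(2)
        by (intro sum_strict_mono_ex1) (auto simp: le_def intro!: bexI[of _ v] order_neq_le_trans)
      then obtain \<gamma> where "\<gamma> \<in> B" "le \<gamma> \<beta>" using less \<beta> by blast
      then show ?thesis using \<beta>(2) by (auto simp: le_def intro: order.trans)
    qed
  qed
  moreover have "\<alpha> = (\<alpha> - \<beta>) + \<beta>" if "le \<beta> \<alpha>" for \<alpha> \<beta>
    using that by (intro poly_mapping_eqI) (auto simp: lookup_add lookup_minus le_def)
  ultimately have "\<forall>\<alpha>\<in>M. \<exists>\<beta>\<in>B. \<exists>\<gamma>. \<alpha> = \<gamma> + \<beta>" by blast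
  moreover have "B \<subseteq> M" by (auto simp: B_def)
  ultimately show ?thesis using \<open>finite B\<close> by blast
qed

text \<open>The product \<open>\<Prod>\<^sub>v p\<^sub>v ^ \<alpha> v\<close> over distinct primes \<open>p\<^sub>v\<close> turns the order of the natural numbers
  into a monomial order.\<close>

lemma monomial_encoding:
  obtains enc :: "('v::finite \<Rightarrow>\<^sub>0 nat) \<Rightarrow> nat" where
    "\<And>\<alpha> \<beta>. enc (\<alpha> + \<beta>) = enc \<alpha> * enc \<beta>" "inj enc" "\<And>\<alpha>. enc \<alpha> > 0"
proof -
  obtain vn :: "nat \<Rightarrow> 'v" and ix where ix: "\<And>v. vn (ix v) = v" by (rule enumerate_finite_type) blast
  obtain f :: "nat \<Rightarrow> nat" where f: "inj f" "range f \<subseteq> {p. prime p}"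
    using infinite_countable_subset[OF primes_infinite] by blast
  define pr where "pr v = f (ix v)" for v
  have inj: "inj pr" unfolding pr_def using f(1) ix by (intro injI) (metis injD)
  have prime: "prime (pr v)" for v using f(2) by (auto simp: pr_def)
  define enc where "enc \<alpha> = (\<Prod>v\<in>UNIV. pr v ^ Poly_Mapping.lookup \<alpha> v)" for \<alpha>
  have pos: "enc \<alpha> > 0" for \<alpha>
    unfolding enc_def using prime by (intro prod_pos) (simp add: prime_gt_0_nat)
  have mult: "multiplicity (pr u) (enc \<alpha>) = Poly_Mapping.lookup \<alpha> u" for u \<alpha>
  proof -
    have "enc \<alpha> = (\<Prod>q\<in>range pr. q ^ Poly_Mapping.lookup \<alpha> (inv pr q))"
      unfolding enc_def by (subst prod.reindex[OF inj]) (simp add: inj)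
    then show ?thesis
      using multiplicity_prod_prime_powers[of "range pr" "pr u" "\<lambda>q. Poly_Mapping.lookup \<alpha> (inv pr q)"] prime inj
      by auto
  qed
  show ?thesis
  proof (rule that)
    show "enc (\<alpha> + \<beta>) = enc \<alpha> * enc \<beta>" for \<alpha> \<beta> by (simp add: enc_def lookup_add power_add prod.distrib)
    show "inj enc" by (intro injI poly_mapping_eqI) (metis mult)
  qed (rule pos)
qed

section \<open>The basis theorem and irreducible decomposition\<close>

lemma ideal_generated_diff:
  "f \<in> ideal_generated S \<Longrightarrow> g \<in> ideal_generated S \<Longrightarrow> f - g \<in> ideal_generated S"
  unfolding ideal_generated_def by (rule module.span_diff[OF module_mult])

lemma ideal_generated_add:
  "f \<in> ideal_generated S \<Longrightarrow> g \<in> ideal_generated S \<Longrightarrow> f + g \<in> ideal_generated S"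
  unfolding ideal_generated_def by (rule module.span_add[OF module_mult])

lemma ideal_generated_mono: "S \<subseteq> T \<Longrightarrow> ideal_generated S \<subseteq> ideal_generated T"
  unfolding ideal_generated_def by (rule module.span_mono[OF module_mult])

text \<open>The ideals \<open>I n\<close> increase. By Dickson's lemma finitely many leading
  exponents generate those of all of them, and these already occur in \<open>I M\<close>. Cancelling
  leading terms shows that every \<open>I n\<close> lies in \<open>I M\<close>, in particular
  \<open>I (Suc M)\<close>, which contains \<open>f M\<close>.\<close>

lemma hilbert_basis_sequence:
  fixes f :: "nat \<Rightarrow> 'v::finite mpoly"
  shows "\<exists>n. f n \<in> ideal_generated (f ` {..<n})"
proof -
  obtain enc :: "('v \<Rightarrow>\<^sub>0 nat) \<Rightarrow> nat" where enc: "\<And>\<alpha> \<beta>. enc (\<alpha> + \<beta>) = enc \<alpha> * enc \<beta>"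
    "inj enc" "\<And>\<alpha>. enc \<alpha> > 0" by (rule monomial_encoding) (rule that)
  define I where "I n = ideal_generated (f ` {..<n})" for n
  have I_mono: "I m \<subseteq> I n" if "m \<le> n" for m n
    unfolding I_def using that by (intro ideal_generated_mono) auto
  define lead where "lead h \<alpha> \<longleftrightarrow> \<alpha> \<in> Poly_Mapping.keys h \<and> (\<forall>\<kappa>\<in>Poly_Mapping.keys h. enc \<kappa> \<le> enc \<alpha>)"
    for h :: "'v mpoly" and \<alpha>
  obtain B where B: "finite B" "B \<subseteq> {\<alpha>. \<exists>n. \<exists>h\<in>I n. lead h \<alpha>}"
    "\<forall>\<alpha>\<in>{\<alpha>. \<exists>n. \<exists>h\<in>I n. lead h \<alpha>}. \<exists>\<beta>\<in>B. \<exists>\<gamma>. \<alpha> = \<gamma> + \<beta>"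
    using dickson[of "{\<alpha>. \<exists>n. \<exists>h\<in>I n. lead h \<alpha>}"] by (elim exE conjE) (rule that)
  have "\<forall>\<beta>\<in>B. \<exists>n h. h \<in> I n \<and> lead h \<beta>" using B(2) by fast
  then obtain nb hb where nb: "\<And>\<beta>. \<beta> \<in> B \<Longrightarrow> hb \<beta> \<in> I (nb \<beta>)" "\<And>\<beta>. \<beta> \<in> B \<Longrightarrow> lead (hb \<beta>) \<beta>" by metis
  define M where "M = Max (insert 0 (nb ` B))"
  have "nb \<beta> \<le> M" if "\<beta> \<in> B" for \<beta> unfolding M_def using that B(1) by (intro Max_ge) auto
  then have hM: "hb \<beta> \<in> I M" if "\<beta> \<in> B" for \<beta> using nb(1)[OF that] I_mono that by blast
  have main: "h \<in> I M" if "h \<in> I n" "\<forall>\<kappa>\<in>Poly_Mapping.keys h. enc \<kappa> < N" for N h n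
    using that
  proof (induction N arbitrary: h n)
    case 0
    then have "Poly_Mapping.keys h = {}" by auto
    then have "h = 0" by simp
    then show ?case unfolding I_def ideal_generated_def by (simp add: module.span_zero[OF module_mult])
  next
    case (Suc N)
    show ?case
    proof (cases "\<exists>\<alpha>\<in>Poly_Mapping.keys h. enc \<alpha> = N")
      case False
      then have "\<forall>\<kappa>\<in>Poly_Mapping.keys h. enc \<kappa> < N" using Suc.prems(2) by (metis less_SucE)
      then show ?thesis using Suc.IH Suc.prems(1) by blast
    next
      case True
      then obtain \<alpha> where \<alpha>: "\<alpha> \<in> Poly_Mapping.keys h" "enc \<alpha> = N" by blast
      then have "lead h \<alpha>" using Suc.prems(2) by (auto simp: lead_def less_Suc_eq_le)
      then obtain \<beta> \<gamma> where \<beta>: "\<beta> \<in> B" "\<alpha> = \<gamma> + \<beta>" using B(3) Suc.prems(1) by blast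
      let ?g = "hb \<beta>"
      have g: "\<beta> \<in> Poly_Mapping.keys ?g" "\<And>\<kappa>. \<kappa> \<in> Poly_Mapping.keys ?g \<Longrightarrow> enc \<kappa> \<le> enc \<beta>"
        using nb(2)[OF \<beta>(1)] by (auto simp: lead_def)
      \<comment> \<open>Chosen such that the leading terms of \<open>h\<close> and \<open>u\<close>
        cancel.\<close>
      define c where "c = Poly_Mapping.lookup h \<alpha> / Poly_Mapping.lookup ?g \<beta>"
      define u where "u = Poly_Mapping.single \<gamma> c * ?g"
      have u: "u = (\<Sum>\<kappa>\<in>Poly_Mapping.keys ?g. Poly_Mapping.single (\<gamma> + \<kappa>) (c * Poly_Mapping.lookup ?g \<kappa>))"
        unfolding u_def by (subst mpoly_sum_monomials[of ?g]) (simp add: sum_distrib_left mult_single)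
      have lu: "Poly_Mapping.lookup u (\<gamma> + \<kappa>) = c * Poly_Mapping.lookup ?g \<kappa>" for \<kappa>
        unfolding u lookup_sum lookup_single when_def
        by (simp add: sum.delta in_keys_iff)
      have ku: "enc \<kappa> \<le> N" if "\<kappa> \<in> Poly_Mapping.keys u" for \<kappa>
      proof -
        have "\<kappa> \<in> (\<Union>\<kappa>\<in>Poly_Mapping.keys ?g. Poly_Mapping.keys (Poly_Mapping.single (\<gamma> + \<kappa>) (c * Poly_Mapping.lookup ?g \<kappa>)))"
          using that keys_sum unfolding u by fastforce
        then obtain \<kappa>' where "\<kappa>' \<in> Poly_Mapping.keys ?g" "\<kappa> = \<gamma> + \<kappa>'" by (auto split: if_splits)
        then show ?thesis using g(2) \<alpha>(2) \<beta>(2) by (auto simp: enc)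
      qed
      have "\<forall>\<kappa>\<in>Poly_Mapping.keys (h - u). enc \<kappa> < N"
      proof
        fix \<kappa> assume \<kappa>: "\<kappa> \<in> Poly_Mapping.keys (h - u)"
        then have "Poly_Mapping.lookup h \<kappa> \<noteq> 0 \<or> Poly_Mapping.lookup u \<kappa> \<noteq> 0"
          by (auto simp: in_keys_iff lookup_minus)
        then have "enc \<kappa> \<le> N" using ku Suc.prems(2) by (auto simp: in_keys_iff less_Suc_eq_le)
        moreover have "Poly_Mapping.lookup (h - u) \<alpha> = 0"
          using g(1) by (simp add: lookup_minus \<beta>(2) lu c_def in_keys_iff)
        then have "\<kappa> \<noteq> \<alpha>" using \<kappa> by (auto simp: in_keys_iff)
        then have "enc \<kappa> \<noteq> N" using \<alpha>(2) enc(2) by (auto dest: injD)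
        ultimately show "enc \<kappa> < N" by simp
      qed
      moreover have "u \<in> I M" unfolding u_def using hM[OF \<beta>(1)] unfolding I_def by (rule ideal_generated_mult)
      moreover have "h - u \<in> I (max n M)"
        using Suc.prems(1) \<open>u \<in> I M\<close> I_mono[of n "max n M"] I_mono[of M "max n M"]
        unfolding I_def by (intro ideal_generated_diff) auto
      ultimately have "h - u + u \<in> I M"
        using Suc.IH[of "h - u"] unfolding I_def by (intro ideal_generated_add) auto
      then show ?thesis by simp
    qed
  qed
  have "f M \<in> I (Suc M)" unfolding I_def by (rule ideal_generated_base) auto
  moreover have "\<forall>\<kappa>\<in>Poly_Mapping.keys (f M). enc \<kappa> < Suc (Max (insert 0 (enc ` Poly_Mapping.keys (f M))))"
    by (auto simp: less_Suc_eq_le)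
  ultimately have "f M \<in> I M" by (rule main)
  then show ?thesis unfolding I_def by blast
qed

lemma Iv_strict:
  assumes "closedin zariski1 A" "A \<subset> Z"
  obtains f where "f \<in> Iv (affine_cone A)" "f \<notin> Iv (affine_cone Z)"
proof -
  obtain p where p: "p \<in> Z" "p \<notin> A" using assms(2) by blast
  obtain f where "hom1 f" "p \<notin> zero_locus crd {f}" "A \<subseteq> zero_locus crd {f}"
    by (rule closedin_zariski1_separate[OF assms(1) p(2)]) auto
  then show ?thesis using p(1) by (intro that[of f]) (auto simp: Iv_def affine_cone_def zero_locus_def)
qed

text \<open>A closed set without finite decomposition contains a proper closed subset of the same
  kind. The descending chain yields \<open>f n\<close> vanishing on \<open>W (Suc n)\<close> but not
  on \<open>W n\<close>, against \<open>hilbert_basis_sequence\<close>.\<close>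

lemma irreducible_decomposition:
  assumes "closedin zariski1 Z"
  obtains K where "finite K" "\<And>Y. Y \<in> K \<Longrightarrow> irreducible_closed zariski1 Y" "Z = \<Union>K"
proof -
  define good where "good Z \<longleftrightarrow> (\<exists>K. finite K \<and> (\<forall>Y\<in>K. irreducible_closed zariski1 Y) \<and> Z = \<Union>K)" for Z :: "'a proj set"
  have step: "\<exists>A. (closedin zariski1 A \<and> \<not> good A) \<and> A \<subset> Z" if Z: "closedin zariski1 Z \<and> \<not> good Z" for Z
  proof -
    have "\<not> irreducible_closed zariski1 Z" using Z unfolding good_def by (metis ccpo_Sup_singleton finite.emptyI finite_insert singletonD)
    moreover have "Z \<noteq> {}" using Z unfolding good_def by (metis Union_empty empty_iff finite.emptyI)
    ultimately obtain A B where AB: "closedin zariski1 A" "closedin zariski1 B" "Z \<subseteq> A \<union> B" "\<not> Z \<subseteq> A" "\<not> Z \<subseteq> B"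
      using Z unfolding irreducible_closed_def by blast
    have cl: "closedin zariski1 (Z \<inter> A)" "closedin zariski1 (Z \<inter> B)" using Z AB by auto
    have "\<not> good (Z \<inter> A) \<or> \<not> good (Z \<inter> B)"
    proof (rule ccontr)
      assume "\<not> ?thesis"
      then have g: "good (Z \<inter> A)" "good (Z \<inter> B)" by auto
      obtain K where K: "finite K" "\<forall>Y\<in>K. irreducible_closed zariski1 Y" "Z \<inter> A = \<Union>K"
        using g(1) unfolding good_def by (elim exE conjE) (rule that)
      obtain L where L: "finite L" "\<forall>Y\<in>L. irreducible_closed zariski1 Y" "Z \<inter> B = \<Union>L"
        using g(2) unfolding good_def by (elim exE conjE) (rule that)
      have "Z = \<Union>(K \<union> L)" using AB(3) K(3) L(3) by blast
      then have "good Z" unfolding good_def using K L by (intro exI[of _ "K \<union> L"]) auto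
      then show False using Z by simp
    qed
    then show ?thesis using cl AB(4,5) by blast
  qed
  have "good Z"
  proof (rule ccontr)
    assume "\<not> good Z"
    then have "\<exists>W. \<forall>n. (closedin zariski1 (W n) \<and> \<not> good (W n)) \<and> W (Suc n) \<subset> W n"
      using assms step by (intro dependent_nat_choice) auto
    then obtain W where W0: "\<forall>n. (closedin zariski1 (W n) \<and> \<not> good (W n)) \<and> W (Suc n) \<subset> W n"
      by (elim exE) (rule that)
    have W: "closedin zariski1 (W n)" "W (Suc n) \<subset> W n" for n using W0[rule_format, of n] by simp_all
    have "\<exists>f. f \<in> Iv (affine_cone (W (Suc n))) \<and> f \<notin> Iv (affine_cone (W n))" for n
      using Iv_strict[OF W(1) W(2)] by blast
    then obtain f where f: "\<And>n. f n \<in> Iv (affine_cone (W (Suc n)))" "\<And>n. f n \<notin> Iv (affine_cone (W n))" by metis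
    obtain n where n: "f n \<in> ideal_generated (f ` {..<n})" using hilbert_basis_sequence by blast
    have "f i \<in> Iv (affine_cone (W n))" if "i < n" for i
    proof -
      have "W n \<subseteq> W (Suc i)" using lift_Suc_antimono_le[of W "Suc i" n] W(2) that by auto
      then show ?thesis using f(1) Iv_antimono cone_mono_iff by blast
    qed
    then have "ideal_generated (f ` {..<n}) \<subseteq> Iv (affine_cone (W n))"
      by (intro ideal_generated_subset_Iv) auto
    then show False using n f(2) by blast
  qed
  then show ?thesis using that unfolding good_def by blast
qed

lemma irreducible_closed_subset_Union:
  assumes "irreducible_closed T W" "finite K" "\<And>Y. Y \<in> K \<Longrightarrow> closedin T Y" "W \<subseteq> \<Union>K"
  shows "\<exists>Y\<in>K. W \<subseteq> Y"
  using assms(2,3,4)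
proof (induction rule: finite_induct)
  case empty
  then show ?case using assms(1) by (auto simp: irreducible_closed_def)
next
  case (insert Y K)
  have "closedin T Y" "closedin T (\<Union>K)" using insert by (auto intro: closedin_Union)
  moreover have "W \<subseteq> Y \<union> \<Union>K" using insert by auto
  ultimately have "W \<subseteq> Y \<or> W \<subseteq> \<Union>K" using assms(1) unfolding irreducible_closed_def by blast
  then show ?case using insert by auto
qed

subsection \<open>Linear systems of parameters and dimension\<close>

definition lin :: "('n::finite \<Rightarrow> complex) \<Rightarrow> ('n \<Rightarrow> complex) \<Rightarrow> complex" where
  "lin z a = (\<Sum>i\<in>UNIV. z i * a i)"

lemma lin_polymap: "lin z \<in> polymap"
  unfolding lin_def[abs_def] by (intro polymap_sum polymap_mult polymap_const polymap_coord)

lemma lin_scale: "lin z (\<lambda>i. c * a i) = c * lin z a"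
  by (simp add: lin_def sum_distrib_left mult_ac)

lemma lin_add: "lin z (\<lambda>i. a i + b i) = lin z a + lin z b"
  by (simp add: lin_def distrib_left sum.distrib)

lemma lin_line: "lin z (\<lambda>u. b u + s * v u) = lin z b + s * lin z v"
  by (simp add: lin_add lin_scale)

lemma lin_diff_left: "lin (\<lambda>i. z i - c * y i) a = lin z a - c * lin y a"
  by (simp add: lin_def sum_subtractf left_diff_distrib sum_distrib_left mult.assoc)

lemma lin_has_field_derivative:
  assumes "\<And>u. ((\<lambda>s. x s u) has_field_derivative v u) (at 0)"
  shows "((\<lambda>s. lin z (x s)) has_field_derivative lin z v) (at 0)"
  unfolding lin_def by (auto intro!: derivative_eq_intros assms simp: mult_ac)

definition cut_out :: "nat \<Rightarrow> (nat \<Rightarrow> 'n::finite \<Rightarrow> complex) \<Rightarrow> ('n \<Rightarrow> complex) set \<Rightarrow> bool" where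
  "cut_out k \<zeta> S \<longleftrightarrow> (\<forall>a\<in>S. \<exists>i<k. lin (\<zeta> i) a \<noteq> 0)"

text \<open>For a closed \<open>X\<close>, the number \<open>ndim (affine_cone X)\<close> is \<open>dim X + 1\<close>.\<close>

definition ndim :: "('n::finite \<Rightarrow> complex) set \<Rightarrow> nat" where
  "ndim S = (LEAST k. \<exists>\<zeta>. cut_out k \<zeta> S)"

definition conic :: "('n \<Rightarrow> complex) set \<Rightarrow> bool" where
  "conic S \<longleftrightarrow> (\<forall>a\<in>S. (\<exists>i. a i \<noteq> 0) \<and> (\<forall>c. c \<noteq> 0 \<longrightarrow> (\<lambda>i. c * a i) \<in> S))"

lemma conic_affine_cone: "conic (affine_cone X)"
  unfolding conic_def using cone_nonzero cone_scale by blast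

lemma cut_out_ex:
  assumes "conic (S :: ('n::finite \<Rightarrow> complex) set)"
  shows "\<exists>k \<zeta>. cut_out k \<zeta> S"
proof -
  obtain vn :: "nat \<Rightarrow> 'n" and ix where ix: "\<And>v. ix v < CARD('n)" "\<And>v. vn (ix v) = v"
    by (rule enumerate_finite_type) blast
  define \<zeta> where "\<zeta> i = (\<lambda>j. if j = vn i then 1 else 0 :: complex)" for i
  have l: "lin (\<zeta> i) a = a (vn i)" for i a
  proof -
    have "lin (\<zeta> i) a = (\<Sum>j\<in>UNIV. if j = vn i then a j else 0)"
      unfolding lin_def \<zeta>_def by (rule sum.cong) auto
    then show ?thesis by simp
  qed
  have "cut_out CARD('n) \<zeta> S"
    unfolding cut_out_def l
  proof
    fix a assume "a \<in> S"
    then obtain j where "a j \<noteq> 0" using assms by (auto simp: conic_def)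
    then show "\<exists>i<CARD('n). a (vn i) \<noteq> 0" using ix by (intro exI[of _ "ix j"]) auto
  qed
  then show ?thesis by blast
qed

lemma ndim_cut_out:
  assumes "conic S"
  obtains \<zeta> where "cut_out (ndim S) \<zeta> S"
proof -
  have "\<exists>\<zeta>. cut_out (ndim S) \<zeta> S" unfolding ndim_def by (rule LeastI_ex) (rule cut_out_ex[OF assms])
  then show ?thesis using that by blast
qed

lemma ndim_le: "cut_out k \<zeta> S \<Longrightarrow> ndim S \<le> k"
  unfolding ndim_def by (rule Least_le) blast

lemma cut_out_subset: "cut_out k \<zeta> S \<Longrightarrow> T \<subseteq> S \<Longrightarrow> cut_out k \<zeta> T"
  by (auto simp: cut_out_def)

text \<open>Project from a point of the parameter space outside the hypersurface that contains the image.\<close>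

lemma cut_out_drop:
  assumes "conic S" "cut_out k \<zeta> S" "r \<in> polfun {..<k}" "\<exists>q. r q \<noteq> 0"
    and r: "\<And>a. a \<in> S \<Longrightarrow> r (\<lambda>i. lin (\<zeta> i) a) = 0"
  shows "\<exists>\<zeta>'. cut_out (k - 1) \<zeta>' S"
proof (cases "S = {}")
  case True
  then show ?thesis by (auto simp: cut_out_def)
next
  case False
  then have "k > 0" using assms(2) by (fastforce simp: cut_out_def)
  \<comment> \<open>The centre of projection avoids the hypersurface of \<open>r\<close>; a nonzero
    \<open>q 0\<close> allows the equations of its line to be solved for coordinate 0.\<close>
  obtain q where q: "r q \<noteq> 0" "q 0 \<noteq> 0"
  proof -
    have "(\<lambda>p. p 0) \<in> polfun {..<k}" using \<open>k > 0\<close> by (intro polfun.coord) auto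
    from polfun_nonzero_mult[OF assms(3) _ this, of _ "\<lambda>_. 1"] show ?thesis using assms(4) that by auto
  qed
  \<comment> \<open>The equations of the line spanned by \<open>q\<close>. A common zero of these
    forms on \<open>S\<close> has parameters proportional to \<open>q\<close>, and rescaling it to
    \<open>q\<close> contradicts the vanishing of \<open>r\<close> on \<open>S\<close>.\<close>
  define \<zeta>' where "\<zeta>' i = (\<lambda>j. \<zeta> (Suc i) j - (q (Suc i) / q 0) * \<zeta> 0 j)" for i
  have "cut_out (k - 1) \<zeta>' S"
    unfolding cut_out_def
  proof (intro ballI, rule ccontr)
    fix a assume a: "a \<in> S" and "\<not> (\<exists>i<k - 1. lin (\<zeta>' i) a \<noteq> 0)"
    then have z: "lin (\<zeta>' i) a = 0" if "i < k - 1" for i using that by blast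
    have "lin (\<zeta>' i) a = lin (\<zeta> (Suc i)) a - (q (Suc i) / q 0) * lin (\<zeta> 0) a" for i
      unfolding \<zeta>'_def by (rule lin_diff_left)
    then have *: "lin (\<zeta> (Suc i)) a = (q (Suc i) / q 0) * lin (\<zeta> 0) a" if "Suc i < k" for i
      using z[of i] that by simp
    define c where "c = lin (\<zeta> 0) a / q 0"
    have c: "lin (\<zeta> i) a = c * q i" if "i < k" for i
      using that * q(2) by (cases i) (auto simp: c_def)
    obtain i where "i < k" "lin (\<zeta> i) a \<noteq> 0" using assms(2) a by (auto simp: cut_out_def)
    then have "c \<noteq> 0" using c by auto
    then have b: "(\<lambda>i. (1 / c) * a i) \<in> S" using assms(1) a unfolding conic_def by (metis divide_eq_0_iff one_neq_zero)
    have "r (\<lambda>i. lin (\<zeta> i) (\<lambda>i. (1 / c) * a i)) = r q"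
    proof (rule polfun_cong[OF assms(3)])
      fix i assume "i \<in> {..<k}"
      then show "lin (\<zeta> i) (\<lambda>i. (1 / c) * a i) = q i"
        using lin_scale[of "\<zeta> i" "1 / c" a] c[of i] \<open>c \<noteq> 0\<close> by simp
    qed
    then show False using r[OF b] q(1) by simp
  qed
  then show ?thesis by blast
qed

text \<open>A relation between the forms would allow one more projection by
  \<open>cut_out_drop\<close>, against the minimality of \<open>ndim S\<close>.\<close>

lemma algindep_ndim:
  assumes "conic S" "S \<noteq> {}" "cut_out (ndim S) \<zeta> S"
  shows "algindep (ndim S) (\<lambda>i. lin (\<zeta> i)) S"
  unfolding algindep_def
proof (intro ballI impI, rule ccontr)
  fix f assume "f \<in> polfun {..<ndim S}" "\<forall>a\<in>S. f (\<lambda>i. lin (\<zeta> i) a) = 0" "\<not> (\<forall>p. f p = 0)"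
  then obtain \<zeta>' where "cut_out (ndim S - 1) \<zeta>' S" using cut_out_drop[OF assms(1,3)] by blast
  then have "ndim S \<le> ndim S - 1" by (rule ndim_le)
  then have "ndim S = 0" by simp
  then show False using assms(2,3) by (fastforce simp: cut_out_def)
qed

section \<open>Bounds from compactness\<close>

lemma continuous_meval:
  fixes x :: "'a::topological_space \<Rightarrow> 'v::finite \<Rightarrow> complex"
  assumes "\<And>v. continuous_on A (\<lambda>s. x s v)"
  shows "continuous_on A (\<lambda>s. meval (x s) F)"
  unfolding meval_def by (intro continuous_intros assms)

lemma closed_Vz_vec: "closed {v :: complex ^ 'n. (\<lambda>i. v $ i) \<in> Vz S}"
proof -
  have "{v :: complex ^ 'n. (\<lambda>i. v $ i) \<in> Vz S} = (\<Inter>F\<in>Iv S. {v. meval (\<lambda>i. v $ i) F = 0})"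
    by (auto simp: Vz_def)
  moreover have "closed {v :: complex ^ 'n. meval (\<lambda>i. v $ i) F = 0}" for F
    by (intro closed_Collect_eq continuous_meval continuous_intros)
  ultimately show ?thesis by auto
qed

lemma continuous_lin_sum: "continuous_on A (\<lambda>v :: complex ^ 'n::finite. \<Sum>i<k. norm (lin (\<zeta> i) (\<lambda>j. v $ j)))"
  unfolding lin_def by (intro continuous_intros)

text \<open>On the unit sphere of the closure the sum of the norms of the forms has a positive lower
  bound \<open>m\<close> by compactness, and homogeneity extends the estimate to all vectors. This
  is the finiteness of the projection in metric form.\<close>

lemma cone_bound:
  assumes "closedin zariski1 X" "cut_out k \<zeta> (affine_cone X)"
  obtains C where "\<And>a j. a \<in> Vz (affine_cone X) \<Longrightarrow> norm (a j) \<le> C * (\<Sum>i<k. norm (lin (\<zeta> i) a))" "C > 0"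
proof -
  define h where "h v = (\<Sum>i<k. norm (lin (\<zeta> i) (\<lambda>j. v $ j)))" for v :: "complex ^ 'a"
  define K where "K = {v :: complex ^ 'a. (\<lambda>i. v $ i) \<in> Vz (affine_cone X)} \<inter> sphere 0 1"
  have "compact K" unfolding K_def by (intro closed_Int_compact closed_Vz_vec compact_sphere)
  have hpos: "h v > 0" if "v \<in> K" for v
  proof -
    have "v \<noteq> 0" using that by (auto simp: K_def)
    then obtain i where "v $ i \<noteq> 0" by (auto simp: vec_eq_iff)
    then have "(\<lambda>i. v $ i) \<in> affine_cone X" using closed_Vz[OF assms(1)] that by (auto simp: K_def)
    then obtain i where "i < k" "lin (\<zeta> i) (\<lambda>j. v $ j) \<noteq> 0" using assms(2) by (auto simp: cut_out_def)
    then show ?thesis unfolding h_def by (intro sum_pos2[of _ i]) auto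
  qed
  obtain m where m: "m > 0" "\<And>v. v \<in> K \<Longrightarrow> m \<le> h v"
  proof (cases "K = {}")
    case False
    have "continuous_on K h" unfolding h_def[abs_def] by (rule continuous_lin_sum)
    then obtain v where "v \<in> K" "\<And>w. w \<in> K \<Longrightarrow> h v \<le> h w"
      using continuous_attains_inf[OF \<open>compact K\<close> False] by blast
    then show ?thesis using hpos that by blast
  qed (use that[of 1] in auto)
  have "norm (a j) \<le> (1 / m) * (\<Sum>i<k. norm (lin (\<zeta> i) a))" if a: "a \<in> Vz (affine_cone X)" for a j
  proof (cases "\<exists>i. a i \<noteq> 0")
    case False
    then show ?thesis by (simp add: lin_def)
  next
    case True
    then obtain i where "a i \<noteq> 0" by blast
    then have ac: "a \<in> affine_cone X" using closed_Vz[OF assms(1) a] by blast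
    define v :: "complex ^ 'a" where "v = (\<chi> i. a i)"
    have v0: "v \<noteq> 0" using \<open>a i \<noteq> 0\<close> by (auto simp: v_def vec_eq_iff)
    define c where "c = complex_of_real (1 / norm v)"
    have c0: "c \<noteq> 0" using v0 by (simp add: c_def)
    have nc: "norm c = 1 / norm v" by (simp add: c_def norm_divide)
    have "(\<lambda>i. c * a i) \<in> affine_cone X" by (rule cone_scale[OF ac c0])
    moreover have "norm (c *s v) = 1"
    proof -
      have "c *s v = (1 / norm v) *\<^sub>R v" unfolding vec_eq_iff vector_smult_component vector_scaleR_component
        by (simp only: c_def scaleR_conv_of_real of_real_divide of_real_1) simp
      then show ?thesis using v0 by simp
    qed
    moreover have e: "($) (c *s v) = (\<lambda>i. c * a i)" by (rule ext) (simp add: v_def)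
    ultimately have "c *s v \<in> K" using subset_Vz[of "affine_cone X"]
      by (auto simp: K_def simp del: vector_smult_component)
    then have "m \<le> h (c *s v)" by (rule m(2))
    also have "h (c *s v) = (1 / norm v) * (\<Sum>i<k. norm (lin (\<zeta> i) a))"
      unfolding h_def e lin_scale norm_mult nc by (simp add: sum_distrib_left)
    finally have "m * norm v \<le> (\<Sum>i<k. norm (lin (\<zeta> i) a))" using v0 by (simp add: field_simps)
    moreover have "norm (a j) \<le> norm v" using Finite_Cartesian_Product.norm_nth_le[of v j] by (simp add: v_def)
    ultimately have "m * norm (a j) \<le> (\<Sum>i<k. norm (lin (\<zeta> i) a))"
      using m(1) by (meson mult_left_mono less_imp_le order.trans)
    then show ?thesis using m(1) by (simp add: field_simps)
  qed
  then show ?thesis using that[of "1 / m"] m(1) by simp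
qed

lemma polymap_bounded:
  assumes "f \<in> polymap"
  shows "\<exists>M. \<forall>a. (\<forall>j. norm (a j) \<le> R) \<longrightarrow> norm (f a) \<le> M"
proof -
  obtain F where F: "f = (\<lambda>a. meval a F)" using assms by (auto simp: polymap_def)
  define M where "M = (\<Sum>\<alpha>\<in>Poly_Mapping.keys F. norm (Poly_Mapping.lookup F \<alpha>) * (\<Prod>v\<in>UNIV. R ^ Poly_Mapping.lookup \<alpha> v))"
  have "norm (f a) \<le> M" if "\<forall>j. norm (a j) \<le> R" for a
    unfolding F meval_def M_def using that
    by (intro order.trans[OF norm_sum] sum_mono) (auto simp: norm_mult norm_power prod_norm[symmetric] intro!: mult_left_mono prod_mono power_mono)
  then show ?thesis by blast
qed

text \<open>Where the forms are bounded all coordinates are, by \<open>cone_bound\<close>; then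
  \<open>\<theta>\<close> is bounded as well and \<open>bounded_imp_algebraic\<close>
  applies.\<close>

lemma cone_algebraic:
  assumes "irreducible_closed zariski1 X" "cut_out k \<zeta> (affine_cone X)" "\<theta> \<in> polymap"
  shows "\<not> algindep (Suc k) ((\<lambda>i. lin (\<zeta> i))(k := \<theta>)) (affine_cone X)"
proof -
  have cl: "closedin zariski1 X" using assms(1) by (simp add: irreducible_closed_def)
  obtain C where C: "\<And>a j. a \<in> Vz (affine_cone X) \<Longrightarrow> norm (a j) \<le> C * (\<Sum>i<k. norm (lin (\<zeta> i) a))" "C > 0"
    using cone_bound[OF cl assms(2)] by metis
  obtain M where M: "\<And>a. (\<forall>j. norm (a j) \<le> C * (\<Sum>i<k. 1)) \<Longrightarrow> norm (\<theta> a) \<le> M"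
    using polymap_bounded[OF assms(3), of "C * (\<Sum>i<k. 1)"] by blast
  show ?thesis
  proof (rule bounded_imp_algebraic[where \<rho> = 1 and C = M and ?q0.0 = "\<lambda>i. 0"])
    fix a assume a: "a \<in> Vz (affine_cone X)" "\<And>i. i < k \<Longrightarrow> norm (lin (\<zeta> i) a - 0) < 1"
    have "norm (a j) \<le> C * (\<Sum>i<k. 1)" for j
      using C(1)[OF a(1), of j] by (rule order.trans)
        (intro mult_left_mono sum_mono; use a(2) C(2) in \<open>auto intro: less_imp_le\<close>)
    then show "norm (\<theta> a) \<le> M" using M by blast
  qed (use assms lin_polymap irreducible_closed_imp_irr in auto)
qed

lemma ndim_strict_mono:
  assumes "irreducible_closed zariski1 X" "closedin zariski1 A" "A \<subset> X"
  shows "ndim (affine_cone A) < ndim (affine_cone X)"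
proof -
  let ?S = "affine_cone X" and ?D = "ndim (affine_cone X)"
  have irr: "irr ?S" by (rule irreducible_closed_imp_irr[OF assms(1)])
  then have ne: "?S \<noteq> {}" by (simp add: irr_def)
  obtain \<zeta> where \<zeta>: "cut_out ?D \<zeta> ?S" by (rule ndim_cut_out[OF conic_affine_cone])
  obtain f where f: "f \<in> Iv (affine_cone A)" "f \<notin> Iv ?S" by (rule Iv_strict[OF assms(2,3)])
  have pm: "(\<lambda>a. meval a f) \<in> polymap" by (rule polymap_meval)
  obtain N F where N: "N \<in> polfun {..<?D}" "\<exists>q. N q \<noteq> 0"
    "\<And>b. b \<in> ?S \<Longrightarrow> N (\<lambda>i. lin (\<zeta> i) b) = F b * meval b f"
  proof (rule nonzero_multiple_in_parameters[OF irr lin_polymap pm _ algindep_ndim[OF conic_affine_cone ne \<zeta>]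
        cone_algebraic[OF assms(1) \<zeta> pm]])
    show "\<exists>b\<in>?S. meval b f \<noteq> 0" using f(2) by (auto simp: Iv_def)
  qed (rule that)
  have sub: "affine_cone A \<subseteq> ?S" using assms(3) cone_mono_iff by blast
  have "\<exists>\<zeta>'. cut_out (?D - 1) \<zeta>' (affine_cone A)"
    using N f(1) sub by (intro cut_out_drop[OF conic_affine_cone cut_out_subset[OF \<zeta> sub] N(1,2)]) (auto simp: Iv_def subset_iff)
  then have "ndim (affine_cone A) \<le> ?D - 1" using ndim_le by blast
  moreover have "?D > 0" using \<zeta> ne by (fastforce simp: cut_out_def)
  ultimately show ?thesis by simp
qed

text \<open>The form found so far is changed by \<open>s\<close> times the coordinate
  \<open>i\<close> with \<open>a i\<close> nonzero; each vector forbids at most one value of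
  \<open>s\<close>.\<close>

lemma linear_form_avoiding:
  fixes A :: "('n::finite \<Rightarrow> complex) set"
  assumes "finite A" "\<And>a. a \<in> A \<Longrightarrow> \<exists>i. a i \<noteq> 0"
  shows "\<exists>z. \<forall>a\<in>A. lin z a \<noteq> 0"
  using assms
proof (induction A rule: finite_induct)
  case empty
  then show ?case by simp
next
  case (insert a A)
  then obtain z where z: "\<forall>b\<in>A. lin z b \<noteq> 0" by auto
  obtain i where i: "a i \<noteq> 0" using insert.prems by auto
  define bad where "bad = (\<Union>b\<in>insert a A. {s. lin z b + s * b i = 0})"
  have "finite {s. lin z b + s * b i = 0}" if "b \<in> insert a A" for b
  proof (cases "b i = 0")
    case True
    then have "{s. lin z b + s * b i = 0} = {}" using that i z by auto
    then show ?thesis by simp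
  next
    case False
    then have "{s. lin z b + s * b i = 0} \<subseteq> {- lin z b / b i}" by (auto simp: field_simps eq_neg_iff_add_eq_0)
    then show ?thesis using finite_subset by blast
  qed
  then have "finite bad" using insert by (auto simp: bad_def)
  then obtain s where s: "s \<notin> bad" using infinite_UNIV_char_0[where 'a = complex] ex_new_if_finite by blast
  have "lin (\<lambda>j. z j + (if j = i then s else 0)) b = lin z b + s * b i" for b
  proof -
    have "(\<Sum>j\<in>UNIV. (if j = i then s else 0) * b j) = (\<Sum>j\<in>UNIV. if j = i then s * b j else 0)"
      by (rule sum.cong) auto
    then show ?thesis by (simp add: lin_def distrib_right sum.distrib)
  qed
  then show ?case using s by (intro exI[of _ "\<lambda>j. z j + (if j = i then s else 0)"]) (auto simp: bad_def)
qed

text \<open>A hyperplane containing no component of \<open>Z\<close> lowers the number of forms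
  required by at most one. The chain in the section ends inside a component of \<open>Z\<close> that
  it does not fill, and this component is appended.\<close>

lemma chain_exists:
  assumes "closedin zariski1 Z" "\<And>\<zeta>. \<not> cut_out k \<zeta> (affine_cone Z)"
  shows "\<exists>C :: nat \<Rightarrow> 'n::finite proj set. (\<forall>i\<le>k. irreducible_closed zariski1 (C i) \<and> C i \<subseteq> Z) \<and> (\<forall>i<k. C i \<subset> C (Suc i))"
  using assms
proof (induction k arbitrary: Z)
  case 0
  obtain K where K: "finite K" "\<And>Y. Y \<in> K \<Longrightarrow> irreducible_closed zariski1 Y" "Z = \<Union>K"
    by (rule irreducible_decomposition[OF 0(1)]) (rule that)
  have "affine_cone Z \<noteq> {}" using 0(2) by (auto simp: cut_out_def)
  then have "K \<noteq> {}" using K(3) by (auto simp: affine_cone_def)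
  then obtain Y where "Y \<in> K" by blast
  then show ?case using K by (intro exI[of _ "\<lambda>_. Y"]) auto
next
  case (Suc k)
  obtain K where K: "finite K" "\<And>Y. Y \<in> K \<Longrightarrow> irreducible_closed zariski1 Y" "Z = \<Union>K"
    by (rule irreducible_decomposition[OF Suc(2)]) (rule that)
  have "\<exists>a. a \<in> affine_cone Y" if "Y \<in> K" for Y
    using irreducible_closed_imp_irr[OF K(2)[OF that]] by (auto simp: irr_def)
  then obtain pt where pt: "\<And>Y. Y \<in> K \<Longrightarrow> pt Y \<in> affine_cone Y" by metis
  obtain z where z: "\<forall>a\<in>pt ` K. lin z a \<noteq> 0"
    using linear_form_avoiding[of "pt ` K"] K(1) pt cone_nonzero by blast
  define F where "F = (\<Sum>i\<in>UNIV. mconst (z i) * mvar i)"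
  have F: "meval a F = lin z a" for a by (simp add: F_def lin_def)
  define Z' where "Z' = Z \<inter> zero_locus crd {F}"
  have cone': "a \<in> affine_cone Z \<and> lin z a = 0" if "a \<in> affine_cone Z'" for a
    using that by (auto simp: Z'_def affine_cone_def zero_locus_def F)
  have cone'': "a \<in> affine_cone Z'" if a: "a \<in> affine_cone Z" "lin z a = 0" for a
  proof -
    obtain p where p: "p \<in> Z" "a \<in> crd p" using a by (auto simp: affine_cone_def)
    have "lin z b = 0" if b: "b \<in> crd p" for b
      by (rule crd_proportional[OF p(2) b]) (simp add: lin_scale a(2))
    then show ?thesis using p by (auto simp: Z'_def affine_cone_def zero_locus_def F)
  qed
  have cl: "closedin zariski1 Z'"
    unfolding Z'_def by (intro closedin_Int Suc.prems closedin_zariski1_zero_locus)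
  have nc: "\<not> cut_out k \<zeta> (affine_cone Z')" for \<zeta>
  proof
    assume *: "cut_out k \<zeta> (affine_cone Z')"
    have "cut_out (Suc k) (\<zeta>(k := z)) (affine_cone Z)"
      unfolding cut_out_def
    proof
      fix a assume a: "a \<in> affine_cone Z"
      show "\<exists>i<Suc k. lin ((\<zeta>(k := z)) i) a \<noteq> 0"
      proof (cases "lin z a = 0")
        case True
        then obtain i where "i < k" "lin (\<zeta> i) a \<noteq> 0" using * cone''[OF a] by (auto simp: cut_out_def)
        then show ?thesis by (intro exI[of _ i]) auto
      qed (auto intro!: exI[of _ k])
    qed
    then show False using Suc.prems by blast
  qed
  obtain C where C: "\<forall>i\<le>k. irreducible_closed zariski1 (C i) \<and> C i \<subseteq> Z'" "\<forall>i<k. C i \<subset> C (Suc i)"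
    using Suc.IH[OF cl nc] by (elim exE conjE) (rule that)
  have "\<exists>Y\<in>K. C k \<subseteq> Y"
    by (rule irreducible_closed_subset_Union[where T = zariski1])
      (use C K in \<open>auto simp: Z'_def irreducible_closed_def\<close>)
  then obtain Y where Y: "Y \<in> K" "C k \<subseteq> Y" by blast
  have "C k \<noteq> Y"
  proof
    assume "C k = Y"
    then have "Y \<subseteq> Z'" using C by auto
    then have "pt Y \<in> affine_cone Z'" using pt[OF Y(1)] cone_mono_iff by blast
    then show False using cone' z Y(1) by auto
  qed
  then have "C k \<subset> Y" using Y by auto
  define C' where "C' i = (if i \<le> k then C i else Y)" for i
  have "irreducible_closed zariski1 (C' i) \<and> C' i \<subseteq> Z" for i
    using C K Y(1) by (auto simp: C'_def Z'_def)
  moreover have "C' i \<subset> C' (Suc i)" if "i < Suc k" for i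
    using that C(2) \<open>C k \<subset> Y\<close> by (cases "i = k") (auto simp: C'_def)
  ultimately show ?case by blast
qed

text \<open>Upper bound: \<open>ndim\<close> grows strictly along a chain and is positive at its
  bottom. Lower bound: \<open>ndim - 1\<close> forms always have a common zero, so
  \<open>chain_exists\<close> gives a chain with that many inclusions. The offset of one is the
  passage from projective to affine dimension.\<close>

lemma krull_dim_eq_ndim:
  assumes "irreducible_closed zariski1 X"
  shows "krull_dim zariski1 X + 1 = enat (ndim (affine_cone X))"
proof -
  let ?E = "ndim (affine_cone X)"
  obtain \<zeta> where \<zeta>: "cut_out ?E \<zeta> (affine_cone X)" by (rule ndim_cut_out[OF conic_affine_cone])
  have pos: "0 < ndim (affine_cone Y)" if Y: "irreducible_closed zariski1 Y" for Y :: "'a proj set"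
  proof -
    obtain \<zeta> where "cut_out (ndim (affine_cone Y)) \<zeta> (affine_cone Y)" by (rule ndim_cut_out[OF conic_affine_cone])
    then show ?thesis using irreducible_closed_imp_irr[OF Y] by (fastforce simp: cut_out_def irr_def)
  qed
  have "krull_dim zariski1 X = enat (?E - 1)"
  proof (rule antisym)
    show "krull_dim zariski1 X \<le> enat (?E - 1)"
      unfolding krull_dim_def
    proof (rule Sup_least, clarsimp)
      fix k and C :: "nat \<Rightarrow> 'a proj set"
      assume C: "\<forall>i\<le>k. irreducible_closed zariski1 (C i) \<and> C i \<subseteq> X" "\<forall>i<k. C i \<subset> C (Suc i)"
      have "Suc i \<le> ndim (affine_cone (C i))" if "i \<le> k" for i
        using that
      proof (induction i)
        case 0
        have "irreducible_closed zariski1 (C 0)" using C by auto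
        from pos[OF this] show ?case by simp
      next
        case (Suc i)
        have "ndim (affine_cone (C i)) < ndim (affine_cone (C (Suc i)))"
          by (rule ndim_strict_mono) (use C Suc in \<open>auto simp: irreducible_closed_def\<close>)
        then show ?case using Suc by simp
      qed
      from this[of k] have "Suc k \<le> ndim (affine_cone (C k))" by simp
      also have "\<dots> \<le> ?E"
        by (rule ndim_le[OF cut_out_subset[OF \<zeta>]]) (use C cone_mono_iff in blast)
      finally show "k \<le> ?E - Suc 0" by simp
    qed
    have "\<not> cut_out (?E - 1) \<zeta>' (affine_cone X)" for \<zeta>'
      using ndim_le[of "?E - 1" \<zeta>' "affine_cone X"] pos[OF assms] by linarith
    moreover have "closedin zariski1 X" using assms by (simp add: irreducible_closed_def)
    ultimately have "\<exists>C :: nat \<Rightarrow> 'a proj set. (\<forall>i\<le>?E - 1. irreducible_closed zariski1 (C i) \<and> C i \<subseteq> X) \<and> (\<forall>i<?E - 1. C i \<subset> C (Suc i))"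
      by (intro chain_exists) auto
    then show "enat (?E - 1) \<le> krull_dim zariski1 X"
      unfolding krull_dim_def by (intro Sup_upper) blast
  qed
  then show ?thesis using pos[OF assms] by (simp add: one_enat_def)
qed

subsection \<open>Smooth points and conormal vectors\<close>

text \<open>The Zariski tangent space at \<open>b\<close>; for an affine cone it is the linear space
  behind the embedded projective tangent space.\<close>

definition TS :: "('n::finite \<Rightarrow> complex) set \<Rightarrow> ('n \<Rightarrow> complex) \<Rightarrow> (complex ^ 'n) set" where
  "TS S b = {v. \<forall>F\<in>Iv S. (\<Sum>i\<in>UNIV. meval b (mpderiv i F) * v $ i) = 0}"

lemma TS_subspace: "vec.subspace (TS S b)"
  unfolding vec.subspace_def TS_def
  by (auto simp: distrib_left sum.distrib sum_distrib_left[symmetric] mult.left_commute)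

text \<open>Where \<open>\<delta>\<close> is nonzero, the map from tangent vectors to velocities of
  the parameters is bijective. This gives the dimension and shows that each tangent vector is the
  velocity of a curve in the cone, on which the minimisation argument relies.\<close>

lemma smooth_points:
  assumes X: "irreducible_closed zariski1 X"
  obtains \<delta> where "\<delta> \<in> polymap" "\<exists>b\<in>affine_cone X. \<delta> b \<noteq> 0"
    "\<And>b. b \<in> affine_cone X \<Longrightarrow> \<delta> b \<noteq> 0 \<Longrightarrow> vec.dim (TS (affine_cone X) b) = ndim (affine_cone X)"
    "\<And>b v. b \<in> affine_cone X \<Longrightarrow> \<delta> b \<noteq> 0 \<Longrightarrow> v \<in> TS (affine_cone X) b \<Longrightarrow>
       \<exists>x. x 0 = b \<and> eventually (\<lambda>s. x s \<in> affine_cone X) (nhds 0) \<and>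
         (\<forall>u. ((\<lambda>s. x s u) has_field_derivative v $ u) (at 0))"
proof -
  let ?S = "affine_cone X" and ?D = "ndim (affine_cone X)"
  have irr: "irr ?S" by (rule irreducible_closed_imp_irr[OF X])
  then have ne: "?S \<noteq> {}" by (simp add: irr_def)
  have cl: "closedin zariski1 X" using X by (simp add: irreducible_closed_def)
  obtain \<zeta> where \<zeta>: "cut_out ?D \<zeta> ?S" by (rule ndim_cut_out[OF conic_affine_cone])
  obtain \<delta> where \<delta>: "\<delta> \<in> polymap" "\<exists>b\<in>?S. \<delta> b \<noteq> 0"
    and curve: "\<And>b w. b \<in> ?S \<Longrightarrow> \<delta> b \<noteq> 0 \<Longrightarrow> \<exists>x. x 0 = b \<and> eventually (\<lambda>s. x s \<in> Vz ?S) (nhds 0) \<and>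
       (\<forall>u. (\<lambda>s. x s u) field_differentiable at 0) \<and> (\<forall>i<?D. eventually (\<lambda>s. lin (\<zeta> i) (x s) = lin (\<zeta> i) b + s * w i) (nhds 0))"
    and inj: "\<And>b v. b \<in> ?S \<Longrightarrow> \<delta> b \<noteq> 0 \<Longrightarrow> \<forall>F\<in>Iv ?S. (\<Sum>u\<in>UNIV. meval b (mpderiv u F) * v u) = 0 \<Longrightarrow>
       \<forall>i<?D. \<forall>s. lin (\<zeta> i) (\<lambda>u. b u + s * v u) = lin (\<zeta> i) b \<Longrightarrow> v = (\<lambda>u. 0)"
    by (rule generic_smoothness[OF irr lin_polymap algindep_ndim[OF conic_affine_cone ne \<zeta>] cone_algebraic[OF X \<zeta>]])
      (assumption, rule that)
  have inj': "v = 0" if "b \<in> ?S" "\<delta> b \<noteq> 0" "v \<in> TS ?S b" "\<And>i. i < ?D \<Longrightarrow> lin (\<zeta> i) (\<lambda>u. v $ u) = 0" for b v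
  proof -
    have "(\<lambda>u. v $ u) = (\<lambda>u. 0)"
      by (rule inj[OF that(1,2)]) (use that in \<open>auto simp: TS_def lin_line\<close>)
    then show ?thesis by (auto simp: vec_eq_iff fun_eq_iff)
  qed
  have curve': "\<exists>x v. v \<in> TS ?S b \<and> (\<forall>i<?D. lin (\<zeta> i) (\<lambda>u. v $ u) = w i) \<and> x 0 = b \<and>
      eventually (\<lambda>s. x s \<in> ?S) (nhds 0) \<and> (\<forall>u. ((\<lambda>s. x s u) has_field_derivative v $ u) (at 0))"
    if b: "b \<in> ?S" "\<delta> b \<noteq> 0" for b w
  proof -
    obtain x where x: "x 0 = b" "eventually (\<lambda>s. x s \<in> Vz ?S) (nhds 0)"
       "\<forall>u. (\<lambda>s. x s u) field_differentiable at 0"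
       "\<forall>i<?D. eventually (\<lambda>s. lin (\<zeta> i) (x s) = lin (\<zeta> i) b + s * w i) (nhds 0)"
      using curve[OF b, of w] by (elim exE conjE) (rule that)
    obtain v' where v': "\<And>u. ((\<lambda>s. x s u) has_field_derivative v' u) (at 0)"
      using x(3) unfolding field_differentiable_def by metis
    define v :: "complex ^ 'a" where "v = (\<chi> u. v' u)"
    have vd: "((\<lambda>s. x s u) has_field_derivative v $ u) (at 0)" for u using v' by (simp add: v_def)
    have "v \<in> TS ?S b"
      unfolding TS_def
    proof (intro CollectI ballI)
      fix F assume F: "F \<in> Iv ?S"
      have "eventually (\<lambda>s. meval (x s) F = 0) (nhds 0)"
        using x(2) by eventually_elim (use F in \<open>auto simp: Vz_def\<close>)
      then have "((\<lambda>s. meval (x s) F) has_field_derivative 0) (at 0)"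
        by (subst DERIV_cong_ev[OF refl _ refl]) auto
      moreover have "((\<lambda>s. meval (x s) F) has_field_derivative (\<Sum>u\<in>UNIV. meval (x 0) (mpderiv u F) * v $ u)) (at 0)"
        by (rule meval_has_field_derivative[OF vd])
      ultimately show "(\<Sum>u\<in>UNIV. meval b (mpderiv u F) * v $ u) = 0"
        using DERIV_unique x(1) by blast
    qed
    moreover have "lin (\<zeta> i) (\<lambda>u. v $ u) = w i" if "i < ?D" for i
    proof -
      have "((\<lambda>s. lin (\<zeta> i) (x s)) has_field_derivative lin (\<zeta> i) (\<lambda>u. v $ u)) (at 0)"
        by (rule lin_has_field_derivative[OF vd])
      moreover have "((\<lambda>s. lin (\<zeta> i) (x s)) has_field_derivative w i) (at 0)"
        using x(4) that by (subst DERIV_cong_ev[OF refl _ refl]) (auto intro!: derivative_eq_intros)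
      ultimately show ?thesis by (rule DERIV_unique)
    qed
    moreover have "eventually (\<lambda>s. x s \<in> ?S) (nhds 0)"
    proof -
      obtain u where u: "b u \<noteq> 0" using cone_nonzero[OF b(1)] by blast
      have "((\<lambda>s. x s u) \<longlongrightarrow> x 0 u) (nhds 0)"
        using DERIV_isCont[OF vd[of u]] tendsto_at_iff_tendsto_nhds[of "\<lambda>s. x s u" 0] by (simp add: isCont_def)
      then have "eventually (\<lambda>s. x s u \<noteq> 0) (nhds 0)"
        by (rule tendsto_imp_eventually_ne) (use u x(1) in auto)
      then show ?thesis using x(2) by eventually_elim (rule closed_Vz[OF cl])
    qed
    ultimately show ?thesis using x(1) vd by blast
  qed
  show ?thesis
  proof (rule that[OF \<delta>])
    fix b assume b: "b \<in> ?S" "\<delta> b \<noteq> 0"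
    \<comment> \<open>\<open>e k\<close> is the tangent vector whose parameter velocity is the
      \<open>k\<close>-th unit vector; these vectors form a basis.\<close>
    have "\<exists>v. v \<in> TS ?S b \<and> (\<forall>i<?D. lin (\<zeta> i) (\<lambda>u. v $ u) = (if i = k then 1 else 0))" for k
      using curve'[OF b, of "\<lambda>i. if i = k then 1 else 0"] by blast
    then obtain e where e: "\<And>k. e k \<in> TS ?S b" "\<And>k i. i < ?D \<Longrightarrow> lin (\<zeta> i) (\<lambda>u. e k $ u) = (if i = k then 1 else 0)"
      by metis
    have lsum: "lin z (\<lambda>u. (\<Sum>k\<in>A. c k *s g k) $ u) = (\<Sum>k\<in>A. c k * lin z (\<lambda>u. g k $ u))"
      for z and A :: "'i set" and c and g :: "'i \<Rightarrow> complex ^ 'a"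
      unfolding lin_def by (simp add: sum_distrib_left sum.swap[of _ UNIV] mult_ac)
    have inj_e: "inj_on e {..<?D}"
    proof (rule inj_onI)
      fix k l assume "k \<in> {..<?D}" "l \<in> {..<?D}" "e k = e l"
      then show "k = l" using e(2)[of k k] e(2)[of k l] by (auto split: if_splits)
    qed
    show "vec.dim (TS ?S b) = ?D"
    proof (rule vec.dim_unique)
      show "e ` {..<?D} \<subseteq> TS ?S b" using e by auto
      show "card (e ` {..<?D}) = ?D" using card_image[OF inj_e] by simp
      show "vec.independent (e ` {..<?D})"
      proof (rule vec.independent_if_scalars_zero)
        fix f x assume f: "(\<Sum>x\<in>e ` {..<?D}. f x *s x) = 0" "x \<in> e ` {..<?D}"
        then obtain k where k: "k < ?D" "x = e k" by auto
        have "(\<Sum>i<?D. f (e i) *s e i) = 0" using f(1) by (simp add: sum.reindex[OF inj_e])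
        then have "0 = lin (\<zeta> k) (\<lambda>u. (\<Sum>i<?D. f (e i) *s e i) $ u)" by (simp add: lin_def)
        also have "\<dots> = (\<Sum>i<?D. if k = i then f (e i) else 0)"
          unfolding lsum by (rule sum.cong) (use e(2)[OF k(1)] in auto)
        also have "\<dots> = f x" using k by simp
        finally show "f x = 0" by simp
      qed simp
      show "TS ?S b \<subseteq> vec.span (e ` {..<?D})"
      proof
        fix v assume v: "v \<in> TS ?S b"
        define v' where "v' = (\<Sum>k<?D. lin (\<zeta> k) (\<lambda>u. v $ u) *s e k)"
        have "v' \<in> TS ?S b"
          unfolding v'_def using e(1) TS_subspace by (intro vec.subspace_sum vec.subspace_scale) auto
        then have "v - v' \<in> TS ?S b" using v TS_subspace vec.subspace_diff by blast
        moreover have "lin (\<zeta> i) (\<lambda>u. (v - v') $ u) = 0" if "i < ?D" for i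
        proof -
          have "lin (\<zeta> i) (\<lambda>u. v' $ u) = (\<Sum>k<?D. if i = k then lin (\<zeta> k) (\<lambda>u. v $ u) else 0)"
            unfolding v'_def lsum by (rule sum.cong) (use e(2)[OF that] in auto)
          then have "lin (\<zeta> i) (\<lambda>u. v' $ u) = lin (\<zeta> i) (\<lambda>u. v $ u)" using that by simp
          then show ?thesis by (simp add: lin_def right_diff_distrib sum_subtractf)
        qed
        ultimately have "v - v' = 0" using inj'[OF b] by blast
        then have "v = v'" by simp
        also have "v' \<in> vec.span (e ` {..<?D})"
          unfolding v'_def by (intro vec.span_sum vec.span_scale vec.span_base) auto
        finally show "v \<in> vec.span (e ` {..<?D})" .
      qed
    qed
  next
    fix b v assume b: "b \<in> ?S" "\<delta> b \<noteq> 0" "v \<in> TS ?S b"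
    obtain x :: "complex \<Rightarrow> 'a \<Rightarrow> complex" and v' :: "complex ^ 'a" where x: "v' \<in> TS ?S b" "\<forall>i<?D. lin (\<zeta> i) (\<lambda>u. v' $ u) = lin (\<zeta> i) (\<lambda>u. v $ u)" "x 0 = b"
      "eventually (\<lambda>s. x s \<in> ?S) (nhds 0)" "\<forall>u. ((\<lambda>s. x s u) has_field_derivative v' $ u) (at 0)"
      using curve'[OF b(1,2), of "\<lambda>i. lin (\<zeta> i) (\<lambda>u. v $ u)"] by (elim exE conjE) (rule that)
    \<comment> \<open>By injectivity, the curve built for the parameter velocity of \<open>v\<close>
      has \<open>v\<close> itself as its velocity.\<close>
    have "v - v' = 0"
    proof (rule inj'[OF b(1,2)])
      show "v - v' \<in> TS ?S b" using b(3) x(1) TS_subspace vec.subspace_diff by blast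
      show "lin (\<zeta> i) (\<lambda>u. (v - v') $ u) = 0" if "i < ?D" for i
        using x(2) that by (simp add: lin_def right_diff_distrib sum_subtractf)
    qed
    then have "v' = v" by simp
    then show "\<exists>x. x 0 = b \<and> eventually (\<lambda>s. x s \<in> ?S) (nhds 0) \<and>
         (\<forall>u. ((\<lambda>s. x s u) has_field_derivative v $ u) (at 0))" using x by blast
  qed
qed

text \<open>Both sides are the derivative at 0 of the same function of \<open>s\<close>.\<close>

lemma meval_mpderiv_diag:
  fixes d :: "'n::finite \<Rightarrow> complex"
  shows "(\<Sum>i\<in>UNIV. meval a (mpderiv i (msubst (\<lambda>i. mconst (d i) * mvar i) F)) * v i) =
    (\<Sum>i\<in>UNIV. meval (\<lambda>i. d i * a i) (mpderiv i F) * (d i * v i))"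
proof -
  have "((\<lambda>s. meval (\<lambda>i. a i + s * v i) (msubst (\<lambda>i. mconst (d i) * mvar i) F)) has_field_derivative
      (\<Sum>i\<in>UNIV. meval (\<lambda>i. a i + 0 * v i) (mpderiv i (msubst (\<lambda>i. mconst (d i) * mvar i) F)) * v i)) (at 0)"
    by (rule meval_has_field_derivative) (auto intro!: derivative_eq_intros)
  moreover have "((\<lambda>s. meval (\<lambda>i. d i * (a i + s * v i)) F) has_field_derivative
      (\<Sum>i\<in>UNIV. meval (\<lambda>i. d i * (a i + 0 * v i)) (mpderiv i F) * (d i * v i))) (at 0)"
    by (rule meval_has_field_derivative) (auto intro!: derivative_eq_intros)
  ultimately show ?thesis
    by (intro DERIV_unique[of _ _ 0]) (auto simp: meval_msubst)
qed

lemma TS_diag: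
  assumes "\<And>a. a \<in> S \<Longrightarrow> (\<lambda>i. d i * a i) \<in> S'" "v \<in> TS S a"
  shows "(\<chi> i. d i * v $ i) \<in> TS S' (\<lambda>i. d i * a i)"
  unfolding TS_def
proof (intro CollectI ballI)
  fix F assume F: "F \<in> Iv S'"
  have "msubst (\<lambda>i. mconst (d i) * mvar i) F \<in> Iv S"
    using F assms(1) by (auto simp: Iv_def meval_msubst)
  then have "(\<Sum>i\<in>UNIV. meval a (mpderiv i (msubst (\<lambda>i. mconst (d i) * mvar i) F)) * v $ i) = 0"
    using assms(2) by (auto simp: TS_def)
  then show "(\<Sum>i\<in>UNIV. meval (\<lambda>i. d i * a i) (mpderiv i F) * (\<chi> i. d i * v $ i) $ i) = 0"
    by (simp add: meval_mpderiv_diag)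
qed

lemma TS_scale:
  assumes "conic S" "c \<noteq> 0"
  shows "TS S (\<lambda>i. c * a i) = TS S a"
proof
  have 1: "TS S b \<subseteq> TS S (\<lambda>i. e * b i)" if "e \<noteq> 0" for e b
  proof
    fix v assume "v \<in> TS S b"
    then have "(\<chi> i. e * v $ i) \<in> TS S (\<lambda>i. e * b i)"
      by (rule TS_diag[rotated]) (use assms(1) that in \<open>auto simp: conic_def\<close>)
    then have "inverse e *s (\<chi> i. e * v $ i) \<in> TS S (\<lambda>i. e * b i)" by (intro vec.subspace_scale TS_subspace)
    moreover have "inverse e *s (\<chi> i. e * v $ i) = v" using that by (simp add: vec_eq_iff)
    ultimately show "v \<in> TS S (\<lambda>i. e * b i)" by simp
  qed
  show "TS S a \<subseteq> TS S (\<lambda>i. c * a i)" by (rule 1[OF assms(2)])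
  show "TS S (\<lambda>i. c * a i) \<subseteq> TS S a"
  proof -
    have "(\<lambda>i. inverse c * (c * a i)) = a" using assms(2) by (simp add: fun_eq_iff)
    then show ?thesis using 1[of "inverse c" "\<lambda>i. c * a i"] assms(2) by simp
  qed
qed

lemma tangent_cone_space_eq:
  assumes "a \<in> crd x"
  shows "tangent_cone_space Y x = TS (affine_cone Y) a"
proof -
  have eq: "TS (affine_cone Y) b = TS (affine_cone Y) a" if b: "b \<in> crd x" for b
    by (rule crd_proportional[OF assms b]) (simp add: TS_scale conic_affine_cone)
  have "(\<Inter>b\<in>crd x. TS (affine_cone Y) b) = (\<Inter>b\<in>crd x. TS (affine_cone Y) a)"
    by (intro INF_cong refl eq)
  then have "(\<Inter>b\<in>crd x. TS (affine_cone Y) b) = TS (affine_cone Y) a" using assms by auto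
  moreover have "tangent_cone_space Y x = (\<Inter>b\<in>crd x. TS (affine_cone Y) b)"
    unfolding tangent_cone_space_def TS_def vanishing_ideal_cone by auto
  ultimately show ?thesis by simp
qed

text \<open>For irreducible closed \<open>X\<close> these turn out to be the coordinate vectors of
  \<open>Con_smooth X\<close>; they replace projective points by linear algebra.\<close>

definition conormal_vectors :: "'n::finite proj set \<Rightarrow> ('n + 'n \<Rightarrow> complex) set" where
  "conormal_vectors X = {case_sum a b |a b. a \<in> affine_cone X \<and> (\<exists>j. b j \<noteq> 0) \<and>
     vec.dim (TS (affine_cone X) a) = ndim (affine_cone X) \<and>
     (\<forall>v\<in>TS (affine_cone X) a. lin b (\<lambda>i. v $ i) = 0)}"

lemma homog_coords_crd: "v \<in> homog_coords p \<longleftrightarrow> (\<lambda>i. v $ i) \<in> crd p"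
proof
  assume "(\<lambda>i. v $ i) \<in> crd p"
  then obtain w where "(\<lambda>i. v $ i) = (\<lambda>i. w $ i)" "w \<in> homog_coords p" by (auto simp: crd_def)
  then show "v \<in> homog_coords p" by (metis vec_nth_inject)
qed (auto simp: crd_def)

lemma tangent_subset_hyperplane:
  assumes "a \<in> crd x" "b \<in> crd H"
  shows "proj_tangent_space Y x \<subseteq> hyperplane H \<longleftrightarrow> (\<forall>v\<in>TS (affine_cone Y) a. lin b (\<lambda>i. v $ i) = 0)"
proof
  assume *: "proj_tangent_space Y x \<subseteq> hyperplane H"
  show "\<forall>v\<in>TS (affine_cone Y) a. lin b (\<lambda>i. v $ i) = 0"
  proof
    fix v assume v: "v \<in> TS (affine_cone Y) a"
    show "lin b (\<lambda>i. v $ i) = 0"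
    proof (cases "v = 0")
      case True
      then show ?thesis by (simp add: lin_def)
    next
      case False
      then obtain i where "v $ i \<noteq> 0" by (auto simp: vec_eq_iff)
      then obtain p where p: "(\<lambda>i. v $ i) \<in> crd p" using crd_exists[of "\<lambda>i. v $ i" i] by blast
      have "p \<in> proj_tangent_space Y x"
        unfolding proj_tangent_space_def tangent_cone_space_eq[OF assms(1)]
      proof (intro CollectI subsetI)
        fix w assume "w \<in> homog_coords p"
        then obtain c where "(\<lambda>i. w $ i) = (\<lambda>i. c * v $ i)"
          using crd_proportional[OF p] by (auto simp: homog_coords_crd)
        then have "w = c *s v" by (simp add: vec_eq_iff fun_eq_iff)
        then show "w \<in> TS (affine_cone Y) a" using v by (simp add: vec.subspace_scale[OF TS_subspace])
      qed
      then have "p \<in> hyperplane H" using * by blast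
      moreover have "(\<chi> i. b i) \<in> homog_coords H" using assms(2) by (simp add: homog_coords_crd)
      moreover have "v \<in> homog_coords p" using p by (simp add: homog_coords_crd)
      ultimately show ?thesis unfolding hyperplane_def lin_def by fastforce
    qed
  qed
next
  assume *: "\<forall>v\<in>TS (affine_cone Y) a. lin b (\<lambda>i. v $ i) = 0"
  show "proj_tangent_space Y x \<subseteq> hyperplane H"
  proof
    fix p assume p: "p \<in> proj_tangent_space Y x"
    show "p \<in> hyperplane H"
      unfolding hyperplane_def
    proof (intro CollectI ballI)
      fix u z assume u: "u \<in> homog_coords H" and z: "z \<in> homog_coords p"
      obtain c where "(\<lambda>i. u $ i) = (\<lambda>i. c * b i)"
        using crd_proportional[OF assms(2)] u by (auto simp: homog_coords_crd)
      moreover have "lin b (\<lambda>i. z $ i) = 0"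
        using p z * by (auto simp: proj_tangent_space_def tangent_cone_space_eq[OF assms(1)])
      ultimately show "(\<Sum>i\<in>UNIV. u $ i * z $ i) = 0"
        by (simp add: fun_eq_iff lin_def mult.assoc flip: sum_distrib_left)
    qed
  qed
qed

lemma Con_smooth_iff:
  assumes "irreducible_closed zariski1 X" "a \<in> crd x" "b \<in> crd H"
  shows "(x, H) \<in> Con_smooth X \<longleftrightarrow> a \<in> affine_cone X \<and>
     vec.dim (TS (affine_cone X) a) = ndim (affine_cone X) \<and> (\<forall>v\<in>TS (affine_cone X) a. lin b (\<lambda>i. v $ i) = 0)"
  unfolding Con_smooth_def smooth_locus_def
  by (simp add: krull_dim_eq_ndim[OF assms(1)] tangent_cone_space_eq[OF assms(2)]
      tangent_subset_hyperplane[OF assms(2,3)] mem_cone_iff[OF assms(2)])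

lemma crd2_Con_smooth:
  assumes "irreducible_closed zariski1 X"
  shows "\<Union>(crd2 ` Con_smooth X) = conormal_vectors X"
proof (intro equalityI subsetI)
  fix c assume "c \<in> \<Union>(crd2 ` Con_smooth X)"
  then obtain x H a b where "(x, H) \<in> Con_smooth X" "c = case_sum a b" "a \<in> crd x" "b \<in> crd H"
    by (auto simp: crd2_def)
  then show "c \<in> conormal_vectors X"
    using Con_smooth_iff[OF assms, of a x b H] crd_nonzero[of b H] by (auto simp: conormal_vectors_def)
next
  fix c assume "c \<in> conormal_vectors X"
  then obtain a b j where c: "c = case_sum a b" "a \<in> affine_cone X" "b j \<noteq> 0"
     "vec.dim (TS (affine_cone X) a) = ndim (affine_cone X)"
     "\<forall>v\<in>TS (affine_cone X) a. lin b (\<lambda>i. v $ i) = 0"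
    by (auto simp: conormal_vectors_def)
  obtain x where x: "a \<in> crd x" using c(2) by (auto simp: affine_cone_def)
  obtain H where H: "b \<in> crd H" using crd_exists[of b j] c(3) by blast
  have "(x, H) \<in> Con_smooth X" using c Con_smooth_iff[OF assms x H] by simp
  moreover have "c \<in> crd2 (x, H)" using x H c(1)
    unfolding crd2_def mem_Collect_eq fst_conv snd_conv by blast
  ultimately show "c \<in> \<Union>(crd2 ` Con_smooth X)" by blast
qed

subsection \<open>Torus translates\<close>

lemma act_inverse: "t \<noteq> 0 \<Longrightarrow> act (\<lambda>v. - w v) t (act w t a) = a"
  by (auto simp: act_def fun_eq_iff power_int_minus)

lemma act_inverse': "t \<noteq> 0 \<Longrightarrow> act w t (act (\<lambda>v. - w v) t a) = a"
  by (auto simp: act_def fun_eq_iff power_int_minus)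

lemma act_nonzero_iff: "t \<noteq> 0 \<Longrightarrow> (\<exists>i. act w t a i \<noteq> 0) \<longleftrightarrow> (\<exists>i. a i \<noteq> 0)"
  by (auto simp: act_def)

lemma meval_act: "meval (act w t a) F = meval a (msubst (\<lambda>i. mconst (t powi w i) * mvar i) F)"
  by (simp add: meval_msubst act_def)

lemma act_polymap: "f \<in> polymap \<Longrightarrow> (\<lambda>a. f (act w t a)) \<in> polymap"
  unfolding polymap_def by (auto simp: meval_act)

lemma irr_act:
  assumes "irr S"
  shows "irr (act w t ` S)"
  unfolding irr_def
proof (intro conjI ballI impI)
  show "act w t ` S \<noteq> {}" using assms by (simp add: irr_def)
  fix f g assume fg: "f \<in> polymap" "g \<in> polymap" "\<forall>a\<in>act w t ` S. f a * g a = 0"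
  then have "\<forall>a\<in>S. f (act w t a) * g (act w t a) = 0" by blast
  then have "(\<forall>a\<in>S. f (act w t a) = 0) \<or> (\<forall>a\<in>S. g (act w t a) = 0)"
    using assms[unfolded irr_def, THEN conjunct2, THEN bspec, OF act_polymap[OF fg(1), of w t],
        THEN bspec, OF act_polymap[OF fg(2), of w t]] by simp
  then show "(\<forall>a\<in>act w t ` S. f a = 0) \<or> (\<forall>a\<in>act w t ` S. g a = 0)" by blast
qed

text \<open>The forms are transported by the inverse characters; acting back later turns this into
  an equality.\<close>

lemma ndim_act_le:
  assumes "conic S" "t \<noteq> 0"
  shows "ndim (act w t ` S) \<le> ndim S"
proof -
  obtain \<zeta> where \<zeta>: "cut_out (ndim S) \<zeta> S" by (rule ndim_cut_out[OF assms(1)])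
  have "lin (\<lambda>j. \<zeta> i j * t powi (- w j)) (act w t a) = lin (\<zeta> i) a" for i a
    unfolding lin_def act_def by (rule sum.cong) (use assms(2) in \<open>auto simp: power_int_minus\<close>)
  then have "cut_out (ndim S) (\<lambda>i j. \<zeta> i j * t powi (- w j)) (act w t ` S)"
    using \<zeta> by (auto simp: cut_out_def)
  then show ?thesis by (rule ndim_le)
qed

lemma act_image_inverse: "t \<noteq> 0 \<Longrightarrow> act (\<lambda>v. - w v) t ` act w t ` S = S"
  by (auto simp: image_image act_inverse)

lemma conic_act: "conic S \<Longrightarrow> t \<noteq> 0 \<Longrightarrow> conic (act w t ` S)"
  unfolding conic_def
proof (intro ballI conjI allI impI)
  fix b assume S: "\<forall>a\<in>S. (\<exists>i. a i \<noteq> 0) \<and> (\<forall>c. c \<noteq> 0 \<longrightarrow> (\<lambda>i. c * a i) \<in> S)" and t: "t \<noteq> 0" and "b \<in> act w t ` S"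
  then obtain a where a: "a \<in> S" "b = act w t a" by blast
  have "\<exists>i. a i \<noteq> 0" using S a(1) by blast
  then show "\<exists>i. b i \<noteq> 0" unfolding a(2) using act_nonzero_iff[OF t, of w a] by blast
  fix c :: complex assume c: "c \<noteq> 0"
  have "(\<lambda>i. c * b i) = act w t (\<lambda>i. c * a i)" by (simp add: a(2) act_def mult.left_commute)
  moreover have "(\<lambda>i. c * a i) \<in> S" using S a(1) c by auto
  ultimately show "(\<lambda>i. c * b i) \<in> act w t ` S" by simp
qed

lemma ndim_act:
  assumes "conic S" "t \<noteq> 0"
  shows "ndim (act w t ` S) = ndim S"
  using ndim_act_le[OF assms, of w] ndim_act_le[OF conic_act[OF assms, of w] assms(2), of "\<lambda>v. - w v"]
    act_image_inverse[OF assms(2), of w S] by simp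

lemma TS_act:
  assumes "t \<noteq> 0"
  shows "TS (act w t ` S) (act w t a) = (\<lambda>v. \<chi> i. t powi w i * v $ i) ` TS S a"
proof (intro equalityI subsetI)
  fix v assume "v \<in> TS (act w t ` S) (act w t a)"
  then have "(\<chi> i. t powi (- w i) * v $ i) \<in> TS S (act (\<lambda>v. - w v) t (act w t a))"
    unfolding act_def[of "\<lambda>v. - w v"]
    by (rule TS_diag[rotated]) (use act_inverse[OF assms, of w] in \<open>auto simp: act_def\<close>)
  then have "(\<chi> i. t powi (- w i) * v $ i) \<in> TS S a" by (simp add: act_inverse[OF assms])
  moreover have "v = (\<chi> i. t powi w i * (\<chi> i. t powi (- w i) * v $ i) $ i)"
    using assms by (simp add: vec_eq_iff power_int_minus)
  ultimately show "v \<in> (\<lambda>v. \<chi> i. t powi w i * v $ i) ` TS S a" by blast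
next
  fix v assume "v \<in> (\<lambda>v. \<chi> i. t powi w i * v $ i) ` TS S a"
  then show "v \<in> TS (act w t ` S) (act w t a)"
    using TS_diag[of S "\<lambda>i. t powi w i" "act w t ` S"] by (auto simp: act_def)
qed

lemma dim_TS_act:
  assumes "t \<noteq> 0"
  shows "vec.dim (TS (act w t ` S) (act w t a)) = vec.dim (TS S a)"
  unfolding TS_act[OF assms]
proof (rule vec.dim_image_eq)
  show "Vector_Spaces.linear (*s) (*s) (\<lambda>v :: complex ^ 'a. \<chi> i. t powi w i * v $ i)"
    by (rule Vector_Spaces.linear_iff[THEN iffD2]) (auto simp: vec_eq_iff distrib_left vec.vector_space_axioms)
  show "inj_on (\<lambda>v :: complex ^ 'a. \<chi> i. t powi w i * v $ i) (vec.span (TS S a))"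
    using assms by (auto simp: inj_on_def vec_eq_iff)
qed

lemma act_case_sum:
  "act (case_sum \<omega> (\<lambda>i. - \<omega> i)) t (case_sum a b) = case_sum (act \<omega> t a) (act (\<lambda>i. - \<omega> i) t b)"
  by (auto simp: act_def fun_eq_iff split: sum.splits)

text \<open>The weights \<omega> and -\<omega> cancel in the pairing of a hyperplane vector with a
  tangent vector.\<close>

lemma conormal_vectors_act_subset:
  assumes "affine_cone X' = act \<omega> t ` affine_cone X" "t \<noteq> 0" "c \<in> conormal_vectors X"
  shows "act (case_sum \<omega> (\<lambda>i. - \<omega> i)) t c \<in> conormal_vectors X'"
proof -
  obtain a b where c: "c = case_sum a b" "a \<in> affine_cone X" "\<exists>j. b j \<noteq> 0"
     "vec.dim (TS (affine_cone X) a) = ndim (affine_cone X)"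
     "\<forall>v\<in>TS (affine_cone X) a. lin b (\<lambda>i. v $ i) = 0"
    using assms(3) by (auto simp: conormal_vectors_def)
  have "lin (act (\<lambda>i. - \<omega> i) t b) (\<lambda>i. v $ i) = 0" if "v \<in> TS (affine_cone X') (act \<omega> t a)" for v
  proof -
    obtain w where w: "w \<in> TS (affine_cone X) a" "v = (\<chi> i. t powi \<omega> i * w $ i)"
      using \<open>v \<in> _\<close> unfolding assms(1) TS_act[OF assms(2)] by auto
    have "lin (act (\<lambda>i. - \<omega> i) t b) (\<lambda>i. v $ i) = lin b (\<lambda>i. w $ i)"
      unfolding lin_def act_def w(2) by (rule sum.cong) (use assms(2) in \<open>auto simp: power_int_minus\<close>)
    then show ?thesis using c(5) w(1) by simp
  qed
  then show ?thesis
    unfolding conormal_vectors_def c(1) act_case_sum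
    using c(2-4) assms(1,2) dim_TS_act[OF assms(2), of \<omega> "affine_cone X" a]
      ndim_act[OF conic_affine_cone[of X] assms(2), of \<omega>]
    by (intro CollectI exI[of _ "act \<omega> t a"] exI[of _ "act (\<lambda>i. - \<omega> i) t b"]) (auto simp: act_nonzero_iff)
qed

lemma conormal_vectors_act:
  assumes "affine_cone X' = act \<omega> t ` affine_cone X" "t \<noteq> 0"
  shows "conormal_vectors X' = act (case_sum \<omega> (\<lambda>i. - \<omega> i)) t ` conormal_vectors X"
proof (intro equalityI subsetI)
  fix c assume c: "c \<in> conormal_vectors X'"
  have "affine_cone X = act (\<lambda>i. - \<omega> i) t ` affine_cone X'"
    unfolding assms(1) by (simp add: act_image_inverse[OF assms(2)])
  from conormal_vectors_act_subset[OF this assms(2) c]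
  have "act (case_sum (\<lambda>i. - \<omega> i) \<omega>) t c \<in> conormal_vectors X" by simp
  moreover have "case_sum (\<lambda>i. - \<omega> i) \<omega> = (\<lambda>v. - case_sum \<omega> (\<lambda>i. - \<omega> i) v)"
    by (auto simp: fun_eq_iff split: sum.splits)
  ultimately have "act (\<lambda>v. - case_sum \<omega> (\<lambda>i. - \<omega> i) v) t c \<in> conormal_vectors X" by simp
  then show "c \<in> act (case_sum \<omega> (\<lambda>i. - \<omega> i)) t ` conormal_vectors X"
    using act_inverse'[OF assms(2), of "case_sum \<omega> (\<lambda>i. - \<omega> i)" c] by (metis imageI)
qed (use conormal_vectors_act_subset[OF assms] in auto)

subsection \<open>Division with bounded quotients\<close>

lemma polfun_subst:
  assumes "f \<in> polfun A" "\<And>i. i \<in> A \<Longrightarrow> g i \<in> polfun B"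
  shows "(\<lambda>p. f (\<lambda>i. g i p)) \<in> polfun B"
  using assms(1) by (induction rule: polfun.induct) (auto intro: polfun.intros assms(2))

text \<open>By the bound a zero of \<open>g\<close> is a zero of \<open>f\<close>, so a linear
  factor cancels. At the cancelled zero the bound for the cofactors follows by continuity, and the
  degree of \<open>g\<close> has dropped.\<close>

lemma bounded_quotient_dvd:
  fixes f g :: "complex poly"
  assumes "g \<noteq> 0" "continuous_on UNIV B" "\<And>x. norm (poly f x) \<le> B x * norm (poly g x)"
  shows "g dvd f"
  using assms(1,3)
proof (induction "degree g" arbitrary: f g)
  case 0
  then have "is_unit g" by (simp add: is_unit_iff_degree)
  then show ?case by (rule unit_imp_dvd)
next
  case (Suc n)
  then have "\<not> constant (poly g)" by (simp add: constant_degree)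
  then obtain x0 where x0: "poly g x0 = 0" using fundamental_theorem_of_algebra by blast
  then have "poly f x0 = 0" using Suc.prems(2)[of x0] by simp
  then obtain f' g' where fg: "f = [:- x0, 1:] * f'" "g = [:- x0, 1:] * g'"
    using x0 by (auto simp: poly_eq_0_iff_dvd elim!: dvdE)
  have g'0: "g' \<noteq> 0" using fg Suc.prems(1) by auto
  then have "degree g = Suc (degree g')" unfolding fg(2) by (subst degree_mult_eq) auto
  then have deg: "n = degree g'" using Suc.hyps(2) by simp
  have 1: "norm (poly f' x) \<le> B x * norm (poly g' x)" if "x \<noteq> x0" for x
  proof -
    have "norm (x - x0) * norm (poly f' x) \<le> norm (x - x0) * (B x * norm (poly g' x))"
    proof -
      have "poly f x = (x - x0) * poly f' x" "poly g x = (x - x0) * poly g' x"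
        by (simp_all add: fg algebra_simps)
      then show ?thesis using Suc.prems(2)[of x] by (simp only: norm_mult mult.left_commute)
    qed
    then show ?thesis using that by simp
  qed
  have "norm (poly f' x) \<le> B x * norm (poly g' x)" for x
  proof (cases "x = x0")
    case True
    have "(B \<longlongrightarrow> B x0) (at x0)" using assms(2) by (simp add: continuous_on_eq_continuous_at isCont_def)
    then have "((\<lambda>x. B x * norm (poly g' x)) \<longlongrightarrow> B x0 * norm (poly g' x0)) (at x0)"
      by (intro tendsto_intros)
    moreover have "((\<lambda>x. norm (poly f' x)) \<longlongrightarrow> norm (poly f' x0)) (at x0)" by (intro tendsto_intros)
    moreover have "eventually (\<lambda>x. norm (poly f' x) \<le> B x * norm (poly g' x)) (at x0)"
      using eventually_neq_at_within[of x0 x0 UNIV] by eventually_elim (rule 1)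
    ultimately show ?thesis unfolding True by (intro tendsto_le) auto
  qed (rule 1)
  then have "g' dvd f'" by (rule Suc.hyps(1)[OF deg g'0])
  then show ?case unfolding fg by (rule mult_dvd_mono[OF dvd_refl])
qed

lemma norm_coeff_prod_le:
  fixes A :: "complex multiset"
  assumes "\<And>x. x \<in># A \<Longrightarrow> norm x \<le> R" "R \<ge> 0"
  shows "norm (coeff (\<Prod>x\<in>#A. [:- x, 1:]) i) \<le> (1 + R) ^ size A"
  using assms(1)
proof (induction A arbitrary: i)
  case empty
  then show ?case by simp
next
  case (add x A)
  let ?P = "\<Prod>x\<in>#A. [:- x, 1:]"
  have IH: "norm (coeff ?P i) \<le> (1 + R) ^ size A" for i using add by auto
  have "coeff ([:- x, 1:] * ?P) i = - x * coeff ?P i + (case i of 0 \<Rightarrow> 0 | Suc j \<Rightarrow> coeff ?P j)"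
    by (cases i) (auto simp: coeff_pCons)
  then have "norm (coeff ([:- x, 1:] * ?P) i) \<le> norm (- x * coeff ?P i) + norm (case i of 0 \<Rightarrow> 0 | Suc j \<Rightarrow> coeff ?P j)"
    by (simp only: norm_triangle_ineq)
  also have "norm (- x * coeff ?P i) = norm x * norm (coeff ?P i)" by (simp add: norm_mult)
  also have "norm x * norm (coeff ?P i) + norm (case i of 0 \<Rightarrow> 0 | Suc j \<Rightarrow> coeff ?P j) \<le>
      R * (1 + R) ^ size A + (1 + R) ^ size A"
    using add.prems IH assms(2) by (intro add_mono mult_mono) (auto split: nat.splits)
  finally show ?case by (simp add: algebra_simps)
qed

text \<open>Up to sign and the factor \<open>a d\<close>, the coefficients are elementary symmetric
  functions of the roots.\<close>

lemma coeff_le_of_roots: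
  fixes a :: "nat \<Rightarrow> complex"
  assumes "a d \<noteq> 0" "\<And>r. (\<Sum>i\<le>d. a i * r ^ i) = 0 \<Longrightarrow> norm r \<le> R" "R \<ge> 0" "i \<le> d"
  shows "norm (a i) \<le> norm (a d) * (1 + R) ^ d"
proof -
  obtain A where A: "size A = d" "\<And>y. (\<Sum>i\<le>d. a i * y ^ i) = a d * (\<Prod>x\<in>#A. y - x)"
    "\<And>r. r \<in># A \<Longrightarrow> (\<Sum>i\<le>d. a i * r ^ i) = 0"
    using poly_factorization[of a d, OF assms(1)] by blast
  have "poly (\<Prod>x\<in>#A. [:-x, 1:]) y = (\<Prod>x\<in>#A. y - x)" for y
    by (induction A) (auto simp: algebra_simps)
  then have "poly (\<Sum>i\<le>d. monom (a i) i) y = poly (smult (a d) (\<Prod>x\<in>#A. [:-x, 1:])) y" for y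
    by (simp add: poly_sum poly_monom A(2))
  then have "(\<Sum>i\<le>d. monom (a i) i) = smult (a d) (\<Prod>x\<in>#A. [:-x, 1:])"
    by (simp add: poly_eq_poly_eq_iff[symmetric] fun_eq_iff)
  then have "coeff (\<Sum>i\<le>d. monom (a i) i) i = a d * coeff (\<Prod>x\<in>#A. [:-x, 1:]) i" by simp
  moreover have "coeff (\<Sum>i\<le>d. monom (a i) i) i = a i" using assms(4) by (simp add: coeff_sum coeff_monom)
  ultimately have "norm (a i) = norm (a d) * norm (coeff (\<Prod>x\<in>#A. [:-x, 1:]) i)" by (simp add: norm_mult)
  also have "\<dots> \<le> norm (a d) * (1 + R) ^ d"
    using norm_coeff_prod_le[of A R i] A assms(2,3) by (intro mult_left_mono) auto
  finally show ?thesis .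
qed

text \<open>\<open>P\<close> has the coefficients of \<open>Q\<close> in reverse order with respect
  to degree \<open>e\<close>. It yields the degree and the top coefficient of a homogeneous function
  restricted to a line.\<close>

lemma reversed_poly:
  fixes P Q :: "complex poly"
  assumes "\<And>s. s \<noteq> 0 \<Longrightarrow> poly P s = s ^ e * poly Q (1 / s)"
  shows "degree P \<le> e" "coeff P e = coeff Q 0"
proof -
  have "poly (monom 1 (degree Q) * P) s = poly (monom 1 e * reflect_poly Q) s" if "s \<noteq> 0" for s
    using assms[OF that] that
    by (simp add: poly_monom poly_reflect_poly_nz inverse_eq_divide mult_ac)
  then have "- {0} \<subseteq> {s. poly (monom 1 (degree Q) * P - monom 1 e * reflect_poly Q) s = 0}" by auto
  then have "infinite {s. poly (monom 1 (degree Q) * P - monom 1 e * reflect_poly Q) s = 0}"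
    using infinite_nonzero_complex finite_subset by blast
  then have "monom 1 (degree Q) * P - monom 1 e * reflect_poly Q = 0" using poly_roots_finite by blast
  then have eq: "monom 1 (degree Q) * P = monom 1 e * reflect_poly Q" by simp
  have c: "coeff P l = (if degree Q + l < e then 0 else coeff (reflect_poly Q) (degree Q + l - e))" for l
    using arg_cong[OF eq, of "\<lambda>P. coeff P (degree Q + l)"] by (simp add: coeff_monom_mult)
  show "degree P \<le> e"
    by (rule degree_le) (auto simp: c coeff_reflect_poly)
  show "coeff P e = coeff Q 0" by (simp add: c coeff_reflect_poly)
qed

section \<open>Homogeneity in the first coordinates\<close>

definition scale_coords :: "nat \<Rightarrow> complex \<Rightarrow> (nat \<Rightarrow> complex) \<Rightarrow> nat \<Rightarrow> complex" where
  "scale_coords k c p = (\<lambda>i. if i < k then c * p i else p i)"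

text \<open>The scaling factor is treated as one more coordinate, number \<open>m\<close>, in which
  \<open>f\<close> is expanded; comparing coefficients under a second scaling shows that the parts
  are homogeneous.\<close>

lemma polfun_homogeneous_parts:
  assumes "f \<in> polfun {..<m}"
  obtains M g where "\<And>s. g s \<in> polfun {..<m}" "\<And>p c. f (scale_coords k c p) = (\<Sum>s\<le>M. g s p * c ^ s)"
    "\<And>s p c. s \<le> M \<Longrightarrow> g s (scale_coords k c p) = c ^ s * g s p"
proof -
  have "(\<lambda>p. f (\<lambda>i. (if i < k then p m else 1) * p i)) \<in> polfun {..<Suc m}"
  proof (rule polfun_subst[OF assms])
    fix i assume "i \<in> {..<m}"
    then show "(\<lambda>p. (if i < k then p m else 1) * p i) \<in> polfun {..<Suc m}"
      by (cases "i < k") (auto intro!: polfun_intros)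
  qed
  then obtain M g where g: "\<And>s. g s \<in> polfun {..<m}"
    "\<And>p. f (\<lambda>i. (if i < k then p m else 1) * p i) = (\<Sum>s\<le>M. g s p * p m ^ s)"
    by (rule polfun_expand_Suc) (rule that)
  have 1: "f (scale_coords k c p) = (\<Sum>s\<le>M. g s p * c ^ s)" for p c
  proof -
    have "f (scale_coords k c p) = f (\<lambda>i. (if i < k then (p(m := c)) m else 1) * (p(m := c)) i)"
      by (rule polfun_cong[OF assms]) (auto simp: scale_coords_def)
    also have "\<dots> = (\<Sum>s\<le>M. g s (p(m := c)) * (p(m := c)) m ^ s)" by (rule g(2))
    also have "\<dots> = (\<Sum>s\<le>M. g s p * c ^ s)"
      by (intro sum.cong refl arg_cong2[where f = "(*)"] polfun_cong[OF g(1)]) auto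
    finally show ?thesis .
  qed
  have 2: "g s (scale_coords k c p) = c ^ s * g s p" if "s \<le> M" for s p c
  proof -
    have "(\<Sum>s\<le>M. (g s (scale_coords k c p) - c ^ s * g s p) * x ^ s) = 0" for x
    proof -
      have "scale_coords k x (scale_coords k c p) = scale_coords k (c * x) p" by (auto simp: scale_coords_def)
      then have "(\<Sum>s\<le>M. g s (scale_coords k c p) * x ^ s) = (\<Sum>s\<le>M. g s p * (c * x) ^ s)"
        using 1[of x "scale_coords k c p"] 1[of "c * x" p] by simp
      moreover have "(\<Sum>s\<le>M. c ^ s * g s p * x ^ s) = (\<Sum>s\<le>M. g s p * (c * x) ^ s)"
        by (rule sum.cong) (auto simp: power_mult_distrib)
      ultimately show ?thesis by (simp only: left_diff_distrib sum_subtractf diff_self)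
    qed
    then have "g s (scale_coords k c p) - c ^ s * g s p = 0"
      using polyfun_eq_0[of "\<lambda>s. g s (scale_coords k c p) - c ^ s * g s p" M] that by blast
    then show ?thesis by simp
  qed
  show ?thesis by (rule that[OF g(1) 1 2])
qed

lemma polfun_divide_coord:
  assumes "f \<in> polfun {..<Suc k}" "\<And>p. p k = 0 \<Longrightarrow> f p = 0"
  obtains f' where "f' \<in> polfun {..<Suc k}" "\<And>p. f p = p k * f' p"
proof -
  obtain n a where a: "\<And>i. a i \<in> polfun {..<k}" "\<And>p. f p = (\<Sum>i\<le>n. a i p * p k ^ i)"
    by (rule polfun_expand_Suc[OF assms(1)]) (rule that)
  have a0: "a 0 p = 0" for p
  proof -
    have "a 0 p = a 0 (p(k := 0))" by (rule polfun_cong[OF a(1)]) auto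
    also have "\<dots> = f (p(k := 0))"
    proof -
      have "(\<Sum>i\<le>n. a i (p(k := 0)) * (p(k := 0)) k ^ i) = (\<Sum>i\<in>{0}. a i (p(k := 0)) * (p(k := 0)) k ^ i)"
        by (rule sum.mono_neutral_right) auto
      then show ?thesis unfolding a(2) by simp
    qed
    also have "\<dots> = 0" by (rule assms(2)) simp
    finally show ?thesis .
  qed
  show ?thesis
  proof (rule that[of "\<lambda>p. \<Sum>i<n. a (Suc i) p * p k ^ i"])
    show "(\<lambda>p. \<Sum>i<n. a (Suc i) p * p k ^ i) \<in> polfun {..<Suc k}"
      using a(1) by (intro polfun_sum polfun.mult polfun_power polfun.coord) (auto intro: polfun_lessThan_mono[of k])
  next
    fix p
    have "f p = (\<Sum>i<Suc n. a i p * p k ^ i)" by (simp add: a(2) lessThan_Suc_atMost)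
    then show "f p = p k * (\<Sum>i<n. a (Suc i) p * p k ^ i)"
      unfolding sum.lessThan_Suc_shift by (simp add: a0 sum_distrib_left mult_ac)
  qed
qed

lemma polfun_line_continuous:
  assumes "f \<in> polfun A"
  shows "continuous_on UNIV (\<lambda>s. f (\<lambda>i. q i + s * (p i - q i)))"
proof -
  obtain P where "\<And>s. f (\<lambda>i. q i + s * (p i - q i)) = poly P s" using polfun_line[OF assms] by blast
  then show ?thesis by (simp add: continuous_intros)
qed

subsection \<open>The total space of the degeneration\<close>

lemma degen_laurent:
  obtains M c where "finite M" "\<And>t. t \<noteq> 0 \<Longrightarrow> meval (case_option t (act \<omega> t a)) F = (\<Sum>m\<in>M. c m * t powi m)"
proof (rule that)
  let ?c = "\<lambda>m. \<Sum>\<beta> | \<beta> \<in> Poly_Mapping.keys F \<and> tdeg \<omega> \<beta> = m. Poly_Mapping.lookup F \<beta> * mon a (restrict_exp \<beta>)"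
  show "finite (tdeg \<omega> ` Poly_Mapping.keys F)" by simp
  fix t :: complex assume t: "t \<noteq> 0"
  have "meval (case_option t (act \<omega> t a)) F =
      (\<Sum>\<beta>\<in>Poly_Mapping.keys F. Poly_Mapping.lookup F \<beta> * mon a (restrict_exp \<beta>) * t powi tdeg \<omega> \<beta>)"
    unfolding meval_eq_sum_mon mon_case_option mon_act[OF t] tdeg_def
    by (rule sum.cong) (use t in \<open>auto simp: power_int_add\<close>)
  also have "\<dots> = (\<Sum>m\<in>tdeg \<omega> ` Poly_Mapping.keys F. \<Sum>\<beta> | \<beta> \<in> Poly_Mapping.keys F \<and> tdeg \<omega> \<beta> = m.
      Poly_Mapping.lookup F \<beta> * mon a (restrict_exp \<beta>) * t powi tdeg \<omega> \<beta>)"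
    by (rule sum.group[symmetric]) auto
  also have "\<dots> = (\<Sum>m\<in>tdeg \<omega> ` Poly_Mapping.keys F. ?c m * t powi m)"
    by (intro sum.cong refl) (simp add: sum_distrib_right)
  finally show "meval (case_option t (act \<omega> t a)) F = (\<Sum>m\<in>tdeg \<omega> ` Poly_Mapping.keys F. ?c m * t powi m)" .
qed

lemma degen_finite_zeros:
  assumes "t1 \<noteq> 0" "meval (case_option t1 (act \<omega> t1 a)) F \<noteq> 0"
  shows "finite {t. t \<noteq> 0 \<and> meval (case_option t (act \<omega> t a)) F = 0}"
proof (rule ccontr)
  assume inf: "infinite {t. t \<noteq> 0 \<and> meval (case_option t (act \<omega> t a)) F = 0}"
  obtain M c where M: "finite M" "\<And>t. t \<noteq> 0 \<Longrightarrow> meval (case_option t (act \<omega> t a)) F = (\<Sum>m\<in>M. c m * t powi m)"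
    by (rule degen_laurent) (rule that)
  have "c m = 0" if "m \<in> M" for m
    by (rule laurent_zero[OF M(1) inf _ _ that]) (use M(2) in auto)
  then show False using M(2)[OF assms(1)] assms(2) by simp
qed

text \<open>A function that does not vanish on the family is nonzero along one orbit for all but
  finitely many \<open>t\<close>. For two such functions a common \<open>t\<close> is found at which
  neither vanishes on the fibre, against the irreducibility of \<open>S\<close>.\<close>

lemma irr_degen:
  assumes "irr S"
  shows "irr (degen \<omega> S)"
  unfolding irr_def
proof (intro conjI ballI impI)
  obtain a where "a \<in> S" using assms by (auto simp: irr_def)
  then have "case_option 1 (act \<omega> 1 a) \<in> degen \<omega> S" unfolding degen_def by (intro CollectI exI conjI) auto
  then show "degen \<omega> S \<noteq> {}" by blast
  fix f g :: "('a option \<Rightarrow> complex) \<Rightarrow> complex"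
  assume "f \<in> polymap" "g \<in> polymap" and fg: "\<forall>b\<in>degen \<omega> S. f b * g b = 0"
  then obtain F G where FG: "f = (\<lambda>a. meval a F)" "g = (\<lambda>a. meval a G)" by (auto simp: polymap_def)
  show "(\<forall>b\<in>degen \<omega> S. f b = 0) \<or> (\<forall>b\<in>degen \<omega> S. g b = 0)"
  proof (rule ccontr)
    assume "\<not> ?thesis"
    then obtain t1 a1 t2 a2 where 1: "t1 \<noteq> 0" "a1 \<in> S" "meval (case_option t1 (act \<omega> t1 a1)) F \<noteq> 0"
      and 2: "t2 \<noteq> 0" "a2 \<in> S" "meval (case_option t2 (act \<omega> t2 a2)) G \<noteq> 0"
      unfolding FG degen_def by auto
    have "finite ({t. t \<noteq> 0 \<and> meval (case_option t (act \<omega> t a1)) F = 0} \<union>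
        {t. t \<noteq> 0 \<and> meval (case_option t (act \<omega> t a2)) G = 0} \<union> {0})"
      using degen_finite_zeros[OF 1(1,3)] degen_finite_zeros[OF 2(1,3)] by simp
    from ex_new_if_finite[OF infinite_UNIV_char_0 this] obtain t where
      t: "t \<noteq> 0" "meval (case_option t (act \<omega> t a1)) F \<noteq> 0" "meval (case_option t (act \<omega> t a2)) G \<noteq> 0"
      by auto
    have pm: "(\<lambda>a. meval (case_option t (act \<omega> t a)) H) \<in> polymap" for H
    proof -
      have "meval (case_option t (act \<omega> t a)) H = meval a (msubst (case_option (mconst t) (\<lambda>i. mconst (t powi \<omega> i) * mvar i)) H)" for a
        unfolding meval_msubst by (rule arg_cong[where f = "\<lambda>x. meval x H"]) (auto simp: act_def split: option.splits)
      then show ?thesis using polymap_meval by simp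
    qed
    have "\<forall>a\<in>S. meval (case_option t (act \<omega> t a)) F * meval (case_option t (act \<omega> t a)) G = 0"
      using fg t(1) unfolding FG degen_def by blast
    from irr_cancel[OF assms pm pm this] 2(2) t(3) have "\<forall>a\<in>S. meval (case_option t (act \<omega> t a)) F = 0" by blast
    then show False using 1(2) t(2) by blast
  qed
qed

lemma degen_scale:
  assumes "conic S" "case_option t a \<in> degen \<omega> S" "c \<noteq> 0"
  shows "case_option t (\<lambda>i. c * a i) \<in> degen \<omega> S"
proof -
  obtain t' a' where "case_option t a = case_option t' (act \<omega> t' a')" "t' \<noteq> 0" "a' \<in> S"
    using assms(2) by (auto simp: degen_def)
  then have *: "t' = t" "a = act \<omega> t a'" "t \<noteq> 0" "a' \<in> S"
    by (auto simp: fun_eq_iff split: option.splits dest: spec[of _ None] spec[of _ "Some _"])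
  have "(\<lambda>i. c * a i) = act \<omega> t (\<lambda>i. c * a' i)" by (simp add: *(2) act_def mult.left_commute)
  moreover have "(\<lambda>i. c * a' i) \<in> S" using assms(1,3) *(4) by (auto simp: conic_def)
  ultimately show ?thesis using *(3) by (auto simp: degen_def)
qed

lemma Vz_degen_scale:
  assumes "conic S" "case_option t a \<in> Vz (degen \<omega> S)" "c \<noteq> 0"
  shows "case_option t (\<lambda>i. c * a i) \<in> Vz (degen \<omega> S)"
  unfolding Vz_def
proof (intro CollectI ballI)
  fix F assume F: "F \<in> Iv (degen \<omega> S)"
  define F' where "F' = msubst (case_option (mvar None) (\<lambda>i. mconst c * mvar (Some i))) F"
  have F': "meval (case_option t a) F' = meval (case_option t (\<lambda>i. c * a i)) F" for t a
    unfolding F'_def meval_msubst by (rule arg_cong[where f = "\<lambda>x. meval x F"]) (auto split: option.splits)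
  have "F' \<in> Iv (degen \<omega> S)"
    unfolding Iv_def
  proof (intro CollectI ballI)
    fix b assume b: "b \<in> degen \<omega> S"
    then obtain t a where b': "b = case_option t a" by (auto simp: degen_def)
    show "meval b F' = 0" using F degen_scale[OF assms(1) b[unfolded b'] assms(3)] by (simp add: b' F' Iv_def)
  qed
  then have "meval (case_option t a) F' = 0" using assms(2) by (simp add: Vz_def)
  then show "meval (case_option t (\<lambda>i. c * a i)) F = 0" by (simp add: F')
qed

text \<open>The weight homogenizations of the equations of \<open>X\<close> cut out the translate
  over \<open>t \<noteq> 0\<close>, so the closure can add at most the origin there.\<close>

lemma Vz_degen_fibre:
  assumes "closedin zariski1 X" "case_option t a \<in> Vz (degen \<omega> (affine_cone X))" "t \<noteq> 0" "a i \<noteq> 0"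
  shows "a \<in> act \<omega> t ` affine_cone X"
proof -
  define a' where "a' = act (\<lambda>v. - \<omega> v) t a"
  have a: "a = act \<omega> t a'" by (simp add: a'_def act_inverse'[OF assms(3)])
  have "a' \<in> Vz (affine_cone X)"
    unfolding Vz_def
  proof (intro CollectI ballI)
    fix f assume "f \<in> Iv (affine_cone X)"
    then have "weight_homogenization \<omega> f \<in> Iv (degen \<omega> (affine_cone X))"
      by (auto simp: Iv_def degen_def meval_weight_homogenization_act)
    then have "meval (case_option t (act \<omega> t a')) (weight_homogenization \<omega> f) = 0"
      using assms(2) by (auto simp: Vz_def a)
    then show "meval a' f = 0" using assms(3) by (simp add: meval_weight_homogenization_act)
  qed
  moreover have "a' i \<noteq> 0" using assms(3,4) by (simp add: a'_def act_def)
  ultimately have "a' \<in> affine_cone X" by (rule closed_Vz[OF assms(1)])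
  then show ?thesis unfolding a by blast
qed

text \<open>For closed \<open>X\<close> this is the translated cone if \<open>t \<noteq> 0\<close>,
  and the cone over the special fibre if \<open>t = 0\<close>.\<close>

definition fibre_cone :: "('n::finite \<Rightarrow> int) \<Rightarrow> ('n \<Rightarrow> complex) set \<Rightarrow> complex \<Rightarrow> ('n \<Rightarrow> complex) set" where
  "fibre_cone \<omega> S t = {a. (\<exists>i. a i \<noteq> 0) \<and> case_option t a \<in> Vz (degen \<omega> S)}"

lemma fibre_cone_nonzero:
  assumes "closedin zariski1 X" "t \<noteq> 0"
  shows "fibre_cone \<omega> (affine_cone X) t = act \<omega> t ` affine_cone X"
proof (intro equalityI subsetI)
  fix a assume "a \<in> fibre_cone \<omega> (affine_cone X) t"
  then show "a \<in> act \<omega> t ` affine_cone X" using Vz_degen_fibre[OF assms(1) _ assms(2)] by (auto simp: fibre_cone_def)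
next
  fix a assume "a \<in> act \<omega> t ` affine_cone X"
  then obtain a' where a: "a = act \<omega> t a'" "a' \<in> affine_cone X" by blast
  then have "case_option t a \<in> degen \<omega> (affine_cone X)" using assms(2) by (auto simp: degen_def)
  then show "a \<in> fibre_cone \<omega> (affine_cone X) t"
    using subset_Vz cone_nonzero[OF a(2)] a(1) act_nonzero_iff[OF assms(2), of \<omega> a'] by (auto simp: fibre_cone_def)
qed

lemma conic_fibre_cone: "conic S \<Longrightarrow> conic (fibre_cone \<omega> S t)"
  unfolding conic_def[of "fibre_cone \<omega> S t"] by (auto simp: fibre_cone_def intro: Vz_degen_scale)

lemma meval_fibre: "meval a (msubst (case_option (mconst t) mvar) F) = meval (case_option t a) F"
  unfolding meval_msubst by (rule arg_cong[where f = "\<lambda>x. meval x F"]) (auto split: option.splits)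

lemma affine_cone_fibre_points:
  "affine_cone (fibre_points (Iv (degen \<omega> (affine_cone X))) t) = fibre_cone \<omega> (affine_cone X) t"
proof (intro equalityI subsetI)
  fix a assume "a \<in> affine_cone (fibre_points (Iv (degen \<omega> (affine_cone X))) t)"
  then show "a \<in> fibre_cone \<omega> (affine_cone X) t"
    using crd_nonzero[of a]
    by (auto simp: affine_cone_def fibre_points_def zero_locus_def fibre_ideal_def fibre_cone_def Vz_def meval_fibre)
next
  fix a assume a: "a \<in> fibre_cone \<omega> (affine_cone X) t"
  then obtain i where "a i \<noteq> 0" by (auto simp: fibre_cone_def)
  then obtain p where p: "a \<in> crd p" using crd_exists[of a i] by blast
  have "case_option t b \<in> Vz (degen \<omega> (affine_cone X))" if b: "b \<in> crd p" for b
    by (rule crd_proportional[OF p b])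
      (use a in \<open>auto simp: fibre_cone_def intro: Vz_degen_scale[OF conic_affine_cone]\<close>)
  then have "p \<in> fibre_points (Iv (degen \<omega> (affine_cone X))) t"
    by (auto simp: fibre_points_def zero_locus_def fibre_ideal_def Vz_def meval_fibre)
  then show "a \<in> affine_cone (fibre_points (Iv (degen \<omega> (affine_cone X))) t)"
    using p by (auto simp: affine_cone_def)
qed

lemma continuous_case_option:
  "continuous_on A (\<lambda>x :: (complex ^ 'n::finite) \<times> complex. meval (case_option (snd x) (\<lambda>i. fst x $ i)) F)"
proof (rule continuous_meval)
  show "continuous_on A (\<lambda>x :: (complex ^ 'n) \<times> complex. case_option (snd x) (\<lambda>i. fst x $ i) v)" for v
    by (cases v) (auto intro!: continuous_intros)
qed

lemma closed_Vz_pair: "closed {x :: (complex ^ 'n::finite) \<times> complex. case_option (snd x) (\<lambda>i. fst x $ i) \<in> Vz T}"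
proof -
  have "{x :: (complex ^ 'n) \<times> complex. case_option (snd x) (\<lambda>i. fst x $ i) \<in> Vz T} =
      (\<Inter>F\<in>Iv T. {x. meval (case_option (snd x) (\<lambda>i. fst x $ i)) F = 0})"
    by (auto simp: Vz_def)
  moreover have "closed {x :: (complex ^ 'n) \<times> complex. meval (case_option (snd x) (\<lambda>i. fst x $ i)) F = 0}" for F
    by (intro closed_Collect_eq continuous_case_option continuous_intros)
  ultimately show ?thesis by auto
qed

text \<open>As in \<open>cone_bound\<close>, but on a compact piece of the total space. Absence of
  common zeros is only known over \<open>t = 0\<close>, so \<open>norm t\<close> is added to obtain
  a positive function; for \<open>norm t < m / 2\<close> the forms alone contribute at least
  \<open>m / 2\<close>.\<close>

lemma degen_bound:
  fixes S :: "('n::finite \<Rightarrow> complex) set"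
  assumes "conic S" "cut_out k \<zeta> (fibre_cone \<omega> S 0)"
  obtains \<epsilon> C where "0 < \<epsilon>" "\<epsilon> \<le> 1" "0 < C"
    "\<And>t a j. norm t < \<epsilon> \<Longrightarrow> case_option t a \<in> Vz (degen \<omega> S) \<Longrightarrow> norm (a j) \<le> C * (\<Sum>i<k. norm (lin (\<zeta> i) a))"
proof -
  define h where "h x = (\<Sum>i<k. norm (lin (\<zeta> i) (\<lambda>j. fst x $ j))) + norm (snd x)" for x :: "(complex ^ 'n) \<times> complex"
  define K where "K = {x :: (complex ^ 'n) \<times> complex. case_option (snd x) (\<lambda>i. fst x $ i) \<in> Vz (degen \<omega> S)} \<inter> sphere 0 1 \<times> cball 0 1"
  have "compact K" unfolding K_def by (intro closed_Int_compact closed_Vz_pair compact_Times compact_sphere compact_cball)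
  have hpos: "h x > 0" if x: "x \<in> K" for x
  proof (cases "snd x = 0")
    case True
    have "fst x \<noteq> 0" using x by (auto simp: K_def)
    then obtain i where "fst x $ i \<noteq> 0" by (auto simp: vec_eq_iff)
    then have "(\<lambda>i. fst x $ i) \<in> fibre_cone \<omega> S 0" using x True by (auto simp: K_def fibre_cone_def)
    then obtain i where "i < k" "lin (\<zeta> i) (\<lambda>j. fst x $ j) \<noteq> 0" using assms(2) by (auto simp: cut_out_def)
    then have "(\<Sum>i<k. norm (lin (\<zeta> i) (\<lambda>j. fst x $ j))) > 0" by (intro sum_pos2[of _ i]) auto
    then show ?thesis by (simp add: h_def add_pos_nonneg)
  next
    case False
    then show ?thesis by (simp add: h_def add_nonneg_pos sum_nonneg)
  qed
  obtain m where m: "m > 0" "\<And>v. v \<in> K \<Longrightarrow> m \<le> h v"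
  proof (cases "K = {}")
    case False
    have "continuous_on K h" unfolding h_def[abs_def] lin_def by (intro continuous_intros)
    then obtain v where "v \<in> K" "\<And>w. w \<in> K \<Longrightarrow> h v \<le> h w"
      using continuous_attains_inf[OF \<open>compact K\<close> False] by blast
    then show ?thesis using hpos that by blast
  qed (use that[of 1] in auto)
  show ?thesis
  proof (rule that[of "min 1 (m / 2)" "2 / m"])
    show "0 < min 1 (m / 2)" "min 1 (m / 2) \<le> 1" "0 < 2 / m" using m(1) by auto
    fix t and a :: "'n \<Rightarrow> complex" and j
    assume t: "norm t < min 1 (m / 2)" and a: "case_option t a \<in> Vz (degen \<omega> S)"
    show "norm (a j) \<le> 2 / m * (\<Sum>i<k. norm (lin (\<zeta> i) a))"
    proof (cases "\<exists>i. a i \<noteq> 0")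
      case False
      then show ?thesis by (simp add: lin_def)
    next
      case True
      then obtain i where "a i \<noteq> 0" by blast
      define v :: "complex ^ 'n" where "v = (\<chi> i. a i)"
      have v0: "v \<noteq> 0" using \<open>a i \<noteq> 0\<close> by (auto simp: v_def vec_eq_iff)
      define c where "c = complex_of_real (1 / norm v)"
      have c0: "c \<noteq> 0" using v0 by (simp add: c_def)
      have nc: "norm c = 1 / norm v" by (simp add: c_def norm_divide)
      have e: "($) (c *s v) = (\<lambda>i. c * a i)" by (rule ext) (simp add: v_def)
      have "case_option t (\<lambda>i. c * a i) \<in> Vz (degen \<omega> S)" by (rule Vz_degen_scale[OF assms(1) a c0])
      moreover have "norm (c *s v) = 1"
      proof -
        have "c *s v = (1 / norm v) *\<^sub>R v" unfolding vec_eq_iff vector_smult_component vector_scaleR_component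
          by (simp only: c_def scaleR_conv_of_real of_real_divide of_real_1) simp
        then show ?thesis using v0 by simp
      qed
      ultimately have "(c *s v, t) \<in> K" using t by (simp add: K_def e dist_norm)
      then have "m \<le> h (c *s v, t)" by (rule m(2))
      also have "h (c *s v, t) = (1 / norm v) * (\<Sum>i<k. norm (lin (\<zeta> i) a)) + norm t"
        unfolding h_def fst_conv snd_conv e lin_scale norm_mult nc by (simp add: sum_distrib_left)
      finally have "m \<le> (1 / norm v) * (\<Sum>i<k. norm (lin (\<zeta> i) a)) + norm t" .
      moreover have "norm t < m / 2" using t by simp
      ultimately have "m / 2 \<le> (1 / norm v) * (\<Sum>i<k. norm (lin (\<zeta> i) a))" by linarith
      then have "m / 2 * norm v \<le> (\<Sum>i<k. norm (lin (\<zeta> i) a))" using v0 by (simp add: field_simps)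
      moreover have "norm (a j) \<le> norm v" using Finite_Cartesian_Product.norm_nth_le[of v j] by (simp add: v_def)
      ultimately have "m / 2 * norm (a j) \<le> (\<Sum>i<k. norm (lin (\<zeta> i) a))"
        using m(1) by (meson mult_left_mono less_imp_le order.trans half_gt_zero)
      then show ?thesis using m(1) by (simp add: field_simps)
    qed
  qed
qed

subsection \<open>Parameters on the total space\<close>

lemma polfun_shift_expand:
  assumes "f \<in> polfun {..<m}"
  obtains n \<alpha> where "\<And>l. \<alpha> l \<in> polfun {..<m}" "\<And>p s. f (\<lambda>i. p i + s * v i) = (\<Sum>l\<le>n. \<alpha> l p * s ^ l)"
proof -
  have "(\<lambda>p. f (\<lambda>i. p i + p m * v i)) \<in> polfun {..<Suc m}"
    by (rule polfun_subst[OF assms]) (auto intro!: polfun_intros)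
  then obtain n \<alpha> where \<alpha>: "\<And>l. \<alpha> l \<in> polfun {..<m}"
    "\<And>p. f (\<lambda>i. p i + p m * v i) = (\<Sum>l\<le>n. \<alpha> l p * p m ^ l)"
    by (rule polfun_expand_Suc) (rule that)
  show ?thesis
  proof (rule that[OF \<alpha>(1)])
    fix p s
    have "f (\<lambda>i. p i + s * v i) = f (\<lambda>i. (p(m := s)) i + (p(m := s)) m * v i)"
      by (rule polfun_cong[OF assms]) auto
    also have "\<dots> = (\<Sum>l\<le>n. \<alpha> l (p(m := s)) * (p(m := s)) m ^ l)" by (rule \<alpha>(2))
    also have "\<dots> = (\<Sum>l\<le>n. \<alpha> l p * s ^ l)"
      by (intro sum.cong refl arg_cong2[where f = "(*)"] polfun_cong[OF \<alpha>(1)]) auto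
    finally show "f (\<lambda>i. p i + s * v i) = (\<Sum>l\<le>n. \<alpha> l p * s ^ l)" .
  qed
qed

lemma poly_eq_sum_upto: "degree P \<le> e \<Longrightarrow> poly P (x :: complex) = (\<Sum>l\<le>e. coeff P l * x ^ l)"
  unfolding poly_altdef by (rule sum.mono_neutral_left) (auto simp: coeff_eq_0)

lemma norm_lin_le: "norm (lin z a) \<le> (\<Sum>j\<in>UNIV. norm (z j)) * R" if "\<And>j. norm (a j) \<le> R"
  unfolding lin_def sum_distrib_right
  by (rule order.trans[OF norm_sum]) (auto simp: norm_mult intro!: sum_mono mult_left_mono that)

text \<open>\<open>k\<close> is the least number of forms for the special fibre, not for
  \<open>X\<close>: minimality at \<open>t = 0\<close> makes the forms independent there, and the
  bound makes all other functions algebraic over the forms and \<open>t\<close>.\<close>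

locale degeneration_parameters =
  fixes X :: "'n::finite proj set" and \<omega> :: "'n \<Rightarrow> int" and \<zeta> :: "nat \<Rightarrow> 'n \<Rightarrow> complex"
    and k :: nat and \<epsilon> C :: real
  assumes X: "irreducible_closed zariski1 X"
    and ne: "fibre_cone \<omega> (affine_cone X) 0 \<noteq> {}"
    and k: "k = ndim (fibre_cone \<omega> (affine_cone X) 0)"
    and cut: "cut_out k \<zeta> (fibre_cone \<omega> (affine_cone X) 0)"
    and eps: "0 < \<epsilon>" "\<epsilon> \<le> 1" "0 < C"
    and bound: "\<And>t a j. norm t < \<epsilon> \<Longrightarrow> case_option t a \<in> Vz (degen \<omega> (affine_cone X)) \<Longrightarrow>
      norm (a j) \<le> C * (\<Sum>i<k. norm (lin (\<zeta> i) a))"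
begin

abbreviation T where "T \<equiv> degen \<omega> (affine_cone X)"

text \<open>The parameter with index \<open>k\<close> is \<open>t\<close>; larger indices repeat it
  to make the sequence total.\<close>

definition par :: "nat \<Rightarrow> ('n option \<Rightarrow> complex) \<Rightarrow> complex" where
  "par i = (if i < k then (\<lambda>b. lin (\<zeta> i) (\<lambda>j. b (Some j))) else (\<lambda>b. b None))"

lemma lin_Some_polymap: "(\<lambda>b. lin z (\<lambda>j. b (Some j))) \<in> polymap"
  unfolding lin_def by (intro polymap_sum polymap_mult polymap_const polymap_coord)

lemma par_polymap: "par i \<in> polymap"
  by (auto simp: par_def lin_Some_polymap polymap_coord)

lemma par_case_option: "par i (case_option t a) = (if i < k then lin (\<zeta> i) a else t)"
  by (simp add: par_def)

lemma irrT: "irr T"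
  by (rule irr_degen[OF irreducible_closed_imp_irr[OF X]])

lemma T_None: "b \<in> T \<Longrightarrow> b None \<noteq> 0"
  by (auto simp: degen_def)

lemma option_fun_eta: "case_option (b None) (\<lambda>j. b (Some j)) = b"
  by (auto simp: fun_eq_iff split: option.splits)

lemma polymap_vanish_Vz: "f \<in> polymap \<Longrightarrow> (\<And>b. b \<in> T \<Longrightarrow> f b = 0) \<Longrightarrow> b \<in> Vz T \<Longrightarrow> f b = 0"
  by (auto simp: polymap_def Vz_def Iv_def)

text \<open>At \<open>t = 0\<close> only the term \<open>i = 0\<close> survives and gives a relation
  between the forms on the special fibre; a nontrivial one would permit fewer than \<open>k\<close>
  forms.\<close>

lemma par_special_zero:
  assumes "\<And>i. a i \<in> polfun {..<k}" "\<And>b. b \<in> T \<Longrightarrow> (\<Sum>i\<le>n. a i (\<lambda>i. par i b) * b None ^ i) = 0"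
  shows "a 0 p = 0"
proof (rule ccontr)
  assume "a 0 p \<noteq> 0"
  have pm: "(\<lambda>b. \<Sum>i\<le>n. a i (\<lambda>i. par i b) * b None ^ i) \<in> polymap"
  proof -
    have "(\<lambda>b. (b None :: complex) ^ i) \<in> polymap" for i
      using polymap_prod[of "{..<i}" "\<lambda>_ b. b None"] polymap_coord[of None] by simp
    then show ?thesis by (intro polymap_sum polymap_mult polymap_compose[OF assms(1)] par_polymap)
  qed
  have "a 0 (\<lambda>i. lin (\<zeta> i) x) = 0" if x: "x \<in> fibre_cone \<omega> (affine_cone X) 0" for x
  proof -
    have "case_option 0 x \<in> Vz T" using x by (simp add: fibre_cone_def)
    from polymap_vanish_Vz[OF pm assms(2) this]
    have "(\<Sum>i\<le>n. a i (\<lambda>i. par i (case_option 0 x)) * 0 ^ i) = 0" by simp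
    moreover have "(\<Sum>i\<le>n. a i (\<lambda>i. par i (case_option 0 x)) * 0 ^ i) =
        (\<Sum>i\<in>{0}. a i (\<lambda>i. par i (case_option 0 x)) * 0 ^ i)"
      by (rule sum.mono_neutral_right) auto
    moreover have "a 0 (\<lambda>i. par i (case_option 0 x)) = a 0 (\<lambda>i. lin (\<zeta> i) x)"
      by (rule polfun_cong[OF assms(1)]) (simp add: par_case_option)
    ultimately show ?thesis by simp
  qed
  then obtain \<zeta>' where "cut_out (k - 1) \<zeta>' (fibre_cone \<omega> (affine_cone X) 0)"
    using cut_out_drop[OF conic_fibre_cone[OF conic_affine_cone] cut assms(1)] \<open>a 0 p \<noteq> 0\<close> by blast
  then have "k \<le> k - 1" unfolding k by (rule ndim_le)
  then have "k = 0" by simp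
  then show False using cut ne by (fastforce simp: cut_out_def)
qed

text \<open>The constant term in \<open>t\<close> is zero and \<open>t\<close> is nonzero on
  \<open>T\<close>, so the relation can be divided by \<open>t\<close> repeatedly.\<close>

lemma par_indep_aux:
  assumes "\<And>i. a i \<in> polfun {..<k}" "\<And>b. b \<in> T \<Longrightarrow> (\<Sum>i\<le>n. a i (\<lambda>i. par i b) * b None ^ i) = 0" "i \<le> n"
  shows "a i p = 0"
  using assms
proof (induction n arbitrary: a i)
  case (0 a i)
  show ?case using par_special_zero[of a 0 p, OF 0(1,2)] 0(3) by simp
next
  case (Suc n a i)
  have a0: "a 0 p = 0" for p using par_special_zero[of a "Suc n"] Suc.prems by blast
  have "(\<Sum>i\<le>n. a (Suc i) (\<lambda>i. par i b) * b None ^ i) = 0" if b: "b \<in> T" for b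
  proof -
    have "b None * (\<Sum>i\<le>n. a (Suc i) (\<lambda>i. par i b) * b None ^ i) = (\<Sum>i\<le>Suc n. a i (\<lambda>i. par i b) * b None ^ i)"
      unfolding sum.atMost_Suc_shift by (simp add: a0 sum_distrib_left mult_ac)
    then show ?thesis using Suc.prems(2)[OF b] T_None[OF b] by simp
  qed
  from Suc.IH[of "\<lambda>i. a (Suc i)", OF Suc.prems(1) this] show ?case
    using a0 Suc.prems(3) by (cases i) auto
qed

lemma par_indep: "algindep (Suc k) par T"
  unfolding algindep_def
proof (intro ballI impI allI)
  fix f p assume f: "f \<in> polfun {..<Suc k}" "\<forall>b\<in>T. f (\<lambda>i. par i b) = 0"
  obtain n a where a: "\<And>i. a i \<in> polfun {..<k}" "\<And>p. f p = (\<Sum>i\<le>n. a i p * p k ^ i)"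
    by (rule polfun_expand_Suc[OF f(1)]) (rule that)
  have "par k b = b None" for b by (simp add: par_def)
  then have "a i p = 0" if "i \<le> n" for i
    using par_indep_aux[of a n i p] a(1) f(2) that by (simp add: a(2))
  then show "f p = 0" by (simp add: a(2))
qed

lemma par_dep:
  assumes "\<theta> \<in> polymap"
  shows "\<not> algindep (Suc (Suc k)) (par(Suc k := \<theta>)) T"
proof -
  obtain M where M: "\<And>b. (\<forall>j. norm (b j) \<le> C * (\<Sum>i<k. 1) + 1) \<Longrightarrow> norm (\<theta> b) \<le> M"
    using polymap_bounded[OF assms, of "C * (\<Sum>i<k. 1) + 1"] by blast
  \<comment> \<open>The box of radius \<open>\<epsilon> / 4\<close> around
    \<open>t = \<epsilon> / 2\<close> stays inside \<open>norm t < \<epsilon>\<close>, where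
    \<open>bound\<close> holds, and \<open>\<epsilon> \<le> 1\<close> keeps the forms below
    1.\<close>
  show ?thesis
  proof (rule bounded_imp_algebraic[where \<rho> = "\<epsilon> / 4" and C = M and ?q0.0 = "\<lambda>i. if i < k then 0 else complex_of_real (\<epsilon> / 2)"])
    fix b assume b: "b \<in> Vz T" "\<And>i. i < Suc k \<Longrightarrow> norm (par i b - (if i < k then 0 else complex_of_real (\<epsilon> / 2))) < \<epsilon> / 4"
    have "norm (b None - complex_of_real (\<epsilon> / 2)) < \<epsilon> / 4" using b(2)[of k] by (simp add: par_def)
    moreover have "norm (b None) \<le> norm (b None - complex_of_real (\<epsilon> / 2)) + norm (complex_of_real (\<epsilon> / 2))"
      using norm_triangle_ineq[of "b None - complex_of_real (\<epsilon> / 2)" "complex_of_real (\<epsilon> / 2)"] by simp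
    moreover have "norm (complex_of_real (\<epsilon> / 2)) = \<epsilon> / 2" using eps(1) by (simp only: norm_of_real abs_of_pos half_gt_zero)
    ultimately have t: "norm (b None) < \<epsilon>" using eps(1) by linarith
    have l: "norm (lin (\<zeta> i) (\<lambda>j. b (Some j))) \<le> 1" if "i < k" for i
      using b(2)[of i] that eps(2) by (simp add: par_def)
    have h1: "norm (b (Some j)) \<le> C * (\<Sum>i<k. 1)" for j
    proof -
      have "norm (b (Some j)) \<le> C * (\<Sum>i<k. norm (lin (\<zeta> i) (\<lambda>j. b (Some j))))"
        by (rule bound[OF t]) (simp add: option_fun_eta b(1))
      also have "\<dots> \<le> C * (\<Sum>i<k. 1)" using l eps(3) by (intro mult_left_mono sum_mono) auto
      finally show ?thesis .
    qed
    have h2: "norm (b None) \<le> C * (\<Sum>i<k. 1) + 1" using t eps(2,3) by (auto intro: add_increasing)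
    have "norm (b j) \<le> C * (\<Sum>i<k. 1) + 1" for j
    proof (cases j)
      case (Some x)
      then show ?thesis using h1[of x] by simp
    qed (use h2 in simp)
    then show "norm (\<theta> b) \<le> M" using M by blast
  qed (use irrT par_polymap assms eps in auto)
qed

lemma par_scale: "(\<lambda>i. par i (case_option t (\<lambda>j. c * a j))) = scale_coords k c (\<lambda>i. par i (case_option t a))"
  by (auto simp: par_case_option scale_coords_def lin_scale fun_eq_iff)

text \<open>While all coefficients vanish on \<open>t = 0\<close> they are divided by
  \<open>t\<close>. Each division lowers the degree in \<open>t\<close> of the leading coefficient
  on the line through \<open>p0\<close>, so the process ends.\<close>

lemma relation_content_free:
  assumes "\<And>i. c i \<in> polfun {..<Suc k}" "\<And>b. b \<in> T \<Longrightarrow> (\<Sum>i\<le>d. c i (\<lambda>i. par i b) * \<eta> b ^ i) = 0"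
    "c d p0 \<noteq> 0"
  shows "\<exists>c. (\<forall>i. c i \<in> polfun {..<Suc k}) \<and> (\<forall>b\<in>T. (\<Sum>i\<le>d. c i (\<lambda>i. par i b) * \<eta> b ^ i) = 0) \<and>
    (\<exists>i\<le>d. \<exists>p. p k = 0 \<and> c i p \<noteq> 0)"
proof -
  have main: "\<exists>c. (\<forall>i. c i \<in> polfun {..<Suc k}) \<and> (\<forall>b\<in>T. (\<Sum>i\<le>d. c i (\<lambda>i. par i b) * \<eta> b ^ i) = 0) \<and>
    (\<exists>i\<le>d. \<exists>p. p k = 0 \<and> c i p \<noteq> 0)"
    if "P \<noteq> 0" "\<And>t. poly P t = c d (p0(k := t))" "\<And>i. c i \<in> polfun {..<Suc k}"
      "\<And>b. b \<in> T \<Longrightarrow> (\<Sum>i\<le>d. c i (\<lambda>i. par i b) * \<eta> b ^ i) = 0" for P :: "complex poly" and c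
    using that
  proof (induction "degree P" arbitrary: P c rule: less_induct)
    case (less P c)
    show ?case
    proof (cases "\<exists>i\<le>d. \<exists>p. p k = 0 \<and> c i p \<noteq> 0")
      case True
      then show ?thesis using less.prems(3,4) by blast
    next
      case False
      have "\<exists>f'. f' \<in> polfun {..<Suc k} \<and> (i \<le> d \<longrightarrow> (\<forall>p. c i p = p k * f' p))" for i
      proof (cases "i \<le> d")
        case True
        obtain f' where "f' \<in> polfun {..<Suc k}" "\<And>p. c i p = p k * f' p"
          by (rule polfun_divide_coord[OF less.prems(3)[of i]]) (use False True in auto)
        then show ?thesis by blast
      qed (use polfun.const in blast)
      then obtain c' where c': "\<And>i. c' i \<in> polfun {..<Suc k}" "\<And>i p. i \<le> d \<Longrightarrow> c i p = p k * c' i p" by metis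
      obtain P' where P': "\<And>t. c' d (\<lambda>i. poly (if i = k then [:0, 1:] else [:p0 i:]) t) = poly P' t"
        by (rule polfun_poly[OF c'(1), of _ "\<lambda>i. if i = k then [:0, 1:] else [:p0 i:]"]) (rule that)
      have upd: "(\<lambda>i. poly (if i = k then [:0, 1:] else [:p0 i:]) t) = p0(k := t)" for t by auto
      have "poly P t = poly ([:0, 1:] * P') t" for t
        using P'[of t] unfolding upd by (simp add: less.prems(2) c'(2))
      then have PP: "P = [:0, 1:] * P'" by (simp add: poly_eq_poly_eq_iff[symmetric] fun_eq_iff)
      then have P'0: "P' \<noteq> 0" using less.prems(1) by auto
      then have "degree P' < degree P" unfolding PP by (subst degree_mult_eq) auto
      moreover have "(\<Sum>i\<le>d. c' i (\<lambda>i. par i b) * \<eta> b ^ i) = 0" if b: "b \<in> T" for b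
      proof -
        have "par k b * (\<Sum>i\<le>d. c' i (\<lambda>i. par i b) * \<eta> b ^ i) = (\<Sum>i\<le>d. c i (\<lambda>i. par i b) * \<eta> b ^ i)"
          unfolding sum_distrib_left by (rule sum.cong) (auto simp: c'(2))
        moreover have "par k b \<noteq> 0" using T_None[OF b] by (simp add: par_def)
        ultimately show ?thesis using less.prems(4)[OF b] by simp
      qed
      ultimately show ?thesis using less.hyps[of P' c'] P'0 P' c'(1) unfolding upd by auto
    qed
  qed
  obtain P where P: "\<And>t. c d (\<lambda>i. poly (if i = k then [:0, 1:] else [:p0 i:]) t) = poly P t"
    by (rule polfun_poly[OF assms(1), of _ "\<lambda>i. if i = k then [:0, 1:] else [:p0 i:]"]) (rule that)
  have upd: "(\<lambda>i. poly (if i = k then [:0, 1:] else [:p0 i:]) t) = p0(k := t)" for t by auto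
  have "poly P (p0 k) \<noteq> 0" using P[of "p0 k"] assms(3) unfolding upd by simp
  then have "P \<noteq> 0" by auto
  then show ?thesis using main[of P c] P assms(1,2) unfolding upd by simp
qed

text \<open>Scaling gives the forms and \<open>\<eta>\<close> weight one and \<open>t\<close> weight
  zero. Since \<open>T\<close> is stable under scaling, every weight part of a relation is a
  relation.\<close>

lemma relation_homogeneous_part:
  assumes c: "\<And>i. c i \<in> polfun {..<Suc k}" "\<And>b. b \<in> T \<Longrightarrow> (\<Sum>i\<le>d. c i (\<lambda>i. par i b) * \<eta> b ^ i) = 0"
    and \<eta>: "\<And>t a c. \<eta> (case_option t (\<lambda>j. c * a j)) = c * \<eta> (case_option t a)"
    and i0: "i0 \<le> d" "c i0 p0 \<noteq> 0"
  obtains c' m where "\<And>i. c' i \<in> polfun {..<Suc k}" "\<And>b. b \<in> T \<Longrightarrow> (\<Sum>i\<le>d. c' i (\<lambda>i. par i b) * \<eta> b ^ i) = 0"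
    "c' i0 p0 \<noteq> 0" "\<And>i p s. c' i (scale_coords k s p) = s ^ (m - i) * c' i p"
proof -
  have "\<forall>i. \<exists>M g. (\<forall>s. g s \<in> polfun {..<Suc k}) \<and> (\<forall>p x. c i (scale_coords k x p) = (\<Sum>s\<le>M. g s p * x ^ s)) \<and>
      (\<forall>s p x. s \<le> M \<longrightarrow> g s (scale_coords k x p) = x ^ s * g s p)"
    by (rule allI, rule polfun_homogeneous_parts[OF c(1), of _ k]) blast
  then obtain M g where g0: "\<forall>i. (\<forall>s. g i s \<in> polfun {..<Suc k}) \<and> (\<forall>p x. c i (scale_coords k x p) = (\<Sum>s\<le>M i. g i s p * x ^ s)) \<and>
      (\<forall>s p x. s \<le> M i \<longrightarrow> g i s (scale_coords k x p) = x ^ s * g i s p)"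
    unfolding choice_iff by (elim exE) (rule that)
  have g: "\<And>i s. g i s \<in> polfun {..<Suc k}"
    "\<And>i p x. c i (scale_coords k x p) = (\<Sum>s\<le>M i. g i s p * x ^ s)"
    "\<And>i s p x. s \<le> M i \<Longrightarrow> g i s (scale_coords k x p) = x ^ s * g i s p" using g0 by auto
  have "scale_coords k 1 p0 = p0" by (auto simp: scale_coords_def)
  then have "(\<Sum>s\<le>M i0. g i0 s p0) \<noteq> 0" using g(2)[of i0 1 p0] i0(2) by simp
  then obtain s0 where s0: "s0 \<le> M i0" "g i0 s0 p0 \<noteq> 0"
    by (metis (no_types, lifting) atMost_iff sum.neutral)
  \<comment> \<open>The total weight of the part \<open>g i0 s0\<close>, which is nonzero at
    \<open>p0\<close>, so that coefficient \<open>i0\<close> survives. Coefficients with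
    \<open>i > m\<close> are set to zero, which makes the truncated exponent \<open>m - i\<close>
    harmless.\<close>
  define m where "m = s0 + i0"
  define c' where "c' i = (if i \<le> m \<and> m - i \<le> M i then g i (m - i) else (\<lambda>p. 0))" for i
  show ?thesis
  proof (rule that)
    show "c' i \<in> polfun {..<Suc k}" for i using g(1) by (auto simp: c'_def polfun.const)
    show "c' i0 p0 \<noteq> 0" using s0 by (simp add: c'_def m_def)
    show "c' i (scale_coords k s p) = s ^ (m - i) * c' i p" for i p s using g(3) by (auto simp: c'_def)
    fix b assume b: "b \<in> T"
    obtain t a where ta: "b = case_option t a" using b by (auto simp: degen_def)
    define P where "P = (\<Sum>i\<le>d. \<Sum>s\<le>M i. monom (g i s (\<lambda>i. par i b) * \<eta> b ^ i) (s + i))"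
    have "poly P x = 0" if x: "x \<noteq> 0" for x
    proof -
      have "case_option t (\<lambda>j. x * a j) \<in> T" using degen_scale[OF conic_affine_cone b[unfolded ta] x] .
      from c(2)[OF this] have "0 = (\<Sum>i\<le>d. c i (scale_coords k x (\<lambda>i. par i b)) * (x * \<eta> b) ^ i)"
        by (simp add: par_scale \<eta> ta)
      also have "\<dots> = poly P x"
        unfolding P_def g(2) by (simp add: poly_sum poly_monom sum_distrib_left sum_distrib_right power_mult_distrib power_add mult_ac)
      finally show ?thesis by simp
    qed
    then have "- {0} \<subseteq> {x. poly P x = 0}" by auto
    then have "infinite {x. poly P x = 0}" using infinite_nonzero_complex finite_subset by blast
    then have "P = 0" using poly_roots_finite by blast
    then have "0 = coeff P m" by simp
    also have "\<dots> = (\<Sum>i\<le>d. \<Sum>s\<le>M i. if s + i = m then g i s (\<lambda>i. par i b) * \<eta> b ^ i else 0)"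
      by (simp add: P_def coeff_sum coeff_monom)
    also have "\<dots> = (\<Sum>i\<le>d. c' i (\<lambda>i. par i b) * \<eta> b ^ i)"
    proof (rule sum.cong[OF refl])
      fix i
      have "(\<Sum>s\<le>M i. if s + i = m then g i s (\<lambda>i. par i b) * \<eta> b ^ i else 0) =
          (\<Sum>s\<le>M i. if i \<le> m \<and> s = m - i then g i s (\<lambda>i. par i b) * \<eta> b ^ i else 0)"
        by (rule sum.cong) auto
      also have "\<dots> = c' i (\<lambda>i. par i b) * \<eta> b ^ i"
        by (cases "i \<le> m") (auto simp: c'_def)
      finally show "(\<Sum>s\<le>M i. if s + i = m then g i s (\<lambda>i. par i b) * \<eta> b ^ i else 0) = c' i (\<lambda>i. par i b) * \<eta> b ^ i" .
    qed
    finally show "(\<Sum>i\<le>d. c' i (\<lambda>i. par i b) * \<eta> b ^ i) = 0" by simp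
  qed
qed

text \<open>Since the roots of a minimal relation are bounded where they lift to points of the family, its
  leading coefficient divides the other ones up to a function of \<open>t\<close> that does not vanish at \<open>0\<close>.\<close>

lemma monic_relation:
  obtains d c N where "d > 0" "\<And>i. c i \<in> polfun {..<Suc k}" "\<And>p. p k = 0 \<Longrightarrow> c d p \<noteq> 0"
    "N \<in> polfun {..<Suc k}" "\<exists>q. N q \<noteq> 0"
    "\<And>b. b \<in> T \<Longrightarrow> (\<Sum>i\<le>d. c i (\<lambda>i. par i b) * lin z (\<lambda>j. b (Some j)) ^ i) = 0"
    "\<And>p \<tau>. N p \<noteq> 0 \<Longrightarrow> (\<Sum>i\<le>d. c i p * \<tau> ^ i) = 0 \<Longrightarrow>
      \<exists>b\<in>Vz T. (\<forall>i<Suc k. par i b = p i) \<and> lin z (\<lambda>j. b (Some j)) = \<tau>"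
proof -
  define \<eta> where "\<eta> b = lin z (\<lambda>j. b (Some j))" for b :: "'n option \<Rightarrow> complex"
  have \<eta>p: "\<eta> \<in> polymap" unfolding \<eta>_def[abs_def] by (rule lin_Some_polymap)
  have \<eta>s: "\<eta> (case_option t (\<lambda>j. c * a j)) = c * \<eta> (case_option t a)" for t a c
    by (simp add: \<eta>_def lin_scale)
  obtain d a N0 where d: "d > 0" and aA: "\<And>i. a i \<in> polfun {..<Suc k}" and N0: "N0 \<in> polfun {..<Suc k}" "\<exists>q. N0 q \<noteq> 0"
    and ad: "\<exists>q. a d q \<noteq> 0"
    and arel: "\<And>b. b \<in> T \<Longrightarrow> (\<Sum>i\<le>d. a i (\<lambda>i. par i b) * \<eta> b ^ i) = 0"
    and min: "\<And>r i q. \<forall>i. r i \<in> polfun {..<Suc k} \<Longrightarrow> \<forall>b\<in>T. (\<Sum>i<d. r i (\<lambda>i. par i b) * \<eta> b ^ i) = 0 \<Longrightarrow> i < d \<Longrightarrow> r i q = 0"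
    and lift: "\<And>q \<tau>. N0 q \<noteq> 0 \<Longrightarrow> a d q \<noteq> 0 \<Longrightarrow> (\<Sum>i\<le>d. a i q * \<tau> ^ i) = 0 \<Longrightarrow>
       \<exists>b\<in>Vz T. (\<forall>i<Suc k. par i b = q i) \<and> \<eta> b = \<tau>"
    by (rule generic_lift[OF irrT par_polymap \<eta>p par_indep par_dep]) (assumption, rule that)
  obtain pa where pa: "a d pa \<noteq> 0" using ad by blast
  have "\<exists>c. (\<forall>i. c i \<in> polfun {..<Suc k}) \<and> (\<forall>b\<in>T. (\<Sum>i\<le>d. c i (\<lambda>i. par i b) * \<eta> b ^ i) = 0) \<and>
    (\<exists>i\<le>d. \<exists>p. p k = 0 \<and> c i p \<noteq> 0)"
  proof (rule relation_content_free[where c = a and d = d and \<eta> = \<eta> and ?p0.0 = pa])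
    show "(\<Sum>i\<le>d. a i (\<lambda>i. par i b) * \<eta> b ^ i) = 0" if "b \<in> T" for b using arel that by blast
  qed (fact aA pa)+
  then obtain c1 where c1: "\<forall>i. c1 i \<in> polfun {..<Suc k}" "\<forall>b\<in>T. (\<Sum>i\<le>d. c1 i (\<lambda>i. par i b) * \<eta> b ^ i) = 0"
    "\<exists>i\<le>d. \<exists>p. p k = 0 \<and> c1 i p \<noteq> 0"
    by (elim exE) (elim conjE, rule that)
  obtain i0 p0 where i0: "i0 \<le> d" "p0 k = 0" "c1 i0 p0 \<noteq> 0" using c1(3) by blast
  \<comment> \<open>The relation \<open>a\<close> is minimal and its roots lift to points of the
    family. The relation \<open>c\<close> is homogeneous and has a coefficient that is nonzero at
    some \<open>p0\<close> over \<open>t = 0\<close>. The two are compared below.\<close>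
  obtain c m where cA: "\<And>i. c i \<in> polfun {..<Suc k}"
    and crel: "\<And>b. b \<in> T \<Longrightarrow> (\<Sum>i\<le>d. c i (\<lambda>i. par i b) * \<eta> b ^ i) = 0"
    and ci0: "c i0 p0 \<noteq> 0" and hom: "\<And>i p s. c i (scale_coords k s p) = s ^ (m - i) * c i p"
  proof (rule relation_homogeneous_part[where c = c1 and d = d and \<eta> = \<eta> and ?i0.0 = i0 and ?p0.0 = p0])
    show "c1 i \<in> polfun {..<Suc k}" for i using c1(1) by blast
    show "(\<Sum>i\<le>d. c1 i (\<lambda>i. par i b) * \<eta> b ^ i) = 0" if "b \<in> T" for b using c1(2) that by blast
  qed (rule \<eta>s, rule i0(1), rule i0(3), rule that)
  define e where "e = m - d"
  have cd: "\<exists>q. c d q \<noteq> 0"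
  proof (rule ccontr)
    assume "\<not> (\<exists>q. c d q \<noteq> 0)"
    then have z: "c d q = 0" for q by blast
    have "\<forall>b\<in>T. (\<Sum>i<d. c i (\<lambda>i. par i b) * \<eta> b ^ i) = 0"
      using crel z by (simp flip: lessThan_Suc_atMost)
    then have "c i q = 0" if "i < d" for i q using min[of c i q] cA that by blast
    then show False using ci0 z i0(1) by (metis le_neq_implies_less)
  qed
  \<comment> \<open>The combination that cancels the leading terms has degree below
    \<open>d\<close>, so it is zero by minimality.\<close>
  have cross: "c d q * a i q = a d q * c i q" if "i \<le> d" for i q
  proof (cases "i = d")
    case False
    have "c d q * a i q - a d q * c i q = 0"
    proof (rule min[of "\<lambda>i q. c d q * a i q - a d q * c i q"])
      show "\<forall>i. (\<lambda>q. c d q * a i q - a d q * c i q) \<in> polfun {..<Suc k}"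
        using aA cA by (intro allI polfun_diff polfun.mult)
      show "\<forall>b\<in>T. (\<Sum>i<d. (c d (\<lambda>i. par i b) * a i (\<lambda>i. par i b) - a d (\<lambda>i. par i b) * c i (\<lambda>i. par i b)) * \<eta> b ^ i) = 0"
      proof
        fix b assume b: "b \<in> T"
        let ?p = "\<lambda>i. par i b"
        have "(\<Sum>i<d. (c d ?p * a i ?p - a d ?p * c i ?p) * \<eta> b ^ i) =
            (\<Sum>i\<le>d. (c d ?p * a i ?p - a d ?p * c i ?p) * \<eta> b ^ i)"
          by (simp flip: lessThan_Suc_atMost)
        also have "\<dots> = c d ?p * (\<Sum>i\<le>d. a i ?p * \<eta> b ^ i) - a d ?p * (\<Sum>i\<le>d. c i ?p * \<eta> b ^ i)"
          by (simp add: left_diff_distrib sum_subtractf sum_distrib_left mult.assoc)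
        also have "\<dots> = 0" using arel[OF b] crel[OF b] by simp
        finally show "(\<Sum>i<d. (c d ?p * a i ?p - a d ?p * c i ?p) * \<eta> b ^ i) = 0" .
      qed
      show "i < d" using False that by simp
    qed
    then show ?thesis by simp
  qed simp
  have lift': "\<exists>b\<in>Vz T. (\<forall>i<Suc k. par i b = p i) \<and> \<eta> b = \<tau>"
    if "N0 p \<noteq> 0" "a d p \<noteq> 0" "c d p \<noteq> 0" "(\<Sum>i\<le>d. c i p * \<tau> ^ i) = 0" for p \<tau>
  proof -
    have "c d p * (\<Sum>i\<le>d. a i p * \<tau> ^ i) = a d p * (\<Sum>i\<le>d. c i p * \<tau> ^ i)"
      unfolding sum_distrib_left mult.assoc[symmetric] by (rule sum.cong) (auto simp: cross)
    then have "(\<Sum>i\<le>d. a i p * \<tau> ^ i) = 0" using that by simp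
    then show ?thesis using lift that by blast
  qed
  define W where "W p = N0 p * (a d p * c d p)" for p
  have WA: "W \<in> polfun {..<Suc k}" unfolding W_def[abs_def] using N0 aA cA by (intro polfun.mult)
  obtain pw where pw: "W pw \<noteq> 0"
  proof -
    obtain q1 q2 q3 where q: "N0 q1 \<noteq> 0" "a d q2 \<noteq> 0" "c d q3 \<noteq> 0" using N0(2) ad cd by blast
    obtain r where r: "a d r \<noteq> 0" "c d r \<noteq> 0" by (rule polfun_nonzero_mult[OF aA q(2) cA q(3)])
    obtain r' where "N0 r' \<noteq> 0" "a d r' * c d r' \<noteq> 0"
      by (rule polfun_nonzero_mult[OF N0(1) q(1) polfun.mult[OF aA[of d] cA[of d]], of r]) (use r in auto)
    then show ?thesis using that[of r'] by (simp add: W_def)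
  qed
  define K where "K = (\<Sum>j\<in>UNIV. norm (z j)) * C"
  have K: "K \<ge> 0" unfolding K_def using eps(3) by (intro mult_nonneg_nonneg sum_nonneg) auto
  define B where "B p = (1 + K * (\<Sum>i<k. norm (p i))) ^ d" for p :: "nat \<Rightarrow> complex"
  \<comment> \<open>Roots of \<open>c\<close> lift to points of the family over \<open>p\<close>,
    where \<open>bound\<close> controls the linear form; the roots in turn control the
    coefficients.\<close>
  have ineq0: "norm (c i p) \<le> norm (c d p) * B p" if "W p \<noteq> 0" "norm (p k) < \<epsilon>" "i \<le> d" for p i
    unfolding B_def
  proof (rule coeff_le_of_roots)
    show "c d p \<noteq> 0" "i \<le> d" using that by (auto simp: W_def)
    show "0 \<le> K * (\<Sum>i<k. norm (p i))" using K by (intro mult_nonneg_nonneg sum_nonneg) auto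
    fix r assume "(\<Sum>i\<le>d. c i p * r ^ i) = 0"
    moreover have "N0 p \<noteq> 0 \<and> a d p \<noteq> 0 \<and> c d p \<noteq> 0" using \<open>W p \<noteq> 0\<close> by (simp add: W_def)
    ultimately obtain b where b: "b \<in> Vz T" "\<forall>i<Suc k. par i b = p i" "\<eta> b = r" using lift'[of p r] by blast
    have bN: "b None = p k" using b(2) by (auto simp: par_def)
    have "norm (b (Some j)) \<le> C * (\<Sum>i<k. norm (lin (\<zeta> i) (\<lambda>j. b (Some j))))" for j
      by (rule bound[of "b None" "\<lambda>j. b (Some j)"]) (use that bN in simp, simp only: option_fun_eta b(1))
    then have "norm (\<eta> b) \<le> (\<Sum>j\<in>UNIV. norm (z j)) * (C * (\<Sum>i<k. norm (lin (\<zeta> i) (\<lambda>j. b (Some j)))))"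
      unfolding \<eta>_def by (rule norm_lin_le)
    also have "(\<Sum>i<k. norm (lin (\<zeta> i) (\<lambda>j. b (Some j)))) = (\<Sum>i<k. norm (p i))"
    proof (rule sum.cong[OF refl])
      fix i assume "i \<in> {..<k}"
      then show "norm (lin (\<zeta> i) (\<lambda>j. b (Some j))) = norm (p i)" using b(2)[rule_format, of i] by (simp add: par_def)
    qed
    finally show "norm r \<le> K * (\<Sum>i<k. norm (p i))" using b(3) by (simp add: K_def mult.assoc)
  qed
  \<comment> \<open>Nonzeros of \<open>W\<close> accumulate at every point, so the inequality
    extends by continuity.\<close>
  have ineq: "norm (c i p) \<le> norm (c d p) * B p" if p: "norm (p k) < \<epsilon>" "i \<le> d" for p i
  proof (rule ccontr)
    assume neg: "\<not> ?thesis"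
    define l where "l s = (\<lambda>i. p i + s * (pw i - p i))" for s
    have l0: "l 0 = p" by (simp add: l_def)
    have "continuous_on UNIV (\<lambda>s. norm (c d (l s)) * B (l s) - norm (c i (l s)))"
      unfolding B_def l_def by (intro continuous_intros polfun_line_continuous[OF cA])
    then have "((\<lambda>s. norm (c d (l s)) * B (l s) - norm (c i (l s))) \<longlongrightarrow> norm (c d (l 0)) * B (l 0) - norm (c i (l 0))) (at 0)"
      by (simp add: continuous_on_eq_continuous_at isCont_def)
    then have 1: "eventually (\<lambda>s. norm (c d (l s)) * B (l s) - norm (c i (l s)) < 0) (at 0)"
      by (rule order_tendstoD) (use neg in \<open>simp add: l0\<close>)
    have "((\<lambda>s. norm (l s k)) \<longlongrightarrow> norm (p k + 0 * (pw k - p k))) (at 0)"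
      unfolding l_def by (intro tendsto_intros)
    then have 2: "eventually (\<lambda>s. norm (l s k) < \<epsilon>) (at 0)"
      by (rule order_tendstoD) (use p in simp)
    obtain \<rho> where \<rho>: "\<rho> > 0" "\<And>s. s \<noteq> 0 \<Longrightarrow> norm s < \<rho> \<Longrightarrow>
        norm (c d (l s)) * B (l s) - norm (c i (l s)) < 0 \<and> norm (l s k) < \<epsilon>"
      using eventually_conj[OF 1 2] unfolding eventually_at by (auto simp: dist_norm)
    obtain s where s: "s \<noteq> 0" "norm s < \<rho>" "W (l s) \<noteq> 0"
      using polfun_generic[OF WA pw \<rho>(1), of p] by (auto simp: l_def)
    then show False using ineq0[OF s(3) _ p(2)] \<rho>(2)[OF s(1,2)] by auto
  qed
  \<comment> \<open>The decisive consequence of the bound: some coefficient is nonzero at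
    \<open>p0\<close>, hence the leading one is nonzero there too.\<close>
  have cd0: "c d p0 \<noteq> 0" using ineq[of p0 i0] i0(1,2) ci0 eps(1) by auto
  \<comment> \<open>In direction \<open>v\<close> the leading coefficient becomes a polynomial in
    \<open>s\<close> of degree at most \<open>e\<close>. By homogeneity its top coefficient is
    \<open>g p\<close>, the value of \<open>c d\<close> at the forms of \<open>p0\<close> and the
    \<open>t\<close> of \<open>p\<close>; so \<open>g\<close> depends on \<open>t\<close> only and
    is nonzero at \<open>t = 0\<close>.\<close>
  define v where "v i = (if i < k then p0 i else 0)" for i
  define g where "g p = c d (\<lambda>i. if i < k then p0 i else p i)" for p
  have gA: "g \<in> polfun {..<Suc k}"
  proof -
    have "(\<lambda>p. if i < k then p0 i else p i) \<in> polfun {..<Suc k}" if "i \<in> {..<Suc k}" for i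
      using that by (cases "i < k") (auto intro: polfun.intros)
    then show ?thesis unfolding g_def[abs_def] by (rule polfun_subst[OF cA])
  qed
  have g0: "g p \<noteq> 0" if "p k = 0" for p
  proof -
    have "g p = c d p0" unfolding g_def by (rule polfun_cong[OF cA]) (use that i0(2) in \<open>auto simp: less_Suc_eq\<close>)
    then show ?thesis using cd0 by simp
  qed
  have g0': "g p0 \<noteq> 0" by (rule g0) (rule i0(2))
  obtain n \<alpha> where \<alpha>: "\<And>l. \<alpha> l \<in> polfun {..<Suc k}" "\<And>p s. c d (\<lambda>i. p i + s * v i) = (\<Sum>l\<le>n. \<alpha> l p * s ^ l)"
    by (rule polfun_shift_expand[OF cA[of d], of v]) (rule that)
  define P where "P p = (\<Sum>l\<le>n. monom (\<alpha> l p) l)" for p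
  have polyP: "poly (P p) s = c d (\<lambda>i. p i + s * v i)" for p s by (simp add: P_def \<alpha>(2) poly_sum poly_monom)
  have PA: "(\<lambda>p. coeff (P p) l) \<in> polfun {..<Suc k}" for l
  proof -
    have "(\<lambda>p. if j = l then \<alpha> j p else 0) \<in> polfun {..<Suc k}" for j
      using \<alpha>(1) by (cases "j = l") (auto intro: polfun.const)
    then show ?thesis unfolding P_def coeff_sum coeff_monom by (intro polfun_sum)
  qed
  have degP: "degree (P p) \<le> e" "coeff (P p) e = g p" for p
  proof -
    obtain Q where Q: "\<And>s. c d (\<lambda>i. poly (if i < k then [:p0 i, p i:] else [:p i:]) s) = poly Q s"
      by (rule polfun_poly[OF cA[of d], where Q = "\<lambda>i. if i < k then [:p0 i, p i:] else [:p i:]"]) (rule that)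
    have r: "poly (P p) s = s ^ e * poly Q (1 / s)" if "s \<noteq> 0" for s
    proof -
      have "(\<lambda>i. p i + s * v i) = scale_coords k s (\<lambda>i. poly (if i < k then [:p0 i, p i:] else [:p i:]) (1 / s))"
        using that by (auto simp: scale_coords_def v_def fun_eq_iff field_simps)
      then show ?thesis by (simp only: polyP hom e_def Q)
    qed
    show "degree (P p) \<le> e" by (rule reversed_poly[OF r])
    have "coeff (P p) e = coeff Q 0" by (rule reversed_poly[OF r])
    also have "\<dots> = poly Q 0" by (simp add: poly_0_coeff_0)
    also have "\<dots> = c d (\<lambda>i. poly (if i < k then [:p0 i, p i:] else [:p i:]) 0)" by (rule Q[symmetric])
    also have "(\<lambda>i. poly (if i < k then [:p0 i, p i:] else [:p i:]) 0) = (\<lambda>i. if i < k then p0 i else p i)" by auto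
    finally show "coeff (P p) e = g p" by (simp add: g_def)
  qed
  \<comment> \<open>\<open>c i\<close> is divided by \<open>c d\<close> along \<open>v\<close>, with
    \<open>g\<close> as leading coefficient of the divisor. Since \<open>ineq\<close> bounds the
    quotient, the division is exact.\<close>
  have div: "\<exists>\<kappa> h. h \<in> polfun {..<Suc k} \<and> (\<forall>p. g p ^ \<kappa> * c i p = h p * c d p)" if i: "i \<le> d" for i
  proof -
    obtain ni \<beta> where \<beta>: "\<And>l. \<beta> l \<in> polfun {..<Suc k}" "\<And>p s. c i (\<lambda>i. p i + s * v i) = (\<Sum>l\<le>ni. \<beta> l p * s ^ l)"
      by (rule polfun_shift_expand[OF cA[of i], of v]) (rule that)
    obtain \<kappa> q r where q: "\<forall>i. q i \<in> polfun {..<Suc k}" and r: "\<forall>i. r i \<in> polfun {..<Suc k}"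
      and eq: "\<forall>p x. coeff (P p) e ^ \<kappa> * (\<Sum>l\<le>ni. \<beta> l p * x ^ l) =
        (\<Sum>l\<le>ni - e. q l p * x ^ l) * (\<Sum>l\<le>e. coeff (P p) l * x ^ l) + (\<Sum>l<e. r l p * x ^ l)"
      using polfun_pseudo_div[of "\<lambda>l p. coeff (P p) l" "{..<Suc k}" \<beta> e ni, OF PA \<beta>(1)]
      by (elim exE conjE) (rule that)
    have eq': "g p ^ \<kappa> * c i (\<lambda>i. p i + x * v i) =
        (\<Sum>l\<le>ni - e. q l p * x ^ l) * c d (\<lambda>i. p i + x * v i) + (\<Sum>l<e. r l p * x ^ l)" for p x
      using eq[rule_format, of p x] by (simp add: degP(2) \<beta>(2) poly_eq_sum_upto[OF degP(1), symmetric] polyP)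
    have r0: "r l p = 0" if "norm (p k) < \<epsilon>" "g p \<noteq> 0" "l < e" for p l
    proof -
      define f where "f = (\<Sum>l\<le>ni. monom (\<beta> l p) l)"
      define R where "R = (\<Sum>l<e. monom (r l p) l)"
      define Q where "Q = (\<Sum>l\<le>ni - e. monom (q l p) l)"
      have pf: "poly f x = c i (\<lambda>i. p i + x * v i)" for x by (simp add: f_def \<beta>(2) poly_sum poly_monom)
      have pR: "poly R x = (\<Sum>l<e. r l p * x ^ l)" for x by (simp add: R_def poly_sum poly_monom)
      have pQ: "poly Q x = (\<Sum>l\<le>ni - e. q l p * x ^ l)" for x by (simp add: Q_def poly_sum poly_monom)
      have P0: "P p \<noteq> 0" using degP(2)[of p] that(2) by auto
      have dP: "degree (P p) = e" using degP[of p] that(2) le_degree[of "P p" e] by auto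
      have "P p dvd f"
      proof (rule bounded_quotient_dvd[OF P0])
        show "continuous_on UNIV (\<lambda>x. B (\<lambda>i. p i + x * v i))" unfolding B_def by (intro continuous_intros)
        fix x
        have "norm (c i (\<lambda>i. p i + x * v i)) \<le> norm (c d (\<lambda>i. p i + x * v i)) * B (\<lambda>i. p i + x * v i)"
          by (rule ineq[OF _ i]) (use that in \<open>simp add: v_def\<close>)
        then show "norm (poly f x) \<le> B (\<lambda>i. p i + x * v i) * norm (poly (P p) x)"
          by (simp add: pf polyP mult.commute)
      qed
      moreover have "R = smult (g p ^ \<kappa>) f - Q * P p"
      proof -
        have "poly R x = poly (smult (g p ^ \<kappa>) f - Q * P p) x" for x
          using eq'[of p x] by (simp add: pf pR pQ polyP)
        then show ?thesis by (simp add: poly_eq_poly_eq_iff[symmetric] fun_eq_iff)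
      qed
      ultimately have "P p dvd R" by (simp add: dvd_smult)
      moreover have "R = 0 \<or> degree R < e"
      proof (cases "e = 0")
        case False
        have "degree R \<le> e - 1"
          unfolding R_def by (intro degree_sum_le) (auto intro: order.trans[OF degree_monom_le])
        then show ?thesis using False by linarith
      qed (simp add: R_def)
      ultimately have "R = 0" using dP dvd_imp_degree_le[of "P p" R] by (metis not_le)
      have "coeff R l = r l p" using that(3) by (simp add: R_def coeff_sum coeff_monom)
      then show ?thesis using \<open>R = 0\<close> by simp
    qed
    \<comment> \<open>The remainder is known to vanish for small \<open>t\<close> outside the zeros
      of \<open>g\<close>. A nonzero value elsewhere would produce one on a line arbitrarily close
      to \<open>p0\<close>, inside this region.\<close>
    have r1: "r l p = 0" if "l < e" for l p
    proof (rule ccontr)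
      assume "r l p \<noteq> 0"
      obtain p1 where p1: "r l p1 * g p1 \<noteq> 0"
        by (rule polfun_nonzero_mult[of "r l" "{..<Suc k}" p g p0]) (use r gA \<open>r l p \<noteq> 0\<close> g0' in auto)
      have rg: "(\<lambda>p. r l p * g p) \<in> polfun {..<Suc k}" using r gA by (intro polfun.mult) auto
      define \<rho> where "\<rho> = \<epsilon> / (norm (p1 k - p0 k) + 1)"
      have \<rho>: "\<rho> > 0" unfolding \<rho>_def using eps(1) by (intro divide_pos_pos add_nonneg_pos) auto
      obtain s where s: "s \<noteq> 0" "norm s < \<rho>"
        "r l (\<lambda>i. p0 i + s * (p1 i - p0 i)) * g (\<lambda>i. p0 i + s * (p1 i - p0 i)) \<noteq> 0"
        by (rule polfun_generic[OF rg p1 \<rho>, of p0]) (rule that)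
      have "norm (p0 k + s * (p1 k - p0 k)) < \<epsilon>"
      proof -
        have "norm s * norm (p1 k - p0 k) \<le> norm s * (norm (p1 k - p0 k) + 1)" by (intro mult_left_mono) auto
        also have "\<dots> < \<rho> * (norm (p1 k - p0 k) + 1)"
          using s(2) by (intro mult_strict_right_mono add_nonneg_pos) auto
        also have "\<dots> = \<epsilon>"
        proof -
          have "norm (p1 k - p0 k) + 1 \<noteq> 0" using norm_ge_zero[of "p1 k - p0 k"] by linarith
          then show ?thesis by (simp add: \<rho>_def)
        qed
        finally show ?thesis by (simp add: i0(2) norm_mult)
      qed
      then show False using r0[of "\<lambda>i. p0 i + s * (p1 i - p0 i)" l] s(3) \<open>l < e\<close> by auto
    qed
    show ?thesis
    proof (intro exI conjI allI)
      show "(\<lambda>p. \<Sum>l\<le>ni - e. q l p * 0 ^ l) \<in> polfun {..<Suc k}"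
        using q by (auto intro!: polfun_intros)
      fix p show "g p ^ \<kappa> * c i p = (\<Sum>l\<le>ni - e. q l p * 0 ^ l) * c d p"
        using eq'[of p 0] r1 by simp
    qed
  qed
  have "\<forall>i. \<exists>\<kappa> h. i \<le> d \<longrightarrow> h \<in> polfun {..<Suc k} \<and> (\<forall>p. g p ^ \<kappa> * c i p = h p * c d p)" using div by blast
  then obtain \<kappa> h where kh0: "\<forall>i. i \<le> d \<longrightarrow> h i \<in> polfun {..<Suc k} \<and> (\<forall>p. g p ^ \<kappa> i * c i p = h i p * c d p)"
    unfolding choice_iff by (elim exE) (rule that)
  then have kh: "\<And>i. i \<le> d \<Longrightarrow> h i \<in> polfun {..<Suc k}" "\<And>i p. i \<le> d \<Longrightarrow> g p ^ \<kappa> i * c i p = h i p * c d p" by auto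
  define \<kappa>s where "\<kappa>s = (\<Sum>i<d. \<kappa> i)"
  have ks: "\<kappa> i \<le> \<kappa>s" if "i < d" for i unfolding \<kappa>s_def using that by (intro member_le_sum) auto
  \<comment> \<open>With the exponents \<open>\<kappa> i\<close> raised to a common
    \<open>\<kappa>s\<close>, this is \<open>g ^ \<kappa>s\<close> times the relation
    \<open>c\<close> divided by its leading coefficient.\<close>
  define q where "q i p = (if i < d then g p ^ (\<kappa>s - \<kappa> i) * h i p else if i = d then g p ^ \<kappa>s else 0)" for i p
  have qA: "q i \<in> polfun {..<Suc k}" for i
    unfolding q_def[abs_def] using gA kh(1)[of i]
    by (cases "i < d"; cases "i = d") (auto intro!: polfun.mult polfun_power polfun.const)
  have qc: "q i p * c d p = g p ^ \<kappa>s * c i p" if "i \<le> d" for i p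
  proof (cases "i < d")
    case True
    have "q i p * c d p = g p ^ (\<kappa>s - \<kappa> i) * (g p ^ \<kappa> i * c i p)" using True kh(2)[of i p] by (simp add: q_def mult.assoc)
    also have "\<dots> = g p ^ \<kappa>s * c i p" using ks[OF True] by (simp flip: power_add mult.assoc)
    finally show ?thesis .
  next
    case False
    then show ?thesis using that by (simp add: q_def)
  qed
  have qrel: "(\<Sum>i\<le>d. q i p * x ^ i) * c d p = g p ^ \<kappa>s * (\<Sum>i\<le>d. c i p * x ^ i)" for p x
    unfolding sum_distrib_left sum_distrib_right
    by (rule sum.cong) (use qc in \<open>auto simp: mult_ac\<close>)
  show ?thesis
  proof (rule that[OF d qA])
    show "q d p \<noteq> 0" if "p k = 0" for p using g0[of p] that by (simp add: q_def)
    show "(\<lambda>p. W p * g p) \<in> polfun {..<Suc k}" by (intro polfun.mult WA gA)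
    show "\<exists>q. W q * g q \<noteq> 0" by (rule polfun_nonzero_mult[OF WA pw gA g0']) auto
  next
    fix b assume b: "b \<in> T"
    have F: "(\<lambda>b. \<Sum>i\<le>d. q i (\<lambda>i. par i b) * \<eta> b ^ i) \<in> polymap"
    proof -
      have "(\<lambda>b. \<eta> b ^ i) \<in> polymap" for i using polymap_prod[of "{..<i}" "\<lambda>_. \<eta>"] \<eta>p by simp
      then show ?thesis by (intro polymap_sum polymap_mult polymap_compose[OF qA] par_polymap)
    qed
    have G: "(\<lambda>b. c d (\<lambda>i. par i b)) \<in> polymap" by (rule polymap_compose[OF cA par_polymap])
    have "\<forall>b\<in>T. (\<Sum>i\<le>d. q i (\<lambda>i. par i b) * \<eta> b ^ i) * c d (\<lambda>i. par i b) = 0"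
      using crel by (simp add: qrel)
    moreover have "\<exists>b\<in>T. c d (\<lambda>i. par i b) \<noteq> 0" using par_indep cd cA unfolding algindep_def by blast
    ultimately have "\<forall>b\<in>T. (\<Sum>i\<le>d. q i (\<lambda>i. par i b) * \<eta> b ^ i) = 0" by (rule irr_cancel[OF irrT F G])
    then show "(\<Sum>i\<le>d. q i (\<lambda>i. par i b) * lin z (\<lambda>j. b (Some j)) ^ i) = 0" using b by (simp add: \<eta>_def)
  next
    fix p \<tau> assume *: "W p * g p \<noteq> 0" "(\<Sum>i\<le>d. q i p * \<tau> ^ i) = 0"
    then have "(\<Sum>i\<le>d. c i p * \<tau> ^ i) = 0" using qrel[of p \<tau>] by simp
    then show "\<exists>b\<in>Vz T. (\<forall>i<Suc k. par i b = p i) \<and> lin z (\<lambda>j. b (Some j)) = \<tau>"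
      using lift'[of p \<tau>] * by (auto simp: W_def \<eta>_def)
  qed
qed

end

subsection \<open>Generic points of the special fibre\<close>

lemma tendsto_meval:
  fixes x :: "'b \<Rightarrow> 'v::finite \<Rightarrow> complex"
  assumes "\<And>v. ((\<lambda>s. x s v) \<longlongrightarrow> l v) F"
  shows "((\<lambda>s. meval (x s) f) \<longlongrightarrow> meval l f) F"
  unfolding meval_def by (intro tendsto_intros assms)

lemma tendsto_polfun:
  assumes "f \<in> polfun A" "\<And>i. ((\<lambda>s. p s i) \<longlongrightarrow> q i) F"
  shows "((\<lambda>s. f (p s)) \<longlongrightarrow> f q) F"
  using assms(1) by (induction rule: polfun.induct) (auto intro: tendsto_intros assms(2))

lemma tendsto_lin: "(\<And>j. ((\<lambda>s. a s j) \<longlongrightarrow> l j) F) \<Longrightarrow> ((\<lambda>s. lin z (a s)) \<longlongrightarrow> lin z l) F"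
  unfolding lin_def by (intro tendsto_intros)

lemma Vz_limit:
  assumes "\<And>v. ((\<lambda>s. b s v) \<longlongrightarrow> l v) F" "eventually (\<lambda>s. b s \<in> Vz S) F" "F \<noteq> bot"
  shows "l \<in> Vz S"
  unfolding Vz_def
proof (intro CollectI ballI)
  fix f assume f: "f \<in> Iv S"
  have "((\<lambda>s. meval (b s) f) \<longlongrightarrow> meval l f) F" by (rule tendsto_meval) (rule assms(1))
  moreover have "eventually (\<lambda>s. meval (b s) f = 0) F"
    using assms(2) by eventually_elim (use f in \<open>auto simp: Vz_def\<close>)
  then have "((\<lambda>s. meval (b s) f) \<longlongrightarrow> 0) F" by (rule tendsto_eventually)
  ultimately show "meval l f = 0" using assms(3) tendsto_unique by blast
qed

lemma norm_vec_le_sum: "norm (v :: complex ^ 'n::finite) \<le> (\<Sum>i\<in>UNIV. norm (v $ i))"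
  unfolding norm_vec_def by (rule L2_set_le_sum) simp

lemma bounded_vec_subsequence:
  fixes a :: "nat \<Rightarrow> 'n::finite \<Rightarrow> complex"
  assumes "\<And>m j. norm (a m j) \<le> R"
  obtains r l where "strict_mono r" "\<And>j. (\<lambda>m. a (r m) j) \<longlonglongrightarrow> l j"
proof -
  define v :: "nat \<Rightarrow> complex ^ 'n" where "v m = (\<chi> j. a m j)" for m
  have "norm (v m) \<le> (\<Sum>i\<in>(UNIV :: 'n set). R)" for m
    by (rule order.trans[OF norm_vec_le_sum], rule sum_mono) (simp add: v_def assms)
  then have "bounded (range v)" unfolding bounded_iff by blast
  then obtain l r where r: "strict_mono r" and l: "(v \<circ> r) \<longlonglongrightarrow> l"
    using bounded_imp_convergent_subsequence by blast
  have "(\<lambda>m. a (r m) j) \<longlonglongrightarrow> l $ j" for j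
    using tendsto_vec_nth[OF l, of j] by (simp add: v_def o_def)
  with r show ?thesis by (rule that)
qed

text \<open>Splits off the power of \<open>t\<close> from a function of the parameters, so that the
  rest does not vanish identically over \<open>t = 0\<close>.\<close>

lemma polfun_extract_coord:
  assumes "f \<in> polfun {..<Suc k}" "f p0 \<noteq> 0"
  obtains i0 g q where "g \<in> polfun {..<Suc k}" "\<And>p. f p = p k ^ i0 * g p" "q k = 0" "g q \<noteq> 0"
proof -
  obtain n a where a: "\<And>i. a i \<in> polfun {..<k}" "\<And>p. f p = (\<Sum>i\<le>n. a i p * p k ^ i)"
    by (rule polfun_expand_Suc[OF assms(1)]) (rule that)
  have ex: "\<exists>i. i \<le> n \<and> (\<exists>q. a i q \<noteq> 0)"
  proof (rule ccontr)
    assume "\<not> ?thesis"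
    then have "f p0 = 0" by (auto simp: a(2))
    then show False using assms(2) by simp
  qed
  define i0 where "i0 = (LEAST i. i \<le> n \<and> (\<exists>q. a i q \<noteq> 0))"
  have i0: "i0 \<le> n" "\<exists>q. a i0 q \<noteq> 0" using LeastI_ex[OF ex] by (auto simp: i0_def)
  have low: "a i p = 0" if "i < i0" for i p
    using not_less_Least[OF that[unfolded i0_def]] that i0(1) by auto
  obtain q where q: "a i0 q \<noteq> 0" using i0(2) by blast
  define g where "g p = (\<Sum>i\<le>n - i0. a (i0 + i) p * p k ^ i)" for p
  show ?thesis
  proof (rule that[of g i0 "q(k := 0)"])
    show "g \<in> polfun {..<Suc k}"
      unfolding g_def[abs_def]
      by (intro polfun_sum polfun.mult polfun_power polfun.coord polfun_mono[OF _ a(1)]) auto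
    show "f p = p k ^ i0 * g p" for p
    proof -
      have "f p = (\<Sum>i\<in>{i0..n}. a i p * p k ^ i)"
        unfolding a(2) by (rule sum.mono_neutral_right) (use low in \<open>auto simp: not_le\<close>)
      also have "\<dots> = (\<Sum>i\<le>n - i0. a (i0 + i) p * p k ^ (i0 + i))"
        by (rule sum.reindex_bij_witness[where i = "\<lambda>i. i0 + i" and j = "\<lambda>i. i - i0"]) (use i0(1) in auto)
      also have "\<dots> = p k ^ i0 * g p" by (simp add: g_def sum_distrib_left power_add mult_ac)
      finally show ?thesis .
    qed
    show "(q(k := 0)) k = 0" by simp
    have "g (q(k := 0)) = (\<Sum>i\<in>{0}. a (i0 + i) (q(k := 0)) * 0 ^ i)"
      unfolding g_def by (rule sum.mono_neutral_cong_right) auto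
    also have "\<dots> = a i0 (q(k := 0))" by simp
    also have "\<dots> = a i0 q" by (rule polfun_cong[OF a(1)]) auto
    finally show "g (q(k := 0)) \<noteq> 0" using q by simp
  qed
qed

context degeneration_parameters
begin

lemma par_None: "par k b = b None"
  by (simp add: par_def)

lemma tendsto_par:
  assumes "\<And>v. ((\<lambda>s. b s v) \<longlongrightarrow> l v) F"
  shows "((\<lambda>s. par i (b s)) \<longlongrightarrow> par i l) F"
  by (cases "i < k") (auto simp: par_def intro!: tendsto_lin assms)

text \<open>A nonzero parameter below \<open>k\<close> excludes the origin, the only point that the
  closure can add over \<open>t \<noteq> 0\<close>.\<close>

lemma degen_member:
  assumes "b \<in> Vz T" "b None \<noteq> 0" "i < k" "par i b \<noteq> 0"
  shows "b \<in> T"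
proof -
  have "\<exists>j. b (Some j) \<noteq> 0"
  proof (rule ccontr)
    assume "\<not> ?thesis"
    then show False using assms(3,4) by (simp add: par_def lin_def)
  qed
  then obtain j where j: "b (Some j) \<noteq> 0" by blast
  have "case_option (b None) (\<lambda>j. b (Some j)) \<in> Vz T" using assms(1) by (simp only: option_fun_eta)
  from Vz_degen_fibre[OF _ this assms(2), of j] have "(\<lambda>j. b (Some j)) \<in> act \<omega> (b None) ` affine_cone X"
    using X j by (auto simp: irreducible_closed_def)
  then obtain x where "x \<in> affine_cone X" "(\<lambda>j. b (Some j)) = act \<omega> (b None) x" by blast
  then show ?thesis
    using assms(2) option_fun_eta[of b] unfolding degen_def by (metis (mono_tags, lifting) mem_Collect_eq)
qed

lemma norm_le_of_par:
  assumes "b \<in> Vz T" "norm (b None) < \<epsilon>"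
  shows "norm (b (Some j)) \<le> C * (\<Sum>i<k. norm (par i b))"
proof -
  have "norm (b (Some j)) \<le> C * (\<Sum>i<k. norm (lin (\<zeta> i) (\<lambda>j. b (Some j))))"
    by (rule bound[of "b None" "\<lambda>j. b (Some j)"]) (use assms(2) in simp, simp only: option_fun_eta assms(1))
  also have "(\<Sum>i<k. norm (lin (\<zeta> i) (\<lambda>j. b (Some j)))) = (\<Sum>i<k. norm (par i b))"
    by (rule sum.cong) (auto simp: par_def)
  finally show ?thesis .
qed

text \<open>A root of the monic relation at \<open>t = 0\<close> extends to roots for small \<open>t\<close>, which lift to points of
  the family; these stay bounded and accumulate at a point of the special fibre.\<close>

lemma special_point_is_limit:
  assumes "d > 0" and cA: "\<And>i. c i \<in> polfun {..<Suc k}" and cd: "c d p \<noteq> 0" and g: "g \<in> polfun {..<Suc k}" "g p \<noteq> 0"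
    and lift: "\<And>t \<tau>. t \<noteq> 0 \<Longrightarrow> g (p(k := t)) \<noteq> 0 \<Longrightarrow> (\<Sum>i\<le>d. c i (p(k := t)) * \<tau> ^ i) = 0 \<Longrightarrow>
      \<exists>b\<in>Vz T. (\<forall>i<Suc k. par i b = (p(k := t)) i) \<and> lin z (\<lambda>j. b (Some j)) = \<tau>"
    and root: "(\<Sum>i\<le>d. c i p * \<tau> ^ i) = 0" and pk: "p k = 0" and nz: "i1 < k" "p i1 \<noteq> 0"
  obtains b where "b \<in> Vz T" "\<And>i. i < Suc k \<Longrightarrow> par i b = p i" "lin z (\<lambda>j. b (Some j)) = \<tau>"
    "\<And>r. r > 0 \<Longrightarrow> \<exists>b'\<in>T. norm (b' None) < r \<and> (\<forall>j. norm (b' (Some j) - b (Some j)) < r)"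
proof -
  \<comment> \<open>The factor \<open>\<epsilon> / 2\<close> keeps the \<open>t m\<close> nonzero
    and within the range of \<open>bound\<close>.\<close>
  define t where "t m = complex_of_real (\<epsilon> / 2 * inverse (real (Suc m)))" for m
  have t0: "t m \<noteq> 0" for m using eps(1) by (simp add: t_def del: of_nat_Suc)
  have tlim: "t \<longlonglongrightarrow> 0"
  proof -
    have "(\<lambda>m. complex_of_real (\<epsilon> / 2 * inverse (real (Suc m)))) \<longlonglongrightarrow> complex_of_real (\<epsilon> / 2 * 0)"
      by (intro tendsto_intros LIMSEQ_inverse_real_of_nat)
    then show ?thesis by (simp add: t_def[abs_def])
  qed
  have te: "norm (t m) < \<epsilon>" for m
  proof -
    have "norm (t m) = \<epsilon> / 2 * inverse (real (Suc m))"
      unfolding t_def norm_of_real using eps(1) by (intro abs_of_pos mult_pos_pos) auto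
    also have "\<dots> \<le> \<epsilon> / 2 * 1" using eps(1) by (intro mult_left_mono) (auto simp: inverse_eq_divide)
    finally show ?thesis using eps(1) by simp
  qed
  have plim: "((\<lambda>m. (p(k := t m)) i) \<longlonglongrightarrow> p i)" for i using tlim pk by (cases "i = k") auto
  have flim: "(\<lambda>m. f (p(k := t m))) \<longlonglongrightarrow> f p" if "f \<in> polfun {..<Suc k}" for f
    using that by (rule tendsto_polfun) (rule plim)
  have ev: "eventually (\<lambda>m. g (p(k := t m)) \<noteq> 0 \<and> c d (p(k := t m)) \<noteq> 0) sequentially"
    using tendsto_imp_eventually_ne[OF flim[OF g(1)] g(2)] tendsto_imp_eventually_ne[OF flim[OF cA] cd]
    by eventually_elim simp
  then obtain M where M: "\<And>m. m \<ge> M \<Longrightarrow> g (p(k := t m)) \<noteq> 0 \<and> c d (p(k := t m)) \<noteq> 0"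
    by (auto simp: eventually_sequentially)
  define q where "q m = p(k := t (m + M))" for m
  have q: "g (q m) \<noteq> 0" "c d (q m) \<noteq> 0" for m using M[of "m + M"] by (auto simp: q_def)
  have qlim: "(\<lambda>m. f (q m)) \<longlonglongrightarrow> f p" if "f \<in> polfun {..<Suc k}" for f
    unfolding q_def by (rule LIMSEQ_ignore_initial_segment[OF flim[OF that]])
  have "\<exists>r. (\<Sum>i\<le>d. c i (q m) * r ^ i) = 0 \<and>
      norm (r - \<tau>) ^ d \<le> norm (\<Sum>i\<le>d. c i (q m) * \<tau> ^ i) / norm (c d (q m))" for m
    by (rule close_root[of "\<lambda>i. c i (q m)" d \<tau>]) (use q(2) \<open>d > 0\<close> in auto)
  then obtain r where r: "\<And>m. (\<Sum>i\<le>d. c i (q m) * r m ^ i) = 0"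
    "\<And>m. norm (r m - \<tau>) ^ d \<le> norm (\<Sum>i\<le>d. c i (q m) * \<tau> ^ i) / norm (c d (q m))" by metis
  have rlim: "r \<longlonglongrightarrow> \<tau>"
  proof -
    have "(\<lambda>m. norm (\<Sum>i\<le>d. c i (q m) * \<tau> ^ i) / norm (c d (q m))) \<longlonglongrightarrow> norm (\<Sum>i\<le>d. c i p * \<tau> ^ i) / norm (c d p)"
      using cd by (intro tendsto_intros qlim cA) auto
    then have "(\<lambda>m. norm (\<Sum>i\<le>d. c i (q m) * \<tau> ^ i) / norm (c d (q m))) \<longlonglongrightarrow> 0" using root by simp
    then have "(\<lambda>m. norm (r m - \<tau>) ^ d) \<longlonglongrightarrow> 0"
      by (rule tendsto_sandwich[rotated 2, OF tendsto_const]) (auto intro!: always_eventually r(2))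
    then have "(\<lambda>m. r m - \<tau>) \<longlonglongrightarrow> 0" by (rule tendsto_power_0D) (rule \<open>d > 0\<close>)
    then show ?thesis by (simp add: LIM_zero_iff)
  qed
  have "\<exists>b\<in>Vz T. (\<forall>i<Suc k. par i b = q m i) \<and> lin z (\<lambda>j. b (Some j)) = r m" for m
    unfolding q_def by (rule lift) (use t0 q(1)[of m] r(1)[of m] in \<open>auto simp: q_def\<close>)
  then obtain b where b: "\<And>m. b m \<in> Vz T" "\<And>m i. i < Suc k \<Longrightarrow> par i (b m) = q m i"
    "\<And>m. lin z (\<lambda>j. b m (Some j)) = r m" by metis
  have bN: "b m None = t (m + M)" for m using b(2)[of k m] by (simp add: par_None q_def)
  have bT: "b m \<in> T" for m
    by (rule degen_member[OF b(1) _ nz(1)]) (use t0 bN b(2)[of i1 m] nz in \<open>auto simp: q_def\<close>)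
  have bd: "norm (b m (Some j)) \<le> C * (\<Sum>i<k. norm (p i))" for m j
  proof -
    have "norm (b m (Some j)) \<le> C * (\<Sum>i<k. norm (par i (b m)))"
      by (rule norm_le_of_par[OF b(1)]) (simp add: bN te)
    also have "(\<Sum>i<k. norm (par i (b m))) = (\<Sum>i<k. norm (p i))"
      by (rule sum.cong) (auto simp: b(2) q_def)
    finally show ?thesis .
  qed
  obtain s l where s: "strict_mono s" and l: "\<And>j. (\<lambda>m. b (s m) (Some j)) \<longlonglongrightarrow> l j"
    by (rule bounded_vec_subsequence[of "\<lambda>m j. b m (Some j)", OF bd]) (rule that)
  have slim: "(\<lambda>m. f (s m)) \<longlonglongrightarrow> x" if "f \<longlonglongrightarrow> x" for f :: "nat \<Rightarrow> complex" and x
    using LIMSEQ_subseq_LIMSEQ[OF that s] by (simp add: o_def)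
  define b0 where "b0 = case_option 0 l"
  have tl: "(\<lambda>m. t (m + M)) \<longlonglongrightarrow> 0" by (rule LIMSEQ_ignore_initial_segment[OF tlim])
  have blim: "(\<lambda>m. b (s m) v) \<longlonglongrightarrow> b0 v" for v
  proof (cases v)
    case None
    then show ?thesis using slim[OF tl] by (simp add: b0_def bN)
  next
    case (Some j)
    then show ?thesis using l by (simp add: b0_def)
  qed
  show ?thesis
  proof (rule that)
    show "b0 \<in> Vz T" by (rule Vz_limit[OF blim]) (use b(1) in auto)
    show "par i b0 = p i" if "i < Suc k" for i
    proof -
      have "(\<lambda>m. par i (b (s m))) \<longlonglongrightarrow> par i b0" by (rule tendsto_par) (rule blim)
      moreover have "(\<lambda>m. q m i) \<longlonglongrightarrow> p i" unfolding q_def by (rule LIMSEQ_ignore_initial_segment[OF plim])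
      then have "(\<lambda>m. par i (b (s m))) \<longlonglongrightarrow> p i" using slim that by (simp add: b(2))
      ultimately show ?thesis by (rule LIMSEQ_unique)
    qed
    have "(\<lambda>m. lin z (\<lambda>j. b (s m) (Some j))) \<longlonglongrightarrow> lin z (\<lambda>j. b0 (Some j))" by (rule tendsto_lin) (rule blim)
    moreover have "(\<lambda>m. lin z (\<lambda>j. b (s m) (Some j))) \<longlonglongrightarrow> \<tau>" using slim[OF rlim] by (simp add: b(3))
    ultimately show "lin z (\<lambda>j. b0 (Some j)) = \<tau>" by (rule LIMSEQ_unique)
    fix \<rho> :: real assume "\<rho> > 0"
    have b0N: "b0 None = 0" by (simp add: b0_def)
    have "eventually (\<lambda>m. \<forall>v. norm (b (s m) v - b0 v) < \<rho>) sequentially"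
      unfolding dist_norm[symmetric] by (intro eventually_all_finite tendstoD[OF blim \<open>\<rho> > 0\<close>])
    then obtain m where "\<forall>v. norm (b (s m) v - b0 v) < \<rho>" by (auto simp: eventually_sequentially)
    then show "\<exists>b'\<in>T. norm (b' None) < \<rho> \<and> (\<forall>j. norm (b' (Some j) - b0 (Some j)) < \<rho>)"
      using bT[of "s m"] by (intro bexI[of _ "b (s m)"]) (auto dest: spec[of _ "Some _"] spec[of _ None] simp: b0N)
  qed
qed

text \<open>Each coordinate satisfies a relation over the parameters whose leading coefficient has
  no zero at \<open>t = 0\<close>, so it takes finitely many values.\<close>

lemma special_fibre_finite:
  "finite {a \<in> fibre_cone \<omega> (affine_cone X) 0. \<forall>i<k. lin (\<zeta> i) a = lin (\<zeta> i) y}" (is "finite ?F")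
proof -
  have "finite ((\<lambda>a. a j) ` ?F)" for j
  proof -
    define z where "z i = (if i = j then 1 else 0 :: complex)" for i
    have linz: "lin z a = a j" for a by (simp add: lin_def z_def if_distrib[where f = "\<lambda>x. x * _"] cong: if_cong)
    obtain d c where d: "d > 0" and cA: "\<And>i. c i \<in> polfun {..<Suc k}" and cd: "\<And>p. p k = 0 \<Longrightarrow> c d p \<noteq> 0"
      and rel: "\<And>b. b \<in> T \<Longrightarrow> (\<Sum>i\<le>d. c i (\<lambda>i. par i b) * lin z (\<lambda>j. b (Some j)) ^ i) = 0"
      by (rule monic_relation[of z]) (rule that)
    define p where "p i = par i (case_option 0 y)" for i
    have pk: "p k = 0" by (simp add: p_def par_None)
    define P where "P = (\<Sum>i\<le>d. monom (c i p) i)"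
    have "coeff P d = c d p" by (simp add: P_def coeff_sum coeff_monom)
    then have "P \<noteq> 0" using cd[of p] pk by auto
    moreover have "(\<lambda>a. a j) ` ?F \<subseteq> {x. poly P x = 0}"
    proof clarify
      fix a assume a: "a \<in> fibre_cone \<omega> (affine_cone X) 0" "\<forall>i<k. lin (\<zeta> i) a = lin (\<zeta> i) y"
      have F: "(\<lambda>b. \<Sum>i\<le>d. c i (\<lambda>i. par i b) * lin z (\<lambda>j. b (Some j)) ^ i) \<in> polymap"
      proof -
        have "(\<lambda>b. lin z (\<lambda>j. b (Some j)) ^ i) \<in> polymap" for i
          using polymap_prod[of "{..<i}" "\<lambda>_ b. lin z (\<lambda>j. b (Some j))"] lin_Some_polymap[of z] by simp
        then show ?thesis by (intro polymap_sum polymap_mult polymap_compose[OF cA] par_polymap)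
      qed
      have "case_option 0 a \<in> Vz T" using a(1) by (simp add: fibre_cone_def)
      from polymap_vanish_Vz[OF F rel this]
      have "(\<Sum>i\<le>d. c i (\<lambda>i. par i (case_option 0 a)) * a j ^ i) = 0" by (simp add: linz)
      moreover have "c i (\<lambda>i. par i (case_option 0 a)) = c i p" for i
        by (rule polfun_cong[OF cA]) (use a(2) in \<open>auto simp: p_def par_case_option\<close>)
      ultimately show "poly P (a j) = 0" by (simp add: P_def poly_sum poly_monom)
    qed
    ultimately show ?thesis using poly_roots_finite finite_subset by blast
  qed
  then have "finite (PiE UNIV (\<lambda>j. (\<lambda>a. a j) ` ?F))" by (intro finite_PiE) auto
  then show ?thesis by (rule finite_subset[rotated]) (auto simp: PiE_UNIV_domain)
qed

text \<open>The parameters of \<open>y\<close> are moved slightly, keeping \<open>t = 0\<close>, to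
  avoid the zeros of \<open>g\<close>; points over the moved parameters are limits of the family. To
  make these points return to \<open>y\<close> and not to another point over the same parameters, a
  linear form \<open>z\<close> separating \<open>y\<close> from the others is followed as
  well.\<close>

lemma generic_special_point:
  assumes y: "y \<in> fibre_cone \<omega> (affine_cone X) 0" and \<delta>: "\<delta> \<in> polymap" "\<exists>b\<in>T. \<delta> b \<noteq> 0" and "e > 0"
  obtains y' \<rho> where "y' \<in> fibre_cone \<omega> (affine_cone X) 0" "\<And>j. norm (y' j - y j) < e" "\<rho> > 0"
    "\<And>b. b \<in> T \<Longrightarrow> norm (b None) < \<rho> \<Longrightarrow> \<forall>j. norm (b (Some j) - y' j) < \<rho> \<Longrightarrow> \<delta> b \<noteq> 0"
    "\<And>r. r > 0 \<Longrightarrow> \<exists>b\<in>T. norm (b None) < r \<and> (\<forall>j. norm (b (Some j) - y' j) < r)"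
proof -
  define F where "F = {a \<in> fibre_cone \<omega> (affine_cone X) 0. \<forall>i<k. lin (\<zeta> i) a = lin (\<zeta> i) y}"
  have "finite F" unfolding F_def by (rule special_fibre_finite)
  have "\<exists>z. \<forall>v\<in>(\<lambda>a i. a i - y i) ` (F - {y}). lin z v \<noteq> 0"
    by (rule linear_form_avoiding) (use \<open>finite F\<close> in \<open>auto simp: fun_eq_iff\<close>)
  then obtain z where z: "\<And>a. a \<in> F \<Longrightarrow> a \<noteq> y \<Longrightarrow> lin z (\<lambda>i. a i - y i) \<noteq> 0" by auto
  obtain d c N where d: "d > 0" and cA: "\<And>i. c i \<in> polfun {..<Suc k}" and cd: "\<And>p. p k = 0 \<Longrightarrow> c d p \<noteq> 0"
    and N: "N \<in> polfun {..<Suc k}" "\<exists>q. N q \<noteq> 0"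
    and rel: "\<And>b. b \<in> T \<Longrightarrow> (\<Sum>i\<le>d. c i (\<lambda>i. par i b) * lin z (\<lambda>j. b (Some j)) ^ i) = 0"
    and lift: "\<And>p \<tau>. N p \<noteq> 0 \<Longrightarrow> (\<Sum>i\<le>d. c i p * \<tau> ^ i) = 0 \<Longrightarrow>
      \<exists>b\<in>Vz T. (\<forall>i<Suc k. par i b = p i) \<and> lin z (\<lambda>j. b (Some j)) = \<tau>"
    by (rule monic_relation[of z]) (rule that)
  obtain N2 G where N2: "N2 \<in> polfun {..<Suc k}" "\<exists>q. N2 q \<noteq> 0" and G: "\<And>b. b \<in> T \<Longrightarrow> N2 (\<lambda>i. par i b) = G b * \<delta> b"
    by (rule nonzero_multiple_in_parameters[OF irrT par_polymap \<delta> par_indep par_dep[OF \<delta>(1)]]) (rule that)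
  obtain q1 q2 where "N q1 \<noteq> 0" "N2 q2 \<noteq> 0" using N(2) N2(2) by blast
  then obtain q0 where "N q0 \<noteq> 0" "N2 q0 \<noteq> 0" by (rule polfun_nonzero_mult[OF N(1) _ N2(1)])
  then have q0: "N q0 * N2 q0 \<noteq> 0" by simp
  \<comment> \<open>\<open>N\<close> is the obstruction to lifting and \<open>N2\<close> a multiple
    of \<open>\<delta>\<close> on \<open>T\<close>. Powers of \<open>t\<close> in them are harmless
    for \<open>t \<noteq> 0\<close>; the remaining factor \<open>g\<close> is nonzero at some point
    over \<open>t = 0\<close>.\<close>
  obtain i0 g q where g: "g \<in> polfun {..<Suc k}" and gN: "\<And>p. N p * N2 p = p k ^ i0 * g p" and q: "q k = 0" "g q \<noteq> 0"
    by (rule polfun_extract_coord[OF polfun.mult[OF N(1) N2(1)] q0]) (rule that)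
  define p0 where "p0 i = par i (case_option 0 y)" for i
  have p0k: "p0 k = 0" by (simp add: p0_def par_None)
  obtain i1 where i1: "i1 < k" "p0 i1 \<noteq> 0"
    using cut y by (auto simp: cut_out_def p0_def par_case_option)
  define l where "l s = (\<lambda>i. p0 i + s * (q i - p0 i))" for s
  have lk: "l s k = 0" for s by (simp add: l_def p0k q(1))
  have "\<exists>s. s \<noteq> 0 \<and> norm s < inverse (real (Suc m)) \<and> g (l s) \<noteq> 0" for m
    unfolding l_def by (rule polfun_generic[OF g q(2), of "inverse (real (Suc m))" p0]) auto
  then obtain s where s: "\<And>m. s m \<noteq> 0 \<and> norm (s m) < inverse (real (Suc m)) \<and> g (l (s m)) \<noteq> 0" by metis
  have slim: "s \<longlonglongrightarrow> 0"
    by (rule Lim_null_comparison[OF _ LIMSEQ_inverse_real_of_nat]) (use s in \<open>auto intro!: always_eventually simp: less_imp_le\<close>)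
  have llim: "(\<lambda>m. l (s m) i) \<longlonglongrightarrow> p0 i" for i
  proof -
    have "(\<lambda>m. p0 i + s m * (q i - p0 i)) \<longlonglongrightarrow> p0 i + 0 * (q i - p0 i)" by (intro tendsto_intros slim)
    then show ?thesis by (simp add: l_def)
  qed
  have "eventually (\<lambda>m. l (s m) i1 \<noteq> 0) sequentially" by (rule tendsto_imp_eventually_ne[OF llim i1(2)])
  then obtain M where M: "\<And>m. m \<ge> M \<Longrightarrow> l (s m) i1 \<noteq> 0" by (auto simp: eventually_sequentially)
  define w where "w m = l (s (m + M))" for m
  have wlim: "(\<lambda>m. w m i) \<longlonglongrightarrow> p0 i" for i unfolding w_def by (rule LIMSEQ_ignore_initial_segment[OF llim])
  have wk: "w m k = 0" and w1: "w m i1 \<noteq> 0" and gw: "g (w m) \<noteq> 0" for m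
    using lk M s by (auto simp: w_def)
  define \<tau>0 where "\<tau>0 = lin z y"
  have root0: "(\<Sum>i\<le>d. c i p0 * \<tau>0 ^ i) = 0"
  proof -
    have F: "(\<lambda>b. \<Sum>i\<le>d. c i (\<lambda>i. par i b) * lin z (\<lambda>j. b (Some j)) ^ i) \<in> polymap"
    proof -
      have "(\<lambda>b. lin z (\<lambda>j. b (Some j)) ^ i) \<in> polymap" for i
        using polymap_prod[of "{..<i}" "\<lambda>_ b. lin z (\<lambda>j. b (Some j))"] lin_Some_polymap[of z] by simp
      then show ?thesis by (intro polymap_sum polymap_mult polymap_compose[OF cA] par_polymap)
    qed
    have "case_option 0 y \<in> Vz T" using y by (simp add: fibre_cone_def)
    from polymap_vanish_Vz[OF F rel this] show ?thesis by (simp add: p0_def[abs_def] \<tau>0_def)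
  qed
  have "\<exists>r. (\<Sum>i\<le>d. c i (w m) * r ^ i) = 0 \<and>
      norm (r - \<tau>0) ^ d \<le> norm (\<Sum>i\<le>d. c i (w m) * \<tau>0 ^ i) / norm (c d (w m))" for m
    by (rule close_root[of "\<lambda>i. c i (w m)" d \<tau>0]) (use cd wk d in auto)
  then obtain r where r: "\<And>m. (\<Sum>i\<le>d. c i (w m) * r m ^ i) = 0"
    "\<And>m. norm (r m - \<tau>0) ^ d \<le> norm (\<Sum>i\<le>d. c i (w m) * \<tau>0 ^ i) / norm (c d (w m))" by metis
  have rlim: "r \<longlonglongrightarrow> \<tau>0"
  proof -
    have "(\<lambda>m. norm (\<Sum>i\<le>d. c i (w m) * \<tau>0 ^ i) / norm (c d (w m))) \<longlonglongrightarrow> norm (\<Sum>i\<le>d. c i p0 * \<tau>0 ^ i) / norm (c d p0)"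
      using cd p0k by (intro tendsto_intros tendsto_polfun[OF cA] wlim) auto
    then have "(\<lambda>m. norm (\<Sum>i\<le>d. c i (w m) * \<tau>0 ^ i) / norm (c d (w m))) \<longlonglongrightarrow> 0" using root0 by simp
    then have "(\<lambda>m. norm (r m - \<tau>0) ^ d) \<longlonglongrightarrow> 0"
      by (rule tendsto_sandwich[rotated 2, OF tendsto_const]) (auto intro!: always_eventually r(2))
    then have "(\<lambda>m. r m - \<tau>0) \<longlonglongrightarrow> 0" by (rule tendsto_power_0D) (rule d)
    then show ?thesis by (simp add: LIM_zero_iff)
  qed
  have "\<exists>b. b \<in> Vz T \<and> (\<forall>i<Suc k. par i b = w m i) \<and> lin z (\<lambda>j. b (Some j)) = r m \<and>
    (\<forall>r>0. \<exists>b'\<in>T. norm (b' None) < r \<and> (\<forall>j. norm (b' (Some j) - b (Some j)) < r))" for m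
  proof -
    have lift': "\<exists>b\<in>Vz T. (\<forall>i<Suc k. par i b = ((w m)(k := t)) i) \<and> lin z (\<lambda>j. b (Some j)) = \<tau>"
      if "t \<noteq> 0" "g ((w m)(k := t)) \<noteq> 0" "(\<Sum>i\<le>d. c i ((w m)(k := t)) * \<tau> ^ i) = 0" for t \<tau>
    proof -
      have "N ((w m)(k := t)) \<noteq> 0" using gN[of "(w m)(k := t)"] that(1,2) by auto
      then show ?thesis using lift that(3) by blast
    qed
    have cdw: "c d (w m) \<noteq> 0" by (rule cd) (rule wk)
    obtain b where "b \<in> Vz T" "\<And>i. i < Suc k \<Longrightarrow> par i b = w m i" "lin z (\<lambda>j. b (Some j)) = r m"
      "\<And>r. r > 0 \<Longrightarrow> \<exists>b'\<in>T. norm (b' None) < r \<and> (\<forall>j. norm (b' (Some j) - b (Some j)) < r)"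
      by (rule special_point_is_limit[OF d cA cdw g gw lift' r(1) wk i1(1) w1]) (assumption+, rule that)
    then show ?thesis by blast
  qed
  then have "\<exists>B. \<forall>m. B m \<in> Vz T \<and> (\<forall>i<Suc k. par i (B m) = w m i) \<and> lin z (\<lambda>j. B m (Some j)) = r m \<and>
    (\<forall>r>0. \<exists>b'\<in>T. norm (b' None) < r \<and> (\<forall>j. norm (b' (Some j) - B m (Some j)) < r))"
    by (intro choice allI)
  then obtain B where B: "\<And>m. B m \<in> Vz T" "\<And>m i. i < Suc k \<Longrightarrow> par i (B m) = w m i"
    "\<And>m. lin z (\<lambda>j. B m (Some j)) = r m"
    "\<And>m r. r > 0 \<Longrightarrow> \<exists>b'\<in>T. norm (b' None) < r \<and> (\<forall>j. norm (b' (Some j) - B m (Some j)) < r)" by blast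
  have BN: "B m None = 0" for m using B(2)[of k m] by (simp add: par_None wk)
  have "Bseq (\<lambda>m. w m i)" for i using wlim[of i] by (intro convergent_imp_Bseq convergentI)
  then have "\<exists>K. \<forall>m. norm (w m i) \<le> K" for i by (auto simp: Bseq_def)
  then obtain K where K: "\<And>i m. norm (w m i) \<le> K i" by metis
  have bd: "norm (B m (Some j)) \<le> C * (\<Sum>i<k. K i)" for m j
  proof -
    have "norm (B m (Some j)) \<le> C * (\<Sum>i<k. norm (par i (B m)))"
      by (rule norm_le_of_par[OF B(1)]) (simp add: BN eps)
    also have "\<dots> \<le> C * (\<Sum>i<k. K i)" using K eps(3) by (intro mult_left_mono sum_mono) (auto simp: B(2))
    finally show ?thesis .
  qed
  obtain \<sigma> Y where \<sigma>: "strict_mono \<sigma>" and Y: "\<And>j. (\<lambda>m. B (\<sigma> m) (Some j)) \<longlonglongrightarrow> Y j"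
    by (rule bounded_vec_subsequence[of "\<lambda>m j. B m (Some j)", OF bd]) (rule that)
  have \<sigma>lim: "(\<lambda>m. f (\<sigma> m)) \<longlonglongrightarrow> x" if "f \<longlonglongrightarrow> x" for f :: "nat \<Rightarrow> complex" and x
    using LIMSEQ_subseq_LIMSEQ[OF that \<sigma>] by (simp add: o_def)
  have Blim: "(\<lambda>m. B (\<sigma> m) v) \<longlonglongrightarrow> case_option 0 Y v" for v
    using Y by (cases v) (auto simp: BN)
  have parY: "par i (case_option 0 Y) = p0 i" if "i < Suc k" for i
  proof -
    have "(\<lambda>m. par i (B (\<sigma> m))) \<longlonglongrightarrow> par i (case_option 0 Y)" by (rule tendsto_par) (rule Blim)
    moreover have "(\<lambda>m. par i (B (\<sigma> m))) \<longlonglongrightarrow> p0 i" using \<sigma>lim[OF wlim[of i]] that by (simp add: B(2))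
    ultimately show ?thesis by (rule LIMSEQ_unique)
  qed
  have "lin z Y = \<tau>0"
  proof -
    have "(\<lambda>m. lin z (\<lambda>j. B (\<sigma> m) (Some j))) \<longlonglongrightarrow> lin z Y" by (rule tendsto_lin) (rule Y)
    moreover have "(\<lambda>m. lin z (\<lambda>j. B (\<sigma> m) (Some j))) \<longlonglongrightarrow> \<tau>0" using \<sigma>lim[OF rlim] by (simp add: B(3))
    ultimately show ?thesis by (rule LIMSEQ_unique)
  qed
  moreover have "Y \<in> F"
  proof -
    have "case_option 0 Y \<in> Vz T" by (rule Vz_limit[OF Blim]) (use B(1) in auto)
    moreover have "\<exists>i. Y i \<noteq> 0"
    proof (rule ccontr)
      assume "\<not> ?thesis"
      then have "par i1 (case_option 0 Y) = 0" using i1(1) by (simp add: par_case_option lin_def)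
      then show False using parY[of i1] i1 by simp
    qed
    moreover have "lin (\<zeta> i) Y = lin (\<zeta> i) y" if "i < k" for i
      using parY[of i] that by (simp add: p0_def par_case_option)
    ultimately show ?thesis by (simp add: F_def fibre_cone_def)
  qed
  \<comment> \<open>The limit lies over the parameters of \<open>y\<close> and has the same value
    under \<open>z\<close>, which by choice of \<open>z\<close> identifies it.\<close>
  ultimately have "Y = y"
    using z[of Y] by (auto simp: lin_def \<tau>0_def right_diff_distrib sum_subtractf)
  have "eventually (\<lambda>m. \<forall>j. norm (B (\<sigma> m) (Some j) - Y j) < e) sequentially"
    unfolding dist_norm[symmetric] by (intro eventually_all_finite tendstoD[OF Y \<open>e > 0\<close>])
  then obtain m where m: "\<forall>j. norm (B (\<sigma> m) (Some j) - Y j) < e"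
    by (auto simp: eventually_sequentially)
  define b0 where "b0 = B (\<sigma> m)"
  define y' where "y' j = b0 (Some j)" for j
  have b0: "case_option 0 y' = b0" using option_fun_eta[of b0] BN[of "\<sigma> m"] by (simp add: y'_def[abs_def] b0_def)
  have gb0: "g (\<lambda>i. par i b0) \<noteq> 0"
  proof -
    have "g (\<lambda>i. par i b0) = g (w (\<sigma> m))" by (rule polfun_cong[OF g]) (auto simp: b0_def B(2))
    then show ?thesis using gw by simp
  qed
  define h where "h x = g (\<lambda>i. par i (case_option (snd x) (\<lambda>j. fst x $ j)))" for x :: "(complex ^ 'n) \<times> complex"
  have "(\<lambda>b. g (\<lambda>i. par i b)) \<in> polymap" by (rule polymap_compose[OF g par_polymap])
  then obtain G' where "(\<lambda>b. g (\<lambda>i. par i b)) = (\<lambda>b. meval b G')" by (auto simp: polymap_def)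
  then have "h x = meval (case_option (snd x) (\<lambda>i. fst x $ i)) G'" for x unfolding h_def by meson
  then have "continuous_on UNIV h" using continuous_case_option[of UNIV G'] by simp
  then have "h \<midarrow>((\<chi> j. y' j), 0)\<rightarrow> h ((\<chi> j. y' j), 0)" by (simp add: continuous_on_eq_continuous_at isCont_def)
  moreover have h0: "h ((\<chi> j. y' j), 0) \<noteq> 0" using gb0 by (simp add: h_def b0)
  ultimately have "eventually (\<lambda>x. h x \<noteq> 0) (at ((\<chi> j. y' j), 0))" by (rule tendsto_imp_eventually_ne)
  then obtain \<rho>1 where \<rho>1: "\<rho>1 > 0" "\<And>x. dist x ((\<chi> j. y' j), 0) < \<rho>1 \<Longrightarrow> h x \<noteq> 0"
    using h0 unfolding eventually_at by (metis UNIV_I)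
  \<comment> \<open>The distances in \<open>CARD('n)\<close> coordinates and in \<open>t\<close> add
    up, hence the divisor.\<close>
  define \<rho> where "\<rho> = \<rho>1 / (real CARD('n) + 1)"
  show ?thesis
  proof (rule that)
    have "\<exists>i. y' i \<noteq> 0"
    proof (rule ccontr)
      assume "\<not> ?thesis"
      then have "par i1 b0 = 0" using i1(1) by (simp add: y'_def par_def lin_def)
      then show False using B(2)[of i1 "\<sigma> m"] i1 w1 by (simp add: b0_def)
    qed
    then show "y' \<in> fibre_cone \<omega> (affine_cone X) 0" using B(1)[of "\<sigma> m"] by (simp add: fibre_cone_def b0 b0_def)
    show "norm (y' j - y j) < e" for j using m by (simp add: y'_def b0_def \<open>Y = y\<close>)
    show "\<rho> > 0" using \<rho>1(1) by (simp add: \<rho>_def add_pos_nonneg)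
    show "\<exists>b\<in>T. norm (b None) < r \<and> (\<forall>j. norm (b (Some j) - y' j) < r)" if "r > 0" for r
      using B(4)[OF that, of "\<sigma> m"] by (simp add: y'_def b0_def)
    fix b assume b: "b \<in> T" "norm (b None) < \<rho>" "\<forall>j. norm (b (Some j) - y' j) < \<rho>"
    define x where "x = ((\<chi> j. b (Some j)) :: complex ^ 'n, b None)"
    have "dist x ((\<chi> j. y' j), 0) \<le> dist (fst x) (\<chi> j. y' j) + dist (snd x) 0"
      unfolding dist_prod_def by (simp add: sqrt_sum_squares_le_sum)
    also have "\<dots> \<le> (\<Sum>j\<in>UNIV. norm (b (Some j) - y' j)) + norm (b None)"
      using norm_vec_le_sum[of "fst x - (\<chi> j. y' j)"] by (simp add: x_def dist_norm)
    also have "\<dots> < (\<Sum>j\<in>(UNIV :: 'n set). \<rho>) + \<rho>"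
      using b by (intro add_le_less_mono sum_mono) (auto simp: less_imp_le)
    also have "\<dots> = (real CARD('n) + 1) * \<rho>" by (simp add: algebra_simps)
    also have "\<dots> = \<rho>1"
    proof -
      have "real CARD('n) + 1 \<noteq> 0" by linarith
      then show ?thesis by (simp add: \<rho>_def)
    qed
    finally have "h x \<noteq> 0" by (rule \<rho>1(2))
    then have "g (\<lambda>i. par i b) \<noteq> 0" by (simp add: h_def x_def option_fun_eta)
    then have "N (\<lambda>i. par i b) * N2 (\<lambda>i. par i b) \<noteq> 0" using gN T_None[OF b(1)] by (simp add: par_None)
    then show "\<delta> b \<noteq> 0" using G[OF b(1)] by auto
  qed
qed

end

subsection \<open>Limits of conormal vectors\<close>

text \<open>Moving in direction \<open>- cnj D\<close> changes \<open>Re h\<close> at the rate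
  \<open>- (norm D)\<^sup>2\<close>, while \<open>e\<close> is of smaller order; a minimum at 0
  therefore forces \<open>D = 0\<close>.\<close>

lemma complex_derivative_zero_at_min:
  fixes h :: "complex \<Rightarrow> complex" and e :: "complex \<Rightarrow> real"
  assumes h: "(h has_field_derivative D) (at 0)" and e: "((\<lambda>s. of_real (e s) / s) \<longlongrightarrow> 0) (at 0)"
    and min: "eventually (\<lambda>s. 0 \<le> Re (h s - h 0) + e s) (at 0)"
  shows "D = 0"
proof (rule ccontr)
  assume D: "D \<noteq> 0"
  define l where "l \<tau> = - (complex_of_real \<tau> * cnj D)" for \<tau>
  have "(l \<longlongrightarrow> - (complex_of_real 0 * cnj D)) (at_right 0)" unfolding l_def by (intro tendsto_intros)
  moreover have "eventually (\<lambda>\<tau>. l \<tau> \<noteq> 0) (at_right 0)"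
    unfolding eventually_at_right_field l_def using D by (intro exI[of _ 1]) auto
  ultimately have l: "filterlim l (at 0) (at_right 0)" by (simp add: filterlim_at)
  have "((\<lambda>s. (h s - h 0) / s) \<longlongrightarrow> D) (at 0)" using h by (simp add: has_field_derivative_iff)
  from filterlim_compose[OF this l] filterlim_compose[OF e l]
  have "((\<lambda>\<tau>. Re ((h (l \<tau>) - h 0) / l \<tau> * - cnj D + of_real (e (l \<tau>)) / l \<tau> * - cnj D)) \<longlongrightarrow> Re (D * - cnj D + 0 * - cnj D)) (at_right 0)"
    by (intro tendsto_intros)
  moreover have "eventually (\<lambda>\<tau>. 0 \<le> Re ((h (l \<tau>) - h 0) / l \<tau> * - cnj D + of_real (e (l \<tau>)) / l \<tau> * - cnj D)) (at_right 0)"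
    using eventually_compose_filterlim[OF min l] eventually_at_right_less[of 0]
  proof eventually_elim
    case (elim \<tau>)
    have "x / l \<tau> * - cnj D = x / of_real \<tau>" for x using D elim(2) by (simp add: l_def field_simps)
    then have "Re ((h (l \<tau>) - h 0) / l \<tau> * - cnj D + of_real (e (l \<tau>)) / l \<tau> * - cnj D) =
        (Re (h (l \<tau>) - h 0) + e (l \<tau>)) / \<tau>"
      by (simp only: plus_complex.simps Re_divide_of_real Re_complex_of_real add_divide_distrib)
    then show ?case using elim by simp
  qed
  ultimately have "0 \<le> Re (D * - cnj D + 0 * - cnj D)"
    by (rule tendsto_lowerbound) (simp add: trivial_limit_at_right_real)
  also have "\<dots> = - (norm D)\<^sup>2" unfolding cmod_power2 by (simp add: power2_eq_square)
  finally show False using D by simp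
qed

lemma norm_add_power2: "(norm (d + w))\<^sup>2 = (norm d)\<^sup>2 + 2 * Re (cnj d * w) + (norm (w :: complex))\<^sup>2"
  unfolding cmod_power2 by (simp add: power2_eq_square algebra_simps)

text \<open>Besides smoothness it records that tangent vectors are velocities of curves in the
  fibre, since the minimum is exploited along such curves.\<close>

definition smooth_fibre_point :: "'n::finite proj set \<Rightarrow> ('n \<Rightarrow> int) \<Rightarrow> complex \<Rightarrow> ('n \<Rightarrow> complex) \<Rightarrow> bool" where
  "smooth_fibre_point X \<omega> t x \<longleftrightarrow> vec.dim (TS (act \<omega> t ` affine_cone X) x) = ndim (affine_cone X) \<and>
     (\<forall>v\<in>TS (act \<omega> t ` affine_cone X) x. \<exists>\<gamma>. \<gamma> 0 = x \<and> eventually (\<lambda>s. \<gamma> s \<in> act \<omega> t ` affine_cone X) (nhds 0) \<and>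
       (\<forall>u. ((\<lambda>s. \<gamma> s u) has_field_derivative v $ u) (at 0)))"

lemma degen_caseD:
  assumes "case_option t x \<in> degen \<omega> S"
  shows "t \<noteq> 0" "x \<in> act \<omega> t ` S"
proof -
  obtain t' a where *: "case_option t x = case_option t' (act \<omega> t' a)" "t' \<noteq> 0" "a \<in> S"
    using assms unfolding degen_def by blast
  have "t = t'" using fun_cong[OF *(1), of None] by simp
  moreover have "x = act \<omega> t' a" using fun_cong[OF *(1), of "Some _"] by auto
  ultimately show "t \<noteq> 0" "x \<in> act \<omega> t ` S" using * by auto
qed

lemma degen_caseI: "t \<noteq> 0 \<Longrightarrow> x \<in> act \<omega> t ` S \<Longrightarrow> case_option t x \<in> degen \<omega> S"
  by (auto simp: degen_def)

text \<open>The function \<open>\<delta>\<close> of \<open>X\<close> is extended to the total space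
  by its weight homogenization, which on the orbits equals \<open>\<delta>\<close> up to a power of
  \<open>t\<close>; smoothness is transported by the torus.\<close>

lemma smooth_fibre_points:
  assumes X: "irreducible_closed zariski1 X"
  obtains \<delta> where "\<delta> \<in> polymap" "\<exists>b\<in>degen \<omega> (affine_cone X). \<delta> b \<noteq> 0"
    "\<And>t x. case_option t x \<in> degen \<omega> (affine_cone X) \<Longrightarrow> \<delta> (case_option t x) \<noteq> 0 \<Longrightarrow> smooth_fibre_point X \<omega> t x"
proof -
  obtain \<delta> where \<delta>: "\<delta> \<in> polymap" "\<exists>b\<in>affine_cone X. \<delta> b \<noteq> 0"
    and dim: "\<And>b. b \<in> affine_cone X \<Longrightarrow> \<delta> b \<noteq> 0 \<Longrightarrow> vec.dim (TS (affine_cone X) b) = ndim (affine_cone X)"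
    and curve: "\<And>b v. b \<in> affine_cone X \<Longrightarrow> \<delta> b \<noteq> 0 \<Longrightarrow> v \<in> TS (affine_cone X) b \<Longrightarrow>
       \<exists>x. x 0 = b \<and> eventually (\<lambda>s. x s \<in> affine_cone X) (nhds 0) \<and>
         (\<forall>u. ((\<lambda>s. x s u) has_field_derivative v $ u) (at 0))"
    by (rule smooth_points[OF X]) (rule that)
  obtain D where D: "\<delta> = (\<lambda>a. meval a D)" using \<delta>(1) by (auto simp: polymap_def)
  show ?thesis
  proof (rule that)
    show "(\<lambda>b. meval b (weight_homogenization \<omega> D)) \<in> polymap" by (rule polymap_meval)
    obtain a where a: "a \<in> affine_cone X" "\<delta> a \<noteq> 0" using \<delta>(2) by blast
    show "\<exists>b\<in>degen \<omega> (affine_cone X). meval b (weight_homogenization \<omega> D) \<noteq> 0"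
    proof
      show "case_option 1 (act \<omega> 1 a) \<in> degen \<omega> (affine_cone X)" using a(1) by (intro degen_caseI) auto
      show "meval (case_option 1 (act \<omega> 1 a)) (weight_homogenization \<omega> D) \<noteq> 0"
        using a(2) by (simp add: meval_weight_homogenization_act D)
    qed
    fix t x assume tx: "case_option t x \<in> degen \<omega> (affine_cone X)"
      and nz: "meval (case_option t x) (weight_homogenization \<omega> D) \<noteq> 0"
    obtain a where t: "t \<noteq> 0" and a: "a \<in> affine_cone X" "x = act \<omega> t a" using degen_caseD[OF tx] by blast
    have da: "\<delta> a \<noteq> 0" using nz meval_weight_homogenization_act[OF t, of \<omega> a D] by (auto simp: a(2) D)
    show "smooth_fibre_point X \<omega> t x"
      unfolding smooth_fibre_point_def a(2) dim_TS_act[OF t] dim[OF a(1) da]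
    proof (intro conjI refl ballI)
      fix v assume "v \<in> TS (act \<omega> t ` affine_cone X) (act \<omega> t a)"
      then obtain v' where v': "v' \<in> TS (affine_cone X) a" "v = (\<chi> i. t powi \<omega> i * v' $ i)"
        unfolding TS_act[OF t] by blast
      obtain \<gamma> where \<gamma>: "\<gamma> 0 = a" "eventually (\<lambda>s. \<gamma> s \<in> affine_cone X) (nhds 0)"
        "\<And>u. ((\<lambda>s. \<gamma> s u) has_field_derivative v' $ u) (at 0)" using curve[OF a(1) da v'(1)] by blast
      show "\<exists>\<gamma>. \<gamma> 0 = act \<omega> t a \<and> eventually (\<lambda>s. \<gamma> s \<in> act \<omega> t ` affine_cone X) (nhds 0) \<and>
         (\<forall>u. ((\<lambda>s. \<gamma> s u) has_field_derivative v $ u) (at 0))"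
      proof (intro exI[of _ "\<lambda>s. act \<omega> t (\<gamma> s)"] conjI allI)
        show "act \<omega> t (\<gamma> 0) = act \<omega> t a" by (simp add: \<gamma>(1))
        show "eventually (\<lambda>s. act \<omega> t (\<gamma> s) \<in> act \<omega> t ` affine_cone X) (nhds 0)"
          using \<gamma>(2) by eventually_elim simp
        show "((\<lambda>s. act \<omega> t (\<gamma> s) u) has_field_derivative v $ u) (at 0)" for u
          unfolding act_def v'(2) by (simp, rule DERIV_cmult[OF \<gamma>(3)])
      qed
    qed
  qed
qed

abbreviation (input) cowt :: "('n \<Rightarrow> int) \<Rightarrow> 'n + 'n \<Rightarrow> int" where
  "cowt \<omega> \<equiv> case_sum \<omega> (\<lambda>i. - \<omega> i)"

lemma affine_cone_fibre_nonzero: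
  assumes "closedin zariski1 X" "t \<noteq> 0"
  shows "affine_cone (fibre_points (Iv (degen \<omega> (affine_cone X))) t) = act \<omega> t ` affine_cone X"
  by (simp add: affine_cone_fibre_points fibre_cone_nonzero assms)

lemma conormal_degenI:
  assumes X: "closedin zariski1 X" and t: "t \<noteq> 0" and x: "x \<in> act \<omega> t ` affine_cone X" "\<exists>j. u j \<noteq> 0"
    and "vec.dim (TS (act \<omega> t ` affine_cone X) x) = ndim (affine_cone X)"
      "\<forall>v\<in>TS (act \<omega> t ` affine_cone X) x. lin u (\<lambda>i. v $ i) = 0"
  shows "case_option t (case_sum x u) \<in> degen (cowt \<omega>) (conormal_vectors X)"
proof (rule degen_caseI[OF t])
  note eq = affine_cone_fibre_nonzero[OF X t, of \<omega>]
  have "case_sum x u \<in> conormal_vectors (fibre_points (Iv (degen \<omega> (affine_cone X))) t)"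
    unfolding conormal_vectors_def eq ndim_act[OF conic_affine_cone t] using assms by blast
  then show "case_sum x u \<in> act (cowt \<omega>) t ` conormal_vectors X"
    by (simp add: conormal_vectors_act[OF eq t])
qed

text \<open>The squared distance to \<open>y\<close> is a constant plus the real part of an affine
  function plus a term \<open>e\<close> of second order at \<open>x\<close>. So the minimised
  function is \<open>Re h\<close> plus \<open>e\<close> up to a constant, with \<open>h\<close>
  complex differentiable along the curve, and its derivative is the pairing of \<open>u\<close> with
  the tangent vector.\<close>

lemma conormal_at_minimum:
  assumes X: "irreducible_closed zariski1 X" and tx: "case_option t x \<in> degen \<omega> (affine_cone X)"
    and sm: "smooth_fibre_point X \<omega> t x"
    and "r > 0" and min: "\<And>x'. case_option t x' \<in> Vz (degen \<omega> (affine_cone X)) \<Longrightarrow> \<forall>j. norm (x' j - x j) < r \<Longrightarrow>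
      Re (meval x g) + (\<Sum>j\<in>UNIV. (norm (x j - y j))\<^sup>2) \<le> Re (meval x' g) + (\<Sum>j\<in>UNIV. (norm (x' j - y j))\<^sup>2)"
    and u: "u = (\<lambda>j. meval x (mpderiv j g) + 2 * cnj (x j - y j))" "\<exists>j. u j \<noteq> 0"
  shows "case_option t (case_sum x u) \<in> degen (cowt \<omega>) (conormal_vectors X)"
proof (rule conormal_degenI)
  show "closedin zariski1 X" using X by (simp add: irreducible_closed_def)
  show t: "t \<noteq> 0" and "x \<in> act \<omega> t ` affine_cone X" using degen_caseD[OF tx] by auto
  show "\<exists>j. u j \<noteq> 0" by (rule u(2))
  show "vec.dim (TS (act \<omega> t ` affine_cone X) x) = ndim (affine_cone X)"
    using sm by (simp add: smooth_fibre_point_def)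
  show "\<forall>v\<in>TS (act \<omega> t ` affine_cone X) x. lin u (\<lambda>i. v $ i) = 0"
  proof
    fix v assume v: "v \<in> TS (act \<omega> t ` affine_cone X) x"
    have "\<exists>\<gamma>. \<gamma> 0 = x \<and> eventually (\<lambda>s. \<gamma> s \<in> act \<omega> t ` affine_cone X) (nhds 0) \<and>
       (\<forall>u. ((\<lambda>s. \<gamma> s u) has_field_derivative v $ u) (at 0))"
      using sm v unfolding smooth_fibre_point_def by blast
    then obtain \<gamma> where \<gamma>: "\<gamma> 0 = x" "eventually (\<lambda>s. \<gamma> s \<in> act \<omega> t ` affine_cone X) (nhds 0)"
      "\<And>j. ((\<lambda>s. \<gamma> s j) has_field_derivative v $ j) (at 0)" by blast
    define h where "h s = meval (\<gamma> s) g + (\<Sum>j\<in>UNIV. 2 * cnj (x j - y j) * \<gamma> s j)" for s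
    define e where "e s = (\<Sum>j\<in>UNIV. (norm (\<gamma> s j - x j))\<^sup>2)" for s
    have "lin u (\<lambda>i. v $ i) = (\<Sum>j\<in>UNIV. meval (\<gamma> 0) (mpderiv j g) * v $ j) + (\<Sum>j\<in>UNIV. 2 * cnj (x j - y j) * v $ j)"
      by (simp only: lin_def u(1) \<gamma>(1) sum.distrib distrib_right)
    also have "\<dots> = 0"
    proof (rule complex_derivative_zero_at_min)
      show "(h has_field_derivative (\<Sum>j\<in>UNIV. meval (\<gamma> 0) (mpderiv j g) * v $ j) +
          (\<Sum>j\<in>UNIV. 2 * cnj (x j - y j) * v $ j)) (at 0)"
        unfolding h_def[abs_def]
        by (intro DERIV_add DERIV_sum DERIV_cmult \<gamma>(3) meval_has_field_derivative)
      show "((\<lambda>s. of_real (e s) / s) \<longlongrightarrow> 0) (at 0)"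
      proof -
        have "((\<lambda>s. of_real ((norm (\<gamma> s j - x j))\<^sup>2) / s) \<longlongrightarrow> 0) (at 0)" for j
        proof -
          have 1: "((\<lambda>s. (\<gamma> s j - x j) / s) \<longlongrightarrow> v $ j) (at 0)"
            using \<gamma>(3)[of j] by (simp add: has_field_derivative_iff \<gamma>(1))
          have "((\<lambda>s. \<gamma> s j) \<longlongrightarrow> x j) (at 0)" using DERIV_isCont[OF \<gamma>(3)[of j]] by (simp add: isCont_def \<gamma>(1))
          then have "((\<lambda>s. cnj (\<gamma> s j - x j)) \<longlongrightarrow> cnj (x j - x j)) (at 0)" by (intro tendsto_intros)
          from tendsto_mult[OF 1 this] show ?thesis by (simp only: complex_norm_square times_divide_eq_left) simp
        qed
        then have "((\<lambda>s. \<Sum>j\<in>UNIV. of_real ((norm (\<gamma> s j - x j))\<^sup>2) / s) \<longlongrightarrow> (\<Sum>j\<in>(UNIV :: 'a set). 0)) (at 0)"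
          by (intro tendsto_sum)
        then show ?thesis by (simp add: e_def sum_divide_distrib)
      qed
      have "eventually (\<lambda>s. \<forall>j. norm (\<gamma> s j - x j) < r) (nhds 0)"
      proof (intro eventually_all_finite)
        fix j
        have "((\<lambda>s. \<gamma> s j) \<longlongrightarrow> \<gamma> 0 j) (nhds 0)" using DERIV_isCont[OF \<gamma>(3)[of j]] tendsto_at_iff_tendsto_nhds[of "\<lambda>s. \<gamma> s j" 0]
          by (simp add: isCont_def)
        from tendstoD[OF this \<open>r > 0\<close>] show "eventually (\<lambda>s. norm (\<gamma> s j - x j) < r) (nhds 0)"
          by (simp add: dist_norm \<gamma>(1))
      qed
      with \<gamma>(2) have "eventually (\<lambda>s. 0 \<le> Re (h s - h 0) + e s) (nhds 0)"
      proof eventually_elim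
        case (elim s)
        have "case_option t (\<gamma> s) \<in> Vz (degen \<omega> (affine_cone X))"
          using degen_caseI[OF t elim(1)] subset_Vz by blast
        from min[OF this elim(2)]
        have "Re (meval x g) + (\<Sum>j\<in>UNIV. (norm (x j - y j))\<^sup>2) \<le> Re (meval (\<gamma> s) g) + (\<Sum>j\<in>UNIV. (norm (\<gamma> s j - y j))\<^sup>2)" .
        also have "(\<Sum>j\<in>UNIV. (norm (\<gamma> s j - y j))\<^sup>2) = (\<Sum>j\<in>UNIV. (norm (x j - y j))\<^sup>2 +
            2 * Re (cnj (x j - y j) * (\<gamma> s j - x j)) + (norm (\<gamma> s j - x j))\<^sup>2)"
        proof (rule sum.cong[OF refl])
          fix j
          show "(norm (\<gamma> s j - y j))\<^sup>2 = (norm (x j - y j))\<^sup>2 + 2 * Re (cnj (x j - y j) * (\<gamma> s j - x j)) + (norm (\<gamma> s j - x j))\<^sup>2"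
            using norm_add_power2[of "x j - y j" "\<gamma> s j - x j"] by simp
        qed
        also have "\<dots> = (\<Sum>j\<in>UNIV. (norm (x j - y j))\<^sup>2) + Re (\<Sum>j\<in>UNIV. 2 * cnj (x j - y j) * (\<gamma> s j - x j)) + e s"
        proof -
          have "2 * Re z = Re (2 * z)" for z by simp
          then show ?thesis by (simp only: sum.distrib e_def Re_sum mult.assoc)
        qed
        also have "(\<Sum>j\<in>UNIV. 2 * cnj (x j - y j) * (\<gamma> s j - x j)) =
            (\<Sum>j\<in>UNIV. 2 * cnj (x j - y j) * \<gamma> s j) - (\<Sum>j\<in>UNIV. 2 * cnj (x j - y j) * x j)"
          by (simp only: right_diff_distrib sum_subtractf)
        finally show ?case by (simp add: h_def \<gamma>(1))
      qed
      then show "eventually (\<lambda>s. 0 \<le> Re (h s - h 0) + e s) (at 0)" by (simp add: eventually_at_filter eventually_mono)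
    qed
    finally show "lin u (\<lambda>i. v $ i) = 0" .
  qed
qed

lemma inverse_Suc_tendsto_0:
  fixes f :: "nat \<Rightarrow> complex"
  assumes "\<And>m. norm (f m - l) < inverse (real (Suc m))"
  shows "f \<longlonglongrightarrow> l"
  by (rule LIM_zero_cancel, rule Lim_null_comparison[OF _ LIMSEQ_inverse_real_of_nat])
    (use assms in \<open>auto intro!: always_eventually less_imp_le\<close>)

text \<open>Minimising the real part of \<open>g\<close> plus the squared distance to \<open>y\<close> over the fibre over \<open>t\<close>
  yields conormal vectors that converge to the gradient of \<open>g\<close> at \<open>y\<close>.\<close>

lemma conormal_limit_generic:
  assumes X: "irreducible_closed zariski1 X" and y: "y \<in> fibre_cone \<omega> (affine_cone X) 0" and "\<rho> > 0"
    and sm: "\<And>t x. case_option t x \<in> degen \<omega> (affine_cone X) \<Longrightarrow> norm t < \<rho> \<Longrightarrow> \<forall>j. norm (x j - y j) < \<rho> \<Longrightarrow>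
      smooth_fibre_point X \<omega> t x"
    and near: "\<And>r. r > 0 \<Longrightarrow> \<exists>b\<in>degen \<omega> (affine_cone X). norm (b None) < r \<and> (\<forall>j. norm (b (Some j) - y j) < r)"
    and g: "g \<in> Iv (fibre_cone \<omega> (affine_cone X) 0)" and dg: "meval y (mpderiv i1 g) \<noteq> 0"
  shows "case_option 0 (case_sum y (\<lambda>j. meval y (mpderiv j g))) \<in> Vz (degen (cowt \<omega>) (conormal_vectors X))"
proof -
  let ?T = "degen \<omega> (affine_cone X)"
  obtain j0 where j0: "y j0 \<noteq> 0" using y by (auto simp: fibre_cone_def)
  \<comment> \<open>\<open>r < \<rho>\<close> keeps the search region among smooth points, and
    \<open>r < norm (y j0)\<close> keeps it away from the origin.\<close>
  define r where "r = min (\<rho> / 2) (norm (y j0) / 2)"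
  have r: "r > 0" "r < \<rho>" "r < norm (y j0)" using j0 \<open>\<rho> > 0\<close> by (auto simp: r_def min_def)
  define \<phi> where "\<phi> v = Re (meval (\<lambda>j. v $ j) g) + (\<Sum>j\<in>UNIV. (norm (v $ j - y j))\<^sup>2)" for v :: "complex ^ 'a"
  define A where "A t = {v :: complex ^ 'a. case_option t (\<lambda>j. v $ j) \<in> Vz ?T \<and> (\<forall>j. norm (v $ j - y j) \<le> r)}" for t
  have comp: "compact (A t)" for t
  proof -
    have "closed ((\<lambda>v :: complex ^ 'a. (v, t)) -` {x. case_option (snd x) (\<lambda>i. fst x $ i) \<in> Vz ?T})"
      by (intro closed_vimage closed_Vz_pair continuous_intros)
    moreover have "closed {v :: complex ^ 'a. \<forall>j. norm (v $ j - y j) \<le> r}"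
      by (intro closed_Collect_all closed_Collect_le continuous_intros)
    moreover have "A t = (\<lambda>v :: complex ^ 'a. (v, t)) -` {x. case_option (snd x) (\<lambda>i. fst x $ i) \<in> Vz ?T} \<inter>
        {v. \<forall>j. norm (v $ j - y j) \<le> r}" by (auto simp: A_def)
    ultimately have cl: "closed (A t)" by auto
    have "norm v \<le> (\<Sum>j\<in>UNIV. r + norm (y j))" if "v \<in> A t" for v
    proof (rule order.trans[OF norm_vec_le_sum], rule sum_mono)
      fix j
      have "norm (v $ j) \<le> norm (v $ j - y j) + norm (y j)" using norm_triangle_ineq[of "v $ j - y j" "y j"] by simp
      then show "norm (v $ j) \<le> r + norm (y j)" using that by (auto simp: A_def intro: order.trans)
    qed
    then have "bounded (A t)" by (auto simp: bounded_iff)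
    with cl show ?thesis by (simp add: compact_eq_bounded_closed)
  qed
  have cont: "continuous_on B \<phi>" for B
    unfolding \<phi>_def by (intro continuous_intros continuous_meval)
  have "\<exists>b. b \<in> ?T \<and> norm (b None) < min r (inverse (real (Suc m))) \<and> (\<forall>j. norm (b (Some j) - y j) < min r (inverse (real (Suc m))))" for m
    using near[of "min r (inverse (real (Suc m)))"] r(1) by auto
  then obtain b where b: "\<And>m. b m \<in> ?T" "\<And>m. norm (b m None) < min r (inverse (real (Suc m)))"
    "\<And>m j. norm (b m (Some j) - y j) < min r (inverse (real (Suc m)))" by metis
  define t where "t m = b m None" for m
  have tr: "norm (t m) < \<rho>" for m using b(2)[of m] r(2) by (simp add: t_def)
  have tlim: "t \<longlonglongrightarrow> 0" by (rule inverse_Suc_tendsto_0) (use b(2) in \<open>simp add: t_def\<close>)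
  have blim: "(\<lambda>m. b m (Some j)) \<longlonglongrightarrow> y j" for j by (rule inverse_Suc_tendsto_0) (use b(3) in simp)
  have bt: "case_option (t m) (\<lambda>j. b m (Some j)) = b m" for m
    by (auto simp: t_def fun_eq_iff split: option.splits)
  have [simp]: "($) (\<chi> j. f j) = f" for f :: "'a \<Rightarrow> complex" by auto
  have bA: "(\<chi> j. b m (Some j)) \<in> A (t m)" for m
    using b(1)[of m] b(3)[of m] subset_Vz[of ?T] by (auto simp: A_def bt less_imp_le)
  have "\<exists>v\<in>A (t m). \<forall>w\<in>A (t m). \<phi> v \<le> \<phi> w" for m
    by (rule continuous_attains_inf[OF comp _ cont]) (use bA[of m] in auto)
  then obtain v where v: "\<And>m. v m \<in> A (t m)" "\<And>m w. w \<in> A (t m) \<Longrightarrow> \<phi> (v m) \<le> \<phi> w" by metis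
  have vr: "norm (v m $ j - y j) \<le> r" and vV: "case_option (t m) (\<lambda>j. v m $ j) \<in> Vz ?T" for m j
    using v(1)[of m] by (auto simp: A_def)
  have "norm (v m $ j) \<le> r + (\<Sum>j\<in>UNIV. norm (y j))" for m j
  proof -
    have "norm (v m $ j) \<le> norm (v m $ j - y j) + norm (y j)" using norm_triangle_ineq[of "v m $ j - y j" "y j"] by simp
    also have "\<dots> \<le> r + (\<Sum>j\<in>UNIV. norm (y j))" using vr by (intro add_mono member_le_sum) auto
    finally show ?thesis .
  qed
  then obtain \<sigma> x where \<sigma>: "strict_mono \<sigma>" and x: "\<And>j. (\<lambda>m. v (\<sigma> m) $ j) \<longlonglongrightarrow> x j"
    by (rule bounded_vec_subsequence[of "\<lambda>m j. v m $ j"]) (rule that)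
  have \<sigma>lim: "(\<lambda>m. f (\<sigma> m)) \<longlonglongrightarrow> l" if "f \<longlonglongrightarrow> l" for f :: "nat \<Rightarrow> complex" and l
    using LIMSEQ_subseq_LIMSEQ[OF that \<sigma>] by (simp add: o_def)
  have b\<sigma>: "(\<lambda>m. b (\<sigma> m) (Some j)) \<longlonglongrightarrow> y j" for j using \<sigma>lim[OF blim] .
  \<comment> \<open>Both \<open>x\<close> and \<open>y\<close> lie in the special fibre, so
    \<open>g\<close> vanishes at both. Comparing the minimum with the value at the nearby points
    \<open>b\<close> leaves only the squared distance of \<open>x\<close> and \<open>y\<close> in
    the limit.\<close>
  have "x = y"
  proof -
    have "(\<lambda>m. case_option (t (\<sigma> m)) (\<lambda>j. v (\<sigma> m) $ j) i) \<longlonglongrightarrow> case_option 0 x i" for i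
      by (cases i) (use \<sigma>lim[OF tlim] x in auto)
    then have xV: "case_option 0 x \<in> Vz ?T" by (rule Vz_limit) (use vV in auto)
    have "(\<lambda>m. norm (v (\<sigma> m) $ j0 - y j0)) \<longlonglongrightarrow> norm (x j0 - y j0)" by (intro tendsto_intros x)
    then have "norm (x j0 - y j0) \<le> r" by (rule LIMSEQ_le_const2) (use vr in blast)
    then have "norm (x j0 - y j0) < norm (y j0)" using r(3) by simp
    then have "x j0 \<noteq> 0" by auto
    then have gx: "meval x g = 0" using g xV by (auto simp: Iv_def fibre_cone_def)
    have gy: "meval y g = 0" using g y by (auto simp: Iv_def)
    have l1: "(\<lambda>m. \<phi> (v (\<sigma> m))) \<longlonglongrightarrow> Re (meval x g) + (\<Sum>j\<in>UNIV. (norm (x j - y j))\<^sup>2)"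
      unfolding \<phi>_def by (intro tendsto_intros tendsto_meval x)
    have l2: "(\<lambda>m. \<phi> (\<chi> j. b (\<sigma> m) (Some j))) \<longlonglongrightarrow> Re (meval y g) + (\<Sum>j\<in>UNIV. (norm (y j - y j))\<^sup>2)"
      unfolding \<phi>_def by (intro tendsto_intros tendsto_meval) (simp_all add: b\<sigma>)
    have "\<phi> (v (\<sigma> m)) \<le> \<phi> (\<chi> j. b (\<sigma> m) (Some j))" for m by (rule v(2)) (rule bA)
    then have "Re (meval x g) + (\<Sum>j\<in>UNIV. (norm (x j - y j))\<^sup>2) \<le> Re (meval y g) + (\<Sum>j\<in>UNIV. (norm (y j - y j))\<^sup>2)"
      by (intro LIMSEQ_le[OF l1 l2]) blast
    then have "(\<Sum>j\<in>UNIV. (norm (x j - y j))\<^sup>2) \<le> 0" using gx gy by simp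
    then have "(\<Sum>j\<in>UNIV. (norm (x j - y j))\<^sup>2) = 0" by (intro antisym sum_nonneg) auto
    then show ?thesis by (subst (asm) sum_nonneg_eq_0_iff) (auto simp: fun_eq_iff)
  qed
  then have vlim: "(\<lambda>m. v (\<sigma> m) $ j) \<longlonglongrightarrow> y j" for j using x by simp
  define u where "u m = (\<lambda>j. meval (\<lambda>j. v (\<sigma> m) $ j) (mpderiv j g) + 2 * cnj (v (\<sigma> m) $ j - y j))" for m
  have ulim: "(\<lambda>m. u m j) \<longlonglongrightarrow> meval y (mpderiv j g)" for j
  proof -
    have "(\<lambda>m. u m j) \<longlonglongrightarrow> meval y (mpderiv j g) + 2 * cnj (y j - y j)"
      unfolding u_def by (intro tendsto_intros tendsto_meval vlim)
    then show ?thesis by simp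
  qed
  \<comment> \<open>Distance below \<open>r / 2\<close> makes the minimiser interior: a further move
    by less than \<open>r / 2\<close> stays in the region.\<close>
  have "eventually (\<lambda>m. \<forall>j. norm (v (\<sigma> m) $ j - y j) < r / 2) sequentially"
    unfolding dist_norm[symmetric] by (intro eventually_all_finite tendstoD[OF vlim]) (use r(1) in simp)
  moreover have "eventually (\<lambda>m. u m i1 \<noteq> 0) sequentially" by (rule tendsto_imp_eventually_ne[OF ulim dg])
  ultimately have ev: "eventually (\<lambda>m. case_option (t (\<sigma> m)) (case_sum (\<lambda>j. v (\<sigma> m) $ j) (u m)) \<in>
      Vz (degen (cowt \<omega>) (conormal_vectors X))) sequentially"
  proof eventually_elim
    case (elim m)
    let ?x = "\<lambda>j. v (\<sigma> m) $ j"
    have tn: "t (\<sigma> m) \<noteq> 0" using degen_caseD(1)[of "t (\<sigma> m)" "\<lambda>j. b (\<sigma> m) (Some j)"] b(1)[of "\<sigma> m"] by (simp add: bt)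
    have "norm (?x j0 - y j0) < norm (y j0)" using vr[of "\<sigma> m" j0] r(3) by simp
    then have "?x j0 \<noteq> 0" by auto
    with Vz_degen_fibre[OF _ vV[of "\<sigma> m"] tn] X have xT: "case_option (t (\<sigma> m)) ?x \<in> ?T"
      by (intro degen_caseI tn) (auto simp: irreducible_closed_def)
    have sm': "smooth_fibre_point X \<omega> (t (\<sigma> m)) ?x"
    proof (rule sm[OF xT tr], intro allI)
      fix j show "norm (?x j - y j) < \<rho>" using vr[of "\<sigma> m" j] r(2) by simp
    qed
    have "case_option (t (\<sigma> m)) (case_sum ?x (u m)) \<in> degen (cowt \<omega>) (conormal_vectors X)"
    proof (rule conormal_at_minimum[OF X xT sm', of "r / 2" g y])
      show "0 < r / 2" using r(1) by simp
      show "u m = (\<lambda>j. meval ?x (mpderiv j g) + 2 * cnj (?x j - y j))" by (simp add: u_def)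
      show "\<exists>j. u m j \<noteq> 0" using elim(2) by blast
      fix x' assume x': "case_option (t (\<sigma> m)) x' \<in> Vz ?T" "\<forall>j. norm (x' j - ?x j) < r / 2"
      have "norm (x' j - y j) \<le> r" for j
        using norm_triangle_ineq[of "x' j - ?x j" "?x j - y j"] x'(2) elim(1) by (smt (verit) diff_add_cancel add_diff_eq field_sum_of_halves)
      then have "(\<chi> j. x' j) \<in> A (t (\<sigma> m))" using x'(1) by (simp add: A_def)
      from v(2)[OF this] show "Re (meval ?x g) + (\<Sum>j\<in>UNIV. (norm (?x j - y j))\<^sup>2) \<le>
          Re (meval x' g) + (\<Sum>j\<in>UNIV. (norm (x' j - y j))\<^sup>2)" by (simp add: \<phi>_def)
    qed
    then show ?case using subset_Vz by blast
  qed
  show ?thesis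
  proof (rule Vz_limit[OF _ ev])
    fix i :: "('a + 'a) option"
    show "(\<lambda>m. case_option (t (\<sigma> m)) (case_sum (\<lambda>j. v (\<sigma> m) $ j) (u m)) i) \<longlonglongrightarrow>
        case_option 0 (case_sum y (\<lambda>j. meval y (mpderiv j g))) i"
      using \<sigma>lim[OF tlim] vlim ulim by (auto split: option.split sum.split)
  qed simp
qed

text \<open>The vector depends continuously on \<open>y\<close> and \<open>Vz\<close> is closed
  under limits, so generic points arbitrarily close to \<open>y\<close> suffice.\<close>

lemma conormal_limit:
  assumes X: "irreducible_closed zariski1 X" and y: "y \<in> fibre_cone \<omega> (affine_cone X) 0"
    and g: "g \<in> Iv (fibre_cone \<omega> (affine_cone X) 0)" and dg: "meval y (mpderiv i1 g) \<noteq> 0"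
  shows "case_option 0 (case_sum y (\<lambda>j. meval y (mpderiv j g))) \<in> Vz (degen (cowt \<omega>) (conormal_vectors X))"
proof -
  let ?F = "fibre_cone \<omega> (affine_cone X) 0"
  obtain \<zeta> where \<zeta>: "cut_out (ndim ?F) \<zeta> ?F" by (rule ndim_cut_out[OF conic_fibre_cone[OF conic_affine_cone]])
  obtain \<epsilon> C where eps: "0 < \<epsilon>" "\<epsilon> \<le> 1" "0 < C"
    "\<And>t a j. norm t < \<epsilon> \<Longrightarrow> case_option t a \<in> Vz (degen \<omega> (affine_cone X)) \<Longrightarrow>
      norm (a j) \<le> C * (\<Sum>i<ndim ?F. norm (lin (\<zeta> i) a))"
    by (rule degen_bound[OF conic_affine_cone \<zeta>]) (rule that)
  have dp: "degeneration_parameters X \<omega> \<zeta> (ndim ?F) \<epsilon> C"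
    by (unfold_locales) (use X y \<zeta> eps in auto)
  obtain \<delta> where \<delta>: "\<delta> \<in> polymap" "\<exists>b\<in>degen \<omega> (affine_cone X). \<delta> b \<noteq> 0"
    and sm: "\<And>t x. case_option t x \<in> degen \<omega> (affine_cone X) \<Longrightarrow> \<delta> (case_option t x) \<noteq> 0 \<Longrightarrow> smooth_fibre_point X \<omega> t x"
    by (rule smooth_fibre_points[OF X]) (rule that)
  have "\<exists>y'. (\<forall>j. norm (y' j - y j) < inverse (real (Suc m))) \<and> (meval y' (mpderiv i1 g) \<noteq> 0 \<longrightarrow>
      case_option 0 (case_sum y' (\<lambda>j. meval y' (mpderiv j g))) \<in> Vz (degen (cowt \<omega>) (conormal_vectors X)))" for m
  proof -
    have e: "inverse (real (Suc m)) > 0" by simp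
    obtain y' \<rho> where y': "y' \<in> ?F" "\<And>j. norm (y' j - y j) < inverse (real (Suc m))" and \<rho>: "\<rho> > 0"
      "\<And>b. b \<in> degen \<omega> (affine_cone X) \<Longrightarrow> norm (b None) < \<rho> \<Longrightarrow> \<forall>j. norm (b (Some j) - y' j) < \<rho> \<Longrightarrow> \<delta> b \<noteq> 0"
      and near: "\<And>r. r > 0 \<Longrightarrow> \<exists>b\<in>degen \<omega> (affine_cone X). norm (b None) < r \<and> (\<forall>j. norm (b (Some j) - y' j) < r)"
      by (rule degeneration_parameters.generic_special_point[OF dp y \<delta> e]) (rule that)
    have "case_option 0 (case_sum y' (\<lambda>j. meval y' (mpderiv j g))) \<in> Vz (degen (cowt \<omega>) (conormal_vectors X))"
      if "meval y' (mpderiv i1 g) \<noteq> 0"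
    proof (rule conormal_limit_generic[OF X y'(1) \<rho>(1) _ _ g that])
      show "smooth_fibre_point X \<omega> t x"
        if "case_option t x \<in> degen \<omega> (affine_cone X)" "norm t < \<rho>" "\<forall>j. norm (x j - y' j) < \<rho>" for t x
        using sm[OF that(1)] \<rho>(2)[OF that(1)] that(2,3) by simp
    qed (rule near)
    then show ?thesis using y'(2) by blast
  qed
  then obtain Y where Y: "\<And>m j. norm (Y m j - y j) < inverse (real (Suc m))"
    "\<And>m. meval (Y m) (mpderiv i1 g) \<noteq> 0 \<Longrightarrow>
      case_option 0 (case_sum (Y m) (\<lambda>j. meval (Y m) (mpderiv j g))) \<in> Vz (degen (cowt \<omega>) (conormal_vectors X))"
    by metis
  have Ylim: "(\<lambda>m. Y m j) \<longlonglongrightarrow> y j" for j by (rule inverse_Suc_tendsto_0) (rule Y(1))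
  have glim: "(\<lambda>m. meval (Y m) (mpderiv j g)) \<longlonglongrightarrow> meval y (mpderiv j g)" for j by (rule tendsto_meval) (rule Ylim)
  show ?thesis
  proof (rule Vz_limit)
    fix i :: "('a + 'a) option"
    show "(\<lambda>m. case_option 0 (case_sum (Y m) (\<lambda>j. meval (Y m) (mpderiv j g))) i) \<longlonglongrightarrow>
        case_option 0 (case_sum y (\<lambda>j. meval y (mpderiv j g))) i"
      using Ylim glim by (auto split: option.split sum.split)
    show "eventually (\<lambda>m. case_option 0 (case_sum (Y m) (\<lambda>j. meval (Y m) (mpderiv j g))) \<in>
        Vz (degen (cowt \<omega>) (conormal_vectors X))) sequentially"
      using tendsto_imp_eventually_ne[OF glim dg] by eventually_elim (rule Y(2))
  qed simp
qed

subsection \<open>Conormal vectors over the special fibre\<close>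

text \<open>A linear map is extended from a basis of \<open>L\<close>, where it is 0, and
  \<open>u\<close>, where it is the vector of ones; any row of its matrix will do.\<close>

lemma separating_vector:
  fixes u :: "complex ^ 'n::finite"
  assumes "vec.subspace L" "u \<notin> L"
  obtains v :: "complex ^ 'n" where "\<And>w. w \<in> L \<Longrightarrow> (\<Sum>i\<in>UNIV. v $ i * w $ i) = 0" "(\<Sum>i\<in>UNIV. v $ i * u $ i) \<noteq> 0"
proof -
  obtain B where B: "B \<subseteq> L" "vec.independent B" "L \<subseteq> vec.span B" by (rule vec.maximal_independent_subset)
  have u: "u \<notin> vec.span B" using vec.span_minimal[OF B(1) assms(1)] assms(2) by auto
  then have uB: "u \<notin> B" using vec.span_superset by blast
  obtain g :: "complex ^ 'n \<Rightarrow> complex ^ 'n" where g: "Vector_Spaces.linear (*s) (*s) g" "\<forall>x\<in>insert u B. g x = (if x = u then 1 else 0)"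
    using vec.linear_independent_extend[OF vec.independent_insertI[OF u B(2)], of "\<lambda>x. if x = u then 1 else 0"] by blast
  define k :: 'n where "k = undefined"
  have gk: "(\<Sum>i\<in>UNIV. matrix g $ k $ i * w $ i) = g w $ k" for w
    using matrix_works[OF g(1), of w] by (simp add: matrix_vector_mult_def vec_eq_iff)
  show ?thesis
  proof (rule that[of "matrix g $ k"])
    show "(\<Sum>i\<in>UNIV. matrix g $ k $ i * w $ i) = 0" if "w \<in> L" for w
    proof -
      have "g w = 0" by (rule vec.linear_eq_0_on_span[OF g(1), of B]) (use g(2) uB B(3) that in auto)
      then show ?thesis by (simp add: gk)
    qed
    show "(\<Sum>i\<in>UNIV. matrix g $ k $ i * u $ i) \<noteq> 0" using g(2) by (simp add: gk)
  qed
qed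

lemma meval_DERIV_coord:
  fixes a :: "'v::finite \<Rightarrow> complex"
  shows "((\<lambda>s. meval (a(v := s)) f) has_field_derivative meval a (mpderiv v f)) (at (a v))"
proof -
  have "((\<lambda>s. (a(v := s)) u) has_field_derivative (if u = v then 1 else 0)) (at (a v))" for u
    by (cases "u = v") auto
  then have "((\<lambda>s. meval (a(v := s)) f) has_field_derivative
      (\<Sum>u\<in>UNIV. meval (a(v := a v)) (mpderiv u f) * (if u = v then 1 else 0))) (at (a v))"
    by (rule meval_has_field_derivative)
  then show ?thesis by (simp add: if_distrib[where f = "\<lambda>x. _ * x"] cong: if_cong)
qed

lemma meval_mpderiv_unique:
  fixes a :: "'v::finite \<Rightarrow> complex"
  assumes "((\<lambda>s. meval (a(v := s)) f) has_field_derivative D) (at (a v))"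
  shows "meval a (mpderiv v f) = D"
  using meval_DERIV_coord assms by (rule DERIV_unique)

lemma meval_mpderiv_add: "meval a (mpderiv v (f + g)) = meval a (mpderiv v f) + meval a (mpderiv v g)"
  by (rule meval_mpderiv_unique) (simp, intro DERIV_add meval_DERIV_coord)

lemma meval_mpderiv_mult:
  "meval a (mpderiv v (f * g)) = meval a (mpderiv v f) * meval a g + meval a (mpderiv v g) * meval a f"
proof (rule meval_mpderiv_unique)
  have "((\<lambda>s. meval (a(v := s)) f * meval (a(v := s)) g) has_field_derivative
      meval a (mpderiv v f) * meval (a(v := a v)) g + meval a (mpderiv v g) * meval (a(v := a v)) f) (at (a v))"
    by (intro DERIV_mult meval_DERIV_coord)
  then show "((\<lambda>s. meval (a(v := s)) (f * g)) has_field_derivative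
      meval a (mpderiv v f) * meval a g + meval a (mpderiv v g) * meval a f) (at (a v))" by simp
qed

lemma meval_mpderiv_mconst: "meval a (mpderiv v (mconst c)) = 0"
  by (rule meval_mpderiv_unique) simp

text \<open>The gradients at \<open>y\<close> of functions vanishing on \<open>S\<close> form a
  subspace whose annihilator is the tangent space; in finite dimension the double annihilator is the
  subspace itself.\<close>

lemma conormal_is_gradient:
  assumes "\<And>v. v \<in> TS S y \<Longrightarrow> lin u (\<lambda>i. v $ i) = 0"
  obtains g where "g \<in> Iv S" "\<And>j. u j = meval y (mpderiv j g)"
proof -
  define L where "L = {\<chi> j. meval y (mpderiv j g) |g. g \<in> Iv S}"
  have "vec.subspace L"
    unfolding vec.subspace_def
  proof (intro conjI ballI allI)
    have "mconst 0 \<in> Iv S" by (simp add: Iv_def)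
    moreover have "0 = (\<chi> j. meval y (mpderiv j (mconst 0 :: 'a mpoly)))" by (simp add: vec_eq_iff meval_mpderiv_mconst)
    ultimately show "0 \<in> L" unfolding L_def by blast
  next
    fix v w assume "v \<in> L" "w \<in> L"
    then obtain f g where f: "f \<in> Iv S" "v = (\<chi> j. meval y (mpderiv j f))" and g: "g \<in> Iv S" "w = (\<chi> j. meval y (mpderiv j g))"
      unfolding L_def by blast
    have "v + w = (\<chi> j. meval y (mpderiv j (f + g)))" by (simp add: f g vec_eq_iff meval_mpderiv_add)
    moreover have "f + g \<in> Iv S" using f g by (simp add: Iv_def)
    ultimately show "v + w \<in> L" unfolding L_def by blast
  next
    fix c v assume "v \<in> L"
    then obtain f where f: "f \<in> Iv S" "v = (\<chi> j. meval y (mpderiv j f))" unfolding L_def by blast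
    have "c *s v = (\<chi> j. meval y (mpderiv j (mconst c * f)))"
      by (simp add: f vec_eq_iff meval_mpderiv_mult meval_mpderiv_mconst mult.commute)
    moreover have "mconst c * f \<in> Iv S" using f by (simp add: Iv_def)
    ultimately show "c *s v \<in> L" unfolding L_def by blast
  qed
  moreover have False if "(\<chi> j. u j) \<notin> L" "vec.subspace L"
  proof (rule separating_vector[OF that(2,1)])
    fix v assume v: "\<And>w. w \<in> L \<Longrightarrow> (\<Sum>i\<in>UNIV. v $ i * w $ i) = 0" "(\<Sum>i\<in>UNIV. v $ i * (\<chi> j. u j) $ i) \<noteq> 0"
    have "v \<in> TS S y"
      unfolding TS_def
    proof (intro CollectI ballI)
      fix F assume "F \<in> Iv S"
      then have "(\<chi> j. meval y (mpderiv j F)) \<in> L" unfolding L_def by blast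
      from v(1)[OF this] show "(\<Sum>i\<in>UNIV. meval y (mpderiv i F) * v $ i) = 0" by (simp add: mult.commute)
    qed
    from assms[OF this] v(2) show False by (simp add: lin_def mult.commute)
  qed
  ultimately have "(\<chi> j. u j) \<in> L" by blast
  then show ?thesis using that unfolding L_def by (auto simp: vec_eq_iff)
qed

lemma Vz_diag:
  assumes "\<And>b. b \<in> S \<Longrightarrow> (\<lambda>v. d v * b v) \<in> S" "b \<in> Vz S"
  shows "(\<lambda>v. d v * b v) \<in> Vz S"
  unfolding Vz_def
proof (intro CollectI ballI)
  fix f assume f: "f \<in> Iv S"
  let ?f = "msubst (\<lambda>v. mconst (d v) * mvar v) f"
  have eq: "meval b ?f = meval (\<lambda>v. d v * b v) f" for b by (simp add: meval_msubst)
  have "?f \<in> Iv S" unfolding Iv_def using assms(1) f by (auto simp: eq Iv_def)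
  then show "meval (\<lambda>v. d v * b v) f = 0" using assms(2) eq[of b] by (auto simp: Vz_def)
qed

lemma scale_in_diag: "scale_in B c a = (\<lambda>v. (if v \<in> B then c else 1) * a v)"
  by (auto simp: scale_in_def)

lemma degen_scale_in:
  assumes "\<And>a. a \<in> S \<Longrightarrow> scale_in B c a \<in> S" "b \<in> degen w S"
  shows "scale_in (Some ` B) c b \<in> degen w S"
proof -
  obtain t a where b: "b = case_option t (act w t a)" "t \<noteq> 0" "a \<in> S" using assms(2) unfolding degen_def by blast
  have "scale_in (Some ` B) c b = case_option t (act w t (scale_in B c a))"
    by (auto simp: b scale_in_def act_def fun_eq_iff split: option.split)
  then show ?thesis using assms(1) b unfolding degen_def by blast
qed

lemma conormal_vectors_scale_Inl:
  assumes "a \<in> conormal_vectors X" "c \<noteq> 0"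
  shows "scale_in (range Inl) c a \<in> conormal_vectors X"
proof -
  obtain x u where a: "a = case_sum x u" and x: "x \<in> affine_cone X" "\<exists>j. u j \<noteq> 0"
    "vec.dim (TS (affine_cone X) x) = ndim (affine_cone X)" "\<forall>v\<in>TS (affine_cone X) x. lin u (\<lambda>i. v $ i) = 0"
    using assms(1) unfolding conormal_vectors_def by blast
  have "scale_in (range Inl) c a = case_sum (\<lambda>i. c * x i) u"
    by (auto simp: a scale_in_def fun_eq_iff split: sum.split)
  moreover have "(\<lambda>i. c * x i) \<in> affine_cone X" using x(1) assms(2) by (rule cone_scale)
  ultimately show ?thesis
    unfolding conormal_vectors_def using x TS_scale[OF conic_affine_cone assms(2), of X x]
    by (intro CollectI exI[of _ "\<lambda>i. c * x i"] exI[of _ u]) simp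
qed

lemma conormal_vectors_scale_Inr:
  assumes "a \<in> conormal_vectors X" "c \<noteq> 0"
  shows "scale_in (range Inr) c a \<in> conormal_vectors X"
proof -
  obtain x u where a: "a = case_sum x u" and x: "x \<in> affine_cone X" "\<exists>j. u j \<noteq> 0"
    "vec.dim (TS (affine_cone X) x) = ndim (affine_cone X)" "\<forall>v\<in>TS (affine_cone X) x. lin u (\<lambda>i. v $ i) = 0"
    using assms(1) unfolding conormal_vectors_def by blast
  have "scale_in (range Inr) c a = case_sum x (\<lambda>i. c * u i)"
    by (auto simp: a scale_in_def fun_eq_iff split: sum.split)
  moreover have "lin (\<lambda>i. c * u i) v = c * lin u v" for v by (simp add: lin_def sum_distrib_left mult.assoc)
  ultimately show ?thesis
    unfolding conormal_vectors_def using x assms(2)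
    by (intro CollectI exI[of _ x] exI[of _ "\<lambda>i. c * u i"]) simp
qed

text \<open>\<open>conormal_limit\<close> applies to \<open>f * g\<close> at points of
  \<open>Y\<close> where \<open>f\<close> and the \<open>j\<close>-th derivative of \<open>g\<close>
  are nonzero. The other points follow by irreducibility: an equation of the conormal family,
  evaluated at the gradients of \<open>g\<close>, is a polynomial on \<open>Y\<close> that vanishes
  wherever \<open>q\<close> does not.\<close>

lemma conormal_component_limit:
  assumes X: "irreducible_closed zariski1 X"
    and Y: "Y \<in> irreducible_components zariski1 (fibre_points (Iv (degen \<omega> (affine_cone X))) 0)"
    and c: "c \<in> conormal_vectors Y"
  shows "case_option 0 c \<in> Vz (degen (cowt \<omega>) (conormal_vectors X))"
proof -
  let ?X0 = "fibre_points (Iv (degen \<omega> (affine_cone X))) 0" and ?W = "degen (cowt \<omega>) (conormal_vectors X)"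
  have YX: "Y \<subseteq> ?X0" and irrY: "irreducible_closed zariski1 Y"
    and maxY: "\<And>Y'. irreducible_closed zariski1 Y' \<Longrightarrow> Y \<subseteq> Y' \<Longrightarrow> Y' \<subseteq> ?X0 \<Longrightarrow> Y' = Y"
    using Y unfolding irreducible_components_def by auto
  have cl: "closedin zariski1 ?X0" unfolding fibre_points_def by (rule closedin_zariski1_zero_locus)
  obtain K where K: "finite K" "\<And>Z. Z \<in> K \<Longrightarrow> irreducible_closed zariski1 Z" "?X0 = \<Union>K"
    by (rule irreducible_decomposition[OF cl]) (rule that)
  have Kc: "Z \<in> K \<Longrightarrow> closedin zariski1 Z" for Z using K(2) by (auto simp: irreducible_closed_def)
  have inK: "Z = Y" if "Z \<in> K" "Y \<subseteq> Z" for Z using maxY[OF K(2)[OF that(1)] that(2)] K(3) that(1) by blast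
  have YK: "Y \<in> K" using irreducible_closed_subset_Union[OF irrY K(1) Kc] YX K(3) inK by blast
  \<comment> \<open>The union of the other components. \<open>Y\<close> is not contained in it,
    which provides \<open>f\<close>.\<close>
  define Z where "Z = \<Union>(K - {Y})"
  have Zc: "closedin zariski1 Z" unfolding Z_def using K(1) Kc by (intro closedin_Union) auto
  have "\<not> Y \<subseteq> Z"
  proof
    assume "Y \<subseteq> Z"
    then have "\<exists>Y'\<in>K - {Y}. Y \<subseteq> Y'"
      unfolding Z_def by (intro irreducible_closed_subset_Union[OF irrY]) (use K(1) Kc in auto)
    then show False using inK by blast
  qed
  then obtain p where p: "p \<in> Y" "p \<notin> Z" by blast
  obtain f where f: "hom1 f" "p \<notin> zero_locus crd {f}" "Z \<subseteq> zero_locus crd {f}"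
    by (rule closedin_zariski1_separate[OF Zc p(2)])
  have fZ: "meval x f = 0" if "x \<in> affine_cone Z" for x
    using that f(3) by (auto simp: affine_cone_def zero_locus_def)
  obtain a0 where a0: "a0 \<in> affine_cone Y" "meval a0 f \<noteq> 0"
    using f(2) p(1) by (auto simp: zero_locus_def affine_cone_def)
  have X0: "fibre_cone \<omega> (affine_cone X) 0 = affine_cone Y \<union> affine_cone Z"
  proof -
    have "\<Union>K = Y \<union> Z" using YK unfolding Z_def by blast
    then show ?thesis unfolding affine_cone_fibre_points[symmetric] K(3) by (simp add: cone_Un)
  qed
  obtain y u where c: "c = case_sum y u" and y: "y \<in> affine_cone Y" and "\<exists>j. u j \<noteq> 0"
    and ann: "\<And>v. v \<in> TS (affine_cone Y) y \<Longrightarrow> lin u (\<lambda>i. v $ i) = 0"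
    using c unfolding conormal_vectors_def by blast
  then obtain j where j: "u j \<noteq> 0" by blast
  obtain g where g: "g \<in> Iv (affine_cone Y)" and gu: "\<And>j. u j = meval y (mpderiv j g)"
    by (rule conormal_is_gradient[OF ann]) (assumption, rule that)
  have irr: "irr (affine_cone Y)" by (rule irreducible_closed_imp_irr[OF irrY])
  define q where "q x = meval x (f * mpderiv j g)" for x
  have qm: "q \<in> polymap" unfolding q_def[abs_def] by (rule polymap_meval)
  have qnz: "\<exists>x\<in>affine_cone Y. q x \<noteq> 0"
  proof (rule ccontr)
    assume "\<not> ?thesis"
    then have "\<forall>x\<in>affine_cone Y. meval x f * meval x (mpderiv j g) = 0" by (simp add: q_def)
    then have "\<forall>x\<in>affine_cone Y. meval x f = 0"
      by (rule irr_cancel[OF irr polymap_meval polymap_meval]) (use y j gu in auto)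
    then show False using a0 by blast
  qed
  have main: "case_option 0 (case_sum x (\<lambda>i. meval x (mpderiv i g))) \<in> Vz ?W"
    if x: "x \<in> affine_cone Y" "q x \<noteq> 0" for x
  proof -
    have nz: "meval x f \<noteq> 0" "meval x (mpderiv j g) \<noteq> 0" using x(2) by (auto simp: q_def)
    have gx: "meval x g = 0" using g x(1) by (auto simp: Iv_def)
    have d: "meval x (mpderiv i (f * g)) = meval x f * meval x (mpderiv i g)" for i
      by (simp add: meval_mpderiv_mult gx)
    have "case_option 0 (case_sum x (\<lambda>i. meval x (mpderiv i (f * g)))) \<in> Vz ?W"
    proof (rule conormal_limit[OF X])
      show "x \<in> fibre_cone \<omega> (affine_cone X) 0" using x X0 by blast
      show "f * g \<in> Iv (fibre_cone \<omega> (affine_cone X) 0)"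
        unfolding X0 using g fZ by (auto simp: Iv_def)
      show "meval x (mpderiv j (f * g)) \<noteq> 0" using nz by (simp add: d)
    qed
    \<comment> \<open>The conormal family is stable under scaling of the dual coordinates, so the
      factor \<open>f\<close> in the gradient of \<open>f * g\<close> can be removed.\<close>
    then have "scale_in (Some ` range Inr) (inverse (meval x f)) (case_option 0 (case_sum x (\<lambda>i. meval x (mpderiv i (f * g))))) \<in> Vz ?W"
      unfolding scale_in_diag using nz(1)
      by (intro Vz_diag[of ?W] degen_scale_in[unfolded scale_in_diag] conormal_vectors_scale_Inr[unfolded scale_in_diag]) auto
    moreover have "scale_in (Some ` range Inr) (inverse (meval x f)) (case_option 0 (case_sum x (\<lambda>i. meval x (mpderiv i (f * g))))) =
        case_option 0 (case_sum x (\<lambda>i. meval x (mpderiv i g)))"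
      using nz(1) by (auto simp: scale_in_def fun_eq_iff d split: option.split sum.split)
    ultimately show ?thesis by simp
  qed
  have "meval (case_option 0 c) F = 0" if F: "F \<in> Iv ?W" for F
  proof -
    \<comment> \<open>The pullback of \<open>F\<close> along the map that sends \<open>x\<close> to
      the vector with \<open>t = 0\<close>, point \<open>x\<close> and hyperplane the gradient of
      \<open>g\<close> at \<open>x\<close>.\<close>
    define H where "H = msubst (case_option (mconst 0) (case_sum mvar (\<lambda>i. mpderiv i g))) F"
    have H: "meval x H = meval (case_option 0 (case_sum x (\<lambda>i. meval x (mpderiv i g)))) F" for x
      unfolding H_def meval_msubst
      by (intro arg_cong2[where f = meval] refl ext) (auto split: option.split sum.split)
    have "\<forall>x\<in>affine_cone Y. meval x H * q x = 0"
    proof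
      fix x assume x: "x \<in> affine_cone Y"
      show "meval x H * q x = 0"
      proof (cases "q x = 0")
        case False
        from main[OF x this] F show ?thesis by (simp add: H Vz_def)
      qed simp
    qed
    then have "\<forall>x\<in>affine_cone Y. meval x H = 0" by (rule irr_cancel[OF irr polymap_meval qm _ qnz])
    moreover have "u = (\<lambda>i. meval y (mpderiv i g))" using gu by auto
    ultimately show ?thesis using y by (simp add: H c)
  qed
  then show ?thesis by (simp add: Vz_def)
qed

subsection \<open>The ideals of the conormal spaces\<close>

text \<open>Taking components in one variable after another isolates a single monomial, which is
  then evaluated at the vector of ones.\<close>

lemma Iv_UNIV: "Iv (UNIV :: ('v::finite \<Rightarrow> complex) set) = {0}"
proof (intro equalityI subsetI)
  fix f :: "'v mpoly" assume f: "f \<in> Iv UNIV"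
  have "Poly_Mapping.lookup f \<alpha> = 0" for \<alpha>
  proof -
    have "\<exists>g\<in>Iv UNIV. \<forall>\<beta>. Poly_Mapping.lookup g \<beta> =
        (if \<forall>v\<in>V. Poly_Mapping.lookup \<beta> v = Poly_Mapping.lookup \<alpha> v then Poly_Mapping.lookup f \<beta> else 0)"
      if "finite V" for V :: "'v set"
      using that
    proof (induction V)
      case empty
      then show ?case using f by auto
    next
      case (insert x V)
      then obtain g where g: "g \<in> Iv UNIV" "\<And>\<beta>. Poly_Mapping.lookup g \<beta> =
          (if \<forall>v\<in>V. Poly_Mapping.lookup \<beta> v = Poly_Mapping.lookup \<alpha> v then Poly_Mapping.lookup f \<beta> else 0)" by blast
      show ?case
      proof (intro bexI allI)
        show "hcomp {x} (Poly_Mapping.lookup \<alpha> x) g \<in> Iv UNIV" by (rule hcomp_in_Iv[OF g(1)]) auto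
        show "Poly_Mapping.lookup (hcomp {x} (Poly_Mapping.lookup \<alpha> x) g) \<beta> =
          (if \<forall>v\<in>insert x V. Poly_Mapping.lookup \<beta> v = Poly_Mapping.lookup \<alpha> v then Poly_Mapping.lookup f \<beta> else 0)" for \<beta>
          by (simp add: lookup_hcomp g(2) deg_in_def)
      qed
    qed
    from this[of UNIV] obtain g where g: "g \<in> Iv UNIV" "\<And>\<beta>. Poly_Mapping.lookup g \<beta> =
        (if \<forall>v. Poly_Mapping.lookup \<beta> v = Poly_Mapping.lookup \<alpha> v then Poly_Mapping.lookup f \<beta> else 0)" by auto
    have "g = Poly_Mapping.single \<alpha> (Poly_Mapping.lookup f \<alpha>)"
    proof (rule poly_mapping_eqI)
      fix \<beta>
      show "Poly_Mapping.lookup g \<beta> = Poly_Mapping.lookup (Poly_Mapping.single \<alpha> (Poly_Mapping.lookup f \<alpha>)) \<beta>"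
        using poly_mapping_eqI[of \<beta> \<alpha>] by (cases "\<beta> = \<alpha>") (auto simp: g(2) lookup_single when_def)
    qed
    then have "meval (\<lambda>v. 1) g = Poly_Mapping.lookup f \<alpha>" by (simp add: mon_def)
    moreover have "meval (\<lambda>v. 1) g = 0" using g(1) unfolding Iv_def by blast
    ultimately show ?thesis by simp
  qed
  then show "f \<in> {0}" by (simp add: poly_mapping_eqI)
qed (simp add: Iv_def)

lemma meval_eqI: "f = g" if "\<And>a. meval a f = meval a g" for f g :: "'v::finite mpoly"
proof -
  have "f - g \<in> Iv UNIV" using that by (simp add: Iv_def)
  then show ?thesis by (simp add: Iv_UNIV)
qed

text \<open>For the inclusion from right to left, \<open>h\<close> is pulled back to
  \<open>S\<close>, weight homogenized, and divided by the constant power of \<open>t\<close> that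
  this introduces.\<close>

lemma fibre_ideal_degen:
  assumes t: "t \<noteq> 0"
  shows "fibre_ideal t (Iv (degen w S)) = Iv (act w t ` S)"
proof (intro equalityI subsetI)
  fix h assume "h \<in> fibre_ideal t (Iv (degen w S))"
  then obtain F where F: "F \<in> Iv (degen w S)" "h = msubst (case_option (mconst t) mvar) F" unfolding fibre_ideal_def by blast
  show "h \<in> Iv (act w t ` S)"
    unfolding Iv_def
  proof (intro CollectI ballI)
    fix a assume "a \<in> act w t ` S"
    then have "case_option t a \<in> degen w S" by (rule degen_caseI[OF t])
    then show "meval a h = 0" using F by (auto simp: meval_fibre Iv_def)
  qed
next
  fix h assume h: "h \<in> Iv (act w t ` S)"
  define f where "f = msubst (\<lambda>i. mconst (t powi w i) * mvar i) h"
  have f: "meval a f = meval (act w t a) h" for a by (simp add: f_def meval_act)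
  define m where "m = t powi Max (wdeg w ` Poly_Mapping.keys f)"
  have m: "m \<noteq> 0" using t by (simp add: m_def)
  define F where "F = mconst (inverse m) * weight_homogenization w f"
  have "F \<in> Iv (degen w S)"
    using h by (auto simp: F_def Iv_def degen_def meval_weight_homogenization_act f)
  moreover have "h = msubst (case_option (mconst t) mvar) F"
  proof (rule meval_eqI)
    fix a
    define a' where "a' = act (\<lambda>v. - w v) t a"
    have a: "a = act w t a'" unfolding a'_def by (rule act_inverse'[OF t, symmetric])
    have "meval a (msubst (case_option (mconst t) mvar) F) = inverse m * (m * meval a' f)"
      unfolding meval_fibre by (simp add: F_def a meval_weight_homogenization_act[OF t] m_def)
    then show "meval a h = meval a (msubst (case_option (mconst t) mvar) F)" using m by (simp add: f a)
  qed
  ultimately show "h \<in> fibre_ideal t (Iv (degen w S))" unfolding fibre_ideal_def by blast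
qed

lemma vanishing_ideal_subset_Iv: "vanishing_ideal hom cs Y \<subseteq> Iv (\<Union>(cs ` Y))"
  unfolding vanishing_ideal_def by (rule ideal_generated_subset_Iv) (auto simp: Iv_def)

lemma crd2_nonempty: "crd2 p \<noteq> {}"
  using crd_nonempty[of "fst p"] crd_nonempty[of "snd p"] by (auto simp: crd2_def)

lemma crd2_nonzero:
  assumes "a \<in> crd2 p"
  obtains i j where "a (Inl i) * a (Inr j) \<noteq> 0"
proof -
  obtain x u where "x \<in> crd (fst p)" "u \<in> crd (snd p)" "a = case_sum x u" using assms unfolding crd2_def by blast
  then show ?thesis using crd_nonzero[of x] crd_nonzero[of u] that by fastforce
qed

lemma hom2_1: "hom2 1"
  by (simp add: hom2_def homogeneous_in_1)

lemma topspace_zariski2 [simp]: "topspace (zariski2 :: ('n::finite proj \<times> 'n proj) topology) = UNIV"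
  by (rule topspace_zariski) (simp_all add: hom2_1 crd2_nonempty)

lemma closedin_zariski2_zero_locus: "hom2 f \<Longrightarrow> closedin zariski2 (zero_locus crd2 {f})"
  by (rule closedin_zero_locus_hom) (simp_all add: hom2_1 crd2_nonempty)

lemma vanishing_ideal_Con_smooth:
  assumes "irreducible_closed zariski1 X"
  shows "vanishing_ideal hom2 crd2 (Con_smooth X) = Iv (conormal_vectors X)"
proof -
  have "vanishing_ideal (\<lambda>f. homogeneous_in (range Inl) f \<and> homogeneous_in (range Inr) f) crd2 (Con_smooth X) =
      Iv (\<Union>(crd2 ` Con_smooth X))"
    by (rule vanishing_ideal_eq_Iv2)
      (simp_all add: crd2_Con_smooth[OF assms] conormal_vectors_scale_Inl conormal_vectors_scale_Inr)
  then show ?thesis by (simp add: hom2_def[abs_def] crd2_Con_smooth[OF assms])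
qed

text \<open>A bihomogeneous polynomial that vanishes on a set also vanishes on its Zariski
  closure.\<close>

lemma vanishing_ideal_conormal_variety:
  assumes "irreducible_closed zariski1 X"
  shows "vanishing_ideal hom2 crd2 (conormal_variety X) = Iv (conormal_vectors X)"
proof -
  have "Con_smooth X \<subseteq> conormal_variety X"
    unfolding conormal_variety_def by (rule closure_of_subset) simp
  moreover have "conormal_variety X \<subseteq> zero_locus crd2 {f}" if "hom2 f" "Con_smooth X \<subseteq> zero_locus crd2 {f}" for f
    unfolding conormal_variety_def
    by (rule closure_of_minimal[OF that(2) closedin_zariski2_zero_locus[OF that(1)]])
  ultimately have "{f. hom2 f \<and> (\<forall>p\<in>conormal_variety X. \<forall>a\<in>crd2 p. meval a f = 0)} =
      {f. hom2 f \<and> (\<forall>p\<in>Con_smooth X. \<forall>a\<in>crd2 p. meval a f = 0)}"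
    unfolding zero_locus_def by blast
  then show ?thesis
    using vanishing_ideal_Con_smooth[OF assms] by (simp add: vanishing_ideal_def)
qed

context
  fixes X :: "'n::finite proj set" and \<omega> :: "'n \<Rightarrow> int"
  assumes X: "irreducible_closed zariski1 X"
begin

lemma closed_X: "closedin zariski1 X"
  using X by (simp add: irreducible_closed_def)

abbreviation fibre where "fibre t \<equiv> fibre_points (Iv (degen \<omega> (affine_cone X))) t"

lemma irreducible_closed_fibre: "t \<noteq> 0 \<Longrightarrow> irreducible_closed zariski1 (fibre t)"
proof (rule irr_imp_irreducible_closed)
  show "closedin zariski1 (fibre t)" unfolding fibre_points_def by (rule closedin_zariski1_zero_locus)
  show "irr (affine_cone (fibre t))" if "t \<noteq> 0"
    unfolding affine_cone_fibre_nonzero[OF closed_X that] by (rule irr_act[OF irreducible_closed_imp_irr[OF X]])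
qed

lemma conormal_vectors_fibre: "t \<noteq> 0 \<Longrightarrow> conormal_vectors (fibre t) = act (cowt \<omega>) t ` conormal_vectors X"
  by (rule conormal_vectors_act[OF affine_cone_fibre_nonzero[OF closed_X]])

lemma relative_conormal_eq:
  "relative_conormal (Iv (degen \<omega> (affine_cone X))) = subscheme2t (Iv (degen (cowt \<omega>) (conormal_vectors X)))"
proof -
  let ?W = "degen (cowt \<omega>) (conormal_vectors X)" and ?C = "\<Union>t\<in>-{0}. Con_smooth (fibre t) \<times> {t}"
  have "\<Union>(crd2t ` ?C) = {case_option t c |t c. t \<noteq> 0 \<and> c \<in> \<Union>(crd2 ` Con_smooth (fibre t))}"
    by (force simp: crd2t_def)
  also have "\<dots> = {case_option t c |t c. t \<noteq> 0 \<and> c \<in> act (cowt \<omega>) t ` conormal_vectors X}"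
  proof -
    have "\<Union>(crd2 ` Con_smooth (fibre t)) = act (cowt \<omega>) t ` conormal_vectors X" if "t \<noteq> 0" for t
      unfolding crd2_Con_smooth[OF irreducible_closed_fibre[OF that]] by (rule conormal_vectors_fibre[OF that])
    then have "t \<noteq> 0 \<and> c \<in> \<Union>(crd2 ` Con_smooth (fibre t)) \<longleftrightarrow> t \<noteq> 0 \<and> c \<in> act (cowt \<omega>) t ` conormal_vectors X" for t c
      by (cases "t = 0") (simp_all only: not_True_eq_False not_False_eq_True simp_thms)
    then show ?thesis by (simp only:)
  qed
  also have "\<dots> = ?W" unfolding degen_def by blast
  finally have C: "\<Union>(crd2t ` ?C) = ?W" .
  have "vanishing_ideal (\<lambda>f. homogeneous_in (Some ` range Inl) f \<and> homogeneous_in (Some ` range Inr) f) crd2t ?C =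
      Iv (\<Union>(crd2t ` ?C))"
    by (rule vanishing_ideal_eq_Iv2; unfold C; rule degen_scale_in)
      (simp_all add: conormal_vectors_scale_Inl conormal_vectors_scale_Inr)
  then show ?thesis unfolding relative_conormal_def hom2t_def[abs_def] C by (simp only:)
qed

text \<open>At each point of the set some product \<open>x\<^sub>i u\<^sub>j\<close> is nonzero and
  its powers can be cancelled, so the ideal is already saturated.\<close>

lemma subscheme2t_degen:
  "subscheme2t (Iv (degen (cowt \<omega>) (conormal_vectors X))) = Iv (degen (cowt \<omega>) (conormal_vectors X))"
proof (intro equalityI subsetI)
  let ?W = "degen (cowt \<omega>) (conormal_vectors X)"
  fix f assume f: "f \<in> subscheme2t (Iv ?W)"
  show "f \<in> Iv ?W"
    unfolding Iv_def
  proof (intro CollectI ballI)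
    fix b assume b: "b \<in> ?W"
    then obtain t c where tc: "b = case_option t (act (cowt \<omega>) t c)" "t \<noteq> 0" "c \<in> conormal_vectors X"
      unfolding degen_def by blast
    obtain x u where "c = case_sum x u" "x \<in> affine_cone X" "\<exists>j. u j \<noteq> 0"
      using tc(3) unfolding conormal_vectors_def by blast
    with cone_nonzero[of x X] obtain i j where "c (Inl i) \<noteq> 0" "c (Inr j) \<noteq> 0" by auto
    then have nz: "b (Some (Inl i)) * b (Some (Inr j)) \<noteq> 0" using tc(1,2) by (simp add: act_def)
    obtain k where "(mvar (Some (Inl i)) * mvar (Some (Inr j))) ^ k * f \<in> Iv ?W"
      using f unfolding subscheme2t_def saturation_def by blast
    then show "meval b f = 0" using b nz by (auto simp: Iv_def)
  qed
next
  fix f assume f: "f \<in> Iv (degen (cowt \<omega>) (conormal_vectors X))"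
  then show "f \<in> subscheme2t (Iv (degen (cowt \<omega>) (conormal_vectors X)))"
    unfolding subscheme2t_def saturation_def by (auto intro: exI[of _ 0])
qed

lemma conormal_union_fibre_subset:
  "conormal_union (fibre 0) \<subseteq> zero_locus crd2 (subscheme_fibre (Iv (degen (cowt \<omega>) (conormal_vectors X))) 0)"
proof
  let ?W = "degen (cowt \<omega>) (conormal_vectors X)"
  fix p assume "p \<in> conormal_union (fibre 0)"
  then obtain Y where Y: "Y \<in> irreducible_components zariski1 (fibre 0)" and p: "p \<in> conormal_variety Y"
    unfolding conormal_union_def by blast
  have irrY: "irreducible_closed zariski1 Y" using Y by (simp add: irreducible_components_def)
  have F: "meval (case_option 0 a) F = 0" if F: "F \<in> Iv ?W" and a: "a \<in> crd2 p" for F a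
  proof -
    have "msubst (case_option (mconst 0) mvar) F \<in> Iv (conormal_vectors Y)"
      using conormal_component_limit[OF X Y] F by (simp add: Iv_def[of "conormal_vectors Y"] meval_fibre Vz_def)
    then have "msubst (case_option (mconst 0) mvar) F \<in> Iv (\<Union>(crd2 ` conormal_variety Y))"
      using vanishing_ideal_subset_Iv vanishing_ideal_conormal_variety[OF irrY] by blast
    then show ?thesis using p a by (auto simp: Iv_def meval_fibre)
  qed
  show "p \<in> zero_locus crd2 (subscheme_fibre (Iv ?W) 0)"
    unfolding zero_locus_def
  proof (intro CollectI ballI)
    fix f a assume f: "f \<in> subscheme_fibre (Iv ?W) 0" and a: "a \<in> crd2 p"
    \<comment> \<open>Membership in the saturation only concerns \<open>f\<close> times a power of a
      product of coordinates; the product chosen is nonzero at \<open>a\<close> and cancels.\<close>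
    obtain i j where nz: "a (Inl i) * a (Inr j) \<noteq> 0" by (rule crd2_nonzero[OF a])
    obtain k where "(mvar (Inl i) * mvar (Inr j)) ^ k * f \<in> fibre_ideal 0 (Iv ?W)"
      using f unfolding subscheme_fibre_def subscheme2_def saturation_def by blast
    then obtain G where G: "G \<in> Iv ?W" "(mvar (Inl i) * mvar (Inr j)) ^ k * f = msubst (case_option (mconst 0) mvar) G"
      unfolding fibre_ideal_def by blast
    have "meval a ((mvar (Inl i) * mvar (Inr j)) ^ k * f) = 0"
      unfolding G(2) meval_fibre by (rule F[OF G(1) a])
    then show "meval a f = 0" using nz by auto
  qed
qed

end

theorem proposition3p3:
  fixes X :: "'n::finite proj set" and \<omega> :: "'n \<Rightarrow> int"
    and XX :: "'n option mpoly set" and NN :: "('n + 'n) option mpoly set"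
  assumes "irreducible_closed zariski1 X"
  defines "XX \<equiv> groebner_degeneration \<omega> (vanishing_ideal hom1 crd X)"
    and "NN \<equiv> relative_conormal XX"
  shows "NN = subscheme2t (groebner_degeneration (case_sum \<omega> (\<lambda>i. - \<omega> i))
                (vanishing_ideal hom2 crd2 (conormal_variety X)))
    \<and> (\<forall>t. t \<noteq> 0 \<longrightarrow>
          reduced_subscheme2 (conormal_variety (fibre_points XX t)) = subscheme_fibre NN t)
    \<and> conormal_union (fibre_points XX 0) \<subseteq> zero_locus crd2 (subscheme_fibre NN 0)"
proof -
  note X = assms(1)
  have XX: "XX = Iv (degen \<omega> (affine_cone X))"
    unfolding XX_def vanishing_ideal_cone groebner_degeneration_Iv by (rule refl)
  have NN: "NN = Iv (degen (cowt \<omega>) (conormal_vectors X))"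
    unfolding NN_def XX relative_conormal_eq[OF X] subscheme2t_degen[OF X] by (rule refl)
  show ?thesis
  proof (intro conjI allI impI)
    show "NN = subscheme2t (groebner_degeneration (cowt \<omega>) (vanishing_ideal hom2 crd2 (conormal_variety X)))"
      unfolding NN vanishing_ideal_conormal_variety[OF X] groebner_degeneration_Iv subscheme2t_degen[OF X] by (rule refl)
    show "reduced_subscheme2 (conormal_variety (fibre_points XX t)) = subscheme_fibre NN t" if t: "t \<noteq> 0" for t
      unfolding reduced_subscheme2_def subscheme_fibre_def NN XX fibre_ideal_degen[OF t]
        vanishing_ideal_conormal_variety[OF irreducible_closed_fibre[OF X t]] conormal_vectors_fibre[OF X t] by (rule refl)
    show "conormal_union (fibre_points XX 0) \<subseteq> zero_locus crd2 (subscheme_fibre NN 0)"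
      unfolding NN XX by (rule conormal_union_fibre_subset[OF X])
  qed
qed

end
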